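(* Let $k$ be an algebraically closed field and let $M$ be a finitely generated commutative partially cancellative monoid of rank at least two, such that $k[M]$ is reduced. Then $\mathrm{CH}^{LW}_0(k[M]) = 0$.
   Context: Monoids are commutative and finitely generated, written additively. A monoid is cancellative if $a+b=a+c$ implies $b=c$. A subset $I\subset N$ of a monoid is an ideal if $I+N=I$ (the empty set is allowed). The quotient $N/I$ is the monoid obtained from $N$ by collapsing $I$ to a single absorbing element $\infty$ (with $N/\emptyset=N$, and $N/N$ the singleton monoid). $M$ is partially cancellative if $M=N/I$ for a cancellative monoid $N$ and an ideal $I\subset N$ (possibly empty). $k[M]$ is the monoid algebra; for $M=N/I$ with $I\ne N$ nonempty, the convention is $k[N/I]=k[N]/k[I]$; for $I=N$ one takes $k[M]=k$. The rank of $M$ is the rank of the free part of its group completion $\mathrm{gp}(M)$. Levine-Weibel Chow group: let $A$ be a reduced finite type $k$-algebra, $X=\mathrm{Spec}(A)$, $X_{\mathrm{reg}}$ the set of points $x$ with $\mathcal{O}_{X,x}$ a regular local ring, and $X_{\mathrm{sing}}=X\setminus X_{\mathrm{reg}}$. A Cartier curve is a closed subscheme $C\subset X$ of pure dimension one such that (1) no irreducible component of $C$ lies in $X_{\mathrm{sing}}$; (2) for every $x\in C\cap X_{\mathrm{sing}}$ the ideal of $C$ in $\mathcal{O}_{X,x}$ is generated by a regular sequence. Let $k(C,X_{\mathrm{sing}})^{\times}$ be the group of invertible elements of the ring of total quotients of $C$ that are regular and invertible along $C\cap X_{\mathrm{sing}}$. Let $\mathcal{Z}_0(X)$ be the free abelian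 group on the regular closed points of $X$. For a Cartier curve $C$ and $f\in k(C,X_{\mathrm{sing}})^{\times}$, let $\mathrm{div}_C(f)\in\mathcal{Z}_0(X)$ be the divisor of $f$ (in Fulton's sense, with orders of vanishing given by lengths). Then $\mathrm{CH}^{LW}_0(A)=\mathrm{CH}^{LW}_0(X)$ is the quotient of $\mathcal{Z}_0(X)$ by the subgroup generated by all $\mathrm{div}_C(f)$, with $C$ running over all Cartier curves on $X$ and $f\in k(C,X_{\mathrm{sing}})^{\times}$. *)

theory Defs
  imports
    "HOL-Algebra.Algebra"
    "HOL-Algebra.Algebraic_Closure_Type"
    "HOL-Algebra.Free_Abelian_Groups"
    "HOL-Library.Poly_Mapping"
    "HOL-Library.Extended_Nat"
begin

text \<open>
  Cancellative commutative monoids are the types of class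
  \<^class>\<open>cancel_comm_monoid_add\<close>, and the monoid algebra \<open>k[N]\<close> is the type
  \<open>'n \<Rightarrow>\<^sub>0 'k\<close> with its convolution product. Quotient monoids, group completions, coordinate
  rings and local rings do not live on whole types; they are HOL-Algebra records
  (so the quotient monoid \<open>N/I\<close> is written multiplicatively).
\<close>


section \<open>Monoids\<close>

definition monoid_ideal :: "'n::comm_monoid_add set \<Rightarrow> bool"
  where "monoid_ideal I \<longleftrightarrow> {a + b | a b. a \<in> I} = I"

definition rees_class :: "'n set \<Rightarrow> 'n \<Rightarrow> 'n set"
  where "rees_class I x = (if x \<in> I then I else {x})"

text \<open>The monoid \<open>N/I\<close>: the set \<open>I\<close>, if nonempty, is the absorbing element.\<close>

definition rees_quotient :: "'n::comm_monoid_add set \<Rightarrow> 'n set monoid"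
  where "rees_quotient I =
    \<lparr>carrier = range (rees_class I),
     monoid.mult = (\<lambda>U V. \<Union>x\<in>U. \<Union>y\<in>V. rees_class I (x + y)),
     monoid.one = rees_class I 0\<rparr>"

definition finitely_generated_monoid :: "('m, 'x) monoid_scheme \<Rightarrow> bool"
  where "finitely_generated_monoid M \<longleftrightarrow>
    (\<exists>S \<subseteq> carrier M. finite S \<and> (\<forall>H. submonoid H M \<and> S \<subseteq> H \<longrightarrow> H = carrier M))"

text \<open>The class of the formal difference of \<open>a\<close> and \<open>b\<close> in the group completion.\<close>

definition gp_class :: "('m, 'x) monoid_scheme \<Rightarrow> 'm \<Rightarrow> 'm \<Rightarrow> ('m \<times> 'm) set"
  where "gp_class M a b =
    {(c, d). c \<in> carrier M \<and> d \<in> carrier M \<and>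
       (\<exists>e \<in> carrier M. a \<otimes>\<^bsub>M\<^esub> d \<otimes>\<^bsub>M\<^esub> e = c \<otimes>\<^bsub>M\<^esub> b \<otimes>\<^bsub>M\<^esub> e)}"

definition group_completion :: "('m, 'x) monoid_scheme \<Rightarrow> ('m \<times> 'm) set monoid"
  where "group_completion M =
    \<lparr>carrier = {gp_class M a b | a b. a \<in> carrier M \<and> b \<in> carrier M},
     monoid.mult = (\<lambda>U V. \<Union>(a, b)\<in>U. \<Union>(c, d)\<in>V. gp_class M (a \<otimes>\<^bsub>M\<^esub> c) (b \<otimes>\<^bsub>M\<^esub> d)),
     monoid.one = gp_class M \<one>\<^bsub>M\<^esub> \<one>\<^bsub>M\<^esub>\<rparr>"

definition torsion_subgroup :: "('g, 'x) monoid_scheme \<Rightarrow> 'g set"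
  where "torsion_subgroup G = {x \<in> carrier G. \<exists>n::nat. n > 0 \<and> x [^]\<^bsub>G\<^esub> n = \<one>\<^bsub>G\<^esub>}"

text \<open>
  For a finitely generated abelian group, the free part is the quotient by the torsion
  subgroup. The value is meaningful only for groups whose free part has finite rank.
\<close>

definition free_rank :: "('g, 'x) monoid_scheme \<Rightarrow> nat"
  where "free_rank G = (THE r. (G Mod torsion_subgroup G) \<cong> free_Abelian_group {..<r})"

definition monoid_rank :: "('m, 'x) monoid_scheme \<Rightarrow> nat"
  where "monoid_rank M = free_rank (group_completion M)"

text \<open>
  The algebra \<open>k[N/I] = k[N]/k[I]\<close> for \<open>I \<noteq> N\<close>; here \<open>k[I]\<close> consists of the elements of
  \<open>k[N]\<close> supported on \<open>I\<close>, and it is \<open>0\<close> for empty \<open>I\<close>. By convention \<open>k[N/N] = k\<close>, realized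
  as the ring of constants of \<open>k[N]\<close>; the quotient by the zero ideal only adjusts the type.
\<close>

definition quotient_monoid_algebra ::
    "'n::comm_monoid_add set \<Rightarrow> ('n \<Rightarrow>\<^sub>0 'k::field) set ring"
  where "quotient_monoid_algebra I =
    (if I = UNIV
     then ring_of_type_algebra\<lparr>carrier := range (Poly_Mapping.single 0)\<rparr> Quot {0}
     else ring_of_type_algebra Quot {f. Poly_Mapping.keys f \<subseteq> I})"


section \<open>Commutative algebra\<close>

definition reduced_ring :: "('a, 'x) ring_scheme \<Rightarrow> bool"
  where "reduced_ring R \<longleftrightarrow>
    (\<forall>x \<in> carrier R. \<forall>n::nat. x [^]\<^bsub>R\<^esub> n = \<zero>\<^bsub>R\<^esub> \<longrightarrow> x = \<zero>\<^bsub>R\<^esub>)"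

text \<open>The fraction \<open>r/s\<close>, as an equivalence class of pairs, and the ring of fractions.\<close>

definition fraction :: "('a, 'x) ring_scheme \<Rightarrow> 'a set \<Rightarrow> 'a \<Rightarrow> 'a \<Rightarrow> ('a \<times> 'a) set"
  where "fraction R S r s =
    {(r', s'). r' \<in> carrier R \<and> s' \<in> S \<and>
       (\<exists>t \<in> S. t \<otimes>\<^bsub>R\<^esub> (s' \<otimes>\<^bsub>R\<^esub> r \<ominus>\<^bsub>R\<^esub> s \<otimes>\<^bsub>R\<^esub> r') = \<zero>\<^bsub>R\<^esub>)}"

definition localization :: "('a, 'x) ring_scheme \<Rightarrow> 'a set \<Rightarrow> ('a \<times> 'a) set ring"
  where "localization R S =
    \<lparr>carrier = {fraction R S r s | r s. r \<in> carrier R \<and> s \<in> S},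
     monoid.mult = (\<lambda>U V. \<Union>(r, s)\<in>U. \<Union>(r', s')\<in>V.
       fraction R S (r \<otimes>\<^bsub>R\<^esub> r') (s \<otimes>\<^bsub>R\<^esub> s')),
     monoid.one = fraction R S \<one>\<^bsub>R\<^esub> \<one>\<^bsub>R\<^esub>,
     ring.zero = fraction R S \<zero>\<^bsub>R\<^esub> \<one>\<^bsub>R\<^esub>,
     ring.add = (\<lambda>U V. \<Union>(r, s)\<in>U. \<Union>(r', s')\<in>V.
       fraction R S (r \<otimes>\<^bsub>R\<^esub> s' \<oplus>\<^bsub>R\<^esub> r' \<otimes>\<^bsub>R\<^esub> s) (s \<otimes>\<^bsub>R\<^esub> s'))\<rparr>"

abbreviation localization_at :: "('a, 'x) ring_scheme \<Rightarrow> 'a set \<Rightarrow> ('a \<times> 'a) set ring"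
  where "localization_at R P \<equiv> localization R (carrier R - P)"

abbreviation to_local :: "('a, 'x) ring_scheme \<Rightarrow> 'a set \<Rightarrow> 'a \<Rightarrow> ('a \<times> 'a) set"
  where "to_local R P r \<equiv> fraction R (carrier R - P) r \<one>\<^bsub>R\<^esub>"

definition nonzerodivisors :: "('a, 'x) ring_scheme \<Rightarrow> 'a set"
  where "nonzerodivisors R =
    {s \<in> carrier R. \<forall>r \<in> carrier R. s \<otimes>\<^bsub>R\<^esub> r = \<zero>\<^bsub>R\<^esub> \<longrightarrow> r = \<zero>\<^bsub>R\<^esub>}"

abbreviation total_quotient_ring :: "('a, 'x) ring_scheme \<Rightarrow> ('a \<times> 'a) set ring"
  where "total_quotient_ring R \<equiv> localization R (nonzerodivisors R)"

text \<open>Suprema of lengths of strict chains of primes; the zero ring gets the value \<open>0\<close>.\<close>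

definition krull_dim :: "('a, 'x) ring_scheme \<Rightarrow> enat"
  where "krull_dim R =
    Sup {enat n | n. \<exists>P. (\<forall>i\<le>n. primeideal (P i) R) \<and> (\<forall>i<n. P i \<subset> P (Suc i))}"

text \<open>The length of \<open>R\<close> as a module over itself; its submodules are the ideals.\<close>

definition ring_length :: "('a, 'x) ring_scheme \<Rightarrow> enat"
  where "ring_length R =
    Sup {enat n | n. \<exists>I. (\<forall>i\<le>n. ideal (I i) R) \<and> (\<forall>i<n. I i \<subset> I (Suc i))}"

definition regular_local_ring :: "('a, 'x) ring_scheme \<Rightarrow> bool"
  where "regular_local_ring R \<longleftrightarrow>
    cring R \<and> noetherian_ring R \<and>
    (\<exists>\<mm>. {I. maximalideal I R} = {\<mm>} \<and>
      (\<exists>G \<subseteq> carrier R. finite G \<and> enat (card G) = krull_dim R \<and> \<mm> = genideal R G))"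

definition regular_sequence :: "('a, 'x) ring_scheme \<Rightarrow> 'a list \<Rightarrow> bool"
  where "regular_sequence R xs \<longleftrightarrow>
    set xs \<subseteq> carrier R \<and> genideal R (set xs) \<noteq> carrier R \<and>
    (\<forall>i < length xs. \<forall>r \<in> carrier R.
       xs ! i \<otimes>\<^bsub>R\<^esub> r \<in> genideal R (set (take i xs)) \<longrightarrow> r \<in> genideal R (set (take i xs)))"

definition minimal_prime_over :: "('a, 'x) ring_scheme \<Rightarrow> 'a set \<Rightarrow> 'a set \<Rightarrow> bool"
  where "minimal_prime_over R J P \<longleftrightarrow>
    primeideal P R \<and> J \<subseteq> P \<and> (\<forall>Q. primeideal Q R \<and> J \<subseteq> Q \<and> Q \<subseteq> P \<longrightarrow> Q = P)"


section \<open>The Levine-Weibel Chow group of an affine scheme\<close>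

text \<open>
  Points of \<open>X = Spec A\<close> are prime ideals of \<open>A\<close>, closed points are maximal ideals. A closed
  subscheme \<open>C\<close> is given by an ideal \<open>J\<close>; a prime \<open>P\<close> containing \<open>J\<close> is a point of \<open>C\<close>, and
  it corresponds to the prime \<open>quot_point A J P = P/J\<close> of \<open>A/J\<close>.
\<close>

definition Spec :: "('a, 'x) ring_scheme \<Rightarrow> 'a set set"
  where "Spec A = {P. primeideal P A}"

definition reg_locus :: "('a, 'x) ring_scheme \<Rightarrow> 'a set set"
  where "reg_locus A = {P \<in> Spec A. regular_local_ring (localization_at A P)}"

definition sing_locus :: "('a, 'x) ring_scheme \<Rightarrow> 'a set set"
  where "sing_locus A = Spec A - reg_locus A"

definition closed_points :: "('a, 'x) ring_scheme \<Rightarrow> 'a set set"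
  where "closed_points A = {P. maximalideal P A}"

definition vanishing_set :: "('a, 'x) ring_scheme \<Rightarrow> 'a set \<Rightarrow> 'a set set"
  where "vanishing_set A J = {P \<in> Spec A. J \<subseteq> P}"

definition quot_point :: "('a, 'x) ring_scheme \<Rightarrow> 'a set \<Rightarrow> 'a set \<Rightarrow> 'a set set"
  where "quot_point A J P = (\<lambda>a. J +>\<^bsub>A\<^esub> a) ` P"

definition cartier_curve :: "('a, 'x) ring_scheme \<Rightarrow> 'a set \<Rightarrow> bool"
  where "cartier_curve A J \<longleftrightarrow>
    ideal J A \<and>
    (\<forall>P. minimal_prime_over A J P \<longrightarrow> krull_dim (A Quot P) = 1) \<and>
    (\<forall>P. minimal_prime_over A J P \<longrightarrow> \<not> vanishing_set A P \<subseteq> sing_locus A) \<and>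
    (\<forall>P \<in> vanishing_set A J \<inter> sing_locus A.
       \<exists>xs. regular_sequence (localization_at A P) xs \<and>
         genideal (localization_at A P) (to_local A P ` J)
           = genideal (localization_at A P) (set xs))"

text \<open>
  Let \<open>f = a/b\<close> with \<open>b\<close> a nonzerodivisor of \<open>B\<close>. As \<open>b\<close> stays a nonzerodivisor in \<open>B\<^sub>P\<close>, the
  condition \<open>a = u b\<close> in \<open>B\<^sub>P\<close> says that \<open>f\<close> and the unit \<open>u\<close> of \<open>B\<^sub>P\<close> agree in the total
  quotient ring of \<open>B\<^sub>P\<close>. It does not depend on the representation of \<open>f\<close>.
\<close>

definition unit_at :: "('a, 'x) ring_scheme \<Rightarrow> 'a set \<Rightarrow> ('a \<times> 'a) set \<Rightarrow> bool"
  where "unit_at B P f \<longleftrightarrow>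
    (\<exists>a \<in> carrier B. \<exists>b \<in> nonzerodivisors B. f = fraction B (nonzerodivisors B) a b \<and>
      (\<exists>u \<in> Units (localization_at B P).
        to_local B P a = u \<otimes>\<^bsub>localization_at B P\<^esub> to_local B P b))"

text \<open>The group \<open>k(C, X\<^sub>s\<^sub>i\<^sub>n\<^sub>g)\<^sup>\<times>\<close>.\<close>

definition curve_units :: "('a, 'x) ring_scheme \<Rightarrow> 'a set \<Rightarrow> ('a set \<times> 'a set) set set"
  where "curve_units A J =
    {f \<in> Units (total_quotient_ring (A Quot J)).
       \<forall>P \<in> vanishing_set A J \<inter> sing_locus A. unit_at (A Quot J) (quot_point A J P) f}"

definition local_colength :: "('a, 'x) ring_scheme \<Rightarrow> 'a set \<Rightarrow> 'a \<Rightarrow> int"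
  where "local_colength B P a =
    int (the_enat (ring_length
      (localization_at B P Quot genideal (localization_at B P) {to_local B P a})))"

text \<open>
  Order of vanishing of \<open>f = a/b\<close>, with \<open>a\<close> and \<open>b\<close> nonzerodivisors, at a closed point of a
  one-dimensional \<open>Spec B\<close>: the difference of the lengths of \<open>B\<^sub>P/a\<close> and \<open>B\<^sub>P/b\<close>, which does
  not depend on \<open>a\<close> and \<open>b\<close>. For several components, or non-reduced \<open>B\<close>, this is the sum of
  the orders on the components weighted by their multiplicities (Fulton, Intersection
  Theory, Lemma A.2.7).
\<close>

definition vanishing_order :: "('a, 'x) ring_scheme \<Rightarrow> 'a set \<Rightarrow> ('a \<times> 'a) set \<Rightarrow> int"
  where "vanishing_order B P f =
    (THE m. \<exists>a \<in> nonzerodivisors B. \<exists>b \<in> nonzerodivisors B.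
       f = fraction B (nonzerodivisors B) a b \<and>
       m = local_colength B P a - local_colength B P b)"

text \<open>
  The sum is finite. For \<open>f\<close> in \<open>curve_units A J\<close> the order at a singular point of \<open>X\<close> is
  \<open>0\<close>, so only regular closed points contribute.
\<close>

definition curve_divisor ::
    "('a, 'x) ring_scheme \<Rightarrow> 'a set \<Rightarrow> ('a set \<times> 'a set) set \<Rightarrow> 'a set \<Rightarrow>\<^sub>0 int"
  where "curve_divisor A J f =
    (\<Sum>P \<in> {P \<in> closed_points A. J \<subseteq> P \<and>
              vanishing_order (A Quot J) (quot_point A J P) f \<noteq> 0}.
       frag_cmul (vanishing_order (A Quot J) (quot_point A J P) f) (frag_of P))"

definition zero_cycles :: "('a, 'x) ring_scheme \<Rightarrow> ('a set \<Rightarrow>\<^sub>0 int) monoid"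
  where "zero_cycles A = free_Abelian_group (closed_points A \<inter> reg_locus A)"

definition CH0_LW :: "('a, 'x) ring_scheme \<Rightarrow> ('a set \<Rightarrow>\<^sub>0 int) set monoid"
  where "CH0_LW A =
    zero_cycles A Mod
      generate (zero_cycles A)
        {curve_divisor A J f | J f. cartier_curve A J \<and> f \<in> curve_units A J}"

end

theory Submission
  imports Defs "HOL-Computational_Algebra.Fraction_Field"
begin

text \<open>
  A nonempty ideal makes the group completion trivial, so \<open>I = {}\<close> and the ring is \<open>k[N]\<close> with
  \<open>N\<close> cancellative. By the Nullstellensatz a closed point is a character \<open>x\<close> of \<open>N\<close>. It suffices
  to find, for regular \<open>x\<close>, a surjection \<open>\<psi>\<close> from \<open>k[N]\<close> to \<open>k[t, 1/t]\<close> that lies over \<open>x\<close> at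
  \<open>t = 1\<close> and whose kernel is locally a complete intersection away from \<open>x\<close>: on this curve,
  \<open>t - 1\<close> has divisor \<open>[x]\<close>.

  Regularity at \<open>x\<close> bounds the dimension of the cotangent space by the rank \<open>r\<close>. Hence \<open>N\<close> has
  \<open>r\<close> integral coordinates \<open>\<kappa> i\<close>, separating elements up to torsion, such that those with
  \<open>i \<ge> s\<close> are nonnegative and vanish jointly exactly on the face where \<open>x\<close> is nonzero. On this
  face \<open>x\<close> extends to a character \<open>\<phi>\<close> of the whole group completion, and \<open>\<psi>\<close> sends \<open>n\<close> to
  \<open>\<phi>(n) t^(w \<cdot> \<kappa>(n)) (t - 1)^(e \<cdot> \<kappa>(n))\<close>; for \<open>r \<ge> 2\<close> the exponents can be chosen to make \<open>\<psi>\<close>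
  surjective. Away from \<open>x\<close> its kernel is reached from a minimal prime by specializing one
  coordinate at a time, each step adding one equation. Reducedness of \<open>k[N]\<close> means that the
  torsion is prime to the characteristic, so that the irreducible components of the spectrum are
  disjoint.
\<close>

section \<open>Homogeneous linear systems\<close>

text \<open>The monoid need not be normal and may have torsion, so neither its regular points nor
  the curves through them can be read off from known geometry. Regularity is used only numerically:
  it supplies local generators of the maximal ideal together with a chain of primes at least as long
  as their number, and the bound of this length by r forces the monoid, once the face of x is
  inverted, to be a group times a free monoid. The curve is built from powers of t and t - 1 because
  these are invertible away from t = 1. Hence at every point of the curve other than x all monomials
  are invertible, and the equations of the curve only have to be understood on the torus. There the
  primes of the chain are kernels of maps into one field of rational functions, so they are prime by
  construction. Surjectivity requires both t and 1/t in the image. A single nonnegative coordinate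
  cannot supply both, but two can, for instance (t - 1)/t and t - 1; this is where the bound on the
  rank comes from.\<close>

lemma homogeneous_system_nontrivial_solution:
  fixes a :: "'i \<Rightarrow> 'j \<Rightarrow> 'a::idom"
  assumes "finite J" "finite I" "card J < card I"
  shows "\<exists>c. (\<exists>i\<in>I. c i \<noteq> 0) \<and> (\<forall>j\<in>J. (\<Sum>i\<in>I. c i * a i j) = 0)"
  using assms
proof (induction J arbitrary: I a rule: finite_induct)
  case empty
  then have "I \<noteq> {}" by auto
  then show ?case by (intro exI[of _ "\<lambda>_. 1"]) auto
next
  case (insert j J)
  show ?case
  proof (cases "\<forall>i\<in>I. a i j = 0")
    case True
    have "card J < card I" using insert by simp
    from insert.IH[OF insert.prems(1) this, of a] obtain c where
      "\<exists>i\<in>I. c i \<noteq> 0" "\<forall>j\<in>J. (\<Sum>i\<in>I. c i * a i j) = 0" by blast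
    with True show ?thesis by (intro exI[of _ c]) auto
  next
    case False
    then obtain i0 where i0: "i0 \<in> I" "a i0 j \<noteq> 0" by blast
    define I' where "I' = I - {i0}"
    have fI': "finite I'" using insert by (simp add: I'_def)
    have I: "I = insert i0 I'" "i0 \<notin> I'" using i0 by (auto simp: I'_def)
    have "card J < card I'" using insert I fI' by simp
    from insert.IH[OF fI' this, of "\<lambda>i l. a i0 j * a i l - a i j * a i0 l"] obtain c where
      c: "\<exists>i\<in>I'. c i \<noteq> 0" "\<forall>l\<in>J. (\<Sum>i\<in>I'. c i * (a i0 j * a i l - a i j * a i0 l)) = 0"
      by blast
    \<comment> \<open>The rows are combined by cross-multiplication with the pivot
      \<open>a i0 j\<close>, so no division occurs and the argument also covers \<open>int\<close>.
      The coefficient of the pivot row is then forced by the equation for \<open>j\<close>.\<close>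
    define c' where "c' i = (if i = i0 then - (\<Sum>i\<in>I'. c i * a i j) else c i * a i0 j)" for i
    have sum: "(\<Sum>i\<in>I. c' i * a i l) = (\<Sum>i\<in>I'. c i * (a i0 j * a i l - a i j * a i0 l))" for l
    proof -
      have "(\<Sum>i\<in>I. c' i * a i l) = c' i0 * a i0 l + (\<Sum>i\<in>I'. c' i * a i l)"
        using I fI' by simp
      also have "(\<Sum>i\<in>I'. c' i * a i l) = (\<Sum>i\<in>I'. c i * a i0 j * a i l)"
        by (rule sum.cong) (use I in \<open>auto simp: c'_def\<close>)
      finally have "(\<Sum>i\<in>I. c' i * a i l) = c' i0 * a i0 l + (\<Sum>i\<in>I'. c i * a i0 j * a i l)" .
      then show ?thesis
        by (simp add: c'_def[of i0] sum_distrib_right right_diff_distrib sum_subtractf mult.assoc)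
    qed
    have "(\<Sum>i\<in>I. c' i * a i l) = 0" if "l \<in> insert j J" for l
      using that c(2) unfolding sum by (auto simp: algebra_simps)
    moreover have "\<exists>i\<in>I. c' i \<noteq> 0"
      using c(1) i0(2) I by (auto simp: c'_def)
    ultimately show ?thesis by blast
  qed
qed

text \<open>Dimension counting over \<open>int\<close>. With fewer than r vectors the rows
  \<open>w i\<close> would be dependent, and applying the dependence to \<open>v\<close> would make
  a nontrivial combination of unit vectors vanish. With at most r vectors, a relation
  \<open>c\<close> is appended to the rows; the r + 1 rows are dependent, and the same evaluation
  leaves only a multiple of \<open>c\<close>.\<close>

lemma integral_spanning_family:
  fixes v :: "'j \<Rightarrow> nat \<Rightarrow> int" and w :: "nat \<Rightarrow> 'j \<Rightarrow> int"
  assumes fin: "finite J"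
    and span: "\<And>i l. i < r \<Longrightarrow> l < r \<Longrightarrow> (\<Sum>j\<in>J. w i j * v j l) = (if i = l then 1 else 0)"
  shows integral_spanning_family_card: "r \<le> card J"
    and integral_spanning_family_independent:
      "card J \<le> r \<Longrightarrow> (\<And>l. l < r \<Longrightarrow> (\<Sum>j\<in>J. c j * v j l) = 0) \<Longrightarrow> j \<in> J \<Longrightarrow> c j = 0"
proof -
  have comb: "(\<Sum>j\<in>J. (\<Sum>i<r. y i * w i j) * v j l) = y l" if "l < r" for y l
  proof -
    have "(\<Sum>j\<in>J. (\<Sum>i<r. y i * w i j) * v j l) = (\<Sum>j\<in>J. \<Sum>i<r. y i * (w i j * v j l))"
      by (simp add: sum_distrib_right mult.assoc)
    also have "\<dots> = (\<Sum>i<r. y i * (\<Sum>j\<in>J. w i j * v j l))"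
      by (subst sum.swap) (simp add: sum_distrib_left)
    also have "\<dots> = (\<Sum>i<r. if i = l then y i else 0)"
      by (rule sum.cong) (use that span in auto)
    also have "\<dots> = y l" using that by simp
    finally show ?thesis .
  qed
  show "r \<le> card J"
  proof (rule ccontr)
    assume "\<not> r \<le> card J"
    then obtain y where y: "\<exists>i<r. y i \<noteq> 0" "\<forall>j\<in>J. (\<Sum>i<r. y i * w i j) = 0"
      using homogeneous_system_nontrivial_solution[OF fin, of "{..<r}" w] by auto
    then show False using comb[of _ y] by auto
  qed
  assume le: "card J \<le> r" and c0: "\<And>l. l < r \<Longrightarrow> (\<Sum>j\<in>J. c j * v j l) = 0" and j: "j \<in> J"
  have "card J < card {..r}" using le by simp
  from homogeneous_system_nontrivial_solution[OF fin finite_atMost this,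
      of "\<lambda>i j. if i < r then w i j else c j"]
  obtain y where y: "\<exists>i\<le>r. y i \<noteq> 0"
    "\<forall>j\<in>J. (\<Sum>i\<le>r. y i * (if i < r then w i j else c j)) = 0" by auto
  have eq: "(\<Sum>i<r. y i * w i j) = - (y r * c j)" if "j \<in> J" for j
  proof -
    have "(\<Sum>i\<le>r. y i * (if i < r then w i j else c j)) = (\<Sum>i<r. y i * w i j) + y r * c j"
      by (simp add: lessThan_Suc_atMost[symmetric])
    then show ?thesis using y(2) that by (simp add: eq_neg_iff_add_eq_0)
  qed
  have y0: "y l = 0" if "l < r" for l
  proof -
    have "y l = (\<Sum>j\<in>J. - (y r * c j) * v j l)"
      using comb[OF that, of y] eq by (simp cong: sum.cong)
    also have "\<dots> = - y r * (\<Sum>j\<in>J. c j * v j l)"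
      by (simp add: sum_distrib_left sum_negf mult.assoc)
    finally show ?thesis using c0[OF that] by simp
  qed
  then have "y r \<noteq> 0" using y(1) by (metis nat_less_le)
  moreover have "y r * c j = 0" using eq[OF j] y0 by simp
  ultimately show "c j = 0" by simp
qed

section \<open>Integral coordinates on finitely generated monoids\<close>

definition additive_on :: "'a::plus set \<Rightarrow> ('a \<Rightarrow> 'b::plus) \<Rightarrow> bool"
  where "additive_on H p \<longleftrightarrow> (\<forall>x\<in>H. \<forall>y\<in>H. p (x + y) = p x + p y)"

lemma additive_onD: "additive_on H p \<Longrightarrow> x \<in> H \<Longrightarrow> y \<in> H \<Longrightarrow> p (x + y) = p x + p y"
  by (auto simp: additive_on_def)

text \<open>A Z-basis \<open>b\<close> of the subgroup \<open>H\<close> with its dual coordinates.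
  Requiring that the coordinates separate points replaces the statement that \<open>b\<close>
  generates.\<close>

definition lattice_coords ::
    "(nat \<Rightarrow>\<^sub>0 int) set \<Rightarrow> nat \<Rightarrow> (nat \<Rightarrow> (nat \<Rightarrow>\<^sub>0 int) \<Rightarrow> int) \<Rightarrow> (nat \<Rightarrow> (nat \<Rightarrow>\<^sub>0 int)) \<Rightarrow> bool"
  where "lattice_coords H t \<kappa> b \<longleftrightarrow>
    (\<forall>i<t. b i \<in> H) \<and> (\<forall>i<t. additive_on H (\<kappa> i)) \<and>
    (\<forall>i<t. \<forall>j<t. \<kappa> i (b j) = (if i = j then 1 else 0)) \<and>
    (\<forall>x\<in>H. (\<forall>i<t. \<kappa> i x = 0) \<longrightarrow> x = 0)"

definition lattice :: "(nat \<Rightarrow>\<^sub>0 int) set \<Rightarrow> bool"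
  where "lattice H \<longleftrightarrow> 0 \<in> H \<and> (\<forall>x\<in>H. \<forall>y\<in>H. x - y \<in> H)"

lemma lattice_closed:
  assumes "lattice H"
  shows "0 \<in> H" "x \<in> H \<Longrightarrow> y \<in> H \<Longrightarrow> x - y \<in> H" "x \<in> H \<Longrightarrow> - x \<in> H"
    "x \<in> H \<Longrightarrow> y \<in> H \<Longrightarrow> x + y \<in> H" "x \<in> H \<Longrightarrow> frag_cmul m x \<in> H"
proof -
  show 0: "0 \<in> H" and diff: "x \<in> H \<Longrightarrow> y \<in> H \<Longrightarrow> x - y \<in> H" for x y
    using assms by (auto simp: lattice_def)
  show neg: "- x \<in> H" if "x \<in> H" for x
    using diff[OF 0 that] by simp
  show add: "x + y \<in> H" if "x \<in> H" "y \<in> H" for x y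
    using diff[OF that(1) neg[OF that(2)]] by simp
  have nat: "frag_cmul (int n) x \<in> H" if "x \<in> H" for n
    by (induction n) (use 0 add that in \<open>auto simp: frag_cmul_distrib\<close>)
  show "frag_cmul m x \<in> H" if "x \<in> H"
    using nat[OF that] neg[OF nat[OF that]] by (cases m rule: int_cases2) (auto simp flip: minus_frag_cmul)
qed

lemma additive_on_lattice:
  fixes p :: "_ \<Rightarrow> int"
  assumes "lattice H" and "additive_on H p"
  shows "p 0 = 0" "x \<in> H \<Longrightarrow> p (- x) = - p x" "x \<in> H \<Longrightarrow> y \<in> H \<Longrightarrow> p (x - y) = p x - p y"
    "x \<in> H \<Longrightarrow> p (frag_cmul m x) = m * p x"
proof -
  note cl = lattice_closed[OF assms(1)] and add = additive_onD[OF assms(2)]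
  show 0: "p 0 = 0" using add[of 0 0] cl by simp
  show neg: "p (- x) = - p x" if "x \<in> H" for x
    using add[of x "- x"] cl that 0 by simp
  show "p (x - y) = p x - p y" if "x \<in> H" "y \<in> H" for x y
    using add[of x "- y"] neg cl that by simp
  have nat: "p (frag_cmul (int n) x) = int n * p x" if "x \<in> H" for n
    by (induction n) (use 0 add that cl in \<open>auto simp: frag_cmul_distrib algebra_simps\<close>)
  show "p (frag_cmul m x) = m * p x" if "x \<in> H"
    using nat[OF that] neg[OF cl(5)[OF that]]
    by (cases m rule: int_cases2) (auto simp flip: minus_frag_cmul)
qed

text \<open>Since \<open>p\<close> takes the value 1 at \<open>h\<close>, the map
  \<open>x - p(x) h\<close> projects \<open>H\<close> onto the kernel of \<open>p\<close>, and a
  basis of the kernel together with \<open>h\<close> is a basis of \<open>H\<close>. Placing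
  \<open>p\<close> at index 0 allows a prescribed functional to become the first coordinate.\<close>

lemma lattice_coords_extend:
  assumes H: "lattice H" and add: "additive_on H p"
    and h: "h \<in> H" "p h = 1"
    and co: "lattice_coords {x \<in> H. p x = 0} t \<kappa> b"
  shows "\<exists>\<kappa>' b'. lattice_coords H (Suc t) \<kappa>' b' \<and> \<kappa>' 0 = p"
proof -
  note cl = lattice_closed[OF H]
  note pa = additive_on_lattice[OF H add] and padd = additive_onD[OF add]
  let ?H0 = "{x \<in> H. p x = 0}"
  define \<pi> where "\<pi> x = x - frag_cmul (p x) h" for x
  have \<pi>: "\<pi> x \<in> ?H0" if "x \<in> H" for x
    using that cl pa h by (simp add: \<pi>_def)
  have \<pi>add: "\<pi> (x + y) = \<pi> x + \<pi> y" if "x \<in> H" "y \<in> H" for x y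
    using that by (simp add: \<pi>_def padd frag_cmul_distrib)
  have \<pi>0: "\<pi> x = x" if "x \<in> ?H0" for x
    using that by (simp add: \<pi>_def)
  have \<pi>h: "\<pi> h = 0" using h by (simp add: \<pi>_def)
  have k0: "\<kappa> i 0 = 0" if "i < t" for i
  proof -
    have "additive_on ?H0 (\<kappa> i)" using co that by (simp add: lattice_coords_def)
    from additive_onD[OF this, of 0 0] show ?thesis using cl(1) pa(1) by simp
  qed
  define \<kappa>' where "\<kappa>' i x = (case i of 0 \<Rightarrow> p x | Suc j \<Rightarrow> \<kappa> j (\<pi> x))" for i x
  define b' where "b' i = (case i of 0 \<Rightarrow> h | Suc j \<Rightarrow> b j)" for i
  have bH: "b i \<in> ?H0" if "i < t" for i using co that by (auto simp: lattice_coords_def)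
  have "lattice_coords H (Suc t) \<kappa>' b'"
    unfolding lattice_coords_def
  proof (intro conjI allI impI ballI)
    show "b' i \<in> H" if "i < Suc t" for i
      using that h bH by (auto simp: b'_def split: nat.splits)
    show "additive_on H (\<kappa>' i)" if "i < Suc t" for i
      using that co \<pi> padd \<pi>add
      by (auto simp: \<kappa>'_def lattice_coords_def additive_on_def split: nat.splits)
    show "\<kappa>' i (b' j) = (if i = j then 1 else 0)" if "i < Suc t" "j < Suc t" for i j
      using that co h \<pi>h \<pi>0 bH k0
      by (auto simp: \<kappa>'_def b'_def lattice_coords_def split: nat.splits)
    show "x = 0" if "x \<in> H" "\<forall>i<Suc t. \<kappa>' i x = 0" for x
    proof -
      have "\<kappa>' 0 x = 0" using that by blast
      then have px: "p x = 0" by (simp add: \<kappa>'_def)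
      have "\<kappa> i (\<pi> x) = 0" if i: "i < t" for i
      proof -
        have "\<kappa>' (Suc i) x = 0" using that i \<open>\<forall>i<Suc t. \<kappa>' i x = 0\<close> by blast
        then show ?thesis by (simp add: \<kappa>'_def)
      qed
      then have "\<pi> x = 0" using co \<pi>[OF \<open>x \<in> H\<close>] by (auto simp: lattice_coords_def)
      then show "x = 0" using px by (simp add: \<pi>_def)
    qed
  qed
  moreover have "\<kappa>' 0 = p" by (auto simp: \<kappa>'_def)
  ultimately show ?thesis by blast
qed

text \<open>Subgroups of \<open>int\<close> are cyclic: \<open>h\<close> attains the least positive
  value, and the remainder of any other value modulo it is again a value.\<close>

lemma int_subgroup_image_generator:
  fixes p :: "_ \<Rightarrow> int"
  assumes H: "lattice H" and add: "additive_on H p"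
    and ne: "\<exists>x\<in>H. p x \<noteq> 0"
  obtains h where "h \<in> H" "p h > 0" "\<And>x. x \<in> H \<Longrightarrow> p h dvd p x"
proof -
  note cl = lattice_closed[OF H]
  note pa = additive_on_lattice[OF H add] and padd = additive_onD[OF add]
  obtain x where x: "x \<in> H" "p x \<noteq> 0" using ne by blast
  have ex: "\<exists>d. d > 0 \<and> (\<exists>h\<in>H. p h = int d)"
  proof (cases "p x > 0")
    case True
    then show ?thesis using x(1) by (intro exI[of _ "nat (p x)"]) (auto intro: bexI[of _ x])
  next
    case False
    then have "p (- x) > 0" using x pa(2)[OF x(1)] by simp
    then show ?thesis using cl(3)[OF x(1)]
      by (intro exI[of _ "nat (p (- x))"]) (auto intro: bexI[of _ "- x"])
  qed
  define d where "d = (LEAST d. d > 0 \<and> (\<exists>h\<in>H. p h = int d))"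
  obtain h where h: "d > 0" "h \<in> H" "p h = int d"
    using LeastI_ex[OF ex] unfolding d_def by blast
  have "p h dvd p y" if y: "y \<in> H" for y
  proof -
    define z where "z = y - frag_cmul (p y div int d) h"
    have z: "z \<in> H" unfolding z_def by (intro cl(2) cl(5) y h)
    have "p z = p y - (p y div int d) * int d"
      unfolding z_def pa(3)[OF y cl(5)[OF h(2)]] pa(4)[OF h(2)] h(3) ..
    then have pz: "p z = p y mod int d" by (simp add: minus_div_mult_eq_mod)
    have "p z = 0"
    proof (rule ccontr)
      assume "p z \<noteq> 0"
      then have "p z > 0" using pz h(1) pos_mod_sign[of "int d" "p y"] by linarith
      then have "nat (p z) > 0 \<and> (\<exists>h\<in>H. p h = int (nat (p z)))" using z by (auto intro: bexI[of _ z])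
      then have "d \<le> nat (p z)" unfolding d_def by (rule Least_le)
      moreover have "p z < int d" using pz h(1) by simp
      ultimately show False using \<open>p z > 0\<close> by linarith
    qed
    then show ?thesis using pz h(3) by (simp add: mod_eq_0_iff_dvd)
  qed
  with h show ?thesis by (intro that[of h]) simp_all
qed

text \<open>Subgroups of Z^s are free. The last coordinate is divided by the generator of its image,
  so that it attains the value 1 and its kernel, which lies in Z^(s-1), splits off.\<close>

lemma lattice_coords_exist:
  assumes "lattice H" "\<And>x. x \<in> H \<Longrightarrow> Poly_Mapping.keys x \<subseteq> {..<s}"
  shows "\<exists>t \<kappa> b. lattice_coords H t \<kappa> b"
  using assms
proof (induction s arbitrary: H)
  case 0
  then have "\<forall>x\<in>H. x = 0" by auto
  then have "lattice_coords H 0 (\<lambda>_ _. 0) (\<lambda>_. 0)" by (auto simp: lattice_coords_def)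
  then show ?case by blast
next
  case (Suc s)
  let ?p = "\<lambda>x. Poly_Mapping.lookup x s"
  have padd: "additive_on H ?p" by (simp add: lookup_add additive_on_def)
  have keys0: "Poly_Mapping.keys x \<subseteq> {..<s}" if "x \<in> H" "?p x = 0" for x
  proof
    fix i assume "i \<in> Poly_Mapping.keys x"
    then have "i < Suc s" "i \<noteq> s" using Suc.prems(2)[OF that(1)] that(2) by (auto simp: in_keys_iff)
    then show "i \<in> {..<s}" by simp
  qed
  show ?case
  proof (cases "\<exists>x\<in>H. ?p x \<noteq> 0")
    case False
    then show ?thesis using Suc.IH[OF Suc.prems(1)] keys0 by blast
  next
    case True
    obtain h where h: "h \<in> H" "?p h > 0" "\<And>x. x \<in> H \<Longrightarrow> ?p h dvd ?p x"
      using int_subgroup_image_generator[OF Suc.prems(1) padd True] by blast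
    define p' where "p' x = ?p x div ?p h" for x
    have p'eq: "?p x = p' x * ?p h" if "x \<in> H" for x
      using h(3)[OF that] by (simp add: p'_def)
    have p'add: "additive_on H p'"
      unfolding additive_on_def
    proof (intro ballI)
      fix x y assume xy: "x \<in> H" "y \<in> H"
      show "p' (x + y) = p' x + p' y"
        using h(3)[OF xy(1)] by (simp add: p'_def lookup_add div_plus_div_distrib_dvd_left)
    qed
    have p'h: "p' h = 1" using h by (simp add: p'_def)
    have p'0: "p' x = 0 \<longleftrightarrow> ?p x = 0" if "x \<in> H" for x
      using p'eq[OF that] h by auto
    have "lattice {x \<in> H. p' x = 0}"
      using lattice_closed[OF Suc.prems(1)] p'0 by (auto simp: lattice_def lookup_minus)
    then obtain t \<kappa> b where "lattice_coords {x \<in> H. p' x = 0} t \<kappa> b"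
      using Suc.IH[of "{x \<in> H. p' x = 0}"] keys0 p'0 by blast
    from lattice_coords_extend[OF Suc.prems(1) p'add h(1) p'h this] show ?thesis by blast
  qed
qed

section \<open>Multiples, equality up to torsion, and finitely generated submonoids\<close>

definition nmul :: "nat \<Rightarrow> 'a::comm_monoid_add \<Rightarrow> 'a"
  where "nmul n x = (\<Sum>_<n. x)"

lemma nmul_simps [simp]: "nmul 0 x = 0" "nmul (Suc n) x = x + nmul n x" "nmul n 0 = 0"
  by (simp_all add: nmul_def add.commute)

lemma nmul_add: "nmul (m + n) x = nmul m x + nmul n x"
  by (induction m) (simp_all add: add.assoc)

lemma nmul_distrib: "nmul n (x + y) = nmul n x + nmul n y"
  by (simp add: nmul_def sum.distrib)

lemma nmul_mult: "nmul (m * n) x = nmul m (nmul n x)"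
  by (induction m) (simp_all add: nmul_add)

lemma nmul_commute: "nmul m (nmul n x) = nmul n (nmul m x)"
  by (metis nmul_mult mult.commute)

definition submon :: "'a::comm_monoid_add set \<Rightarrow> bool"
  where "submon F \<longleftrightarrow> 0 \<in> F \<and> (\<forall>x\<in>F. \<forall>y\<in>F. x + y \<in> F)"

lemma submon_closed:
  assumes "submon F"
  shows "0 \<in> F" "x \<in> F \<Longrightarrow> y \<in> F \<Longrightarrow> x + y \<in> F" "x \<in> F \<Longrightarrow> nmul n x \<in> F"
    "(\<And>i. i \<in> I \<Longrightarrow> f i \<in> F) \<Longrightarrow> sum f I \<in> F"
proof -
  show 0: "0 \<in> F" and add: "x \<in> F \<Longrightarrow> y \<in> F \<Longrightarrow> x + y \<in> F" for x y
    using assms by (auto simp: submon_def)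
  show "nmul n x \<in> F" if "x \<in> F"
    by (induction n) (use 0 add that in auto)
  show "sum f I \<in> F" if "\<And>i. i \<in> I \<Longrightarrow> f i \<in> F"
    using that by (induction I rule: infinite_finite_induct) (use 0 add in auto)
qed

lemma additive_on_submon:
  fixes p :: "'n::comm_monoid_add \<Rightarrow> 'b::ab_group_add"
  assumes "submon F" "additive_on F p"
  shows "p 0 = 0" "(\<And>i. i \<in> I \<Longrightarrow> f i \<in> F) \<Longrightarrow> p (sum f I) = (\<Sum>i\<in>I. p (f i))"
proof -
  show 0: "p 0 = 0"
    using additive_onD[OF assms(2), of 0 0] submon_closed(1)[OF assms(1)] by simp
  show "p (sum f I) = (\<Sum>i\<in>I. p (f i))" if "\<And>i. i \<in> I \<Longrightarrow> f i \<in> F"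
    using that
  proof (induction I rule: infinite_finite_induct)
    case (insert i I)
    have "sum f I \<in> F" using insert by (intro submon_closed(4)[OF assms(1)]) auto
    then show ?case using insert additive_onD[OF assms(2), of "f i" "sum f I"] by auto
  qed (use 0 in auto)
qed

lemma additive_on_nmul:
  assumes "submon F" "additive_on F p" "x \<in> F"
  shows "p (nmul n x) = (of_nat n * p x :: int)"
  using additive_on_submon(2)[OF assms(1,2), of "{..<n}" "\<lambda>_. x"] assms(3) by (simp add: nmul_def)

text \<open>In a cancellative monoid this is equality of the images in the group completion modulo
  torsion.\<close>

definition torsion_eq :: "'a::comm_monoid_add \<Rightarrow> 'a \<Rightarrow> bool"
  where "torsion_eq x y \<longleftrightarrow> (\<exists>m>0. nmul m x = nmul m y)"

lemma torsion_eq_refl [simp]: "torsion_eq x x"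
  unfolding torsion_eq_def by (rule exI[of _ 1]) simp

lemma torsion_eq_sym: "torsion_eq x y \<Longrightarrow> torsion_eq y x"
  by (auto simp: torsion_eq_def)

lemma torsion_eq_cancel [simp]:
  fixes x y z :: "'a::cancel_comm_monoid_add"
  shows "torsion_eq (x + z) (y + z) \<longleftrightarrow> torsion_eq x y"
  by (simp add: torsion_eq_def nmul_distrib)

lemma torsion_eq_nmul:
  assumes "n > 0"
  shows "torsion_eq (nmul n x) (nmul n y) \<longleftrightarrow> torsion_eq x y"
proof
  assume "torsion_eq (nmul n x) (nmul n y)"
  then obtain m where "m > 0" "nmul m (nmul n x) = nmul m (nmul n y)" by (auto simp: torsion_eq_def)
  then show "torsion_eq x y" using assms unfolding torsion_eq_def
    by (intro exI[of _ "m * n"]) (simp add: nmul_mult)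
next
  assume "torsion_eq x y"
  then obtain m where "m > 0" "nmul m x = nmul m y" by (auto simp: torsion_eq_def)
  then show "torsion_eq (nmul n x) (nmul n y)" unfolding torsion_eq_def
    by (intro exI[of _ m]) (simp add: nmul_commute[of m])
qed

lemma additive_on_torsion_eq:
  fixes p :: "'n::comm_monoid_add \<Rightarrow> int"
  assumes "submon F" "additive_on F p" "x \<in> F" "y \<in> F" "torsion_eq x y"
  shows "p x = p y"
proof -
  obtain m where m: "m > 0" "nmul m x = nmul m y" using assms(5) by (auto simp: torsion_eq_def)
  have "int m * p x = int m * p y"
    using m(2) additive_on_nmul[OF assms(1,2)] assms(3,4) by metis
  then show ?thesis using m(1) by simp
qed

text \<open>The submonoid generated by \<Gamma> when this set is finite; over an infinite set the
  sum is 0 by default.\<close>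

definition mspan :: "'a::comm_monoid_add set \<Rightarrow> 'a set"
  where "mspan \<Gamma> = range (\<lambda>c. \<Sum>g\<in>\<Gamma>. nmul (c g) g)"

lemma mspan_closed:
  shows "0 \<in> mspan \<Gamma>" "x \<in> mspan \<Gamma> \<Longrightarrow> y \<in> mspan \<Gamma> \<Longrightarrow> x + y \<in> mspan \<Gamma>"
  and submon_mspan: "submon (mspan \<Gamma>)"
proof -
  show 1: "0 \<in> mspan \<Gamma>"
    unfolding mspan_def by (rule range_eqI[of _ _ "\<lambda>_. 0"]) simp
  show 2: "x + y \<in> mspan \<Gamma>" if xy: "x \<in> mspan \<Gamma>" "y \<in> mspan \<Gamma>" for x y
  proof -
    obtain c d where "x = (\<Sum>g\<in>\<Gamma>. nmul (c g) g)" "y = (\<Sum>g\<in>\<Gamma>. nmul (d g) g)"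
      using xy by (auto simp: mspan_def)
    then have "x + y = (\<Sum>g\<in>\<Gamma>. nmul (c g + d g) g)" by (simp add: nmul_add sum.distrib)
    then show ?thesis unfolding mspan_def by (intro range_eqI[of _ _ "\<lambda>g. c g + d g"]) simp
  qed
  show "submon (mspan \<Gamma>)" using 1 2 by (simp add: submon_def)
qed

lemma mspan_superset: "finite \<Gamma> \<Longrightarrow> \<Gamma> \<subseteq> mspan \<Gamma>"
proof
  fix x assume x: "finite \<Gamma>" "x \<in> \<Gamma>"
  have "(\<Sum>g\<in>\<Gamma>. nmul (if g = x then 1 else 0) g) = (\<Sum>g\<in>\<Gamma>. if g = x then x else 0)"
    by (rule sum.cong) auto
  also have "\<dots> = x" using x by simp
  finally show "x \<in> mspan \<Gamma>" unfolding mspan_def by (intro range_eqI[of _ _ "\<lambda>g. if g = x then 1 else 0"]) simp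
qed

lemma mspan_insert:
  assumes "finite \<Gamma>" "g \<notin> \<Gamma>"
  shows "mspan (insert g \<Gamma>) = {x + nmul m g | x m. x \<in> mspan \<Gamma>}"
proof (intro Set.set_eqI iffI)
  fix y assume "y \<in> mspan (insert g \<Gamma>)"
  then obtain c where "y = (\<Sum>h\<in>insert g \<Gamma>. nmul (c h) h)" by (auto simp: mspan_def)
  then show "y \<in> {x + nmul m g | x m. x \<in> mspan \<Gamma>}"
    using assms unfolding mspan_def
    by (intro CollectI exI[of _ "\<Sum>h\<in>\<Gamma>. nmul (c h) h"] exI[of _ "c g"] conjI rangeI[of _ c])
      (simp_all add: add.commute)
next
  fix y assume "y \<in> {x + nmul m g | x m. x \<in> mspan \<Gamma>}"
  then obtain c m where y: "y = (\<Sum>h\<in>\<Gamma>. nmul (c h) h) + nmul m g" by (auto simp: mspan_def)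
  have "(\<Sum>h\<in>\<Gamma>. nmul (if h = g then m else c h) h) = (\<Sum>h\<in>\<Gamma>. nmul (c h) h)"
    by (rule sum.cong) (use assms in auto)
  then have "y = (\<Sum>h\<in>insert g \<Gamma>. nmul (if h = g then m else c h) h)"
    using assms y by (simp add: add.commute)
  then show "y \<in> mspan (insert g \<Gamma>)"
    unfolding mspan_def by (intro range_eqI[of _ _ "\<lambda>h. if h = g then m else c h"])
qed

text \<open>The map \<open>e\<close> is extended to \<open>x + m g\<close> by
  \<open>n e(x) + m v\<close>. Read from right to left, \<open>key\<close> makes this independent of
  the representation; read from left to right, it makes the extension faithful up to torsion. The
  factor \<open>n\<close> leaves room for an element \<open>g\<close> that is only rational over
  \<open>F\<close>.\<close>

lemma torsion_embedding_step:
  fixes F :: "'n::cancel_comm_monoid_add set" and e :: "'n \<Rightarrow> (nat \<Rightarrow>\<^sub>0 int)"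
  assumes F: "submon F" and e: "additive_on F e"
    and key: "\<And>x x' m m'. x \<in> F \<Longrightarrow> x' \<in> F \<Longrightarrow>
      frag_cmul n (e x) + frag_cmul (int m) v = frag_cmul n (e x') + frag_cmul (int m') v
      \<longleftrightarrow> torsion_eq (x + nmul m g) (x' + nmul m' g)"
  obtains e' where "additive_on {x + nmul m g | x m. x \<in> F} e'"
    "\<And>x m. x \<in> F \<Longrightarrow> e' (x + nmul m g) = frag_cmul n (e x) + frag_cmul (int m) v"
    "\<And>y y'. y \<in> {x + nmul m g | x m. x \<in> F} \<Longrightarrow> y' \<in> {x + nmul m g | x m. x \<in> F} \<Longrightarrow>
       e' y = e' y' \<Longrightarrow> torsion_eq y y'"
proof -
  define e' where "e' y = (SOME z. \<exists>x\<in>F. \<exists>m. y = x + nmul m g \<and>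
    z = frag_cmul n (e x) + frag_cmul (int m) v)" for y
  have e': "e' (x + nmul m g) = frag_cmul n (e x) + frag_cmul (int m) v" if "x \<in> F" for x m
  proof -
    have "\<exists>x'\<in>F. \<exists>m'. x + nmul m g = x' + nmul m' g \<and>
      e' (x + nmul m g) = frag_cmul n (e x') + frag_cmul (int m') v"
      unfolding e'_def by (rule someI_ex) (use that in blast)
    then obtain x' m' where "x' \<in> F" "x + nmul m g = x' + nmul m' g"
      "e' (x + nmul m g) = frag_cmul n (e x') + frag_cmul (int m') v" by blast
    then show ?thesis using key[OF that \<open>x' \<in> F\<close>, of m m'] by simp
  qed
  show thesis
  proof
    show "additive_on {x + nmul m g | x m. x \<in> F} e'"
      unfolding additive_on_def
    proof (intro ballI)
      fix y y' assume "y \<in> {x + nmul m g | x m. x \<in> F}" "y' \<in> {x + nmul m g | x m. x \<in> F}"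
      then obtain x m x' m' where y: "x \<in> F" "y = x + nmul m g" "x' \<in> F" "y' = x' + nmul m' g"
        by fastforce
      have xx: "x + x' \<in> F" using y submon_closed[OF F] by blast
      have "y + y' = (x + x') + nmul (m + m') g" using y by (simp add: nmul_add ac_simps)
      then have "e' (y + y') = frag_cmul n (e (x + x')) + frag_cmul (int (m + m')) v"
        using e'[OF xx] by simp
      also have "\<dots> = e' y + e' y'"
        using y e' additive_onD[OF e] by (simp add: frag_cmul_distrib frag_cmul_distrib2 ac_simps)
      finally show "e' (y + y') = e' y + e' y'" .
    qed
    show "e' (x + nmul m g) = frag_cmul n (e x) + frag_cmul (int m) v" if "x \<in> F" for x m
      using that by (rule e')
    show "torsion_eq y y'" if yy: "y \<in> {x + nmul m g | x m. x \<in> F}" "y' \<in> {x + nmul m g | x m. x \<in> F}"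
      "e' y = e' y'" for y y'
    proof -
      obtain x m x' m' where y: "x \<in> F" "y = x + nmul m g" "x' \<in> F" "y' = x' + nmul m' g"
        using yy(1,2) by fastforce
      then show ?thesis using key[OF y(1,3), of m m'] e' yy(3) by simp
    qed
  qed
qed

lemma frag_cmul_left_cancel: "k \<noteq> 0 \<Longrightarrow> frag_cmul k x = frag_cmul k y \<Longrightarrow> x = y"
  by (rule poly_mapping_eqI) (metis lookup_frag_cmul mult_left_cancel)

lemma frag_cmul_diff_distrib2: "frag_cmul c (x - y) = frag_cmul c x - frag_cmul c y"
  by (rule poly_mapping_eqI) (simp add: lookup_minus right_diff_distrib)

lemma additive_on_frag_nmul:
  assumes "submon F" "additive_on F (e :: _ \<Rightarrow> (nat \<Rightarrow>\<^sub>0 int))" "x \<in> F"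
  shows "e (nmul n x) = frag_cmul (int n) (e x)"
proof (induction n)
  case 0
  show ?case using additive_on_submon(1)[OF assms(1,2)] by simp
next
  case (Suc n)
  have "e (x + nmul n x) = e x + e (nmul n x)"
    using submon_closed[OF assms(1)] assms(3) by (intro additive_onD[OF assms(2)])
  then show ?case using Suc by (simp add: frag_cmul_distrib)
qed

text \<open>Generators are added one at a time. If a positive multiple \<open>n g\<close> is a
  difference of elements of the monoid built so far, the old embedding is multiplied by
  \<open>n\<close>, which makes room for the image \<open>e b - e a\<close> of \<open>g\<close>
  without denominators. Otherwise no relation up to torsion involves \<open>g\<close>, and
  \<open>g\<close> receives the fresh basis vector \<open>s\<close>.\<close>

lemma torsion_embedding:
  fixes \<Gamma> :: "'n::cancel_comm_monoid_add set"
  assumes "finite \<Gamma>"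
  shows "\<exists>s e. additive_on (mspan \<Gamma>) e \<and> (\<forall>x\<in>mspan \<Gamma>. Poly_Mapping.keys (e x) \<subseteq> {..<s::nat}) \<and>
    (\<forall>x\<in>mspan \<Gamma>. \<forall>y\<in>mspan \<Gamma>. (e x :: nat \<Rightarrow>\<^sub>0 int) = e y \<longrightarrow> torsion_eq x y)"
  using assms
proof (induction \<Gamma> rule: finite_induct)
  case empty
  show ?case by (intro exI[of _ 0] exI[of _ "\<lambda>_. 0"]) (auto simp: additive_on_def mspan_def)
next
  case (insert g \<Gamma>)
  let ?F = "mspan \<Gamma>"
  note F = submon_mspan[of \<Gamma>]
  note cl = submon_closed[OF F]
  obtain s e where e: "additive_on ?F e" "\<And>x. x \<in> ?F \<Longrightarrow> Poly_Mapping.keys (e x) \<subseteq> {..<s::nat}"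
    "\<And>x y. x \<in> ?F \<Longrightarrow> y \<in> ?F \<Longrightarrow> (e x :: nat \<Rightarrow>\<^sub>0 int) = e y \<Longrightarrow> torsion_eq x y"
    using insert.IH by blast
  note ea = additive_onD[OF e(1)] and en = additive_on_frag_nmul[OF F e(1)]
  have etor: "e x = e y" if xy: "x \<in> ?F" "y \<in> ?F" "torsion_eq x y" for x y
  proof -
    obtain m where "m > 0" "nmul m x = nmul m y" using xy(3) by (auto simp: torsion_eq_def)
    then have "frag_cmul (int m) (e x) = frag_cmul (int m) (e y)" using en xy by metis
    then show ?thesis using frag_cmul_left_cancel \<open>m > 0\<close> by (metis of_nat_0_less_iff less_irrefl)
  qed
  have span: "mspan (insert g \<Gamma>) = {x + nmul m g | x m. x \<in> ?F}"
    using mspan_insert insert.hyps by blast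
  show ?case
  proof (cases "\<exists>n a. n > 0 \<and> a \<in> ?F \<and> nmul n g + a \<in> ?F")
    case True
    then obtain n a where na: "n > 0" "a \<in> ?F" "nmul n g + a \<in> ?F" by blast
    define b where "b = nmul n g + a"
    have n: "n > 0" "a \<in> ?F" "b \<in> ?F" "nmul n g + a = b" using na by (simp_all add: b_def)
    have key: "frag_cmul (int n) (e x) + frag_cmul (int m) (e b - e a) =
        frag_cmul (int n) (e x') + frag_cmul (int m') (e b - e a)
      \<longleftrightarrow> torsion_eq (x + nmul m g) (x' + nmul m' g)" if x: "x \<in> ?F" "x' \<in> ?F" for x x' m m'
    proof -
      \<comment> \<open>Multiplying both compared elements by \<open>n\<close> and adding the common
        term \<open>(m + m') a\<close> replaces every \<open>n g + a\<close> by \<open>b\<close>, so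
        that the comparison takes place inside \<open>?F\<close>.\<close>
      let ?l = "nmul n x + nmul m b + nmul m' a" and ?r = "nmul n x' + nmul m' b + nmul m a"
      have mem: "?l \<in> ?F" "?r \<in> ?F" by (intro cl(2,3) x n)+
      have eq: "nmul n y + nmul k b + nmul k' a = nmul n (y + nmul k g) + nmul (k + k') a" for y k k'
        unfolding n(4)[symmetric] by (simp add: nmul_distrib nmul_add nmul_commute[of k n] ac_simps)
      have el: "e ?l = frag_cmul (int n) (e x) + frag_cmul (int m) (e b) + frag_cmul (int m') (e a)"
        and er: "e ?r = frag_cmul (int n) (e x') + frag_cmul (int m') (e b) + frag_cmul (int m) (e a)"
        by (simp_all add: ea en cl(2,3) x n(2,3))
      have "frag_cmul (int n) (e x) + frag_cmul (int m) (e b - e a) =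
        frag_cmul (int n) (e x') + frag_cmul (int m') (e b - e a) \<longleftrightarrow> e ?l = e ?r"
        unfolding el er frag_cmul_diff_distrib2 by (auto simp: algebra_simps)
      also have "\<dots> \<longleftrightarrow> torsion_eq ?l ?r" using e(3) etor mem by blast
      also have "\<dots> \<longleftrightarrow> torsion_eq (nmul n (x + nmul m g)) (nmul n (x' + nmul m' g))"
        unfolding eq by (subst add.commute[of m' m]) (rule torsion_eq_cancel)
      also have "\<dots> \<longleftrightarrow> torsion_eq (x + nmul m g) (x' + nmul m' g)"
        using torsion_eq_nmul n(1) by blast
      finally show ?thesis .
    qed
    obtain e' where e': "additive_on {x + nmul m g | x m. x \<in> ?F} e'"
      "\<And>x m. x \<in> ?F \<Longrightarrow> e' (x + nmul m g) = frag_cmul (int n) (e x) + frag_cmul (int m) (e b - e a)"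
      "\<And>y y'. y \<in> {x + nmul m g | x m. x \<in> ?F} \<Longrightarrow> y' \<in> {x + nmul m g | x m. x \<in> ?F} \<Longrightarrow>
       e' y = e' y' \<Longrightarrow> torsion_eq y y'"
      by (rule torsion_embedding_step[OF F e(1), of "int n" "e b - e a" g]) (erule (1) key, rule that)
    have "Poly_Mapping.keys (e' y) \<subseteq> {..<s}" if y: "y \<in> {x + nmul m g | x m. x \<in> ?F}" for y
    proof -
      obtain x m where x: "x \<in> ?F" "y = x + nmul m g" using y by blast
      have "Poly_Mapping.keys (e' y) \<subseteq>
        Poly_Mapping.keys (frag_cmul (int n) (e x)) \<union> Poly_Mapping.keys (frag_cmul (int m) (e b - e a))"
        unfolding x(2) e'(2)[OF x(1)] by (rule keys_add)
      also have "\<dots> \<subseteq> Poly_Mapping.keys (e x) \<union> (Poly_Mapping.keys (e b) \<union> Poly_Mapping.keys (e a))"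
        using keys_cmul[of "int n" "e x"] keys_cmul[of "int m" "e b - e a"] keys_diff[of "e b" "e a"]
        by (meson Un_mono order_trans)
      finally show ?thesis using e(2)[OF x(1)] e(2)[OF n(2)] e(2)[OF n(3)] by blast
    qed
    then show ?thesis unfolding span using e' by blast
  next
    case False
    have key: "frag_cmul 1 (e x) + frag_cmul (int m) (frag_of s) =
        frag_cmul 1 (e x') + frag_cmul (int m') (frag_of s)
      \<longleftrightarrow> torsion_eq (x + nmul m g) (x' + nmul m' g)" if x: "x \<in> ?F" "x' \<in> ?F" for x x' m m'
    proof
      assume eq: "frag_cmul 1 (e x) + frag_cmul (int m) (frag_of s) =
        frag_cmul 1 (e x') + frag_cmul (int m') (frag_of s)"
      have "Poly_Mapping.lookup (e y) s = 0" if "y \<in> ?F" for y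
        using e(2)[OF that] by (metis in_keys_iff lessThan_iff less_irrefl subsetD)
      then have "m = m'"
        using arg_cong[OF eq, of "\<lambda>z. Poly_Mapping.lookup z s"] x by (simp add: lookup_add)
      then show "torsion_eq (x + nmul m g) (x' + nmul m' g)" using eq e(3) x by simp
    next
      assume "torsion_eq (x + nmul m g) (x' + nmul m' g)"
      then obtain k where k: "k > 0" "nmul k x + nmul (k * m) g = nmul k x' + nmul (k * m') g"
        by (auto simp: torsion_eq_def nmul_distrib nmul_mult)
      have no: "\<not> i < j" if "y \<in> ?F" "y' \<in> ?F" "nmul k y + nmul (k * i) g = nmul k y' + nmul (k * j) g"
        for y y' i j
      proof
        assume "i < j"
        then have "nmul (k * j) g = nmul (k * (j - i)) g + nmul (k * i) g"
          by (simp flip: nmul_add add: right_diff_distrib')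
        then have "nmul k y + nmul (k * i) g = (nmul (k * (j - i)) g + nmul k y') + nmul (k * i) g"
          using that(3) by (simp add: ac_simps)
        then have "nmul (k * (j - i)) g + nmul k y' = nmul k y" by simp
        moreover have "nmul k y \<in> ?F" "nmul k y' \<in> ?F" using that(1,2) by (auto intro: cl(3))
        moreover have "k * (j - i) > 0" using \<open>i < j\<close> k(1) by simp
        ultimately show False using False by metis
      qed
      have mm: "m = m'" using no[OF x k(2)] no[OF x(2,1) k(2)[symmetric]] by simp
      then have "nmul k x = nmul k x'" using k(2) by simp
      then have "e x = e x'" using etor[OF x] k(1) by (auto simp: torsion_eq_def)
      then show "frag_cmul 1 (e x) + frag_cmul (int m) (frag_of s) =
        frag_cmul 1 (e x') + frag_cmul (int m') (frag_of s)" using mm by simp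
    qed
    obtain e' where e': "additive_on {x + nmul m g | x m. x \<in> ?F} e'"
      "\<And>x m. x \<in> ?F \<Longrightarrow> e' (x + nmul m g) = frag_cmul 1 (e x) + frag_cmul (int m) (frag_of s)"
      "\<And>y y'. y \<in> {x + nmul m g | x m. x \<in> ?F} \<Longrightarrow> y' \<in> {x + nmul m g | x m. x \<in> ?F} \<Longrightarrow>
       e' y = e' y' \<Longrightarrow> torsion_eq y y'"
      by (rule torsion_embedding_step[OF F e(1), of 1 "frag_of s" g]) (erule (1) key, rule that)
    have "Poly_Mapping.keys (e' y) \<subseteq> {..<Suc s}" if y: "y \<in> {x + nmul m g | x m. x \<in> ?F}" for y
    proof -
      obtain x m where x: "x \<in> ?F" "y = x + nmul m g" using y by blast
      have "Poly_Mapping.keys (e' y) \<subseteq>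
        Poly_Mapping.keys (frag_cmul 1 (e x)) \<union> Poly_Mapping.keys (frag_cmul (int m) (frag_of s))"
        unfolding x(2) e'(2)[OF x(1)] by (rule keys_add)
      also have "\<dots> \<subseteq> {..<s} \<union> {s}"
        using e(2)[OF x(1)] keys_cmul[of "int m" "frag_of s"] by (auto simp: keys_frag_of)
      finally show ?thesis by (auto simp: less_Suc_eq)
    qed
    then show ?thesis unfolding span using e' by blast
  qed
qed

text \<open>A dual basis for the group completion of \<open>F\<close> modulo torsion. The basis
  vectors need not lie in \<open>F\<close>, so each is given as a formal difference
  \<open>a i - b i\<close> of elements of \<open>F\<close>.\<close>

definition monoid_coords ::
    "'n::comm_monoid_add set \<Rightarrow> nat \<Rightarrow> (nat \<Rightarrow> 'n \<Rightarrow> int) \<Rightarrow> (nat \<Rightarrow> 'n) \<Rightarrow> (nat \<Rightarrow> 'n) \<Rightarrow> bool"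
  where "monoid_coords F t \<kappa> a b \<longleftrightarrow>
    (\<forall>i<t. a i \<in> F \<and> b i \<in> F) \<and> (\<forall>i<t. additive_on F (\<kappa> i)) \<and>
    (\<forall>i<t. \<forall>j<t. \<kappa> i (a j) = \<kappa> i (b j) + (if i = j then 1 else 0)) \<and>
    (\<forall>x\<in>F. \<forall>y\<in>F. (\<forall>i<t. \<kappa> i x = \<kappa> i y) \<longrightarrow> torsion_eq x y)"

lemma lattice_differences:
  fixes e :: "'n::cancel_comm_monoid_add \<Rightarrow> (nat \<Rightarrow>\<^sub>0 int)"
  assumes F: "submon F" and e: "additive_on F e"
  shows "lattice {e x - e y | x y. x \<in> F \<and> y \<in> F}"
  unfolding lattice_def
proof (intro conjI ballI)
  have "0 = e 0 - e 0" by simp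
  then show "0 \<in> {e x - e y | x y. x \<in> F \<and> y \<in> F}" using submon_closed(1)[OF F] by blast
  fix z z' assume "z \<in> {e x - e y | x y. x \<in> F \<and> y \<in> F}" "z' \<in> {e x - e y | x y. x \<in> F \<and> y \<in> F}"
  then obtain x y x' y' where z: "x \<in> F" "y \<in> F" "x' \<in> F" "y' \<in> F" "z = e x - e y" "z' = e x' - e y'"
    by blast
  then have "z - z' = e (x + y') - e (y + x')" by (simp add: additive_onD[OF e])
  then show "z - z' \<in> {e x - e y | x y. x \<in> F \<and> y \<in> F}" using z submon_closed[OF F] by blast
qed

lemma monoid_coords_of_lattice_coords:
  fixes e :: "'n::cancel_comm_monoid_add \<Rightarrow> (nat \<Rightarrow>\<^sub>0 int)"
  assumes F: "submon F" and e: "additive_on F e"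
    and inj: "\<And>x y. x \<in> F \<Longrightarrow> y \<in> F \<Longrightarrow> e x = e y \<Longrightarrow> torsion_eq x y"
    and co: "lattice_coords {e x - e y | x y. x \<in> F \<and> y \<in> F} t \<kappa> h"
  shows "\<exists>a b. monoid_coords F t (\<lambda>i x. \<kappa> i (e x)) a b"
proof -
  let ?H = "{e x - e y | x y. x \<in> F \<and> y \<in> F}"
  have e0: "e 0 = 0" using additive_on_submon(1)[OF F e] .
  have eH: "e x \<in> ?H" if "x \<in> F" for x
  proof -
    have "e x = e x - e 0" using e0 by simp
    then show ?thesis using that submon_closed(1)[OF F] by blast
  qed
  have H: "lattice ?H" by (rule lattice_differences[OF F e])
  have "\<exists>p. fst p \<in> F \<and> snd p \<in> F \<and> h i = e (fst p) - e (snd p)" if "i < t" for i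
  proof -
    have "h i \<in> ?H" using co that by (simp add: lattice_coords_def)
    then obtain x y where "x \<in> F" "y \<in> F" "h i = e x - e y" by blast
    then show ?thesis by (intro exI[of _ "(x, y)"]) simp
  qed
  then obtain p where p: "\<And>i. i < t \<Longrightarrow> fst (p i) \<in> F \<and> snd (p i) \<in> F \<and> h i = e (fst (p i)) - e (snd (p i))"
    by metis
  have add: "additive_on ?H (\<kappa> i)" if "i < t" for i using co that by (simp add: lattice_coords_def)
  have "monoid_coords F t (\<lambda>i x. \<kappa> i (e x)) (\<lambda>i. fst (p i)) (\<lambda>i. snd (p i))"
    unfolding monoid_coords_def
  proof (intro conjI allI impI ballI)
    show "fst (p i) \<in> F" "snd (p i) \<in> F" if "i < t" for i using p that by auto
    show "additive_on F (\<lambda>x. \<kappa> i (e x))" if "i < t" for i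
      using additive_onD[OF add[OF that]] eH additive_onD[OF e] by (simp add: additive_on_def)
    show "\<kappa> i (e (fst (p j))) = \<kappa> i (e (snd (p j))) + (if i = j then 1 else 0)" if "i < t" "j < t" for i j
    proof -
      have "\<kappa> i (e (fst (p j))) - \<kappa> i (e (snd (p j))) = \<kappa> i (h j)"
        using additive_on_lattice(3)[OF H add[OF that(1)]] eH p[OF that(2)] by simp
      then show ?thesis using co that by (simp add: lattice_coords_def)
    qed
    show "torsion_eq x y" if xy: "x \<in> F" "y \<in> F" "\<forall>i<t. \<kappa> i (e x) = \<kappa> i (e y)" for x y
    proof -
      have "\<forall>i<t. \<kappa> i (e x - e y) = 0"
        using additive_on_lattice(3)[OF H add] eH xy by simp
      moreover have "e x - e y \<in> ?H" using xy by blast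
      ultimately have "e x - e y = 0" using co unfolding lattice_coords_def by blast
      then show ?thesis using inj xy by simp
    qed
  qed
  then show ?thesis by blast
qed

lemma keys_diff_image:
  assumes "\<And>x. x \<in> F \<Longrightarrow> Poly_Mapping.keys (e x) \<subseteq> S" "z \<in> {e x - e y | x y. x \<in> F \<and> y \<in> F}"
  shows "Poly_Mapping.keys z \<subseteq> S"
proof -
  obtain x y where "x \<in> F" "y \<in> F" "z = e x - e y" using assms(2) by blast
  then show ?thesis using keys_diff[of "e x" "e y"] assms(1) by blast
qed

lemma monoid_coords_exist:
  fixes \<Gamma> :: "'n::cancel_comm_monoid_add set"
  assumes "finite \<Gamma>"
  shows "\<exists>t \<kappa> a b. monoid_coords (mspan \<Gamma>) t \<kappa> a b"
proof -
  obtain s e where e: "additive_on (mspan \<Gamma>) e"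
    "\<And>x. x \<in> mspan \<Gamma> \<Longrightarrow> Poly_Mapping.keys (e x) \<subseteq> {..<s::nat}"
    "\<And>x y. x \<in> mspan \<Gamma> \<Longrightarrow> y \<in> mspan \<Gamma> \<Longrightarrow> (e x :: nat \<Rightarrow>\<^sub>0 int) = e y \<Longrightarrow> torsion_eq x y"
    using torsion_embedding[OF assms] by blast
  have k: "Poly_Mapping.keys z \<subseteq> {..<s}" if "z \<in> {e x - e y | x y. x \<in> mspan \<Gamma> \<and> y \<in> mspan \<Gamma>}" for z
    by (rule keys_diff_image[OF _ that]) (rule e(2))
  obtain t \<kappa> h where "lattice_coords {e x - e y | x y. x \<in> mspan \<Gamma> \<and> y \<in> mspan \<Gamma>} t \<kappa> h"
    using lattice_coords_exist[OF lattice_differences[OF submon_mspan e(1)] k] by blast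
  from monoid_coords_of_lattice_coords[OF submon_mspan e(1,3) this] show ?thesis by blast
qed

text \<open>For \<open>p\<close> to become a coordinate it is stored as an additional component of
  the embedding, at the index \<open>s\<close> left free by \<open>e\<close>. It attains the value 1
  at \<open>u - v\<close>, so it splits off as coordinate 0.\<close>

lemma monoid_coords_exist_extending:
  fixes \<Gamma> :: "'n::cancel_comm_monoid_add set"
  assumes "finite \<Gamma>" and p: "additive_on (mspan \<Gamma>) p"
    and uv: "u \<in> mspan \<Gamma>" "v \<in> mspan \<Gamma>" "p u - p v = (1::int)"
  shows "\<exists>t \<kappa> a b. monoid_coords (mspan \<Gamma>) (Suc t) \<kappa> a b \<and> \<kappa> 0 = p"
proof -
  let ?F = "mspan \<Gamma>"
  obtain s e where e: "additive_on ?F e"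
    "\<And>x. x \<in> ?F \<Longrightarrow> Poly_Mapping.keys (e x) \<subseteq> {..<s::nat}"
    "\<And>x y. x \<in> ?F \<Longrightarrow> y \<in> ?F \<Longrightarrow> (e x :: nat \<Rightarrow>\<^sub>0 int) = e y \<Longrightarrow> torsion_eq x y"
    using torsion_embedding[OF assms(1)] by blast
  define e' where "e' x = Poly_Mapping.update s (p x) (e x)" for x
  have lk: "Poly_Mapping.lookup (e' x) i = (if i = s then p x else Poly_Mapping.lookup (e x) i)" for x i
    by (simp add: e'_def lookup_update)
  have lks: "Poly_Mapping.lookup (e x) s = 0" if "x \<in> ?F" for x
    using e(2)[OF that] by (metis in_keys_iff lessThan_iff less_irrefl subsetD)
  have e'a: "additive_on ?F e'"
    unfolding additive_on_def
    by (intro ballI poly_mapping_eqI) (simp add: lk lookup_add additive_onD[OF p] additive_onD[OF e(1)])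
  have e'k: "Poly_Mapping.keys (e' x) \<subseteq> {..<Suc s}" if "x \<in> ?F" for x
    using e(2)[OF that] by (auto simp: in_keys_iff lk less_Suc_eq subset_iff split: if_splits)
  have e'i: "torsion_eq x y" if "x \<in> ?F" "y \<in> ?F" "e' x = e' y" for x y
  proof -
    have "e x = e y"
    proof (rule poly_mapping_eqI)
      fix i
      show "Poly_Mapping.lookup (e x) i = Poly_Mapping.lookup (e y) i"
        using arg_cong[OF that(3), of "\<lambda>z. Poly_Mapping.lookup z i"] lks that(1,2)
        by (cases "i = s") (auto simp: lk)
    qed
    then show ?thesis using e(3) that by blast
  qed
  let ?H = "{e' x - e' y | x y. x \<in> ?F \<and> y \<in> ?F}" and ?p = "\<lambda>z. Poly_Mapping.lookup z s"
  have H: "lattice ?H" by (rule lattice_differences[OF submon_mspan e'a])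
  have pa: "additive_on ?H ?p" by (simp add: additive_on_def lookup_add)
  have h: "e' u - e' v \<in> ?H" "?p (e' u - e' v) = 1"
    using uv by (blast, simp add: lookup_minus lk)
  have H0: "lattice {z \<in> ?H. ?p z = 0}"
    using lattice_closed[OF H] unfolding lattice_def by (auto simp: lookup_minus)
  have "Poly_Mapping.keys z \<subseteq> {..<Suc s}" if "z \<in> {z \<in> ?H. ?p z = 0}" for z
    by (rule keys_diff_image[where F = ?F and e = e']) (use that e'k in blast)+
  from lattice_coords_exist[OF H0 this]
  obtain t \<kappa> b where "lattice_coords {z \<in> ?H. ?p z = 0} t \<kappa> b" by blast
  from lattice_coords_extend[OF H pa h this]
  obtain \<kappa>' b' where k: "lattice_coords ?H (Suc t) \<kappa>' b'" "\<kappa>' 0 = ?p" by blast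
  from monoid_coords_of_lattice_coords[OF submon_mspan e'a e'i k(1)]
  obtain a b where ab: "monoid_coords ?F (Suc t) (\<lambda>i x. \<kappa>' i (e' x)) a b" by blast
  moreover have "(\<lambda>x. \<kappa>' 0 (e' x)) = p" using k(2) by (simp add: lk)
  ultimately show ?thesis by blast
qed

section \<open>Monoid algebras and chains of primes\<close>

text \<open>Ideals of a ring given by a whole type. Most of the algebra is done in this form and is
  carried over to the records of the statement by \<open>typed_ring\<close>.\<close>

definition ideal_set :: "'a::comm_ring_1 set \<Rightarrow> bool"
  where "ideal_set P \<longleftrightarrow> 0 \<in> P \<and> (\<forall>x\<in>P. \<forall>y\<in>P. x + y \<in> P) \<and> (\<forall>x\<in>P. \<forall>r. r * x \<in> P)"

definition prime_set :: "'a::comm_ring_1 set \<Rightarrow> bool"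
  where "prime_set P \<longleftrightarrow> ideal_set P \<and> 1 \<notin> P \<and> (\<forall>x y. x * y \<in> P \<longrightarrow> x \<in> P \<or> y \<in> P)"

lemma ideal_set_closed:
  assumes "ideal_set P"
  shows "0 \<in> P" "x \<in> P \<Longrightarrow> y \<in> P \<Longrightarrow> x + y \<in> P" "x \<in> P \<Longrightarrow> r * x \<in> P" "x \<in> P \<Longrightarrow> x * r \<in> P"
    "x \<in> P \<Longrightarrow> - x \<in> P" "x \<in> P \<Longrightarrow> y \<in> P \<Longrightarrow> x - y \<in> P"
    "(\<And>i. i \<in> I \<Longrightarrow> f i \<in> P) \<Longrightarrow> sum f I \<in> P"
proof -
  show 0: "0 \<in> P" and add: "x \<in> P \<Longrightarrow> y \<in> P \<Longrightarrow> x + y \<in> P"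
    and mult: "x \<in> P \<Longrightarrow> r * x \<in> P" for x y r
    using assms by (auto simp: ideal_set_def)
  show "x * r \<in> P" if "x \<in> P" using mult[OF that, of r] by (simp add: mult.commute)
  show neg: "- x \<in> P" if "x \<in> P" for x using mult[OF that, of "-1"] by simp
  show "x - y \<in> P" if "x \<in> P" "y \<in> P" using add[OF that(1) neg[OF that(2)]] by simp
  show "sum f I \<in> P" if "\<And>i. i \<in> I \<Longrightarrow> f i \<in> P"
    using that by (induction I rule: infinite_finite_induct) (auto intro: 0 add)
qed

lemma ideal_set_cong:
  assumes "ideal_set P" "x - y \<in> P"
  shows "x \<in> P \<longleftrightarrow> y \<in> P"
  using ideal_set_closed(2)[OF assms(1) assms(2), of y] ideal_set_closed(6)[OF assms(1) _ assms(2), of x]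
  by auto

lemma prime_set_ideal: "prime_set P \<Longrightarrow> ideal_set P"
  and prime_set_one: "prime_set P \<Longrightarrow> 1 \<notin> P"
  and prime_set_mult: "prime_set P \<Longrightarrow> x * y \<in> P \<Longrightarrow> x \<in> P \<or> y \<in> P"
  by (auto simp: prime_set_def)

lemma prime_set_power: "prime_set P \<Longrightarrow> x ^ n \<in> P \<Longrightarrow> x \<in> P"
  by (induction n) (auto simp: prime_set_def)

definition hom_type :: "('a::comm_ring_1 \<Rightarrow> 'b::comm_ring_1) \<Rightarrow> bool"
  where "hom_type c \<longleftrightarrow> c 1 = 1 \<and> (\<forall>x y. c (x + y) = c x + c y) \<and> (\<forall>x y. c (x * y) = c x * c y)"

lemma hom_type_simps:
  assumes "hom_type c"
  shows "c 1 = 1" "c (x + y) = c x + c y" "c (x * y) = c x * c y" "c 0 = 0" "c (- x) = - c x"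
    "c (x - y) = c x - c y" "c (x ^ n) = c x ^ n" "c (sum f I) = (\<Sum>i\<in>I. c (f i))"
    "c (prod g J) = (\<Prod>j\<in>J. c (g j))" "c (of_nat m) = of_nat m"
proof -
  show 1: "c 1 = 1" and add: "c (x + y) = c x + c y" and mult: "c (x * y) = c x * c y" for x y
    using assms by (auto simp: hom_type_def)
  show 0: "c 0 = 0" using add[of 0 0] by simp
  show neg: "c (- x) = - c x" for x using add[of x "- x"] 0 by (simp add: eq_neg_iff_add_eq_0 add.commute)
  show "c (x - y) = c x - c y" for x y using add[of x "- y"] neg by simp
  show "c (x ^ n) = c x ^ n" by (induction n) (simp_all add: 1 mult)
  show "c (sum f I) = (\<Sum>i\<in>I. c (f i))"
    by (induction I rule: infinite_finite_induct) (simp_all add: 0 add)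
  show "c (prod g J) = (\<Prod>j\<in>J. c (g j))"
    by (induction J rule: infinite_finite_induct) (simp_all add: 1 mult)
  show "c (of_nat m) = of_nat m" by (induction m) (simp_all add: 0 1 add)
qed

lemma prime_set_vimage: "hom_type c \<Longrightarrow> prime_set P \<Longrightarrow> prime_set {x. c x \<in> P}"
  by (auto simp: prime_set_def ideal_set_def hom_type_simps)

lemma prime_set_kernel:
  fixes c :: "'a::comm_ring_1 \<Rightarrow> 'b::idom"
  shows "hom_type c \<Longrightarrow> prime_set {x. c x = 0}"
  by (auto simp: prime_set_def ideal_set_def hom_type_simps)

section \<open>Monoid algebras and their homomorphisms\<close>

abbreviation cst :: "'k \<Rightarrow> 'n::zero \<Rightarrow>\<^sub>0 'k::zero"
  where "cst \<equiv> Poly_Mapping.single 0"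

abbreviation mon :: "'n \<Rightarrow> 'n \<Rightarrow>\<^sub>0 'k::zero_neq_one"
  where "mon n \<equiv> Poly_Mapping.single n 1"

lemma hom_type_cst: "hom_type (cst :: 'k::comm_ring_1 \<Rightarrow> 'n::comm_monoid_add \<Rightarrow>\<^sub>0 'k)"
  by (simp add: hom_type_def single_add mult_single)

lemma mon_mult: "mon a * mon b = (mon (a + b) :: 'n::comm_monoid_add \<Rightarrow>\<^sub>0 'k::comm_ring_1)"
  by (simp add: mult_single)

lemma mon_power: "mon a ^ m = (mon (nmul m a) :: 'n::comm_monoid_add \<Rightarrow>\<^sub>0 'k::comm_ring_1)"
  by (induction m) (simp_all add: mult_single)

lemma cst_mon: "cst c * mon n = (Poly_Mapping.single n c :: 'n::comm_monoid_add \<Rightarrow>\<^sub>0 'k::comm_ring_1)"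
  by (simp add: mult_single)

lemma pm_sum_single:
  fixes f :: "'n \<Rightarrow>\<^sub>0 'k::comm_monoid_add"
  assumes "finite A" "Poly_Mapping.keys f \<subseteq> A"
  shows "f = (\<Sum>n\<in>A. Poly_Mapping.single n (Poly_Mapping.lookup f n))"
proof (rule poly_mapping_eqI)
  fix k
  have "Poly_Mapping.lookup (\<Sum>n\<in>A. Poly_Mapping.single n (Poly_Mapping.lookup f n)) k
    = (\<Sum>n\<in>A. if n = k then Poly_Mapping.lookup f n else 0)"
    unfolding lookup_sum by (rule sum.cong) (auto simp: lookup_single when_def)
  also have "\<dots> = Poly_Mapping.lookup f k"
    using assms by (auto simp: in_keys_iff subset_iff)
  finally show "Poly_Mapping.lookup f k = Poly_Mapping.lookup (\<Sum>n\<in>A. Poly_Mapping.single n (Poly_Mapping.lookup f n)) k" ..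
qed

lemma pm_induct [case_names add single]:
  fixes f :: "'n \<Rightarrow>\<^sub>0 'k::comm_monoid_add"
  assumes add: "\<And>f g. P f \<Longrightarrow> P g \<Longrightarrow> P (f + g)" and single: "\<And>n c. P (Poly_Mapping.single n c)"
  shows "P f"
proof -
  have "P (\<Sum>n\<in>A. Poly_Mapping.single n (Poly_Mapping.lookup f n))" if "finite A" for A
    using that
  proof (induction A rule: finite_induct)
    case empty
    show ?case using single[of undefined 0] by simp
  qed (auto intro: add single)
  then show ?thesis using pm_sum_single[of "Poly_Mapping.keys f" f] by (metis finite_keys order_refl)
qed

text \<open>The linear extension of \<theta> from monomials. It is a ring homomorphism when \<theta>
  is multiplicative, and it also serves for derivations and for linear functionals.\<close>

definition mlift :: "('k::comm_ring_1 \<Rightarrow> 'd::comm_ring_1) \<Rightarrow> ('n \<Rightarrow> 'd) \<Rightarrow> ('n \<Rightarrow>\<^sub>0 'k) \<Rightarrow> 'd"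
  where "mlift c \<theta> f = (\<Sum>n\<in>Poly_Mapping.keys f. c (Poly_Mapping.lookup f n) * \<theta> n)"

lemma mlift_superset:
  assumes "c 0 = 0" "finite A" "Poly_Mapping.keys f \<subseteq> A"
  shows "mlift c \<theta> f = (\<Sum>n\<in>A. c (Poly_Mapping.lookup f n) * \<theta> n)"
  unfolding mlift_def using assms by (intro sum.mono_neutral_left) (auto simp: in_keys_iff)

lemma mlift_add:
  assumes "hom_type c"
  shows "mlift c \<theta> (f + g) = mlift c \<theta> f + mlift c \<theta> g"
proof -
  note c = hom_type_simps[OF assms]
  let ?A = "Poly_Mapping.keys f \<union> Poly_Mapping.keys g"
  have "mlift c \<theta> (f + g) = (\<Sum>n\<in>?A. c (Poly_Mapping.lookup (f + g) n) * \<theta> n)"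
    by (rule mlift_superset) (simp_all add: c keys_add)
  also have "\<dots> = (\<Sum>n\<in>?A. c (Poly_Mapping.lookup f n) * \<theta> n) + (\<Sum>n\<in>?A. c (Poly_Mapping.lookup g n) * \<theta> n)"
    by (simp add: lookup_add c distrib_right sum.distrib)
  also have "\<dots> = mlift c \<theta> f + mlift c \<theta> g"
    by (subst (1 2) mlift_superset[of c ?A]) (use c in auto)
  finally show ?thesis .
qed

lemma mlift_single: "c 0 = 0 \<Longrightarrow> mlift c \<theta> (Poly_Mapping.single n a) = c a * \<theta> n"
  by (cases "a = 0") (simp_all add: mlift_def)

lemma mlift_zero: "mlift c \<theta> 0 = 0" by (simp add: mlift_def)

lemma mlift_sum: "hom_type c \<Longrightarrow> mlift c \<theta> (sum f I) = (\<Sum>i\<in>I. mlift c \<theta> (f i))"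
  by (induction I rule: infinite_finite_induct) (simp_all add: mlift_zero mlift_add)

lemma mlift_cst_mult:
  fixes f :: "'n::comm_monoid_add \<Rightarrow>\<^sub>0 'k::comm_ring_1"
  assumes "hom_type c"
  shows "mlift c \<theta> (cst a * f) = c a * mlift c \<theta> f"
  by (induction f rule: pm_induct)
    (simp_all add: mlift_add[OF assms] mlift_single hom_type_simps[OF assms] mult_single algebra_simps)

lemma hom_type_mlift:
  fixes \<theta> :: "'n::comm_monoid_add \<Rightarrow> 'd::comm_ring_1"
  assumes c: "hom_type c" and \<theta>: "\<theta> 0 = 1" "\<And>a b. \<theta> (a + b) = \<theta> a * \<theta> b"
  shows "hom_type (mlift c \<theta>)"
proof -
  note cs = hom_type_simps[OF c]
  have s: "mlift c \<theta> (Poly_Mapping.single n a * g) = c a * \<theta> n * mlift c \<theta> g" for n a g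
  proof (induction g rule: pm_induct)
    case (add f g)
    then show ?case by (simp add: distrib_left mlift_add[OF c])
  next
    case (single k b)
    show ?case by (simp add: mlift_single cs mult_single \<theta> mult_ac)
  qed
  have "mlift c \<theta> (f * g) = mlift c \<theta> f * mlift c \<theta> g" for f g
    by (induction f rule: pm_induct)
      (simp_all add: distrib_right mlift_add[OF c] s mlift_single cs)
  moreover have "mlift c \<theta> 1 = 1"
    using mlift_single[of c \<theta> 0 1] cs \<theta> by simp
  ultimately show ?thesis by (simp add: hom_type_def mlift_add[OF c])
qed

lemma hom_type_id: "hom_type (\<lambda>x. x)" by (simp add: hom_type_def)

lemma hom_type_comp: "hom_type f \<Longrightarrow> hom_type g \<Longrightarrow> hom_type (\<lambda>x. f (g x))"
  by (simp add: hom_type_def)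

lemma hom_type_ext_mon:
  fixes f g :: "('n::comm_monoid_add \<Rightarrow>\<^sub>0 'k::comm_ring_1) \<Rightarrow> 'd::comm_ring_1"
  assumes "hom_type f" "hom_type g" "\<And>a. f (cst a) = g (cst a)" "\<And>n. f (mon n) = g (mon n)"
  shows "f x = g x"
proof (induction x rule: pm_induct)
  case (single n a)
  have "Poly_Mapping.single n a = cst a * mon n" by (simp add: mult_single)
  then show ?case
    by (simp only: hom_type_simps(3)[OF assms(1)] hom_type_simps(3)[OF assms(2)] assms(3,4))
qed (simp add: hom_type_simps(2)[OF assms(1)] hom_type_simps(2)[OF assms(2)])

text \<open>A binary form over an algebraically closed field is a product of linear forms, and a
  prime that contains the product contains a factor. The factors are split off one root at a
  time.\<close>

lemma homogenized_poly_root: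
  fixes c :: "'k::alg_closed_field \<Rightarrow> 'a::comm_ring_1"
  assumes c: "hom_type c" and P: "prime_set P"
  shows "degree p = m \<Longrightarrow> p \<noteq> 0 \<Longrightarrow> (\<Sum>i\<le>m. c (coeff p i) * x ^ i * y ^ (m - i)) \<in> P \<Longrightarrow>
    \<exists>\<zeta>. x - c \<zeta> * y \<in> P"
proof (induction m arbitrary: p)
  case 0
  note cs = hom_type_simps[OF c]
  have "c (coeff p 0) \<in> P" using 0 by simp
  then have "c (inverse (coeff p 0)) * c (coeff p 0) \<in> P"
    by (rule ideal_set_closed(3)[OF prime_set_ideal[OF P]])
  moreover have "coeff p 0 \<noteq> 0" using 0 by (metis leading_coeff_0_iff)
  ultimately have "1 \<in> P" using cs(1,3) by (metis left_inverse)
  then show ?case using prime_set_one[OF P] by simp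
next
  case (Suc m)
  note cs = hom_type_simps[OF c]
  obtain \<zeta> where "poly p \<zeta> = 0" using alg_closed_imp_poly_has_root[of p] Suc.prems by auto
  then obtain q where q: "p = [:- \<zeta>, 1:] * q" by (metis dvdE poly_eq_0_iff_dvd)
  have q0: "q \<noteq> 0" using q Suc.prems by auto
  have "degree p = degree [:- \<zeta>, 1:] + degree q" unfolding q by (rule degree_mult_eq) (use q0 in auto)
  then have dq: "degree q = m" using Suc.prems(1) by simp
  have coeff: "coeff p i = coeff (pCons 0 q) i - \<zeta> * coeff q i" for i
    unfolding q by simp
  define S where "S = (\<Sum>i\<le>m. c (coeff q i) * x ^ i * y ^ (m - i))"
  have 1: "(\<Sum>i\<le>Suc m. c (coeff (pCons 0 q) i) * x ^ i * y ^ (Suc m - i)) = x * S"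
    unfolding S_def by (subst sum.atMost_Suc_shift) (simp add: cs sum_distrib_left mult_ac)
  have "coeff q (Suc m) = 0" using dq by (simp add: coeff_eq_0)
  then have "(\<Sum>i\<le>Suc m. c (\<zeta> * coeff q i) * x ^ i * y ^ (Suc m - i))
    = (\<Sum>i\<le>m. c (\<zeta> * coeff q i) * x ^ i * y ^ (Suc m - i))" by (simp add: cs)
  also have "\<dots> = c \<zeta> * y * S"
    unfolding S_def sum_distrib_left by (rule sum.cong) (auto simp: cs Suc_diff_le mult_ac)
  finally have 2: "(\<Sum>i\<le>Suc m. c (\<zeta> * coeff q i) * x ^ i * y ^ (Suc m - i)) = c \<zeta> * y * S" .
  have "(\<Sum>i\<le>Suc m. c (coeff p i) * x ^ i * y ^ (Suc m - i)) = (x - c \<zeta> * y) * S"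
    unfolding coeff cs(6) left_diff_distrib sum_subtractf 1 2 ..
  then have "x - c \<zeta> * y \<in> P \<or> S \<in> P" using Suc.prems(3) prime_set_mult[OF P] by metis
  then show ?case using Suc.IH[OF dq q0] unfolding S_def by blast
qed

text \<open>The form in question is \<open>x^m - y^m\<close>. As a consequence, monomials that agree
  up to torsion become proportional modulo any prime.\<close>

lemma prime_set_equal_powers:
  fixes c :: "'k::alg_closed_field \<Rightarrow> 'a::comm_ring_1"
  assumes c: "hom_type c" and P: "prime_set P" and m: "m > 0" and xy: "x ^ m = y ^ m"
  shows "\<exists>\<zeta>. x - c \<zeta> * y \<in> P"
proof (rule homogenized_poly_root[OF c P])
  define p :: "'k poly" where "p = monom 1 m - 1"
  have cp: "coeff p i = (if i = m then 1 else 0) - (if i = 0 then 1 else 0)" for i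
    by (auto simp: p_def coeff_monom)
  have "degree p \<le> m" by (rule degree_le) (use m in \<open>auto simp: cp\<close>)
  moreover have "coeff p m \<noteq> 0" using m by (simp add: cp)
  ultimately show "degree (monom 1 m - 1 :: 'k poly) = m"
    unfolding p_def using le_degree by (metis order_antisym)
  show "monom 1 m - 1 \<noteq> (0 :: 'k poly)"
    using \<open>coeff p m \<noteq> 0\<close> unfolding p_def by (metis coeff_0)
  note cs = hom_type_simps[OF c]
  have "(\<Sum>i\<le>m. c (coeff p i) * x ^ i * y ^ (m - i))
    = (\<Sum>i\<le>m. (if i = m then x ^ m else 0) - (if i = 0 then y ^ m else 0))"
    by (rule sum.cong) (use m in \<open>auto simp: cp cs\<close>)
  also have "\<dots> = 0" using xy by (simp add: sum_subtractf)
  finally show "(\<Sum>i\<le>m. c (coeff (monom 1 m - 1) i) * x ^ i * y ^ (m - i)) \<in> P"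
    unfolding p_def using ideal_set_closed(1)[OF prime_set_ideal[OF P]] by simp
qed

text \<open>Let \<open>x0\<close> be the lowest exponent whose coefficient lies outside
  \<open>Q'\<close>; the coefficients below it vanish by hypothesis. As \<open>a\<close> lies
  outside the prime \<open>Q\<close>, the power \<open>a ^ x0\<close> can be divided out. The
  remaining terms above \<open>x0\<close> are multiples of \<open>a\<close> and lie in
  \<open>Q'\<close>, hence so does \<open>y x0\<close>.\<close>

lemma power_combination_in_prime:
  assumes Q: "prime_set Q" "ideal_set Q'" "Q \<subseteq> Q'" and a: "a \<notin> Q" "a \<in> Q'"
    and y: "\<And>x. x \<le> e \<Longrightarrow> y x \<in> Q' \<Longrightarrow> y x = 0"
    and s: "(\<Sum>x\<le>e. a ^ x * y x) \<in> Q" and x: "x \<le> e"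
  shows "y x \<in> Q'"
proof (rule ccontr)
  assume "y x \<notin> Q'"
  then have ex: "\<exists>x. x \<le> e \<and> y x \<notin> Q'" using x by blast
  define x0 where "x0 = (LEAST x. x \<le> e \<and> y x \<notin> Q')"
  have x0: "x0 \<le> e" "y x0 \<notin> Q'" using LeastI_ex[OF ex] unfolding x0_def by auto
  have small: "y z = 0" if "z < x0" for z
    using not_less_Least[of z "\<lambda>x. x \<le> e \<and> y x \<notin> Q'"] that y x0(1) unfolding x0_def
    by (metis less_imp_le order_trans x0(1) x0_def)
  have "(\<Sum>x\<le>e. a ^ x * y x) = (\<Sum>x\<in>{x0..e}. a ^ x * y x)"
    by (rule sum.mono_neutral_right) (auto simp: small)
  also have "\<dots> = a ^ x0 * (\<Sum>x\<in>{x0..e}. a ^ (x - x0) * y x)"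
    unfolding sum_distrib_left by (rule sum.cong) (auto simp: mult.assoc[symmetric] power_add[symmetric])
  finally have "a ^ x0 * (\<Sum>x\<in>{x0..e}. a ^ (x - x0) * y x) \<in> Q" using s by simp
  then have "(\<Sum>x\<in>{x0..e}. a ^ (x - x0) * y x) \<in> Q'"
    using prime_set_mult[OF Q(1)] prime_set_power[OF Q(1)] a(1) Q(3) by blast
  moreover have "{x0..e} = insert x0 {x0<..e}" using x0(1) by auto
  ultimately have "y x0 + (\<Sum>x\<in>{x0<..e}. a ^ (x - x0) * y x) \<in> Q'" by simp
  moreover have "(\<Sum>x\<in>{x0<..e}. a ^ (x - x0) * y x) \<in> Q'"
  proof (rule ideal_set_closed(7)[OF Q(2)])
    fix x assume "x \<in> {x0<..e}"
    then have "a ^ (x - x0) * y x = (a ^ (x - x0 - 1) * y x) * a"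
      by (metis greaterThanAtMost_iff mult.assoc mult.commute power_minus_mult zero_less_diff)
    then show "a ^ (x - x0) * y x \<in> Q'" using ideal_set_closed(3)[OF Q(2) a(2)] by simp
  qed
  ultimately have "y x0 \<in> Q'" using ideal_set_closed(6)[OF Q(2)] by (metis add_diff_cancel_right')
  then show False using x0 by simp
qed

fun power_product :: "(nat \<Rightarrow> 'a::comm_ring_1) \<Rightarrow> nat \<Rightarrow> nat list \<Rightarrow> 'a" where
  "power_product a j [] = 1"
| "power_product a j (x # xs) = a j ^ x * power_product a (Suc j) xs"

text \<open>A relation modulo \<open>Q j\<close> is sorted by powers of \<open>a j\<close>;
  \<open>power_combination_in_prime\<close> puts its coefficients into \<open>Q (Suc j)\<close>,
  where the induction hypothesis applies. In effect, elements picked from successive steps of a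
  chain of primes are algebraically independent modulo its first prime.\<close>

lemma power_products_independent_mod_prime:
  fixes c :: "'k::field \<Rightarrow> 'a::comm_ring_1"
  assumes c: "hom_type c"
  shows "(\<And>i. i \<le> j + L \<Longrightarrow> prime_set (Q i)) \<Longrightarrow>
    (\<And>i. i < j + L \<Longrightarrow> Q i \<subseteq> Q (Suc i) \<and> a i \<in> Q (Suc i) \<and> a i \<notin> Q i) \<Longrightarrow>
    (\<Sum>xs\<in>{xs. set xs \<subseteq> {..e} \<and> length xs = L}. c (d xs) * power_product a j xs) \<in> Q j \<Longrightarrow>
    set xs \<subseteq> {..e} \<Longrightarrow> length xs = L \<Longrightarrow> d xs = 0"
proof (induction L arbitrary: j d xs)
  case 0
  have "{xs. set xs \<subseteq> {..e} \<and> length xs = 0} = {[]}" by auto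
  then have cd: "c (d []) \<in> Q j" using 0 by simp
  have P: "prime_set (Q j)" using 0 by simp
  show ?case
  proof (rule ccontr)
    assume "d xs \<noteq> 0"
    then have "d [] \<noteq> 0" using 0 by simp
    moreover have "c (inverse (d [])) * c (d []) \<in> Q j"
      using ideal_set_closed(3)[OF prime_set_ideal[OF P] cd] .
    ultimately have "1 \<in> Q j" using hom_type_simps(1,3)[OF c] by (metis left_inverse)
    then show False using prime_set_one[OF P] by simp
  qed
next
  case (Suc L)
  let ?W = "\<lambda>L. {xs. set xs \<subseteq> {..e} \<and> length xs = L}"
  have W: "?W (Suc L) = (\<lambda>(x, xs). x # xs) ` ({..e} \<times> ?W L)"
    by (auto simp: length_Suc_conv image_iff)
  define y where "y x = (\<Sum>xs\<in>?W L. c (d (x # xs)) * power_product a (Suc j) xs)" for x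
  have "(\<Sum>xs\<in>?W (Suc L). c (d xs) * power_product a j xs)
    = (\<Sum>(x, xs)\<in>{..e} \<times> ?W L. c (d (x # xs)) * power_product a j (x # xs))"
    unfolding W by (subst sum.reindex) (auto simp: inj_on_def case_prod_unfold)
  also have "\<dots> = (\<Sum>x\<le>e. a j ^ x * y x)"
    unfolding y_def sum.cartesian_product[symmetric] sum_distrib_left
    by (intro sum.cong) (auto simp: mult_ac)
  finally have s: "(\<Sum>x\<le>e. a j ^ x * y x) \<in> Q j" using Suc.prems(3) by simp
  have IH: "d (x # xs) = 0" if "y x \<in> Q (Suc j)" "xs \<in> ?W L" for x xs
    by (rule Suc.IH[of "Suc j" "\<lambda>xs. d (x # xs)" xs])
      (use Suc.prems(1,2) that in \<open>auto simp: y_def\<close>)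
  have "Q j \<subseteq> Q (Suc j)" "a j \<in> Q (Suc j)" "a j \<notin> Q j" using Suc.prems(2)[of j] by auto
  moreover have "prime_set (Q j)" "ideal_set (Q (Suc j))"
    using Suc.prems(1)[of j] Suc.prems(1)[of "Suc j"] prime_set_ideal by auto
  moreover have "y x = 0" if "y x \<in> Q (Suc j)" for x
    using IH[OF that] hom_type_simps(4)[OF c] by (simp add: y_def)
  ultimately have yQ: "y x \<in> Q (Suc j)" if "x \<le> e" for x
    using power_combination_in_prime[of "Q j" "Q (Suc j)" "a j" e y x] s that by blast
  obtain x ys where "xs = x # ys" "x \<le> e" "ys \<in> ?W L"
    using Suc.prems(4,5) by (cases xs) auto
  then show ?case using IH[OF yQ] by simp
qed

text \<open>The bound \<open>E\<close> adds up under products. This linear growth is what the count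
  for the length of prime chains rests on.\<close>

definition boxed :: "nat \<Rightarrow> (nat \<Rightarrow> 'n \<Rightarrow> int) \<Rightarrow> nat \<Rightarrow> ('n \<Rightarrow>\<^sub>0 'k::zero) \<Rightarrow> bool"
  where "boxed r \<kappa> E f \<longleftrightarrow> (\<forall>n\<in>Poly_Mapping.keys f. \<forall>i<r. \<bar>\<kappa> i n\<bar> \<le> int E)"

lemma boxed_mult:
  fixes f g :: "'n::comm_monoid_add \<Rightarrow>\<^sub>0 'k::comm_ring_1"
  assumes \<kappa>: "\<And>i. i < r \<Longrightarrow> additive_on UNIV (\<kappa> i)" and f: "boxed r \<kappa> E f" and g: "boxed r \<kappa> E' g"
  shows "boxed r \<kappa> (E + E') (f * g)"
  unfolding boxed_def
proof (intro ballI allI impI)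
  fix n i assume "n \<in> Poly_Mapping.keys (f * g)" "i < r"
  then obtain a b where ab: "n = a + b" "a \<in> Poly_Mapping.keys f" "b \<in> Poly_Mapping.keys g"
    using keys_mult[of f g] by blast
  have "\<kappa> i n = \<kappa> i a + \<kappa> i b" using additive_onD[OF \<kappa>[OF \<open>i < r\<close>]] ab by simp
  moreover have "\<bar>\<kappa> i a\<bar> \<le> int E" "\<bar>\<kappa> i b\<bar> \<le> int E'" using f g ab \<open>i < r\<close> by (auto simp: boxed_def)
  ultimately show "\<bar>\<kappa> i n\<bar> \<le> int (E + E')" by simp
qed

lemma boxed_mono: "boxed r \<kappa> E f \<Longrightarrow> E \<le> E' \<Longrightarrow> boxed r \<kappa> E' f"
  by (force simp: boxed_def)

lemma boxed_sum: "(\<And>i. i \<in> I \<Longrightarrow> boxed r \<kappa> E (f i)) \<Longrightarrow> boxed r \<kappa> E (sum f I)"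
proof (induction I rule: infinite_finite_induct)
  case (insert i I)
  then have "boxed r \<kappa> E (f i)" "boxed r \<kappa> E (sum f I)" by auto
  then show ?case using keys_add[of "f i" "sum f I"] insert.hyps by (auto simp: boxed_def)
qed (auto simp: boxed_def)

lemma boxed_one:
  assumes \<kappa>: "\<And>i. i < r \<Longrightarrow> additive_on UNIV (\<kappa> i)"
  shows "boxed r \<kappa> 0 (1 :: 'n::comm_monoid_add \<Rightarrow>\<^sub>0 'k::comm_ring_1)"
  using additive_on_submon(1)[of UNIV, OF _ \<kappa>] by (auto simp: boxed_def submon_def)

lemma boxed_power:
  fixes f :: "'n::comm_monoid_add \<Rightarrow>\<^sub>0 'k::comm_ring_1"
  assumes \<kappa>: "\<And>i. i < r \<Longrightarrow> additive_on UNIV (\<kappa> i)" and f: "boxed r \<kappa> E f"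
  shows "boxed r \<kappa> (m * E) (f ^ m)"
proof (induction m)
  case 0
  show ?case using boxed_one[of r \<kappa>] \<kappa> by simp
next
  case (Suc m)
  show ?case using boxed_mult[of r \<kappa> E f "m * E" "f ^ m", OF \<kappa> f Suc] by simp
qed

lemma boxed_power_product:
  fixes a :: "nat \<Rightarrow> 'n::comm_monoid_add \<Rightarrow>\<^sub>0 'k::comm_ring_1"
  assumes \<kappa>: "\<And>i. i < r \<Longrightarrow> additive_on UNIV (\<kappa> i)"
  shows "(\<And>i. i < j + length xs \<Longrightarrow> boxed r \<kappa> D (a i)) \<Longrightarrow> set xs \<subseteq> {..e} \<Longrightarrow>
    boxed r \<kappa> (D * e * length xs) (power_product a j xs)"
proof (induction xs arbitrary: j)
  case Nil
  show ?case using boxed_one[of r \<kappa>] \<kappa> by simp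
next
  case (Cons x xs)
  have 1: "boxed r \<kappa> (x * D) (a j ^ x)" by (rule boxed_power[OF \<kappa>]) (use Cons.prems in auto)
  have 2: "boxed r \<kappa> (D * e * length xs) (power_product a (Suc j) xs)"
    by (rule Cons.IH) (use Cons.prems in auto)
  have "x * D \<le> e * D" using Cons.prems(2) by simp
  then have "x * D + D * e * length xs \<le> D * e * length (x # xs)" by (simp add: mult.commute)
  then show ?case using boxed_mono[OF boxed_mult[of r \<kappa>, OF \<kappa> 1 2]] by simp
qed

text \<open>A count replaces dimension theory. If the chain had more than r steps, the products of
  powers, with exponents up to \<open>e\<close>, of elements chosen from its steps would number
  \<open>(e + 1) ^ d\<close>. Modulo \<open>Q 0\<close> they lie in a space spanned by at most
  \<open>(2 * E + 1) ^ r\<close> monomials, where \<open>E\<close> is linear in \<open>e\<close>.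
  For large \<open>e\<close> this forces a linear relation, which independence along the chain
  excludes.\<close>

theorem prime_chain_length_le:
  fixes Q :: "nat \<Rightarrow> ('n::cancel_comm_monoid_add \<Rightarrow>\<^sub>0 'k::alg_closed_field) set"
    and \<kappa> :: "nat \<Rightarrow> 'n \<Rightarrow> int"
  assumes \<kappa>: "\<And>i. i < r \<Longrightarrow> additive_on UNIV (\<kappa> i)"
    and inj: "\<And>x y. (\<And>i. i < r \<Longrightarrow> \<kappa> i x = \<kappa> i y) \<Longrightarrow> torsion_eq x y"
    and Q: "\<And>i. i \<le> d \<Longrightarrow> prime_set (Q i)" "\<And>i. i < d \<Longrightarrow> Q i \<subset> Q (Suc i)"
  shows "d \<le> r"
proof (rule ccontr)
  assume "\<not> d \<le> r"
  then have dr: "Suc r \<le> d" by simp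
  have "\<exists>a. a \<in> Q (Suc i) - Q i" if "i < d" for i using Q(2)[OF that] by blast
  then obtain a where a: "\<And>i. i < d \<Longrightarrow> a i \<in> Q (Suc i) - Q i" by metis
  define D where "D = (\<Sum>i<d. \<Sum>n\<in>Poly_Mapping.keys (a i). \<Sum>l<r. nat \<bar>\<kappa> l n\<bar>)"
  have aD: "boxed r \<kappa> D (a i)" if "i < d" for i
    unfolding boxed_def
  proof (intro ballI allI impI)
    fix n l assume n: "n \<in> Poly_Mapping.keys (a i)" "l < r"
    have "nat \<bar>\<kappa> l n\<bar> \<le> (\<Sum>l<r. nat \<bar>\<kappa> l n\<bar>)" using n by (intro member_le_sum) auto
    also have "\<dots> \<le> (\<Sum>n\<in>Poly_Mapping.keys (a i). \<Sum>l<r. nat \<bar>\<kappa> l n\<bar>)"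
      using n by (intro member_le_sum[where f = "\<lambda>n. \<Sum>l<r. nat \<bar>\<kappa> l n\<bar>"]) auto
    also have "\<dots> \<le> D" unfolding D_def using that
      by (intro member_le_sum[where f = "\<lambda>i. \<Sum>n\<in>Poly_Mapping.keys (a i). \<Sum>l<r. nat \<bar>\<kappa> l n\<bar>"]) auto
    finally show "\<bar>\<kappa> l n\<bar> \<le> int D" by linarith
  qed
  \<comment> \<open>With \<open>E = D * e * d\<close> one has
    \<open>2 * E + 1 \<le> C * (e + 1)\<close>. Taking \<open>e = C ^ r\<close> then gives
    \<open>C ^ r * (e + 1) ^ r < (e + 1) ^ (r + 1)\<close>, so that there are more products than
    monomials.\<close>
  define C where "C = 2 * D * d + 1"
  define e where "e = C ^ r"
  define E where "E = D * e * d"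
  define W where "W = {xs. set xs \<subseteq> {..e} \<and> length xs = d}"
  define V where "V = {vs. set vs \<subseteq> {- int E..int E} \<and> length vs = r}"
  have fW: "finite W" and cW: "card W = (e + 1) ^ d"
    unfolding W_def by (auto simp: finite_lists_length_eq card_lists_length_eq)
  have fV: "finite V" and cV: "card V = (2 * E + 1) ^ r"
    unfolding V_def by (auto simp: finite_lists_length_eq card_lists_length_eq)
      (simp add: nat_add_distrib mult_2 flip: of_nat_add of_nat_Suc)
  have "2 * E + 1 \<le> C * (e + 1)" by (simp add: E_def C_def algebra_simps)
  then have "(2 * E + 1) ^ r \<le> C ^ r * (e + 1) ^ r" by (metis power_mono power_mult_distrib zero_le)
  also have "\<dots> < (e + 1) * (e + 1) ^ r" by (simp add: e_def)
  also have "\<dots> \<le> (e + 1) ^ d" using power_increasing[OF dr, of "e + 1"] by simp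
  finally have less: "card V < card W" by (simp add: cW cV)
  define kv where "kv n = map (\<lambda>i. \<kappa> i n) [0..<r]" for n
  define rep where "rep v = (SOME n. kv n = v)" for v
  have rep: "kv (rep (kv n)) = kv n" for n unfolding rep_def by (rule someI) (rule refl)
  have P0: "prime_set (Q 0)" using Q(1) by simp
  note I0 = ideal_set_closed[OF prime_set_ideal[OF P0]]
  have "\<exists>\<zeta>. mon n - cst \<zeta> * mon (rep (kv n)) \<in> Q 0" for n
  proof -
    have "torsion_eq n (rep (kv n))"
      using rep[of n] by (intro inj) (simp add: kv_def)
    then obtain m where "m > 0" "nmul m n = nmul m (rep (kv n))" by (auto simp: torsion_eq_def)
    then show ?thesis using prime_set_equal_powers[OF hom_type_cst P0] by (simp add: mon_power)
  qed
  then obtain \<zeta> where \<zeta>: "\<And>n. mon n - cst (\<zeta> n) * mon (rep (kv n)) \<in> Q 0" by metis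
  \<comment> \<open>Modulo \<open>Q 0\<close> every monomial is a multiple, by
    \<open>\<zeta> n\<close>, of the chosen representative of its coordinate vector. The functional
    \<open>l v\<close> is the total coefficient that \<open>f\<close> then has at the representative
    of \<open>v\<close>.\<close>
  define l where "l v = mlift (\<lambda>x. x) (\<lambda>n. if kv n = v then \<zeta> n else 0)" for v
  have l_in: "f \<in> Q 0" if f: "boxed r \<kappa> E f" "\<And>v. v \<in> V \<Longrightarrow> l v f = 0" for f
  proof -
    let ?K = "Poly_Mapping.keys f" and ?lk = "Poly_Mapping.lookup f"
    have kvV: "kv ` ?K \<subseteq> V" using f(1) by (fastforce simp: V_def kv_def boxed_def)
    have "(\<Sum>n\<in>?K. cst (?lk n * \<zeta> n) * mon (rep (kv n)))
      = (\<Sum>v\<in>V. \<Sum>n\<in>{n \<in> ?K. kv n = v}. cst (?lk n * \<zeta> n) * mon (rep (kv n)))"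
      by (rule sum.group[symmetric]) (use fV kvV in auto)
    also have "\<dots> = (\<Sum>v\<in>V. cst (l v f) * mon (rep v))"
    proof (rule sum.cong[OF refl])
      fix v assume "v \<in> V"
      have "l v f = (\<Sum>n\<in>{n \<in> ?K. kv n = v}. ?lk n * \<zeta> n)"
        unfolding l_def mlift_def by (subst sum.inter_filter) (auto intro: sum.cong)
      then show "(\<Sum>n\<in>{n \<in> ?K. kv n = v}. cst (?lk n * \<zeta> n) * mon (rep (kv n))) = cst (l v f) * mon (rep v)"
        by (simp add: hom_type_simps[OF hom_type_cst] sum_distrib_right)
    qed
    also have "\<dots> = 0" using f(2) by simp
    finally have z: "(\<Sum>n\<in>?K. cst (?lk n * \<zeta> n) * mon (rep (kv n))) = 0" .
    have "f = (\<Sum>n\<in>?K. cst (?lk n) * mon n)"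
      unfolding cst_mon by (rule pm_sum_single) auto
    also have "\<dots> = (\<Sum>n\<in>?K. cst (?lk n) * mon n) - (\<Sum>n\<in>?K. cst (?lk n * \<zeta> n) * mon (rep (kv n)))"
      using z by simp
    also have "\<dots> = (\<Sum>n\<in>?K. cst (?lk n) * (mon n - cst (\<zeta> n) * mon (rep (kv n))))"
      by (simp add: sum_subtractf right_diff_distrib hom_type_simps(3)[OF hom_type_cst] mult.assoc)
    also have "\<dots> \<in> Q 0" by (intro I0(7) I0(3) \<zeta>)
    finally show ?thesis .
  qed
  obtain y where y: "\<exists>xs\<in>W. y xs \<noteq> 0" "\<forall>v\<in>V. (\<Sum>xs\<in>W. y xs * l v (power_product a 0 xs)) = 0"
    using homogeneous_system_nontrivial_solution[OF fV fW less, of "\<lambda>xs v. l v (power_product a 0 xs)"]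
    by blast
  have "(\<Sum>xs\<in>W. cst (y xs) * power_product a 0 xs) \<in> Q 0"
  proof (rule l_in)
    show "boxed r \<kappa> E (\<Sum>xs\<in>W. cst (y xs) * power_product a 0 xs)"
    proof (rule boxed_sum)
      fix xs assume "xs \<in> W"
      then have 1: "boxed r \<kappa> E (power_product a 0 xs)"
        using boxed_power_product[of r \<kappa> 0 xs D a e, OF \<kappa>] aD by (auto simp: W_def E_def)
      have 2: "boxed r \<kappa> 0 (cst (y xs))"
        using additive_on_submon(1)[of UNIV, OF _ \<kappa>] by (auto simp: boxed_def submon_def)
      show "boxed r \<kappa> E (cst (y xs) * power_product a 0 xs)"
        using boxed_mult[of r \<kappa>, OF \<kappa> 2 1] by simp
    qed
    show "l v (\<Sum>xs\<in>W. cst (y xs) * power_product a 0 xs) = 0" if "v \<in> V" for v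
      unfolding l_def mlift_sum[OF hom_type_id] mlift_cst_mult[OF hom_type_id]
      using y(2) that by (simp add: l_def)
  qed
  then have "y xs = 0" if "xs \<in> W" for xs
    using power_products_independent_mod_prime[OF hom_type_cst, of 0 d Q a y e xs] Q a that
    unfolding W_def by auto
  then show False using y(1) by blast
qed

section \<open>The Nullstellensatz\<close>

definition subalg :: "('k \<Rightarrow> 'a::comm_ring_1) \<Rightarrow> 'a set \<Rightarrow> bool"
  where "subalg c S \<longleftrightarrow> range c \<subseteq> S \<and> (\<forall>x\<in>S. \<forall>y\<in>S. x + y \<in> S \<and> x * y \<in> S)"

lemma subalg_closed:
  assumes "subalg c S" "hom_type (c :: 'k::field \<Rightarrow> 'a::comm_ring_1)"
  shows "c a \<in> S" "0 \<in> S" "1 \<in> S" "x \<in> S \<Longrightarrow> y \<in> S \<Longrightarrow> x + y \<in> S" "x \<in> S \<Longrightarrow> y \<in> S \<Longrightarrow> x * y \<in> S"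
    "x \<in> S \<Longrightarrow> - x \<in> S" "x \<in> S \<Longrightarrow> y \<in> S \<Longrightarrow> x - y \<in> S" "x \<in> S \<Longrightarrow> x ^ n \<in> S"
    "(\<And>i. i \<in> I \<Longrightarrow> f i \<in> S) \<Longrightarrow> sum f I \<in> S"
proof -
  note cs = hom_type_simps[OF assms(2)]
  show c: "c a \<in> S" for a using assms(1) by (auto simp: subalg_def)
  show 0: "0 \<in> S" using c[of 0] cs by simp
  show 1: "1 \<in> S" using c[of 1] cs by simp
  show add: "x + y \<in> S" and mult: "x * y \<in> S" if "x \<in> S" "y \<in> S" for x y
    using assms(1) that by (auto simp: subalg_def)
  show neg: "- x \<in> S" if "x \<in> S" for x
  proof -
    have "c (- 1) * x \<in> S" using mult c that by blast
    then show ?thesis by (simp add: cs)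
  qed
  show "x - y \<in> S" if "x \<in> S" "y \<in> S" using add[OF that(1) neg[OF that(2)]] by simp
  show "x ^ n \<in> S" if "x \<in> S" by (induction n) (auto intro: 1 mult that)
  show "sum f I \<in> S" if "\<And>i. i \<in> I \<Longrightarrow> f i \<in> S"
    using that by (induction I rule: infinite_finite_induct) (auto intro: 0 add)
qed

section \<open>Polynomials with coefficients in a subalgebra\<close>

definition polys_over :: "'a::comm_ring_1 set \<Rightarrow> 'a poly set"
  where "polys_over S = {p. \<forall>i. coeff p i \<in> S}"

lemma polys_over_coeff: "p \<in> polys_over S \<Longrightarrow> coeff p i \<in> S"
  by (simp add: polys_over_def)

lemma polys_over_closed:
  assumes S: "subalg c S" and c: "hom_type (c :: 'k::field \<Rightarrow> 'a::comm_ring_1)"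
  shows "p \<in> polys_over S \<Longrightarrow> q \<in> polys_over S \<Longrightarrow> p + q \<in> polys_over S"
    "p \<in> polys_over S \<Longrightarrow> q \<in> polys_over S \<Longrightarrow> p - q \<in> polys_over S"
    "p \<in> polys_over S \<Longrightarrow> - p \<in> polys_over S"
    "p \<in> polys_over S \<Longrightarrow> q \<in> polys_over S \<Longrightarrow> p * q \<in> polys_over S"
    "a \<in> S \<Longrightarrow> p \<in> polys_over S \<Longrightarrow> smult a p \<in> polys_over S"
    "a \<in> S \<Longrightarrow> monom a n \<in> polys_over S" "a \<in> S \<Longrightarrow> [:a:] \<in> polys_over S"
    "p \<in> polys_over S \<Longrightarrow> poly_cutoff n p \<in> polys_over S" "0 \<in> polys_over S"
    "a \<in> S \<Longrightarrow> p \<in> polys_over S \<Longrightarrow> pCons a p \<in> polys_over S"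
proof -
  note sc = subalg_closed[OF S c]
  show "p * q \<in> polys_over S" if "p \<in> polys_over S" "q \<in> polys_over S"
    unfolding polys_over_def coeff_mult mem_Collect_eq
    by (intro allI sc(9) sc(5)) (use that in \<open>auto simp: polys_over_def\<close>)
qed (use subalg_closed[OF S c] in \<open>auto simp: polys_over_def coeff_poly_cutoff coeff_pCons split: nat.splits\<close>)

lemma poly_in_ideal:
  assumes "ideal_set P" "\<And>i. coeff p i \<in> P"
  shows "poly p b \<in> P"
  unfolding poly_altdef by (intro ideal_set_closed(4,7)[OF assms(1)] assms(2))

text \<open>Removing the top terms with coefficients in \<open>P\<close> exposes the degree
  \<open>j\<close> that \<open>p\<close> has modulo \<open>P\<close>; the cut polynomial represents
  \<open>p\<close> modulo \<open>P\<close> and has a leading coefficient outside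
  \<open>P\<close>.\<close>

lemma cutoff_mod_ideal:
  assumes P: "ideal_set P" and ex: "\<exists>i. coeff p i \<notin> P"
  obtains j where "coeff p j \<notin> P" "degree (poly_cutoff (Suc j) p) = j"
    "coeff (poly_cutoff (Suc j) p) j = coeff p j" "j \<le> degree p"
    "\<And>i. coeff p i - coeff (poly_cutoff (Suc j) p) i \<in> P"
    "poly p b - poly (poly_cutoff (Suc j) p) b \<in> P"
proof -
  note I = ideal_set_closed[OF P]
  let ?A = "{i. coeff p i \<notin> P}"
  have sub: "?A \<subseteq> {..degree p}" using I(1) by (auto intro!: le_degree)
  then have fin: "finite ?A" by (rule finite_subset) simp
  define j where "j = Max ?A"
  have j: "coeff p j \<notin> P" "\<And>i. coeff p i \<notin> P \<Longrightarrow> i \<le> j"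
    using Max_in[OF fin] Max_ge[OF fin] ex by (auto simp: j_def)
  have d: "coeff p i - coeff (poly_cutoff (Suc j) p) i \<in> P" for i
    using j(2)[of i] I(1) by (cases "i \<le> j") (auto simp: coeff_poly_cutoff)
  have "degree (poly_cutoff (Suc j) p) \<le> j" by (rule degree_le) (simp add: coeff_poly_cutoff)
  moreover have "coeff (poly_cutoff (Suc j) p) j \<noteq> 0" using j(1) I(1) by (auto simp: coeff_poly_cutoff)
  ultimately have deg: "degree (poly_cutoff (Suc j) p) = j" using le_degree by (metis order_antisym)
  have "poly (p - poly_cutoff (Suc j) p) b \<in> P"
    by (rule poly_in_ideal[OF P]) (use d in simp)
  then show thesis using that[OF j(1) deg] d sub j(1) by (auto simp: coeff_poly_cutoff)
qed

text \<open>The leading coefficient of the divisor need not be invertible, so the dividend is first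
  multiplied by a power of it, one factor for each reduction of the degree.\<close>

lemma pseudo_division_over:
  assumes S: "subalg c S" and c: "hom_type (c :: 'k::field \<Rightarrow> 'a::comm_ring_1)"
    and p: "p \<in> polys_over S" "degree p > 0" and q: "q \<in> polys_over S"
  shows "\<exists>N s r. s \<in> polys_over S \<and> r \<in> polys_over S \<and> degree r < degree p \<and>
    smult (lead_coeff p ^ N) q = p * s + r"
  using q
proof (induction "degree q" arbitrary: q rule: less_induct)
  case less
  note cl = polys_over_closed[OF S c] and sc = subalg_closed[OF S c]
  let ?a = "lead_coeff p" and ?l = "lead_coeff q" and ?D = "degree q" and ?m = "degree p"
  show ?case
  proof (cases "?D < ?m")
    case True
    then show ?thesis using less.prems cl(9)
      by (intro exI[of _ 0] exI[of _ "0 :: 'a poly"] exI[of _ q]) auto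
  next
    case False
    define t where "t = monom ?l (?D - ?m)"
    define q' where "q' = smult ?a q - p * t"
    have mem: "?a \<in> S" "?l \<in> S" using p less.prems by (auto intro: polys_over_coeff)
    have t: "t \<in> polys_over S" unfolding t_def by (intro cl(6) mem)
    have q': "q' \<in> polys_over S" unfolding q'_def by (intro cl(2) cl(4) cl(5) mem less.prems t p(1))
    have "degree q' \<le> ?D"
    proof (unfold q'_def, rule degree_diff_le)
      show "degree (smult ?a q) \<le> ?D" by (rule degree_smult_le)
      have "degree (p * t) \<le> ?m + degree t" by (rule degree_mult_le)
      also have "degree t \<le> ?D - ?m" unfolding t_def by (rule degree_monom_le)
      finally show "degree (p * t) \<le> ?D" using False by simp
    qed
    moreover have "coeff (t * p) ?D = ?l * ?a"
      unfolding t_def using False by (simp add: coeff_monom_mult)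
    then have "coeff q' ?D = 0" unfolding q'_def by (simp add: mult.commute)
    then have "q' = 0 \<or> degree q' \<noteq> ?D" by (metis leading_coeff_0_iff)
    moreover have "?D > 0" using False p(2) by simp
    ultimately have "degree q' < ?D" by auto
    from less.hyps[OF this q'] obtain N s r where
      r: "s \<in> polys_over S" "r \<in> polys_over S" "degree r < ?m" "smult (?a ^ N) q' = p * s + r"
      by blast
    have "smult (?a ^ Suc N) q = smult (?a ^ N) q' + p * smult (?a ^ N) t"
      unfolding q'_def by (simp add: smult_diff_right mult.commute)
    also have "\<dots> = p * (s + smult (?a ^ N) t) + r" unfolding r(4) by (simp add: algebra_simps)
    finally have "smult (?a ^ Suc N) q = p * (s + smult (?a ^ N) t) + r" .
    moreover have "s + smult (?a ^ N) t \<in> polys_over S"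
      by (intro cl(1) cl(5) sc(8) r(1) t mem)
    ultimately show ?thesis using r by blast
  qed
qed

text \<open>Points over \<open>k\<close> of the image of \<open>S\<close> modulo \<open>P\<close>.
  The functions are total, but only their values on \<open>S\<close> are specified.\<close>

definition khom :: "('k \<Rightarrow> 'a::comm_ring_1) \<Rightarrow> 'a set \<Rightarrow> 'a set \<Rightarrow> ('a \<Rightarrow> 'k::comm_ring_1) \<Rightarrow> bool"
  where "khom c P S f \<longleftrightarrow> (\<forall>a. f (c a) = a) \<and>
    (\<forall>x\<in>S. \<forall>y\<in>S. f (x + y) = f x + f y \<and> f (x * y) = f x * f y) \<and> (\<forall>x\<in>S. x \<in> P \<longrightarrow> f x = 0)"

lemma khom_simps:
  assumes f: "khom c P S f" and S: "subalg c S" and c: "hom_type (c :: 'k::field \<Rightarrow> 'a::comm_ring_1)"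
  shows "f (c a) = a" "f 0 = 0" "f 1 = 1" "x \<in> S \<Longrightarrow> y \<in> S \<Longrightarrow> f (x + y) = f x + f y"
    "x \<in> S \<Longrightarrow> y \<in> S \<Longrightarrow> f (x * y) = f x * f y" "x \<in> S \<Longrightarrow> x \<in> P \<Longrightarrow> f x = 0"
    "x \<in> S \<Longrightarrow> y \<in> S \<Longrightarrow> f (x - y) = f x - f y" "x \<in> S \<Longrightarrow> f (x ^ n) = f x ^ n"
    "(\<And>i. i \<in> I \<Longrightarrow> g i \<in> S) \<Longrightarrow> f (sum g I) = (\<Sum>i\<in>I. f (g i))"
proof -
  note cs = hom_type_simps[OF c] and sc = subalg_closed[OF S c]
  show c': "f (c a) = a" for a using f by (simp add: khom_def)
  show 0: "f 0 = 0" using c'[of 0] cs by simp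
  show 1: "f 1 = 1" using c'[of 1] cs by simp
  show add: "f (x + y) = f x + f y" and mult: "f (x * y) = f x * f y" if "x \<in> S" "y \<in> S" for x y
    using f that by (auto simp: khom_def)
  show "f x = 0" if "x \<in> S" "x \<in> P" using f that by (auto simp: khom_def)
  show "f (x - y) = f x - f y" if "x \<in> S" "y \<in> S"
  proof -
    have "f ((x - y) + y) = f (x - y) + f y" using that sc by (intro add)
    then show ?thesis by simp
  qed
  show "f (x ^ n) = f x ^ n" if "x \<in> S"
    by (induction n) (use 1 mult that sc(8)[OF that] in auto)
  show "f (sum g I) = (\<Sum>i\<in>I. f (g i))" if "\<And>i. i \<in> I \<Longrightarrow> g i \<in> S"
    using that
  proof (induction I rule: infinite_finite_induct)
    case (insert i I)
    have "sum g I \<in> S" using insert by (intro sc(9)) auto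
    then show ?case using insert add by simp
  qed (use 0 in auto)
qed

lemma khom_map_poly:
  assumes f: "khom c P S f" and S: "subalg c S" and c: "hom_type (c :: 'k::field \<Rightarrow> 'a::comm_ring_1)"
  shows "coeff (map_poly f p) i = f (coeff p i)"
    "p \<in> polys_over S \<Longrightarrow> q \<in> polys_over S \<Longrightarrow> map_poly f (p + q) = map_poly f p + map_poly f q"
    "p \<in> polys_over S \<Longrightarrow> q \<in> polys_over S \<Longrightarrow> map_poly f (p * q) = map_poly f p * map_poly f q"
    "a \<in> S \<Longrightarrow> p \<in> polys_over S \<Longrightarrow> map_poly f (smult a p) = smult (f a) (map_poly f p)"
proof -
  note fs = khom_simps[OF f S c] and sc = subalg_closed[OF S c]
  show co: "coeff (map_poly f p) i = f (coeff p i)" for p i by (rule coeff_map_poly) (rule fs(2))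
  show "map_poly f (p + q) = map_poly f p + map_poly f q"
    if "p \<in> polys_over S" "q \<in> polys_over S" for p q
    by (rule poly_eqI) (use that in \<open>simp add: co fs(4) polys_over_coeff\<close>)
  show "map_poly f (p * q) = map_poly f p * map_poly f q"
    if "p \<in> polys_over S" "q \<in> polys_over S" for p q
    by (rule poly_eqI)
      (use that in \<open>simp add: co coeff_mult fs(5) fs(9) sc(5) polys_over_coeff\<close>)
  show "map_poly f (smult a p) = smult (f a) (map_poly f p)" if "a \<in> S" "p \<in> polys_over S"
    by (rule poly_eqI) (use that in \<open>simp add: co fs(5) polys_over_coeff\<close>)
qed

definition adjoin :: "'a::comm_ring_1 set \<Rightarrow> 'a \<Rightarrow> 'a set"
  where "adjoin S b = (\<lambda>p. poly p b) ` polys_over S"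

lemma subalg_adjoin:
  assumes S: "subalg c S" and c: "hom_type (c :: 'k::field \<Rightarrow> 'a::comm_ring_1)"
  shows "subalg c (adjoin S b)" "S \<subseteq> adjoin S b" "b \<in> adjoin S b"
proof -
  note cl = polys_over_closed[OF S c] and sc = subalg_closed[OF S c]
  show sub: "S \<subseteq> adjoin S b"
  proof
    fix x assume "x \<in> S"
    then have "x = poly [:x:] b" "[:x:] \<in> polys_over S" using cl(7) by auto
    then show "x \<in> adjoin S b" unfolding adjoin_def by blast
  qed
  have "b = poly [:0, 1:] b" by simp
  moreover have "[:0, 1:] \<in> polys_over S" using cl(9,10) sc(2,3) by blast
  ultimately show "b \<in> adjoin S b" unfolding adjoin_def by blast
  have "poly p b + poly q b \<in> adjoin S b" "poly p b * poly q b \<in> adjoin S b"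
    if "p \<in> polys_over S" "q \<in> polys_over S" for p q
    using cl(1,4)[OF that] unfolding adjoin_def by (metis image_eqI poly_add, metis image_eqI poly_mult)
  then show "subalg c (adjoin S b)"
    unfolding subalg_def using sub sc(1) by (auto simp: adjoin_def)
qed

text \<open>The hypothesis \<open>wd\<close> is the well-definedness of sending \<open>b\<close> to
  \<xi>: every polynomial relation of \<open>b\<close> modulo \<open>P\<close> has to hold at \<xi>
  after its coefficients are specialized.\<close>

lemma khom_extend:
  assumes f: "khom c P S f" and S: "subalg c S" and c: "hom_type (c :: 'k::field \<Rightarrow> 'a::comm_ring_1)"
    and P: "ideal_set P"
    and wd: "\<And>q. q \<in> polys_over S \<Longrightarrow> poly q b \<in> P \<Longrightarrow> poly (map_poly f q) \<xi> = 0"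
  shows "\<exists>f'. khom c P (adjoin S b) f' \<and> (\<forall>p\<in>polys_over S. f' (poly p b) = poly (map_poly f p) \<xi>)"
proof -
  note cl = polys_over_closed[OF S c] and sc = subalg_closed[OF S c]
  note fs = khom_simps[OF f S c] and fm = khom_map_poly[OF f S c]
  define f' where "f' y = poly (map_poly f (SOME p. p \<in> polys_over S \<and> poly p b = y)) \<xi>" for y
  have f': "f' (poly p b) = poly (map_poly f p) \<xi>" if p: "p \<in> polys_over S" for p
  proof -
    define q where "q = (SOME q. q \<in> polys_over S \<and> poly q b = poly p b)"
    have q: "q \<in> polys_over S \<and> poly q b = poly p b"
      unfolding q_def by (rule someI[of _ p]) (use p in simp)
    have d: "p - q \<in> polys_over S" using cl(2) p q by blast
    have "poly (p - q) b \<in> P" using q ideal_set_closed(1)[OF P] by simp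
    from wd[OF d this] have "poly (map_poly f (p - q)) \<xi> = 0" .
    moreover have "map_poly f ((p - q) + q) = map_poly f (p - q) + map_poly f q"
      using fm(2)[OF d] q by blast
    ultimately have "poly (map_poly f p) \<xi> = poly (map_poly f q) \<xi>" by simp
    then show ?thesis by (simp add: f'_def q_def)
  qed
  have "khom c P (adjoin S b) f'"
    unfolding khom_def
  proof (intro conjI allI ballI impI)
    show "f' (c a) = a" for a
    proof -
      have "f' (poly [:c a:] b) = poly (map_poly f [:c a:]) \<xi>" by (rule f') (use cl(7) sc(1) in blast)
      moreover have "map_poly f [:c a:] = [:a:]" by (rule poly_eqI) (simp add: fm(1) fs coeff_pCons split: nat.split)
      ultimately show ?thesis by simp
    qed
    fix x assume "x \<in> adjoin S b"
    then obtain p where p: "p \<in> polys_over S" "x = poly p b" by (auto simp: adjoin_def)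
    show "f' x = 0" if "x \<in> P" using wd[OF p(1)] f'[OF p(1)] p(2) that by simp
    fix y assume "y \<in> adjoin S b"
    then obtain q where q: "q \<in> polys_over S" "y = poly q b" by (auto simp: adjoin_def)
    show "f' (x + y) = f' x + f' y"
      using f'[OF cl(1)[OF p(1) q(1)]] f'[OF p(1)] f'[OF q(1)] fm(2)[OF p(1) q(1)] p q by simp
    show "f' (x * y) = f' x * f' y"
      using f'[OF cl(4)[OF p(1) q(1)]] f'[OF p(1)] f'[OF q(1)] fm(3)[OF p(1) q(1)] p q by simp
  qed
  then show ?thesis using f' by blast
qed

lemma alg_closed_poly_nonroot:
  fixes g :: "'k::alg_closed_field poly"
  assumes "g \<noteq> 0"
  shows "\<exists>\<xi>. poly g \<xi> \<noteq> 0"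
proof (cases "degree g = 0")
  case True
  then show ?thesis using assms by (metis degree_eq_zeroE pCons_0_0 poly_const_conv)
next
  case False
  then have "degree (g - 1) > 0" by (metis degree_1 diff_add_cancel degree_add_le le_zero_eq neq0_conv order_refl)
  then obtain \<xi> where "poly (g - 1) \<xi> = 0" using alg_closed_imp_poly_has_root by blast
  then have "poly g \<xi> = 1" by simp
  then show ?thesis by (metis zero_neq_one)
qed

text \<open>Every value of \<open>b\<close> is allowed. A coefficient outside \<open>P\<close> in a
  polynomial expression for \<beta> serves as \<alpha>: if it survives under \<open>f\<close>, the
  specialized polynomial is nonzero and some value of \<open>b\<close> is not a root.\<close>

lemma khom_extend_transcendental:
  fixes c :: "'k::alg_closed_field \<Rightarrow> 'a::comm_ring_1"
  assumes S: "subalg c S" and c: "hom_type c" and P: "prime_set P"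
    and trans: "\<And>p i. p \<in> polys_over S \<Longrightarrow> poly p b \<in> P \<Longrightarrow> coeff p i \<in> P"
    and \<beta>: "\<beta> \<in> adjoin S b" "\<beta> \<notin> P"
  shows "\<exists>\<alpha>\<in>S. \<alpha> \<notin> P \<and> (\<forall>f. khom c P S f \<longrightarrow> f \<alpha> \<noteq> 0 \<longrightarrow> (\<exists>f'. khom c P (adjoin S b) f' \<and> f' \<beta> \<noteq> 0))"
proof -
  note I = prime_set_ideal[OF P]
  obtain q where q: "q \<in> polys_over S" "\<beta> = poly q b" using \<beta>(1) by (auto simp: adjoin_def)
  then obtain i where i: "coeff q i \<notin> P" using poly_in_ideal[OF I] \<beta>(2) by blast
  have "\<exists>f'. khom c P (adjoin S b) f' \<and> f' \<beta> \<noteq> 0" if f: "khom c P S f" "f (coeff q i) \<noteq> 0" for f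
  proof -
    note fs = khom_simps[OF f(1) S c] and fm = khom_map_poly[OF f(1) S c]
    have "map_poly f q \<noteq> 0" using f(2) fm(1) by (metis coeff_0)
    then obtain \<xi> where \<xi>: "poly (map_poly f q) \<xi> \<noteq> 0" using alg_closed_poly_nonroot by blast
    have "poly (map_poly f p) \<xi> = 0" if p: "p \<in> polys_over S" "poly p b \<in> P" for p
    proof -
      have "map_poly f p = 0"
        by (rule poly_eqI) (simp add: fm(1) fs(6)[OF polys_over_coeff[OF p(1)] trans[OF p]])
      then show ?thesis by simp
    qed
    from khom_extend[OF f(1) S c I this] show ?thesis using q \<xi> by metis
  qed
  then show ?thesis using i polys_over_coeff[OF q(1)] by blast
qed

text \<open>Let \<open>p\<close> be a relation of \<open>b\<close> modulo \<open>P\<close> of least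
  degree, with leading coefficient \<open>a\<close>. A homomorphism with
  \<open>f a \<noteq> 0\<close> extends by sending \<open>b\<close> to a root of the specialized
  \<open>p\<close>. To keep \<beta> nonzero, a multiple \<open>\<beta> * u(b)\<close> is found that
  is congruent to a constant \<open>c0\<close> outside \<open>P\<close>; then \<open>a * c0\<close>
  serves as \<alpha>.\<close>

lemma khom_extend_algebraic:
  fixes c :: "'k::alg_closed_field \<Rightarrow> 'a::comm_ring_1"
  assumes S: "subalg c S" and c: "hom_type c" and P: "prime_set P"
    and alg: "\<exists>p\<in>polys_over S. poly p b \<in> P \<and> (\<exists>i. coeff p i \<notin> P)"
    and \<beta>: "\<beta> \<in> adjoin S b" "\<beta> \<notin> P"
  shows "\<exists>\<alpha>\<in>S. \<alpha> \<notin> P \<and> (\<forall>f. khom c P S f \<longrightarrow> f \<alpha> \<noteq> 0 \<longrightarrow> (\<exists>f'. khom c P (adjoin S b) f' \<and> f' \<beta> \<noteq> 0))"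
proof -
  note I = prime_set_ideal[OF P]
  note Ic = ideal_set_closed[OF I] and cl = polys_over_closed[OF S c] and sc = subalg_closed[OF S c]
  define good where "good m \<longleftrightarrow> (\<exists>p\<in>polys_over S. poly p b \<in> P \<and> coeff p m \<notin> P \<and> degree p = m)" for m
  have cut: "\<exists>j\<le>degree p. good j" if p: "p \<in> polys_over S" "poly p b \<in> P" "coeff p i \<notin> P" for p i
  proof -
    obtain j where j: "coeff p j \<notin> P" "degree (poly_cutoff (Suc j) p) = j"
      "coeff (poly_cutoff (Suc j) p) j = coeff p j" "j \<le> degree p"
      "poly p b - poly (poly_cutoff (Suc j) p) b \<in> P"
      using cutoff_mod_ideal[OF I, of p b thesis] p(3) by blast
    have "poly (poly_cutoff (Suc j) p) b \<in> P" using j(5) p(2) ideal_set_cong[OF I] by blast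
    then have "good j" unfolding good_def using j cl(8)[OF p(1)] by (metis (no_types))
    then show ?thesis using j by blast
  qed
  define m where "m = (LEAST m. good m)"
  have "\<exists>m. good m" using alg cut by blast
  then have "good m" unfolding m_def by (rule LeastI_ex)
  then obtain p where p: "p \<in> polys_over S" "poly p b \<in> P" "coeff p m \<notin> P" "degree p = m"
    unfolding good_def by blast
  define a where "a = lead_coeff p"
  have a: "a \<in> S" "a \<notin> P" using p polys_over_coeff by (auto simp: a_def)
  have min: "coeff q i \<in> P" if q: "q \<in> polys_over S" "poly q b \<in> P" "degree q < m" for q i
  proof (rule ccontr)
    assume "coeff q i \<notin> P"
    from cut[OF q(1,2) this] obtain j where "j < m" "good j" using q(3) order_le_less_trans by blast
    then show False unfolding m_def using not_less_Least by blast
  qed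
  have m: "m > 0"
  proof (rule ccontr)
    assume "\<not> m > 0"
    then have "degree p = 0" using p(4) by simp
    then obtain a where "p = [:a:]" by (rule degree_eq_zeroE)
    then have "poly p b = coeff p m" using \<open>\<not> m > 0\<close> by simp
    then show False using p by simp
  qed
  note pd = pseudo_division_over[OF S c p(1), unfolded p(4), OF m]
  obtain q where q: "q \<in> polys_over S" "\<beta> = poly q b" using \<beta>(1) by (auto simp: adjoin_def)
  \<comment> \<open>These are the degrees of the polynomials \<open>w\<close> for which
    \<open>w(b)\<close> is a multiple of \<beta> modulo \<open>P\<close>. The least such degree
    \<open>e\<close> will turn out to be 0, which yields the constant \<open>c0\<close>.\<close>
  define gw where "gw e \<longleftrightarrow> (\<exists>w\<in>polys_over S. \<exists>u\<in>polys_over S.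
    poly w b - \<beta> * poly u b \<in> P \<and> coeff w e \<notin> P \<and> degree w = e)" for e
  have cutw: "\<exists>j\<le>degree w. gw j"
    if w: "w \<in> polys_over S" "u \<in> polys_over S" "poly w b - \<beta> * poly u b \<in> P" "coeff w i \<notin> P" for w u i
  proof -
    obtain j where j: "coeff w j \<notin> P" "degree (poly_cutoff (Suc j) w) = j"
      "coeff (poly_cutoff (Suc j) w) j = coeff w j" "j \<le> degree w"
      "poly w b - poly (poly_cutoff (Suc j) w) b \<in> P"
      using cutoff_mod_ideal[OF I, of w b thesis] w(4) by blast
    have "(poly w b - \<beta> * poly u b) - (poly w b - poly (poly_cutoff (Suc j) w) b) \<in> P"
      using Ic(6) j(5) w(3) by blast
    then have "poly (poly_cutoff (Suc j) w) b - \<beta> * poly u b \<in> P" by simp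
    then have "gw j" unfolding gw_def using j cl(8)[OF w(1)] w(2) by (metis (no_types))
    then show ?thesis using j by blast
  qed
  have "\<exists>e<m. gw e"
  proof -
    obtain N s r where r: "s \<in> polys_over S" "r \<in> polys_over S" "degree r < m"
      "smult (lead_coeff p ^ N) q = p * s + r" using pd[OF q(1)] p(4) by metis
    have "poly (smult (lead_coeff p ^ N) q) b = poly p b * poly s b + poly r b" unfolding r(4) by simp
    then have e: "poly r b = a ^ N * \<beta> - poly p b * poly s b" by (simp add: q(2) a_def)
    have "poly r b - \<beta> * poly [:a ^ N:] b = - (poly p b * poly s b)" unfolding e by simp
    also have "\<dots> \<in> P" by (intro Ic(5) Ic(4)[OF p(2)])
    finally have r1: "poly r b - \<beta> * poly [:a ^ N:] b \<in> P" .
    have "\<exists>i. coeff r i \<notin> P"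
    proof (rule ccontr)
      assume "\<not> (\<exists>i. coeff r i \<notin> P)"
      then have "poly r b \<in> P" using poly_in_ideal[OF I] by blast
      then have "\<beta> * poly [:a ^ N:] b \<in> P" using ideal_set_cong[OF I r1] by blast
      then have "\<beta> * a ^ N \<in> P" by simp
      then show False using prime_set_mult[OF P] prime_set_power[OF P] \<beta>(2) a(2) by blast
    qed
    then obtain i where "coeff r i \<notin> P" by blast
    from cutw[OF r(2) cl(7)[OF sc(8)[OF a(1)]] r1 this] show ?thesis using r(3) order_le_less_trans by blast
  qed
  then obtain e0 where e0: "e0 < m" "gw e0" by blast
  define e where "e = (LEAST e. gw e)"
  have e: "gw e" "e < m" using LeastI[of gw e0] Least_le[of gw e0] e0 by (auto simp: e_def)
  then obtain w u where w: "w \<in> polys_over S" "u \<in> polys_over S" "poly w b - \<beta> * poly u b \<in> P"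
    "coeff w e \<notin> P" "degree w = e" unfolding gw_def by blast
  \<comment> \<open>Euclid's argument: dividing \<open>p\<close> by \<open>w\<close> leaves a
    remainder whose value at \<open>b\<close> is again a multiple of \<beta>, so by minimality of
    \<open>e\<close> it vanishes modulo \<open>P\<close>. Then \<open>w * s\<close> is congruent to
    a multiple of \<open>p\<close>, and \<open>s(b)\<close> lies in \<open>P\<close> because
    \<open>w(b)\<close> does not. Minimality of \<open>p\<close> makes the degree of
    \<open>s\<close> modulo \<open>P\<close> at least \<open>m\<close>, and the degree of
    \<open>w * s\<close> would exceed \<open>m\<close>.\<close>
  have "e = 0"
  proof (rule ccontr)
    assume "e \<noteq> 0"
    then have wpos: "degree w > 0" using w by simp
    obtain N s r where r: "s \<in> polys_over S" "r \<in> polys_over S" "degree r < e"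
      "smult (lead_coeff w ^ N) p = w * s + r"
      using pseudo_division_over[OF S c w(1) wpos p(1)] w(5) by blast
    let ?l = "lead_coeff w ^ N"
    have l: "?l \<notin> P" using w(4,5) prime_set_power[OF P] by blast
    have "poly (smult ?l p) b = poly w b * poly s b + poly r b" unfolding r(4) by simp
    then have pr: "poly r b = ?l * poly p b - poly w b * poly s b" by simp
    have "poly r b - \<beta> * poly (- (u * s)) b
      = ?l * poly p b - (poly w b - \<beta> * poly u b) * poly s b"
      unfolding pr by (simp add: algebra_simps)
    also have "\<dots> \<in> P" by (intro Ic(6) Ic(3)[OF p(2)] Ic(4)[OF w(3)])
    finally have rP: "poly r b - \<beta> * poly (- (u * s)) b \<in> P" .
    show False
    proof (cases "\<exists>i. coeff r i \<notin> P")
      case True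
      then obtain i where i: "coeff r i \<notin> P" by blast
      have "- (u * s) \<in> polys_over S" by (intro cl(3) cl(4) w(2) r(1))
      from cutw[OF r(2) this rP i] obtain j where "j < e" "gw j"
        using r(3) order_le_less_trans by blast
      then show False unfolding e_def using not_less_Least by blast
    next
      case False
      then have rc: "\<And>i. coeff r i \<in> P" by blast
      then have "poly r b \<in> P" by (rule poly_in_ideal[OF I])
      then have "?l * poly p b - poly r b \<in> P" by (intro Ic(6) Ic(3)[OF p(2)])
      then have "poly w b * poly s b \<in> P" unfolding pr by simp
      moreover have "poly w b \<notin> P" using min[OF w(1)] w(4,5) e(2) by blast
      ultimately have sP: "poly s b \<in> P" using prime_set_mult[OF P] by blast
      have ws: "coeff (w * s) i - ?l * coeff p i \<in> P" for i
      proof -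
        have "coeff (smult ?l p) i = coeff (w * s) i + coeff r i" unfolding r(4) by simp
        then have "coeff (w * s) i - ?l * coeff p i = - coeff r i" by simp
        then show ?thesis using Ic(5)[OF rc] by simp
      qed
      have "\<exists>i. coeff s i \<notin> P"
      proof (rule ccontr)
        assume "\<not> (\<exists>i. coeff s i \<notin> P)"
        then have "coeff (w * s) m \<in> P" unfolding coeff_mult by (intro Ic(7) Ic(3)) blast
        then have "?l * coeff p m \<in> P" using ideal_set_cong[OF I ws] by blast
        then show False using prime_set_mult[OF P] l p(3) by blast
      qed
      then obtain j where j: "coeff s j \<notin> P" "degree (poly_cutoff (Suc j) s) = j"
        "coeff (poly_cutoff (Suc j) s) j = coeff s j"
        "\<And>i. coeff s i - coeff (poly_cutoff (Suc j) s) i \<in> P"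
        "poly s b - poly (poly_cutoff (Suc j) s) b \<in> P"
        using cutoff_mod_ideal[OF I, of s b thesis] by blast
      have "poly (poly_cutoff (Suc j) s) b \<in> P" using ideal_set_cong[OF I j(5)] sP by blast
      then have "\<not> j < m" using min[OF cl(8)[OF r(1)], of "Suc j" j] j(1,2,3) by auto
      then have big: "e + j > m" using \<open>e \<noteq> 0\<close> by simp
      have "coeff (w * poly_cutoff (Suc j) s) (e + j) = coeff w e * coeff s j"
        using coeff_mult_degree_sum[of w "poly_cutoff (Suc j) s"] w(5) j(2,3) by simp
      moreover have "coeff (w * s) (e + j) - coeff (w * poly_cutoff (Suc j) s) (e + j) \<in> P"
      proof -
        have "coeff (w * (s - poly_cutoff (Suc j) s)) (e + j) \<in> P"
          unfolding coeff_mult by (intro Ic(7) Ic(3)) (simp add: j(4))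
        then show ?thesis by (simp add: right_diff_distrib)
      qed
      moreover have "coeff (w * s) (e + j) \<in> P"
        using ws[of "e + j"] big p(4) by (simp add: coeff_eq_0)
      ultimately have "coeff w e * coeff s j \<in> P" using ideal_set_cong[OF I] by metis
      then show False using prime_set_mult[OF P] w(4) j(1) by blast
    qed
  qed
  define c0 where "c0 = coeff w 0"
  obtain w0 where "w = [:w0:]" using w(5) \<open>e = 0\<close> by (blast elim: degree_eq_zeroE)
  then have wc: "poly w b = c0" by (simp add: c0_def)
  have c0: "c0 \<in> S" "c0 \<notin> P" using w polys_over_coeff \<open>e = 0\<close> by (auto simp: c0_def)
  \<comment> \<open>The specialized \<open>p\<close> has a root \<xi> since its coefficient
    \<open>f a\<close> in the positive degree \<open>m\<close> is nonzero. The congruence of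
    \<open>c0\<close> with \<open>\<beta> * u(b)\<close> modulo \<open>P\<close> then gives
    \<open>f' \<beta> \<noteq> 0\<close>.\<close>
  have "\<exists>f'. khom c P (adjoin S b) f' \<and> f' \<beta> \<noteq> 0" if f: "khom c P S f" "f (a * c0) \<noteq> 0" for f
  proof -
    note fs = khom_simps[OF f(1) S c] and fm = khom_map_poly[OF f(1) S c]
    have fa: "f a \<noteq> 0" "f c0 \<noteq> 0" using f(2) fs(5)[OF a(1) c0(1)] by auto
    have "coeff (map_poly f p) m \<noteq> 0" using fa p(4) by (simp add: fm(1) a_def)
    then have "degree (map_poly f p) > 0" using le_degree[of "map_poly f p" m] m by simp
    then obtain \<xi> where \<xi>: "poly (map_poly f p) \<xi> = 0" using alg_closed_imp_poly_has_root by blast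
    have wd: "poly (map_poly f h) \<xi> = 0" if h: "h \<in> polys_over S" "poly h b \<in> P" for h
    proof -
      obtain N s r where r: "s \<in> polys_over S" "r \<in> polys_over S" "degree r < m"
        "smult (a ^ N) h = p * s + r" using pd[OF h(1)] p(4) unfolding a_def by metis
      have "poly (smult (a ^ N) h) b = poly p b * poly s b + poly r b" unfolding r(4) by simp
      then have "poly r b = a ^ N * poly h b - poly p b * poly s b" by simp
      also have "\<dots> \<in> P" by (intro Ic(6) Ic(3)[OF h(2)] Ic(4)[OF p(2)])
      finally have "coeff r i \<in> P" for i using min[OF r(2) _ r(3)] by blast
      then have "map_poly f r = 0"
        by (intro poly_eqI) (simp add: fm(1) fs(6) polys_over_coeff[OF r(2)])
      then have "smult (f (a ^ N)) (map_poly f h) = map_poly f p * map_poly f s"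
        using fm(2)[OF cl(4)[OF p(1) r(1)] r(2)] fm(3)[OF p(1) r(1)] fm(4)[OF sc(8)[OF a(1)] h(1), of N] r(4)
        by simp
      then have "f (a ^ N) * poly (map_poly f h) \<xi> = poly (map_poly f p) \<xi> * poly (map_poly f s) \<xi>"
        by (metis poly_smult poly_mult)
      then show ?thesis using \<xi> fa fs(8)[OF a(1)] by simp
    qed
    obtain f' where f': "khom c P (adjoin S b) f'" "\<And>h. h \<in> polys_over S \<Longrightarrow> f' (poly h b) = poly (map_poly f h) \<xi>"
      using khom_extend[OF f(1) S c I wd] by blast
    note f's = khom_simps[OF f'(1) subalg_adjoin(1)[OF S c] c]
    have ub: "poly u b \<in> adjoin S b" using w(2) by (auto simp: adjoin_def)
    have c0b: "c0 \<in> adjoin S b" using c0 subalg_adjoin(2)[OF S c] by blast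
    note sca = subalg_closed[OF subalg_adjoin(1)[OF S c, of b] c]
    have "f' (c0 - \<beta> * poly u b) = 0"
      by (rule f's(6)) (use sca(5,7) c0b \<beta>(1) ub w(3) wc in auto)
    then have "f' c0 = f' \<beta> * f' (poly u b)"
      using f's(7)[OF c0b sca(5)[OF \<beta>(1) ub]] f's(5)[OF \<beta>(1) ub] by simp
    moreover have "f' c0 = f c0"
    proof -
      have "f' (poly [:c0:] b) = poly (map_poly f [:c0:]) \<xi>" by (rule f'(2)) (use cl(7) c0 in blast)
      moreover have "map_poly f [:c0:] = [:f c0:]" by (rule poly_eqI) (simp add: fm(1) fs coeff_pCons split: nat.split)
      ultimately show ?thesis by simp
    qed
    ultimately have "f' \<beta> \<noteq> 0" using fa(2) by auto
    then show ?thesis using f'(1) by blast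
  qed
  moreover have "a * c0 \<in> S" "a * c0 \<notin> P" using sc(5) a c0 prime_set_mult[OF P] by blast+
  ultimately show ?thesis by blast
qed

fun generated_alg :: "('k \<Rightarrow> 'a::comm_ring_1) \<Rightarrow> 'a list \<Rightarrow> 'a set" where
  "generated_alg c [] = range c"
| "generated_alg c (b # bs) = adjoin (generated_alg c bs) b"

lemma subalg_generated_alg:
  assumes c: "hom_type (c :: 'k::field \<Rightarrow> 'a::comm_ring_1)"
  shows "subalg c (generated_alg c bs) \<and> set bs \<subseteq> generated_alg c bs"
proof (induction bs)
  case Nil
  have "c a + c b \<in> range c" "c a * c b \<in> range c" for a b
    using hom_type_simps(2,3)[OF c] by (metis rangeI)+
  then show ?case by (auto simp: subalg_def)
next
  case (Cons b bs)
  then show ?case using subalg_adjoin[OF _ c] by fastforce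
qed

text \<open>Induction over the generators. Asking in addition that \<beta> survive is what carries
  the induction: each extension step trades \<beta> for an element \<alpha> of the smaller
  algebra.\<close>

lemma khom_exists:
  fixes c :: "'k::alg_closed_field \<Rightarrow> 'a::comm_ring_1"
  assumes c: "hom_type c" and P: "prime_set P"
  shows "\<beta> \<in> generated_alg c bs \<Longrightarrow> \<beta> \<notin> P \<Longrightarrow> \<exists>f. khom c P (generated_alg c bs) f \<and> f \<beta> \<noteq> 0"
proof (induction bs arbitrary: \<beta>)
  case Nil
  note cs = hom_type_simps[OF c]
  have c0: "a = 0" if "c a \<in> P" for a
  proof (rule ccontr)
    assume "a \<noteq> 0"
    then have "c (inverse a) * c a = 1" by (metis cs(1,3) left_inverse)
    then show False using ideal_set_closed(3)[OF prime_set_ideal[OF P] that, of "c (inverse a)"] prime_set_one[OF P] by simp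
  qed
  have inj: "inj c"
  proof (rule injI)
    fix x y assume "c x = c y"
    then have "c (x - y) \<in> P" using ideal_set_closed(1)[OF prime_set_ideal[OF P]] by (simp add: cs)
    then show "x = y" using c0[of "x - y"] by simp
  qed
  have "khom c P (range c) (inv_into UNIV c)"
    unfolding khom_def
  proof (intro conjI allI ballI impI)
    show inv: "inv_into UNIV c (c a) = a" for a using inj by simp
    show "inv_into UNIV c (x + y) = inv_into UNIV c x + inv_into UNIV c y" "inv_into UNIV c (x * y) = inv_into UNIV c x * inv_into UNIV c y"
      if "x \<in> range c" "y \<in> range c" for x y
      using that inv by (auto simp flip: cs)
    show "inv_into UNIV c x = 0" if "x \<in> range c" "x \<in> P" for x using that inv c0 by auto
  qed
  moreover have "inv_into UNIV c \<beta> \<noteq> 0"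
    using Nil inj cs(4) ideal_set_closed(1)[OF prime_set_ideal[OF P]] by auto
  ultimately show ?case by auto
next
  case (Cons b bs)
  note S = subalg_generated_alg[OF c, of bs, THEN conjunct1]
  have "\<exists>\<alpha>\<in>generated_alg c bs. \<alpha> \<notin> P \<and> (\<forall>f. khom c P (generated_alg c bs) f \<longrightarrow> f \<alpha> \<noteq> 0 \<longrightarrow>
      (\<exists>f'. khom c P (adjoin (generated_alg c bs) b) f' \<and> f' \<beta> \<noteq> 0))"
  proof (cases "\<exists>p\<in>polys_over (generated_alg c bs). poly p b \<in> P \<and> (\<exists>i. coeff p i \<notin> P)")
    case True
    then show ?thesis using khom_extend_algebraic[OF S c P] Cons.prems by simp
  next
    case False
    then show ?thesis using khom_extend_transcendental[OF S c P, of b \<beta>] Cons.prems by auto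
  qed
  then show ?case using Cons.IH by fastforce
qed

text \<open>With \<beta> = 1 the extension argument yields an algebra homomorphism to
  \<open>k\<close> that kills \<open>P\<close>. Its kernel is a proper ideal, so maximality
  identifies it with \<open>P\<close>, and the homomorphism is determined by its values on
  monomials.\<close>

theorem maximal_ideal_is_character:
  fixes P :: "('n::comm_monoid_add \<Rightarrow>\<^sub>0 'k::alg_closed_field) set" and \<Gamma> :: "'n set"
  assumes fin: "finite \<Gamma>" and \<Gamma>: "mspan \<Gamma> = UNIV" and P: "prime_set P"
    and max: "\<And>Q. ideal_set Q \<Longrightarrow> P \<subseteq> Q \<Longrightarrow> 1 \<notin> Q \<Longrightarrow> Q = P"
  obtains x where "x 0 = 1" "\<And>m n. x (m + n) = x m * x n" "P = {f. mlift (\<lambda>a. a) x f = 0}"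
proof -
  let ?c = "cst :: 'k \<Rightarrow> 'n \<Rightarrow>\<^sub>0 'k"
  obtain gs where gs: "set gs = \<Gamma>" using fin finite_list by blast
  define G where "G = generated_alg ?c (map (mon :: 'n \<Rightarrow> 'n \<Rightarrow>\<^sub>0 'k) gs)"
  have S: "subalg ?c G" "mon ` \<Gamma> \<subseteq> G"
    using subalg_generated_alg[OF hom_type_cst, of "map (mon :: 'n \<Rightarrow> 'n \<Rightarrow>\<^sub>0 'k) gs"] gs by (auto simp: G_def)
  note sc = subalg_closed[OF S(1) hom_type_cst]
  have "mon (\<Sum>g\<in>A. nmul (d g) g) \<in> G" if "finite A" "A \<subseteq> \<Gamma>" for d A
    using that
  proof (induction A rule: finite_induct)
    case empty
    then show ?case using sc(3) by simp
  next
    case (insert g A)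
    then have "mon g ^ d g * mon (\<Sum>g\<in>A. nmul (d g) g) \<in> G" using sc(5,8) S(2) by blast
    then show ?case using insert by (simp add: mon_power mon_mult)
  qed
  then have "mon m \<in> G" if "m \<in> mspan \<Gamma>" for m using fin that unfolding mspan_def by auto
  then have mon: "mon n \<in> G" for n using \<Gamma> by simp
  have G: "f \<in> G" for f
  proof (induction f rule: pm_induct)
    case (single n a)
    show ?case using sc(5)[OF sc(1)[of a] mon[of n]] by (simp add: mult_single)
  qed (rule sc(4))
  obtain f where f: "khom ?c P UNIV f"
    using khom_exists[OF hom_type_cst P, of 1 "map (mon :: 'n \<Rightarrow> 'n \<Rightarrow>\<^sub>0 'k) gs"] G prime_set_one[OF P]
    unfolding G_def by (metis UNIV_eq_I)
  have Su: "subalg ?c UNIV" by (simp add: subalg_def)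
  note fs = khom_simps[OF f Su hom_type_cst]
  have hf: "hom_type f" using fs by (simp add: hom_type_def)
  define x where "x n = f (mon n)" for n
  have x: "x 0 = 1" "\<And>m n. x (m + n) = x m * x n"
    using fs(3,5) by (simp_all add: x_def flip: mon_mult)
  have fx: "f g = mlift (\<lambda>a. a) x g" for g
  proof (rule hom_type_ext_mon[OF hf hom_type_mlift[OF hom_type_id x]])
    show "f (cst a) = mlift (\<lambda>a. a) x (cst a)" for a using fs(1) x(1) by (simp add: mlift_single)
    show "f (mon n) = mlift (\<lambda>a. a) x (mon n)" for n by (simp add: mlift_single x_def)
  qed
  have "ideal_set {g. f g = 0}" "1 \<notin> {g. f g = 0}"
    using prime_set_kernel[OF hf] by (auto simp: prime_set_def)
  moreover have "P \<subseteq> {g. f g = 0}" using fs(6) by auto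
  ultimately have "{g. f g = 0} = P" using max by blast
  then show thesis using that[OF x] fx by auto
qed

section \<open>Point derivations and the local structure at a character\<close>

text \<open>After the elements of \<open>F\<close> are inverted, the monoid is generated by
  \<open>F\<close> and \<open>S\<close>; the element \<open>f\<close> on the left stands for a
  subtraction.\<close>

definition gen_mod :: "'n::comm_monoid_add set \<Rightarrow> 'n set \<Rightarrow> bool"
  where "gen_mod F S \<longleftrightarrow> (\<forall>n. \<exists>f\<in>F. \<exists>f'\<in>F. \<exists>c. n + f = f' + (\<Sum>t\<in>S. nmul (c t) t))"

lemma nmul_sum: "nmul k (\<Sum>t\<in>S. h t) = (\<Sum>t\<in>S. nmul k (h t))"
  by (induction S rule: infinite_finite_induct) (simp_all add: nmul_distrib)

lemma gen_mod_remove: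
  fixes F :: "'n::comm_monoid_add set"
  assumes F: "submon F" and S: "finite S" "s \<in> S" and gen: "gen_mod F S"
    and red: "g \<in> F" "g' \<in> F" "s + g = g' + (\<Sum>t\<in>S - {s}. nmul (d t) t)"
  shows "gen_mod F (S - {s})"
  unfolding gen_mod_def
proof
  fix n
  note cl = submon_closed[OF F]
  obtain f f' c where f: "f \<in> F" "f' \<in> F" "n + f = f' + (\<Sum>t\<in>S. nmul (c t) t)"
    using gen unfolding gen_mod_def by meson
  let ?k = "c s"
  have "n + (f + nmul ?k g) = f' + (nmul ?k s + (\<Sum>t\<in>S - {s}. nmul (c t) t)) + nmul ?k g"
    using f(3) sum.remove[OF S, of "\<lambda>t. nmul (c t) t"] by (simp add: add.assoc[symmetric])
  also have "\<dots> = f' + nmul ?k (s + g) + (\<Sum>t\<in>S - {s}. nmul (c t) t)"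
    by (simp add: nmul_distrib ac_simps)
  also have "\<dots> = (f' + nmul ?k g') + (\<Sum>t\<in>S - {s}. nmul (?k * d t + c t) t)"
    unfolding red(3) by (simp add: nmul_distrib nmul_sum nmul_add nmul_mult sum.distrib ac_simps)
  finally have "n + (f + nmul ?k g) = (f' + nmul ?k g') + (\<Sum>t\<in>S - {s}. nmul (?k * d t + c t) t)" .
  moreover have "f + nmul ?k g \<in> F" "f' + nmul ?k g' \<in> F" by (intro cl f red)+
  ultimately show "\<exists>f\<in>F. \<exists>f'\<in>F. \<exists>c. n + f = f' + (\<Sum>t\<in>S - {s}. nmul (c t) t)"
    by (intro bexI[of _ "f + nmul ?k g"] bexI[of _ "f' + nmul ?k g'"] exI[of _ "\<lambda>t. ?k * d t + c t"])
qed

text \<open>The Leibniz rule at the point \<open>x\<close>, stated on monomials: the linear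
  extension of \<open>D\<close> is a tangent vector at \<open>x\<close>.\<close>

definition point_derivation :: "('n::comm_monoid_add \<Rightarrow> 'k::comm_ring_1) \<Rightarrow> ('n \<Rightarrow> 'k) \<Rightarrow> bool"
  where "point_derivation x D \<longleftrightarrow> (\<forall>m n. D (m + n) = x m * D n + D m * x n)"

lemma point_derivation_mult:
  fixes f g :: "'n::comm_monoid_add \<Rightarrow>\<^sub>0 'k::comm_ring_1"
  assumes "point_derivation x D" "\<And>m n. x (m + n) = x m * x n"
  shows "mlift (\<lambda>a. a) D (f * g) = mlift (\<lambda>a. a) x f * mlift (\<lambda>a. a) D g + mlift (\<lambda>a. a) D f * mlift (\<lambda>a. a) x g"
proof -
  note add = mlift_add[OF hom_type_id]
  have s: "mlift (\<lambda>a. a) D (Poly_Mapping.single n a * g) =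
      a * x n * mlift (\<lambda>a. a) D g + a * D n * mlift (\<lambda>a. a) x g" for n a g
  proof (induction g rule: pm_induct)
    case (add f g)
    then show ?case by (simp add: distrib_left mlift_add[OF hom_type_id] algebra_simps)
  next
    case (single k b)
    have "D (n + k) = x n * D k + D n * x k" using assms(1) by (simp add: point_derivation_def)
    then show ?case by (simp add: mlift_single mult_single algebra_simps)
  qed
  show ?thesis
  proof (induction f rule: pm_induct)
    case (add f g)
    then show ?case by (simp add: distrib_right mlift_add[OF hom_type_id] algebra_simps)
  next
    case (single k b)
    show ?case by (simp add: s mlift_single)
  qed
qed

lemma mlift_sum_fun:
  fixes f :: "'n \<Rightarrow>\<^sub>0 'k::comm_ring_1"
  shows "mlift (\<lambda>a. a) (\<lambda>n. \<Sum>i\<in>I. c i * D i n) f = (\<Sum>i\<in>I. c i * mlift (\<lambda>a. a) (D i) f)"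
  unfolding mlift_def sum_distrib_left by (subst sum.swap) (simp add: mult_ac)

text \<open>On the face \<open>F\<close> the character is nonzero, and \<open>S\<close> represents
  the generators of the monoid that remain after \<open>F\<close> is inverted. Minimality of
  \<open>S\<close> enters through \<open>irredundant\<close>: it makes each element of
  \<open>S\<close> an atom modulo \<open>F\<close>, and so provides one tangent vector per
  element.\<close>

locale character_face =
  fixes x :: "'n::cancel_comm_monoid_add \<Rightarrow> 'k::field" and F :: "'n set"
    and s :: nat and \<mu> :: "nat \<Rightarrow> 'n \<Rightarrow> int" and p q :: "nat \<Rightarrow> 'n" and S :: "'n set"
  assumes x_zero: "x 0 = 1" and x_add: "x (m + n) = x m * x n"
    and F_def: "F = {n. x n \<noteq> 0}"
    and coords: "monoid_coords F s \<mu> p q"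
    and S: "finite S" "S \<inter> F = {}" "gen_mod F S"
    and irredundant: "t \<in> S \<Longrightarrow> g \<in> F \<Longrightarrow> g' \<in> F \<Longrightarrow> t + g \<noteq> g' + (\<Sum>u\<in>S - {t}. nmul (d u) u)"
begin

lemma face: "m + n \<in> F \<longleftrightarrow> m \<in> F \<and> n \<in> F"
  by (simp add: F_def x_add)

lemma submon_F: "submon F"
  by (simp add: submon_def F_def x_zero x_add)

lemmas F_closed = submon_closed[OF submon_F]

lemma sum_in_face:
  assumes "(\<Sum>t\<in>S. nmul (d t) t) \<in> F" "t \<in> S"
  shows "d t = 0"
proof (rule ccontr)
  assume "d t \<noteq> 0"
  then obtain k where "d t = Suc k" by (cases "d t") auto
  then have "(\<Sum>t\<in>S. nmul (d t) t) = t + (nmul k t + (\<Sum>t\<in>S - {t}. nmul (d t) t))"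
    using sum.remove[OF S(1) assms(2), of "\<lambda>t. nmul (d t) t"] by (simp add: add.assoc)
  then have "t \<in> F" using assms(1) face by metis
  then show False using assms(2) S(2) by blast
qed

text \<open>Both summands are expanded in the generators. By \<open>irredundant\<close> the
  generator \<open>t\<close> occurs in the total. After it is cancelled the rest lies in the face,
  so no other generator occurs, and the single \<open>t\<close> belongs to one of the summands; the
  other one lies in the face.\<close>

lemma irreducible:
  assumes t: "t \<in> S" and f: "f \<in> F" "f' \<in> F" "m + m' + f = t + f'"
  shows "m \<in> F \<or> m' \<in> F"
proof -
  obtain f1 f1' c where c: "f1 \<in> F" "f1' \<in> F" "m + f1 = f1' + (\<Sum>t\<in>S. nmul (c t) t)"
    using S(3) unfolding gen_mod_def by meson
  obtain f2 f2' c' where c': "f2 \<in> F" "f2' \<in> F" "m' + f2 = f2' + (\<Sum>t\<in>S. nmul (c' t) t)"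
    using S(3) unfolding gen_mod_def by meson
  define d where "d u = c u + c' u" for u
  have "t + (f' + f1 + f2) = (m + f1) + (m' + f2) + f"
    using f(3) by (metis (no_types, lifting) add.assoc add.commute)
  also have "\<dots> = (f1' + f2' + f) + (\<Sum>t\<in>S. nmul (d t) t)"
    unfolding c(3) c'(3) by (simp add: d_def nmul_add sum.distrib ac_simps)
  finally have eq: "t + (f' + f1 + f2) = (f1' + f2' + f) + (\<Sum>t\<in>S. nmul (d t) t)" .
  have mem: "f' + f1 + f2 \<in> F" "f1' + f2' + f \<in> F" by (intro F_closed f c c')+
  have split: "(\<Sum>t\<in>S. nmul (d t) t) = nmul (d t) t + (\<Sum>u\<in>S - {t}. nmul (d u) u)"
    using sum.remove[OF S(1) t] .
  show ?thesis
  proof (cases "d t")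
    case 0
    then show ?thesis using eq irredundant[OF t mem, of d] split by simp
  next
    case (Suc k)
    define d' where "d' u = (if u = t then k else d u)" for u
    have "(\<Sum>t\<in>S. nmul (d' t) t) = nmul (d' t) t + (\<Sum>u\<in>S - {t}. nmul (d' u) u)"
      using sum.remove[OF S(1) t] .
    also have "(\<Sum>u\<in>S - {t}. nmul (d' u) u) = (\<Sum>u\<in>S - {t}. nmul (d u) u)"
      by (rule sum.cong) (auto simp: d'_def)
    finally have "(\<Sum>t\<in>S. nmul (d t) t) = t + (\<Sum>t\<in>S. nmul (d' t) t)"
      unfolding split using Suc by (simp add: d'_def add.assoc)
    then have "t + (f' + f1 + f2) = t + ((f1' + f2' + f) + (\<Sum>t\<in>S. nmul (d' t) t))"
      using eq by (simp add: ac_simps)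
    then have "(f1' + f2' + f) + (\<Sum>t\<in>S. nmul (d' t) t) \<in> F" using mem(1) by simp
    then have "(\<Sum>t\<in>S. nmul (d' t) t) \<in> F" using face by blast
    then have d'0: "\<And>u. u \<in> S \<Longrightarrow> d' u = 0" using sum_in_face by blast
    have dt: "d t = 1" using d'0[OF t] Suc by (simp add: d'_def)
    have du: "d u = 0" if "u \<in> S" "u \<noteq> t" for u using d'0[OF that(1)] that(2) by (simp add: d'_def)
    have "c t = 0 \<or> c' t = 0" using dt by (cases "c t") (auto simp: d_def)
    then show ?thesis
    proof
      assume "c t = 0"
      then have "c u = 0" if "u \<in> S" for u using du[OF that] by (cases "u = t") (auto simp: d_def)
      then have "m + f1 = f1'" using c(3) by simp
      then show ?thesis using c(2) face by blast
    next
      assume "c' t = 0"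
      then have "c' u = 0" if "u \<in> S" for u using du[OF that] by (cases "u = t") (auto simp: d_def)
      then have "m' + f2 = f2'" using c'(3) by simp
      then show ?thesis using c'(2) face by blast
    qed
  qed
qed

lemma distinct_mod_face:
  assumes t: "t \<in> S" "u \<in> S" "t \<noteq> u" and f: "f \<in> F" "f' \<in> F"
  shows "t + f \<noteq> u + f'"
proof
  assume eq: "t + f = u + f'"
  have "(\<Sum>v\<in>S - {t}. nmul (if v = u then 1 else 0) v) = (\<Sum>v\<in>S - {t}. if v = u then u else 0)"
    by (rule sum.cong) auto
  also have "\<dots> = u" using t S(1) by simp
  finally show False using irredundant[OF t(1) f, of "\<lambda>v. if v = u then 1 else 0"] eq
    by (simp add: add.commute)
qed

text \<open>The logarithmic derivation \<open>y_i d/dy_i\<close> of the torus of the face, evaluated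
  at \<open>x\<close>; outside the face it vanishes together with \<open>x\<close>.\<close>

definition face_derivation :: "nat \<Rightarrow> 'n \<Rightarrow> 'k"
  where "face_derivation i m = x m * of_int (\<mu> i m)"

lemma point_derivation_face:
  assumes "i < s" shows "point_derivation x (face_derivation i)"
  unfolding point_derivation_def face_derivation_def
proof (intro allI)
  fix m n
  have "\<mu> i (m + n) = \<mu> i m + \<mu> i n" if "m \<in> F" "n \<in> F"
    using coords assms that by (auto simp: monoid_coords_def intro: additive_onD)
  then show "x (m + n) * of_int (\<mu> i (m + n)) = x m * (x n * of_int (\<mu> i n)) + x m * of_int (\<mu> i m) * x n"
    by (cases "m \<in> F \<and> n \<in> F") (auto simp: F_def x_add algebra_simps)
qed

definition congr :: "'n \<Rightarrow> 'n \<Rightarrow> bool"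
  where "congr t m \<longleftrightarrow> (\<exists>f\<in>F. \<exists>f'\<in>F. m + f = t + f')"

text \<open>The partial derivative in the direction of the generator \<open>t\<close>, evaluated at
  \<open>x\<close>. A monomial \<open>m = t + f' - f\<close> with \<open>f\<close> and
  \<open>f'\<close> in the face has the derivative \<open>x f' / x f\<close>, whatever the choice of
  \<open>f\<close> and \<open>f'\<close>.\<close>

definition gen_derivation :: "'n \<Rightarrow> 'n \<Rightarrow> 'k"
  where "gen_derivation t m = (if congr t m then
    (SOME v. \<exists>f\<in>F. \<exists>f'\<in>F. m + f = t + f' \<and> v = x f' / x f) else 0)"

lemma gen_derivation_eq:
  assumes f: "f \<in> F" "f' \<in> F" "m + f = t + f'"
  shows "gen_derivation t m = x f' / x f"
proof -
  have c: "congr t m" using f by (auto simp: congr_def)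
  have "\<exists>f\<in>F. \<exists>f'\<in>F. m + f = t + f' \<and> gen_derivation t m = x f' / x f"
    unfolding gen_derivation_def using c by simp (rule someI_ex, use f in blast)
  then obtain g g' where g: "g \<in> F" "g' \<in> F" "m + g = t + g'" "gen_derivation t m = x g' / x g" by blast
  have "(m + t) + (f + g') = (m + t) + (f' + g)"
    using f(3) g(3) by (metis (no_types, lifting) add.assoc add.commute)
  then have "x f * x g' = x f' * x g" using x_add by (metis add_left_imp_eq)
  moreover have "x f \<noteq> 0" "x g \<noteq> 0" using f g by (simp_all add: F_def)
  ultimately show ?thesis unfolding g(4) by (simp add: frac_eq_eq mult.commute)
qed

lemma congr_face: "t \<in> S \<Longrightarrow> congr t m \<Longrightarrow> m \<notin> F"
  using S(2) F_closed(2) face unfolding congr_def by (metis IntI empty_iff)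

lemma congr_add: "m \<in> F \<Longrightarrow> congr t (m + n) \<longleftrightarrow> congr t n"
proof
  assume m: "m \<in> F"
  show "congr t n" if "congr t (m + n)"
  proof -
    obtain f f' where f: "f \<in> F" "f' \<in> F" "m + n + f = t + f'"
      using \<open>congr t (m + n)\<close> by (auto simp: congr_def)
    then have "n + (m + f) = t + f'" by (simp add: ac_simps)
    then show ?thesis using f F_closed(2)[OF m f(1)] unfolding congr_def by blast
  qed
  show "congr t (m + n)" if "congr t n"
  proof -
    obtain f f' where f: "f \<in> F" "f' \<in> F" "n + f = t + f'"
      using \<open>congr t n\<close> by (auto simp: congr_def)
    then have "m + n + f = t + (m + f')" by (metis (no_types, lifting) add.assoc add.commute)
    then show ?thesis using f F_closed(2)[OF m f(2)] unfolding congr_def by blast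
  qed
qed

lemma gen_derivation_add:
  assumes "m \<in> F" shows "gen_derivation t (m + n) = x m * gen_derivation t n"
proof (cases "congr t n")
  case True
  then obtain f f' where f: "f \<in> F" "f' \<in> F" "n + f = t + f'" by (auto simp: congr_def)
  then have "m + n + f = t + (m + f')" by (metis (no_types, lifting) add.assoc add.commute)
  then have "gen_derivation t (m + n) = x (m + f') / x f"
    using gen_derivation_eq f F_closed(2)[OF assms f(2)] by blast
  then show ?thesis using gen_derivation_eq[OF f] by (simp add: x_add)
next
  case False
  then show ?thesis using congr_add[OF assms, of t n] by (simp add: gen_derivation_def)
qed

text \<open>The delicate case is that \<open>m\<close> and \<open>n\<close> both lie outside the
  face. The right side is then 0, and irreducibility of \<open>t\<close> modulo the face makes the
  left side 0 as well.\<close>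

lemma point_derivation_gen:
  assumes t: "t \<in> S" shows "point_derivation x (gen_derivation t)"
  unfolding point_derivation_def
proof (intro allI)
  fix m n
  have z: "gen_derivation t m = 0" if "m \<in> F" for m
    using congr_face[OF t, of m] that by (auto simp: gen_derivation_def)
  consider "m \<in> F" "n \<in> F" | "m \<in> F" "n \<notin> F" | "m \<notin> F" "n \<in> F" | "m \<notin> F" "n \<notin> F" by blast
  then show "gen_derivation t (m + n) = x m * gen_derivation t n + gen_derivation t m * x n"
  proof cases
    case 1 then show ?thesis using gen_derivation_add[of m t n] z by simp
  next
    case 2 then show ?thesis using gen_derivation_add[of m t n] z by simp
  next
    case 3 then show ?thesis using gen_derivation_add[of n t m] z by (simp add: ac_simps)
  next
    case 4
    have "\<not> congr t (m + n)" using irreducible[OF t] 4 by (auto simp: congr_def)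
    moreover have "x m = 0" "x n = 0" using 4 by (simp_all add: F_def)
    ultimately show ?thesis by (simp add: gen_derivation_def)
  qed
qed

lemma gen_derivation_gen:
  assumes "t \<in> S" "u \<in> S" shows "gen_derivation t u = (if t = u then 1 else 0)"
proof (cases "t = u")
  case True
  have "gen_derivation u u = x 0 / x 0" by (rule gen_derivation_eq) (use F_closed in auto)
  then show ?thesis using True x_zero by simp
next
  case False
  then have "\<not> congr t u" using distinct_mod_face[OF assms(2,1)] by (auto simp: congr_def)
  then show ?thesis using False by (simp add: gen_derivation_def)
qed

text \<open>
  The derivations attached to the coordinates of the face and to the generators outside it are
  linearly independent, so the maximal ideal of the local ring needs at least as many generators.
\<close>

lemma cotangent_bound:
  assumes G: "finite G" "G \<subseteq> {f. mlift (\<lambda>a. a) x f = 0}"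
    and gen: "\<And>K h. ideal_set K \<Longrightarrow> G \<subseteq> K \<Longrightarrow> mlift (\<lambda>a. a) x h = 0 \<Longrightarrow>
      \<exists>w. mlift (\<lambda>a. a) x w \<noteq> 0 \<and> w * h \<in> K"
  shows "s + card S \<le> card G"
proof (rule ccontr)
  let ?X = "mlift (\<lambda>a. a) x"
  assume "\<not> s + card S \<le> card G"
  let ?I = "Sum_Type.Plus {..<s} S"
  define DD where "DD i = (case i of Inl j \<Rightarrow> face_derivation j | Inr t \<Rightarrow> gen_derivation t)" for i
  have cI: "card G < card ?I" using \<open>\<not> s + card S \<le> card G\<close> S(1) by (simp add: card_Plus)
  have fI: "finite ?I" using S(1) by simp
  \<comment> \<open>There are more tangent vectors than elements of \<open>G\<close>, so some
    nontrivial combination \<open>D\<close> of them vanishes on \<open>G\<close>.\<close>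
  from homogeneous_system_nontrivial_solution[OF G(1) fI cI, of "\<lambda>i g. mlift (\<lambda>a. a) (DD i) g"]
  obtain c where c: "\<exists>i\<in>?I. c i \<noteq> 0" "\<forall>g\<in>G. (\<Sum>i\<in>?I. c i * mlift (\<lambda>a. a) (DD i) g) = 0"
    by (elim exE conjE)
  define D where "D m = (\<Sum>i\<in>?I. c i * DD i m)" for m
  have pd: "point_derivation x (DD i)" if "i \<in> ?I" for i
    using that point_derivation_face point_derivation_gen by (auto simp: DD_def)
  have D: "point_derivation x D"
    unfolding point_derivation_def D_def
  proof (intro allI)
    fix m n
    have "(\<Sum>i\<in>?I. c i * DD i (m + n)) = (\<Sum>i\<in>?I. x m * (c i * DD i n) + c i * DD i m * x n)"
      by (rule sum.cong) (use pd in \<open>auto simp: point_derivation_def algebra_simps\<close>)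
    then show "(\<Sum>i\<in>?I. c i * DD i (m + n)) = x m * (\<Sum>i\<in>?I. c i * DD i n) + (\<Sum>i\<in>?I. c i * DD i m) * x n"
      by (simp add: sum.distrib sum_distrib_left sum_distrib_right)
  qed
  let ?D = "mlift (\<lambda>a. a) D"
  have DG: "?D g = 0" if "g \<in> G" for g
    using c(2) that unfolding D_def mlift_sum_fun by blast
  note hX = hom_type_mlift[OF hom_type_id, of x, OF x_zero x_add]
  note Xs = hom_type_simps[OF hX]
  \<comment> \<open>The functions for which both the value at \<open>x\<close> and the value of
    \<open>D\<close> vanish form an ideal containing \<open>G\<close>. As \<open>G\<close> generates
    the maximal ideal locally, \<open>D\<close> vanishes on all of the maximal ideal, in particular
    on \<open>mon n - x n\<close>, and is therefore zero.\<close>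
  have K: "ideal_set {f. ?X f = 0 \<and> ?D f = 0}"
    unfolding ideal_set_def
    by (auto simp: Xs mlift_zero mlift_add[OF hom_type_id] point_derivation_mult[OF D x_add])
  have DP: "?D h = 0" if h: "?X h = 0" for h
  proof -
    obtain w where w: "?X w \<noteq> 0" "?D (w * h) = 0" using gen[OF K _ h] G(2) DG by blast
    then show ?thesis using point_derivation_mult[OF D x_add, of w h] h by simp
  qed
  have "D (0 + 0) = x 0 * D 0 + D 0 * x 0" using D unfolding point_derivation_def by blast
  then have "D 0 + 0 = D 0 + D 0" by (simp add: x_zero del: mult_2_right)
  then have D0: "D 0 = 0" by (metis add_left_imp_eq)
  have Dz: "D n = 0" for n
  proof -
    let ?h = "mon n + cst (- x n)"
    have "?X ?h = 0" by (simp add: mlift_add[OF hom_type_id] mlift_single x_zero)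
    then have "?D ?h = 0" by (rule DP)
    then show ?thesis using D0 by (simp add: mlift_add[OF hom_type_id] mlift_single)
  qed
  have Deq: "D n = (\<Sum>j<s. c (Inl j) * face_derivation j n) + (\<Sum>t\<in>S. c (Inr t) * gen_derivation t n)" for n
    unfolding D_def using S(1) by (simp add: sum.Plus DD_def)
  have cS: "c (Inr t) = 0" if t: "t \<in> S" for t
  proof -
    have "x t = 0" using t S(2) by (auto simp: F_def)
    then have "D t = (\<Sum>u\<in>S. c (Inr u) * (if u = t then 1 else 0))"
      unfolding Deq face_derivation_def using gen_derivation_gen t by simp
    also have "\<dots> = (\<Sum>u\<in>S. if u = t then c (Inr u) else 0)" by (rule sum.cong) auto
    also have "\<dots> = c (Inr t)" using t S(1) by simp
    finally show ?thesis using Dz by simp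
  qed
  have cF: "(\<Sum>j<s. c (Inl j) * of_int (\<mu> j n)) = 0" if n: "n \<in> F" for n
  proof -
    have "x n * (\<Sum>j<s. c (Inl j) * of_int (\<mu> j n)) = D n"
      unfolding Deq face_derivation_def using cS by (simp add: sum_distrib_left mult_ac)
    then show ?thesis using Dz n by (simp add: F_def)
  qed
  \<comment> \<open>The dual pairs have coordinate differences 0 and 1, so the coefficient with
    index \<open>i\<close> is isolated in every characteristic.\<close>
  have "c (Inl i) = 0" if i: "i < s" for i
  proof -
    have pq: "p i \<in> F" "q i \<in> F" "\<And>j. j < s \<Longrightarrow> \<mu> j (p i) = \<mu> j (q i) + (if j = i then 1 else 0)"
      using coords i by (auto simp: monoid_coords_def)
    have "(\<Sum>j<s. c (Inl j) * of_int (\<mu> j (p i))) - (\<Sum>j<s. c (Inl j) * of_int (\<mu> j (q i)))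
      = (\<Sum>j<s. if j = i then c (Inl j) else 0)"
      unfolding sum_subtractf[symmetric]
      by (rule sum.cong) (use pq(3) in \<open>auto simp: algebra_simps\<close>)
    also have "\<dots> = c (Inl i)" using i by simp
    finally show ?thesis using cF[OF pq(1)] cF[OF pq(2)] by simp
  qed
  then show False using c(1) cS by auto
qed

text \<open>In the group completion \<open>g\<close> differs by torsion from the combination of the
  basis vectors \<open>p j - q j\<close> with coefficients \<open>\<mu> j g\<close>. Since the
  monoid lacks negatives, the terms to be added and to be subtracted are collected in
  \<open>P\<close> and \<open>Q\<close>. Additive functions with values in \<open>int\<close> do not
  see the torsion.\<close>

lemma face_coordinate_expansion:
  assumes Lam: "additive_on UNIV (Lam :: 'n \<Rightarrow> int)" and g: "g \<in> F"
  shows "Lam g = (\<Sum>j<s. \<mu> j g * (Lam (p j) - Lam (q j)))"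
proof -
  define P where "P j = nmul (nat (\<mu> j g)) (p j) + nmul (nat (- \<mu> j g)) (q j)" for j
  define Q where "Q j = nmul (nat (\<mu> j g)) (q j) + nmul (nat (- \<mu> j g)) (p j)" for j
  have pq: "p j \<in> F" "q j \<in> F" if "j < s" for j using coords that by (auto simp: monoid_coords_def)
  have PQ: "P j \<in> F" "Q j \<in> F" if "j < s" for j
    unfolding P_def Q_def by (intro F_closed pq that)+
  have UV: "sum P {..<s} \<in> F" "sum Q {..<s} \<in> F" by (intro F_closed(4) PQ; simp)+
  have dif: "L (P j) - L (Q j) = \<mu> j g * (L (p j) - L (q j))"
    if L: "additive_on F L" and j: "j < s" for L :: "'n \<Rightarrow> int" and j
  proof -
    note n = additive_on_nmul[OF submon_F L] additive_onD[OF L]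
    have "L (P j) = int (nat (\<mu> j g)) * L (p j) + int (nat (- \<mu> j g)) * L (q j)"
      "L (Q j) = int (nat (\<mu> j g)) * L (q j) + int (nat (- \<mu> j g)) * L (p j)"
      unfolding P_def Q_def using pq[OF j] F_closed(3) by (simp_all add: n)
    then show ?thesis by (cases "\<mu> j g \<ge> 0") (simp_all add: algebra_simps)
  qed
  have sums: "L (sum P {..<s}) - L (sum Q {..<s}) = (\<Sum>j<s. \<mu> j g * (L (p j) - L (q j)))"
    if L: "additive_on F L" for L :: "'n \<Rightarrow> int"
    using additive_on_submon(2)[OF submon_F L, of "{..<s}"] PQ dif[OF L] by (simp flip: sum_subtractf)
  have lam: "additive_on F (\<mu> i)" if "i < s" for i using coords that by (auto simp: monoid_coords_def)
  have LF: "additive_on F Lam" using Lam by (auto simp: additive_on_def)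
  have "torsion_eq (g + sum Q {..<s}) (sum P {..<s})"
  proof -
    have "\<mu> i (g + sum Q {..<s}) = \<mu> i (sum P {..<s})" if i: "i < s" for i
    proof -
      have "\<mu> i (sum P {..<s}) - \<mu> i (sum Q {..<s}) = (\<Sum>j<s. if j = i then \<mu> j g else 0)"
        unfolding sums[OF lam[OF i]]
        by (rule sum.cong) (use coords i in \<open>auto simp: monoid_coords_def\<close>)
      also have "\<dots> = \<mu> i g" using i by simp
      finally show ?thesis using additive_onD[OF lam[OF i] g UV(2)] by simp
    qed
    moreover have "g + sum Q {..<s} \<in> F" using F_closed(2) g UV by blast
    ultimately show ?thesis using coords UV(1) by (auto simp: monoid_coords_def)
  qed
  then have "Lam (g + sum Q {..<s}) = Lam (sum P {..<s})"
    using additive_on_torsion_eq[OF submon_F LF] F_closed(2)[OF g UV(2)] UV by blast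
  then show ?thesis using sums[OF LF] additive_onD[OF LF g UV(2)] by simp
qed

text \<open>The face contributes the \<open>s\<close> vectors \<open>p i - q i\<close> and the
  generators contribute \<open>card S\<close> further ones; together they span Z^r. A spanning
  family has at least r members, so the bound \<open>s + card S \<le> r\<close> supplied by
  regularity makes it a basis, and the multiplicities of the generators are unique.\<close>

lemma local_decomposition:
  fixes Lam :: "nat \<Rightarrow> 'n \<Rightarrow> int"
  assumes r: "monoid_coords UNIV r Lam A B" "s + card S \<le> r"
  shows "r = s + card S"
    "f \<in> F \<Longrightarrow> f' \<in> F \<Longrightarrow> f + (\<Sum>t\<in>S. nmul (c t) t) = f' + (\<Sum>t\<in>S. nmul (c' t) t) \<Longrightarrow>
      t \<in> S \<Longrightarrow> c t = c' t"
proof -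
  let ?J = "Sum_Type.Plus {..<s} S"
  define v where "v j l = (case j of Inl i \<Rightarrow> Lam l (p i) - Lam l (q i) | Inr t \<Rightarrow> Lam l t)" for j l
  have Lam: "additive_on UNIV (Lam l)" if "l < r" for l using r(1) that by (auto simp: monoid_coords_def)
  have U: "submon (UNIV :: 'n set)" by (simp add: submon_def)
  have LS: "Lam l (\<Sum>t\<in>S. nmul (c t) t) = (\<Sum>t\<in>S. int (c t) * v (Inr t) l)" if "l < r" for l c
    using additive_on_submon(2)[OF U Lam[OF that], of S "\<lambda>t. nmul (c t) t"]
      additive_on_nmul[OF U Lam[OF that]] by (simp add: v_def)
  have LF: "Lam l f = (\<Sum>j<s. \<mu> j f * v (Inl j) l)" if "l < r" "f \<in> F" for l f
    using face_coordinate_expansion[OF Lam[OF that(1)] that(2)] by (simp add: v_def)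
  have "\<exists>w. \<forall>l<r. (\<Sum>j\<in>?J. w j * v j l) = Lam l n" for n
  proof -
    obtain f f' c where f: "f \<in> F" "f' \<in> F" "n + f = f' + (\<Sum>t\<in>S. nmul (c t) t)"
      using S(3) unfolding gen_mod_def by meson
    define w where "w j = (case j of Inl i \<Rightarrow> \<mu> i f' - \<mu> i f | Inr t \<Rightarrow> int (c t))" for j
    have "(\<Sum>j\<in>?J. w j * v j l) = Lam l n" if l: "l < r" for l
    proof -
      have "Lam l n + Lam l f = Lam l f' + (\<Sum>t\<in>S. int (c t) * v (Inr t) l)"
        using additive_onD[OF Lam[OF l]] f(3) LS[OF l, of c] by (metis UNIV_I)
      then have "Lam l n = Lam l f' - Lam l f + (\<Sum>t\<in>S. int (c t) * v (Inr t) l)" by simp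
      also have "\<dots> = (\<Sum>j\<in>?J. w j * v j l)"
        unfolding LF[OF l f(1)] LF[OF l f(2)] using S(1)
        by (simp add: sum.Plus w_def left_diff_distrib sum_subtractf)
      finally show ?thesis ..
    qed
    then show ?thesis by blast
  qed
  then obtain W where W: "\<And>n l. l < r \<Longrightarrow> (\<Sum>j\<in>?J. W n j * v j l) = Lam l n" by metis
  have fJ: "finite ?J" using S(1) by simp
  have span: "(\<Sum>j\<in>?J. (W (A i) j - W (B i) j) * v j l) = (if i = l then 1 else 0)"
    if "i < r" "l < r" for i l
    using W[OF that(2), of "A i"] W[OF that(2), of "B i"] r(1) that
    by (auto simp: left_diff_distrib sum_subtractf monoid_coords_def)
  have "r \<le> card ?J" by (rule integral_spanning_family_card[OF fJ span])
  then show rs: "r = s + card S" using r(2) S(1) by (simp add: card_Plus)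
  assume f: "f \<in> F" "f' \<in> F" "f + (\<Sum>t\<in>S. nmul (c t) t) = f' + (\<Sum>t\<in>S. nmul (c' t) t)" and t: "t \<in> S"
  define d where "d j = (case j of Inl i \<Rightarrow> \<mu> i f - \<mu> i f' | Inr t \<Rightarrow> int (c t) - int (c' t))" for j
  have d0: "(\<Sum>j\<in>?J. d j * v j l) = 0" if l: "l < r" for l
  proof -
    have "Lam l f + (\<Sum>t\<in>S. int (c t) * v (Inr t) l) = Lam l f' + (\<Sum>t\<in>S. int (c' t) * v (Inr t) l)"
      using additive_onD[OF Lam[OF l]] f(3) LS[OF l, of c] LS[OF l, of c'] by (metis UNIV_I)
    then show ?thesis
      unfolding LF[OF l f(1)] LF[OF l f(2)] using S(1)
      by (simp add: sum.Plus d_def left_diff_distrib sum_subtractf)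
  qed
  have "card ?J \<le> r" using r(2) S(1) by (simp add: card_Plus)
  then have "d (Inr t) = 0"
    using integral_spanning_family_independent[OF fJ span _ d0, where j = "Inr t"] t by blast
  then show "c t = c' t" by (simp add: d_def)
qed

text \<open>After the face is inverted the monoid is the group of the face times the free monoid on
  \<open>S\<close>. The first \<open>s\<close> coordinates come from the group; the others are the
  multiplicities of the generators and hence nonnegative. The character \<phi> agrees with
  \<open>x\<close> on the face and is 1 on \<open>S\<close>.\<close>

lemma split_coordinates:
  fixes Lam :: "nat \<Rightarrow> 'n \<Rightarrow> int"
  assumes r: "monoid_coords UNIV r Lam A B" "s + card S \<le> r"
  shows "\<exists>\<kappa> a b \<phi>. monoid_coords UNIV r \<kappa> a b \<and> s \<le> r \<and>
    (\<forall>i\<in>{s..<r}. b i = 0 \<and> (\<forall>n. \<kappa> i n \<ge> 0)) \<and>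
    (\<forall>i<s. \<forall>j\<in>{s..<r}. \<kappa> j (a i) = 0 \<and> \<kappa> j (b i) = 0) \<and>
    \<phi> 0 = 1 \<and> (\<forall>m n. \<phi> (m + n) = \<phi> m * \<phi> n) \<and> (\<forall>n. \<phi> n \<noteq> 0) \<and>
    (\<forall>n. x n = (if \<forall>i\<in>{s..<r}. \<kappa> i n = 0 then \<phi> n else 0))"
proof -
  note rs = local_decomposition(1)[OF r] and indep = local_decomposition(2)[OF r]
  have "\<exists>z. fst z \<in> F \<and> fst (snd z) \<in> F \<and> n + fst z = fst (snd z) + (\<Sum>t\<in>S. nmul (snd (snd z) t) t)" for n
  proof -
    obtain f f' c where f: "f \<in> F" "f' \<in> F" "n + f = f' + (\<Sum>t\<in>S. nmul (c t) t)"
      using S(3) unfolding gen_mod_def by meson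
    then show ?thesis by (intro exI[of _ "(f, f', c)"]) simp
  qed
  then have "\<forall>n. \<exists>z. fst z \<in> F \<and> fst (snd z) \<in> F \<and>
    n + fst z = fst (snd z) + (\<Sum>t\<in>S. nmul (snd (snd z) t) t)" by blast
  from choice[OF this] obtain Z where Z: "\<And>n. fst (Z n) \<in> F \<and> fst (snd (Z n)) \<in> F \<and>
    n + fst (Z n) = fst (snd (Z n)) + (\<Sum>t\<in>S. nmul (snd (snd (Z n)) t) t)" by blast
  define ff where "ff n = fst (Z n)" for n
  define gg where "gg n = fst (snd (Z n))" for n
  define cc where "cc n = snd (snd (Z n))" for n
  have rep: "ff n \<in> F" "gg n \<in> F" "n + ff n = gg n + (\<Sum>t\<in>S. nmul (cc n t) t)" for n
    using Z[of n] by (auto simp: ff_def gg_def cc_def)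
  have mu: "additive_on F (\<mu> i)" if "i < s" for i using coords that by (auto simp: monoid_coords_def)
  define \<phi> where "\<phi> n = x (gg n) / x (ff n)" for n
  have nz: "x f \<noteq> 0" if "f \<in> F" for f using that by (simp add: F_def)
  \<comment> \<open>Every way of writing \<open>n\<close> modulo the face determines the same
    multiplicities, coordinates and value of \<phi>, so the choices behind \<open>ff\<close>,
    \<open>gg\<close> and \<open>cc\<close> are immaterial.\<close>
  have calc: "(\<forall>t\<in>S. cc n t = c t) \<and> (\<forall>i<s. \<mu> i (gg n) - \<mu> i (ff n) = \<mu> i f' - \<mu> i f) \<and> \<phi> n = x f' / x f"
    if f: "f \<in> F" "f' \<in> F" "n + f = f' + (\<Sum>t\<in>S. nmul (c t) t)" for n f f' c
  proof -
    have "(gg n + f) + (\<Sum>t\<in>S. nmul (cc n t) t) = (n + ff n) + f"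
      using rep(3)[of n] by (simp add: ac_simps)
    also have "\<dots> = (n + f) + ff n" by (simp add: ac_simps)
    also have "\<dots> = (f' + ff n) + (\<Sum>t\<in>S. nmul (c t) t)" unfolding f(3) by (simp add: ac_simps)
    finally have eq: "(gg n + f) + (\<Sum>t\<in>S. nmul (cc n t) t) = (f' + ff n) + (\<Sum>t\<in>S. nmul (c t) t)" .
    have mem: "gg n + f \<in> F" "f' + ff n \<in> F" by (intro F_closed(2) rep f)+
    have cc: "cc n t = c t" if "t \<in> S" for t using indep[OF mem eq that] .
    then have "(\<Sum>t\<in>S. nmul (cc n t) t) = (\<Sum>t\<in>S. nmul (c t) t)" by (intro sum.cong) auto
    then have eq': "gg n + f = f' + ff n" using eq by simp
    have "\<mu> i (gg n) - \<mu> i (ff n) = \<mu> i f' - \<mu> i f" if i: "i < s" for i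
    proof -
      have "\<mu> i (gg n) + \<mu> i f = \<mu> i f' + \<mu> i (ff n)"
        using additive_onD[OF mu[OF i]] rep f eq' by metis
      then show ?thesis by simp
    qed
    moreover have "x (gg n) * x f = x f' * x (ff n)" using eq' by (simp flip: x_add)
    then have "\<phi> n = x f' / x f" unfolding \<phi>_def using nz rep f by (simp add: frac_eq_eq)
    ultimately show ?thesis using cc by blast
  qed
  have calc_F: "(\<forall>t\<in>S. cc n t = 0) \<and> (\<forall>i<s. \<mu> i (gg n) - \<mu> i (ff n) = \<mu> i n) \<and> \<phi> n = x n"
    if n: "n \<in> F" for n
  proof -
    have "\<mu> i 0 = 0" if "i < s" for i using additive_on_submon(1)[OF submon_F mu[OF that]] .
    then show ?thesis using calc[of 0 n n "\<lambda>_. 0"] n F_closed(1) x_zero by simp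
  qed
  obtain ss where ss: "set ss = S" "distinct ss" using finite_distinct_list[OF S(1)] by blast
  have len: "length ss = card S" using ss distinct_card by metis
  define \<kappa> where "\<kappa> i n = (if i < s then \<mu> i (gg n) - \<mu> i (ff n) else int (cc n (ss ! (i - s))))" for i n
  define a where "a i = (if i < s then p i else ss ! (i - s))" for i
  define b where "b i = (if i < s then q i else 0)" for i
  have ssS: "ss ! (i - s) \<in> S" if "s \<le> i" "i < r" for i
    using that ss(1) len rs by (metis less_diff_conv2 add.commute nth_mem)
  have inds: "\<exists>i. s \<le> i \<and> i < r \<and> ss ! (i - s) = t" if t: "t \<in> S" for t
  proof -
    have "t \<in> set ss" using t ss(1) by simp
    then obtain k where "k < length ss" "ss ! k = t" by (auto simp: in_set_conv_nth)
    then show ?thesis using len rs by (intro exI[of _ "s + k"]) auto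
  qed
  have pq: "p i \<in> F" "q i \<in> F" if "i < s" for i using coords that by (auto simp: monoid_coords_def)
  have cc_gen: "(\<forall>u\<in>S. cc t u = (if u = t then 1 else 0)) \<and> (\<forall>i<s. \<mu> i (gg t) - \<mu> i (ff t) = 0)"
    if t: "t \<in> S" for t
  proof -
    have "(\<Sum>u\<in>S. nmul (if u = t then 1 else 0) u) = (\<Sum>u\<in>S. if u = t then u else 0)"
      by (rule sum.cong) auto
    also have "\<dots> = t" using t S(1) by simp
    finally show ?thesis
      using calc[of 0 0 t "\<lambda>u. if u = t then 1 else 0"] F_closed(1) by simp
  qed
  have add: "additive_on UNIV (\<kappa> i)" if i: "i < r" for i
    unfolding additive_on_def
  proof (intro ballI)
    fix m n
    have "m + n + (ff m + ff n) = (m + ff m) + (n + ff n)" by (simp add: ac_simps)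
    also have "\<dots> = (gg m + gg n) + (\<Sum>t\<in>S. nmul (cc m t + cc n t) t)"
      unfolding rep(3) by (simp add: nmul_add sum.distrib ac_simps)
    finally have "m + n + (ff m + ff n) = (gg m + gg n) + (\<Sum>t\<in>S. nmul (cc m t + cc n t) t)" .
    from calc[OF _ _ this] F_closed(2) rep
    have "(\<forall>t\<in>S. cc (m + n) t = cc m t + cc n t)"
      "(\<forall>i<s. \<mu> i (gg (m + n)) - \<mu> i (ff (m + n)) = \<mu> i (gg m + gg n) - \<mu> i (ff m + ff n))"
      by blast+
    then show "\<kappa> i (m + n) = \<kappa> i m + \<kappa> i n"
      using additive_onD[OF mu] rep ssS[of i] i by (auto simp: \<kappa>_def)
  qed
  have \<phi>add: "\<phi> (m + n) = \<phi> m * \<phi> n" for m n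
  proof -
    have "m + n + (ff m + ff n) = (m + ff m) + (n + ff n)" by (simp add: ac_simps)
    also have "\<dots> = (gg m + gg n) + (\<Sum>t\<in>S. nmul (cc m t + cc n t) t)"
      unfolding rep(3) by (simp add: nmul_add sum.distrib ac_simps)
    finally have "m + n + (ff m + ff n) = (gg m + gg n) + (\<Sum>t\<in>S. nmul (cc m t + cc n t) t)" .
    from calc[OF _ _ this] F_closed(2) rep
    have "\<phi> (m + n) = x (gg m + gg n) / x (ff m + ff n)" by blast
    then show ?thesis by (simp add: \<phi>_def x_add)
  qed
  have \<kappa>F: "\<kappa> i n = (if i < s then \<mu> i n else 0)" if "n \<in> F" "i < r" for i n
    using calc_F[OF that(1)] ssS[of i] that(2) by (auto simp: \<kappa>_def)
  have "monoid_coords UNIV r \<kappa> a b"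
    unfolding monoid_coords_def
  proof (intro conjI allI impI ballI)
    show "\<kappa> i (a j) = \<kappa> i (b j) + (if i = j then 1 else 0)" if ij: "i < r" "j < r" for i j
    proof (cases "j < s")
      case True
      then show ?thesis using coords pq[OF True] \<kappa>F[of "p j" i] \<kappa>F[of "q j" i] ij
        by (auto simp: a_def b_def monoid_coords_def)
    next
      case False
      let ?t = "ss ! (j - s)"
      have t: "?t \<in> S" using ssS False ij by simp
      have "\<kappa> i ?t = (if i = j then 1 else 0)"
      proof (cases "i < s")
        case True
        then show ?thesis using cc_gen[OF t] False by (auto simp: \<kappa>_def)
      next
        case i: False
        have "i - s < length ss" "j - s < length ss" using i False ij len rs by auto
        then have "ss ! (i - s) = ?t \<longleftrightarrow> i = j"
          using nth_eq_iff_index_eq[OF ss(2)] i False by auto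
        then show ?thesis using cc_gen[OF t] ssS[of i] i ij by (auto simp: \<kappa>_def)
      qed
      moreover have "\<kappa> i 0 = 0" using \<kappa>F[of 0 i] F_closed(1) ij
          additive_on_submon(1)[OF submon_F mu] by auto
      ultimately show ?thesis using False by (simp add: a_def b_def)
    qed
    show "torsion_eq m n" if mn: "\<forall>i<r. \<kappa> i m = \<kappa> i n" for m n
    proof -
      have cmn: "cc m t = cc n t" if "t \<in> S" for t
      proof -
        obtain i where "s \<le> i" "i < r" "ss ! (i - s) = t" using inds \<open>t \<in> S\<close> by blast
        then show ?thesis using mn by (auto simp: \<kappa>_def dest!: spec[of _ i])
      qed
      then have sm: "(\<Sum>t\<in>S. nmul (cc m t) t) = (\<Sum>t\<in>S. nmul (cc n t) t)" by (intro sum.cong) auto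
      have "m + (ff m + gg n) = (m + ff m) + gg n" by (simp add: ac_simps)
      also have "\<dots> = gg m + (\<Sum>t\<in>S. nmul (cc n t) t) + gg n" unfolding rep(3) sm ..
      also have "\<dots> = gg m + (n + ff n)" unfolding rep(3) by (simp add: ac_simps)
      also have "\<dots> = n + (ff n + gg m)" by (simp add: ac_simps)
      finally have e: "m + (ff m + gg n) = n + (ff n + gg m)" .
      have mem: "ff m + gg n \<in> F" "ff n + gg m \<in> F" by (intro F_closed(2) rep)+
      have "\<mu> i (ff m + gg n) = \<mu> i (ff n + gg m)" if i: "i < s" for i
      proof -
        have "i < r" using i rs by simp
        then have "\<kappa> i m = \<kappa> i n" using mn by blast
        then show ?thesis using additive_onD[OF mu[OF i]] rep i by (simp add: \<kappa>_def)
      qed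
      then have "torsion_eq (ff m + gg n) (ff n + gg m)"
        using coords mem by (auto simp: monoid_coords_def)
      then have "torsion_eq ((ff m + gg n) + m) ((ff n + gg m) + m)" by simp
      also have "(ff m + gg n) + m = n + (ff n + gg m)" using e by (simp add: add.commute)
      finally have "torsion_eq (n + (ff n + gg m)) (m + (ff n + gg m))" by (simp add: add.commute)
      then show ?thesis using torsion_eq_sym by auto
    qed
  qed (use add in auto)
  moreover have "x n = (if \<forall>i\<in>{s..<r}. \<kappa> i n = 0 then \<phi> n else 0)" for n
  proof (cases "\<forall>i\<in>{s..<r}. \<kappa> i n = 0")
    case True
    have "cc n t = 0" if t: "t \<in> S" for t
    proof -
      obtain i where "s \<le> i" "i < r" "ss ! (i - s) = t" using inds t by blast
      moreover have "\<kappa> i n = 0" using True calculation by auto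
      ultimately show ?thesis by (auto simp: \<kappa>_def)
    qed
    then have "n + ff n = gg n" using rep(3)[of n] by simp
    then have "x n * x (ff n) = x (gg n)" by (simp flip: x_add)
    then have "x n = \<phi> n" using nz[OF rep(1)] by (simp add: \<phi>_def field_simps)
    then show ?thesis unfolding if_P[OF True] .
  next
    case False
    then obtain i where i: "s \<le> i" "i < r" "\<kappa> i n \<noteq> 0" by auto
    then have "n \<notin> F" using \<kappa>F[of n i] by auto
    then have "x n = 0" by (simp add: F_def)
    then show ?thesis unfolding if_not_P[OF False] .
  qed
  moreover have "\<phi> 0 = 1" using calc_F[OF F_closed(1)] x_zero by simp
  moreover have "\<phi> n \<noteq> 0" for n unfolding \<phi>_def using nz rep by simp
  moreover have "\<kappa> j (a i) = 0 \<and> \<kappa> j (b i) = 0" if "i < s" "j \<in> {s..<r}" for i j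
    using \<kappa>F pq[OF that(1)] that by (auto simp: a_def b_def)
  moreover have "b i = 0 \<and> (\<forall>n. \<kappa> i n \<ge> 0)" if "i \<in> {s..<r}" for i
    using that by (auto simp: b_def \<kappa>_def)
  moreover have "s \<le> r" using rs by simp
  ultimately show ?thesis using \<phi>add by (intro exI[of _ \<kappa>] exI[of _ a] exI[of _ b] exI[of _ \<phi>]) blast
qed

end

text \<open>The set \<open>S\<close> has least cardinality among the sets of given generators
  outside the face that still generate modulo the face; removing a redundant element would
  contradict this. The face itself is generated by the members of \<Gamma> in it, since a sum lies
  in the face only if its terms do.\<close>

lemma face_minimal_generators:
  fixes x :: "'n::cancel_comm_monoid_add \<Rightarrow> 'k::field" and \<Gamma> :: "'n set"
  assumes fin: "finite \<Gamma>" "mspan \<Gamma> = UNIV"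
    and x: "x 0 = 1" "\<And>m n. x (m + n) = x m * x n"
  shows "\<exists>s \<mu> p q S. character_face x {n. x n \<noteq> 0} s \<mu> p q S"
proof -
  let ?F = "{n. x n \<noteq> 0}"
  have F: "submon ?F" by (simp add: submon_def x)
  have face: "m + n \<in> ?F \<longleftrightarrow> m \<in> ?F \<and> n \<in> ?F" for m n by (simp add: x)
  have rep: "\<exists>c. n = (\<Sum>g\<in>\<Gamma>. nmul (c g) g)" for n
  proof -
    have "n \<in> mspan \<Gamma>" using fin(2) by simp
    then show ?thesis unfolding mspan_def by blast
  qed
  have decomp: "n = (\<Sum>g\<in>\<Gamma> \<inter> ?F. nmul (c g) g) + (\<Sum>g\<in>\<Gamma> - ?F. nmul (c g) g)"
    if "n = (\<Sum>g\<in>\<Gamma>. nmul (c g) g)" for n c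
    unfolding that by (rule sum.Int_Diff[OF fin(1)])
  have span: "mspan (\<Gamma> \<inter> ?F) = ?F"
  proof
    show "mspan (\<Gamma> \<inter> ?F) \<subseteq> ?F"
    proof
      fix m assume "m \<in> mspan (\<Gamma> \<inter> ?F)"
      then obtain c where m: "m = (\<Sum>g\<in>\<Gamma> \<inter> ?F. nmul (c g) g)" unfolding mspan_def by blast
      show "m \<in> ?F" unfolding m by (intro submon_closed(4)[OF F] submon_closed(3)[OF F]) blast
    qed
    show "?F \<subseteq> mspan (\<Gamma> \<inter> ?F)"
    proof
      fix n assume n: "n \<in> ?F"
      obtain c where c: "n = (\<Sum>g\<in>\<Gamma>. nmul (c g) g)" using rep by blast
      have "c g = 0" if g: "g \<in> \<Gamma> - ?F" for g
      proof (rule ccontr)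
        assume "c g \<noteq> 0"
        then obtain k where "c g = Suc k" by (cases "c g") auto
        then have "n = g + (nmul k g + (\<Sum>g\<in>\<Gamma> - {g}. nmul (c g) g))"
          using c sum.remove[OF fin(1), of g "\<lambda>g. nmul (c g) g"] g by (simp add: add.assoc)
        then show False using n face g by (metis DiffD2)
      qed
      then have "(\<Sum>g\<in>\<Gamma> - ?F. nmul (c g) g) = 0" by simp
      then have "n = (\<Sum>g\<in>\<Gamma> \<inter> ?F. nmul (c g) g)" using decomp[OF c] by simp
      then show "n \<in> mspan (\<Gamma> \<inter> ?F)" unfolding mspan_def by (intro range_eqI[of _ _ c])
    qed
  qed
  obtain s \<mu> p q where co: "monoid_coords ?F s \<mu> p q"
    using monoid_coords_exist[of "\<Gamma> \<inter> ?F"] fin(1) unfolding span by auto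
  have gen0: "gen_mod ?F (\<Gamma> - ?F)"
    unfolding gen_mod_def
  proof
    fix n
    obtain c where c: "n = (\<Sum>g\<in>\<Gamma>. nmul (c g) g)" using rep by blast
    have "(\<Sum>g\<in>\<Gamma> \<inter> ?F. nmul (c g) g) \<in> ?F"
      by (intro submon_closed(4)[OF F] submon_closed(3)[OF F]) blast
    moreover have "n + 0 = (\<Sum>g\<in>\<Gamma> \<inter> ?F. nmul (c g) g) + (\<Sum>g\<in>\<Gamma> - ?F. nmul (c g) g)"
      using decomp[OF c] by simp
    ultimately show "\<exists>f\<in>?F. \<exists>f'\<in>?F. \<exists>c. n + f = f' + (\<Sum>t\<in>\<Gamma> - ?F. nmul (c t) t)"
      using submon_closed(1)[OF F] by (intro bexI exI)
  qed
  define ok where "ok S \<longleftrightarrow> S \<subseteq> \<Gamma> - ?F \<and> gen_mod ?F S" for S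
  define S where "S = arg_min card ok"
  have ok0: "ok (\<Gamma> - ?F)" using gen0 by (simp add: ok_def)
  have S: "ok S" "\<And>T. ok T \<Longrightarrow> card S \<le> card T"
    unfolding S_def by (rule arg_min_natI[of ok, OF ok0], rule arg_min_nat_le)
  have fS: "finite S" using S(1) fin(1) unfolding ok_def by (meson finite_Diff finite_subset)
  have "character_face x ?F s \<mu> p q S"
  proof
    show "S \<inter> ?F = {}" "gen_mod ?F S" using S(1) by (auto simp: ok_def)
    show "t + g \<noteq> g' + (\<Sum>u\<in>S - {t}. nmul (d u) u)" if t: "t \<in> S" "g \<in> ?F" "g' \<in> ?F" for t g g' d
    proof
      assume "t + g = g' + (\<Sum>u\<in>S - {t}. nmul (d u) u)"
      from gen_mod_remove[OF F fS t(1) _ t(2,3) this] have "ok (S - {t})"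
        using S(1) by (auto simp: ok_def)
      from S(2)[OF this] show False using fS t(1) by (metis card_Diff1_less linorder_not_less)
    qed
  qed (use x co fS in auto)
  then show ?thesis by blast
qed

theorem regular_character_coordinates:
  fixes x :: "'n::cancel_comm_monoid_add \<Rightarrow> 'k::field" and Lam :: "nat \<Rightarrow> 'n \<Rightarrow> int" and \<Gamma> :: "'n set"
  assumes fin: "finite \<Gamma>" "mspan \<Gamma> = UNIV"
    and x: "x 0 = 1" "\<And>m n. x (m + n) = x m * x n"
    and r: "monoid_coords UNIV r Lam A B"
    and G: "finite G" "card G \<le> r" "G \<subseteq> {f. mlift (\<lambda>a. a) x f = 0}"
    and gen: "\<And>K h. ideal_set K \<Longrightarrow> G \<subseteq> K \<Longrightarrow> mlift (\<lambda>a. a) x h = 0 \<Longrightarrow>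
      \<exists>w. mlift (\<lambda>a. a) x w \<noteq> 0 \<and> w * h \<in> K"
  shows "\<exists>s \<kappa> a b \<phi>. monoid_coords UNIV r \<kappa> a b \<and> s \<le> r \<and>
    (\<forall>i\<in>{s..<r}. b i = 0 \<and> (\<forall>n. \<kappa> i n \<ge> 0)) \<and>
    (\<forall>i<s. \<forall>j\<in>{s..<r}. \<kappa> j (a i) = 0 \<and> \<kappa> j (b i) = 0) \<and>
    \<phi> 0 = 1 \<and> (\<forall>m n. \<phi> (m + n) = \<phi> m * \<phi> n) \<and> (\<forall>n. \<phi> n \<noteq> 0) \<and>
    (\<forall>n. x n = (if \<forall>i\<in>{s..<r}. \<kappa> i n = 0 then \<phi> n else 0))"
proof -
  obtain s \<mu> p q S where "character_face x {n. x n \<noteq> 0} s \<mu> p q S"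
    using face_minimal_generators[OF fin x] by blast
  then interpret character_face x "{n. x n \<noteq> 0}" s \<mu> p q S .
  have "s + card S \<le> card G" by (rule cotangent_bound[OF G(1,3) gen])
  then have "s + card S \<le> r" using G(2) by simp
  from split_coordinates[OF r this] show ?thesis by blast
qed

section \<open>Monomial curves\<close>

definition chi :: "nat \<Rightarrow> (nat \<Rightarrow> 'n \<Rightarrow> int) \<Rightarrow> (nat \<Rightarrow> 'q::field) \<Rightarrow> 'n \<Rightarrow> 'q"
  where "chi r \<kappa> H n = (\<Prod>i<r. H i powi \<kappa> i n)"

lemma chi_nonzero: "(\<And>i. H i \<noteq> 0) \<Longrightarrow> chi r \<kappa> H n \<noteq> 0"
  by (simp add: chi_def)

lemma chi_add:
  assumes "monoid_coords UNIV r \<kappa> a b" "\<And>i. H i \<noteq> 0"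
  shows "chi r \<kappa> H (m + n) = chi r \<kappa> H m * chi r \<kappa> H n"
  unfolding chi_def prod.distrib[symmetric]
proof (rule prod.cong[OF refl])
  fix i assume "i \<in> {..<r}"
  then have "\<kappa> i (m + n) = \<kappa> i m + \<kappa> i n"
    using assms(1) by (auto simp: monoid_coords_def additive_on_def)
  then show "H i powi \<kappa> i (m + n) = H i powi \<kappa> i m * H i powi \<kappa> i n"
    using assms(2) by (simp add: power_int_add)
qed

lemma chi_zero:
  fixes \<kappa> :: "nat \<Rightarrow> 'n::comm_monoid_add \<Rightarrow> int"
  assumes "monoid_coords UNIV r \<kappa> a b"
  shows "chi r \<kappa> H 0 = 1"
proof -
  have "\<kappa> i 0 = 0" if "i < r" for i
    using assms that additive_on_submon(1)[of UNIV "\<kappa> i"] by (auto simp: monoid_coords_def submon_def)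
  then show ?thesis by (simp add: chi_def)
qed

lemma chi_basis:
  assumes co: "monoid_coords UNIV r \<kappa> a b" and H: "\<And>i. H i \<noteq> 0" and j: "j < r"
  shows "chi r \<kappa> H (a j) = H j * chi r \<kappa> H (b j)"
proof -
  have "chi r \<kappa> H (a j) = (\<Prod>i<r. (if i = j then H i else 1) * H i powi \<kappa> i (b j))"
    unfolding chi_def
    by (rule prod.cong) (use co H j in \<open>auto simp: monoid_coords_def power_int_add power_int_1_right\<close>)
  also have "\<dots> = H j * chi r \<kappa> H (b j)"
    unfolding prod.distrib chi_def using j by simp
  finally show ?thesis .
qed

lemma chi_update:
  assumes H: "\<And>i. H i \<noteq> 0" and y: "y \<noteq> 0" and j: "j < r"
  shows "chi r \<kappa> (H(j := y)) n = chi r \<kappa> H n * (y / H j) powi \<kappa> j n"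
proof -
  have "chi r \<kappa> (H(j := y)) n = (\<Prod>i<r. H i powi \<kappa> i n * (if i = j then (y / H j) powi \<kappa> j n else 1))"
    unfolding chi_def
  proof (rule prod.cong[OF refl])
    fix i assume "i \<in> {..<r}"
    show "(H(j := y)) i powi \<kappa> i n = H i powi \<kappa> i n * (if i = j then (y / H j) powi \<kappa> j n else 1)"
      using H[of j] y by (simp flip: power_int_mult_distrib)
  qed
  also have "\<dots> = chi r \<kappa> H n * (y / H j) powi \<kappa> j n"
    unfolding prod.distrib chi_def using j by simp
  finally show ?thesis .
qed

text \<open>Monomials divided by their value under \<phi>. In these terms \<phi> becomes the unit
  point of the torus, and the equations of the curves have integer coefficients.\<close>

definition twisted_mon :: "('n \<Rightarrow> 'k::field) \<Rightarrow> 'n \<Rightarrow> 'n \<Rightarrow>\<^sub>0 'k"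
  where "twisted_mon \<phi> n = Poly_Mapping.single n (inverse (\<phi> n))"

abbreviation loc_par :: "int \<Rightarrow>\<^sub>0 'k::field"
  where "loc_par \<equiv> mon 1 - 1"

text \<open>The exponent of \<open>t - 1\<close> is nonnegative wherever this defines a
  homomorphism, so \<open>nat\<close> does not alter it there.\<close>

definition curve_fun :: "nat \<Rightarrow> (nat \<Rightarrow> 'n \<Rightarrow> int) \<Rightarrow> (nat \<Rightarrow> int) \<Rightarrow> (nat \<Rightarrow> int) \<Rightarrow> 'n \<Rightarrow> int \<Rightarrow>\<^sub>0 'k::field"
  where "curve_fun r \<kappa> w e n = mon (\<Sum>i<r. w i * \<kappa> i n) * loc_par ^ nat (\<Sum>i<r. e i * \<kappa> i n)"

definition curve_hom :: "nat \<Rightarrow> (nat \<Rightarrow> 'n \<Rightarrow> int) \<Rightarrow> ('n \<Rightarrow> 'k::field) \<Rightarrow> (nat \<Rightarrow> int) \<Rightarrow> (nat \<Rightarrow> int) \<Rightarrow>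
    ('n \<Rightarrow>\<^sub>0 'k) \<Rightarrow> (int \<Rightarrow>\<^sub>0 'k)"
  where "curve_hom r \<kappa> \<phi> w e = mlift cst (\<lambda>n. cst (\<phi> n) * curve_fun r \<kappa> w e n)"

text \<open>Rational functions in variables \<open>y_0, y_1, ...\<close>, obtained as fractions of
  Laurent polynomials. Countably many variables are provided so that the type does not depend on
  r.\<close>

type_synonym 'k ratfun = "((nat \<Rightarrow>\<^sub>0 int) \<Rightarrow>\<^sub>0 'k) fract"

definition rf :: "((nat \<Rightarrow>\<^sub>0 int) \<Rightarrow>\<^sub>0 'k::field) \<Rightarrow> 'k ratfun"
  where "rf p = Fract p 1"

definition rfc :: "'k::field \<Rightarrow> 'k ratfun" where "rfc c = rf (cst c)"

definition rfv :: "nat \<Rightarrow> 'k::field ratfun" where "rfv i = rf (mon (Poly_Mapping.single i 1))"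

lemma hom_type_rf: "hom_type rf"
  by (simp add: hom_type_def rf_def One_fract_def)

lemma rf_eq_iff: "rf p = rf q \<longleftrightarrow> p = q"
  by (simp add: rf_def eq_fract)

lemma rf_zero_iff: "rf p = 0 \<longleftrightarrow> p = 0"
  using rf_eq_iff[of p 0] by (simp add: hom_type_simps(4)[OF hom_type_rf])

lemma hom_type_rfc: "hom_type rfc"
  unfolding rfc_def by (rule hom_type_comp[OF hom_type_rf hom_type_cst])

lemma rfv_nonzero: "rfv i \<noteq> 0"
  by (simp add: rfv_def rf_zero_iff) (metis lookup_single_eq lookup_zero zero_neq_one)

lemma rfv_power: "(rfv i :: 'k::field ratfun) powi z = rf (mon (Poly_Mapping.single i z))"
proof -
  have nat: "(rfv i :: 'k ratfun) ^ k = rf (mon (Poly_Mapping.single i (int k)))" for k i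
  proof (induction k)
    case 0
    then show ?case by (simp add: hom_type_simps[OF hom_type_rf])
  next
    case (Suc k)
    have "mon (Poly_Mapping.single i (int (Suc k))) =
      (mon (Poly_Mapping.single i 1) * mon (Poly_Mapping.single i (int k)) :: _ \<Rightarrow>\<^sub>0 'k)"
      by (simp add: mult_single flip: single_add)
    then show ?case
      by (simp only: power_Suc Suc.IH) (simp only: rfv_def hom_type_simps(3)[OF hom_type_rf])
  qed
  show ?thesis
  proof (cases "z \<ge> 0")
    case True
    then show ?thesis using nat[of i "nat z"] by (simp add: power_int_def)
  next
    case False
    have "mon (Poly_Mapping.single i z) * mon (Poly_Mapping.single i (- z)) = (1 :: _ \<Rightarrow>\<^sub>0 'k)"
      by (simp add: mult_single flip: single_add)
    then have "rf (mon (Poly_Mapping.single i z)) * rfv i ^ nat (- z) = (1 :: 'k ratfun)"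
      using False nat[of i "nat (- z)"] hom_type_simps(1,3)[OF hom_type_rf] by (metis int_nat_eq linorder_not_le neg_0_le_iff_le order_less_imp_le)
    then show ?thesis using False by (simp add: power_int_def power_inverse inverse_unique mult.commute)
  qed
qed

text \<open>Evaluation at the point of the torus, twisted by \<phi>, whose coordinates
  \<open>H i\<close> are rational functions. Its kernel is prime because the target is a field;
  specializing the \<open>H i\<close> one after the other produces the chain of primes.\<close>

definition Theta :: "nat \<Rightarrow> (nat \<Rightarrow> 'n \<Rightarrow> int) \<Rightarrow> ('n \<Rightarrow> 'k::field) \<Rightarrow> (nat \<Rightarrow> 'k ratfun) \<Rightarrow> ('n \<Rightarrow>\<^sub>0 'k) \<Rightarrow> 'k ratfun"
  where "Theta r \<kappa> \<phi> H = mlift rfc (\<lambda>n. rfc (\<phi> n) * chi r \<kappa> H n)"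

text \<open>Modulo \<open>P - Q\<close> both terms become the power
  \<open>P ^ (2 * M)\<close>.\<close>

lemma minus_dvd_power_product:
  fixes P Q :: "'a::comm_ring_1"
  assumes "i + j = 2 * M"
  shows "(P - Q) dvd (P * Q) ^ M - P ^ i * Q ^ j"
proof -
  have d: "(P - Q) dvd P ^ k - Q ^ k" for k
    by (metis dvd_triv_left power_diff_sumr2)
  show ?thesis
  proof (cases "i \<le> M")
    case True
    then obtain k where k: "M = i + k" by (auto simp: le_iff_add)
    then have "j = M + k" using assms by simp
    then have "(P * Q) ^ M - P ^ i * Q ^ j = P ^ i * Q ^ M * (P ^ k - Q ^ k)"
      unfolding k by (simp add: power_add power_mult_distrib algebra_simps)
    then show ?thesis using d[of k] by (simp add: dvd_mult)
  next
    case False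
    then obtain k where k: "M = j + k" using assms by (metis add_leD2 le_iff_add mult_2 nat_add_left_cancel_le nat_le_linear add_le_mono)
    then have "i = M + k" using assms by simp
    then have "(P * Q) ^ M - P ^ i * Q ^ j = - (P ^ M * Q ^ j * (P ^ k - Q ^ k))"
      unfolding k by (simp add: power_add power_mult_distrib algebra_simps)
    then show ?thesis using d[of k] by (simp add: dvd_mult)
  qed
qed

text \<open>Reducedness enters through \<open>tame_torsion\<close>: the integer \<open>l\<close> is
  invertible in \<open>k\<close>, so the equation satisfied by the quotient of two monomials with
  equal coordinates is separable.\<close>

locale twisted_coordinates =
  fixes r :: nat and \<kappa> :: "nat \<Rightarrow> 'n::cancel_comm_monoid_add \<Rightarrow> int" and a b :: "nat \<Rightarrow> 'n"
    and \<phi> :: "'n \<Rightarrow> 'k::field"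
  assumes coords: "monoid_coords UNIV r \<kappa> a b"
    and phi: "\<phi> 0 = 1" "\<And>m n. \<phi> (m + n) = \<phi> m * \<phi> n" "\<And>n. \<phi> n \<noteq> 0"
    and tame_torsion: "(\<And>i. i < r \<Longrightarrow> \<kappa> i m = \<kappa> i n) \<Longrightarrow> \<exists>l. of_nat l \<noteq> (0::'k) \<and> nmul l m = nmul l n"
begin

abbreviation xm :: "'n \<Rightarrow> 'n \<Rightarrow>\<^sub>0 'k" where "xm \<equiv> twisted_mon \<phi>"

lemma xm_add: "xm (m + n) = xm m * xm n"
  by (simp add: twisted_mon_def mult_single phi)

lemma xm_zero: "xm 0 = 1"
  by (simp add: twisted_mon_def phi)

lemma xm_nmul: "xm (nmul l n) = xm n ^ l"
  by (induction l) (simp_all add: xm_zero xm_add)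

lemma single_eq_xm: "Poly_Mapping.single n c = cst (c * \<phi> n) * xm n"
  by (simp add: twisted_mon_def mult_single phi mult.assoc)

lemma expansion_xm: "f = (\<Sum>n\<in>Poly_Mapping.keys f. cst (Poly_Mapping.lookup f n * \<phi> n) * xm n)"
  unfolding single_eq_xm[symmetric] by (rule pm_sum_single) auto

lemma kappa_add: "i < r \<Longrightarrow> \<kappa> i (m + n) = \<kappa> i m + \<kappa> i n"
  using coords by (auto simp: monoid_coords_def additive_on_def)

lemma kappa_zero: "i < r \<Longrightarrow> \<kappa> i 0 = 0"
  using kappa_add[of i 0 0] by simp

lemma kappa_basis: "i < r \<Longrightarrow> j < r \<Longrightarrow> \<kappa> i (a j) = \<kappa> i (b j) + (if i = j then 1 else 0)"
  using coords by (auto simp: monoid_coords_def)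

lemma hom_type_Theta: "(\<And>i. H i \<noteq> 0) \<Longrightarrow> hom_type (Theta r \<kappa> \<phi> H)"
  unfolding Theta_def
  by (rule hom_type_mlift[OF hom_type_rfc])
    (simp_all add: phi chi_zero[OF coords] chi_add[OF coords] hom_type_simps[OF hom_type_rfc] mult_ac)

lemma Theta_xm: "Theta r \<kappa> \<phi> H (xm n) = chi r \<kappa> H n"
proof -
  have "rfc (inverse (\<phi> n)) * rfc (\<phi> n) = rfc (inverse (\<phi> n) * \<phi> n)"
    using hom_type_simps(3)[OF hom_type_rfc] by metis
  then show ?thesis
    using phi(3)[of n]
    by (simp add: Theta_def twisted_mon_def mlift_single mult.assoc[symmetric]
        hom_type_simps(1,4)[OF hom_type_rfc])
qed

lemma Theta_cst: "(\<And>i. H i \<noteq> 0) \<Longrightarrow> Theta r \<kappa> \<phi> H (cst c) = rfc c"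
  by (simp add: Theta_def mlift_single phi chi_zero[OF coords] hom_type_simps(1,4)[OF hom_type_rfc])

lemma Theta_expansion:
  "Theta r \<kappa> \<phi> H f = (\<Sum>n\<in>Poly_Mapping.keys f. rfc (Poly_Mapping.lookup f n * \<phi> n) * chi r \<kappa> H n)"
  unfolding Theta_def mlift_def by (simp add: mult.assoc hom_type_simps(3)[OF hom_type_rfc])

text \<open>
  Replacing the coordinate \<open>H j\<close> by \<open>y\<close> enlarges the kernel by one relation \<open>P = Q\<close>: after
  multiplication by a power of \<open>P Q\<close>, every monomial can be balanced so that the difference
  between the two specializations becomes a common factor.
\<close>

lemma elimination:
  assumes H: "\<And>i. H i \<noteq> 0" and y: "y \<noteq> 0" and j: "j < r"
    and PQ: "Theta r \<kappa> \<phi> H Pj * y = H j * Theta r \<kappa> \<phi> H Qj"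
    and f: "Theta r \<kappa> \<phi> (H(j := y)) f = 0"
  shows "\<exists>M c. Theta r \<kappa> \<phi> H ((Pj * Qj) ^ M * f - c * (Pj - Qj)) = 0"
proof -
  let ?K = "Poly_Mapping.keys f"
  define M where "M = (\<Sum>n\<in>?K. nat \<bar>\<kappa> j n\<bar>)"
  have M: "\<bar>\<kappa> j n\<bar> \<le> int M" if "n \<in> ?K" for n
  proof -
    have "nat \<bar>\<kappa> j n\<bar> \<le> M" unfolding M_def using that by (intro member_le_sum) auto
    then show ?thesis by linarith
  qed
  \<comment> \<open>For the monomial \<open>n\<close>, the factor
    \<open>Pj ^ up n * Qj ^ dn n\<close> evaluates under \<open>H\<close> to
    \<open>(y / H j) powi \<kappa> j n\<close> times a quantity that is the same for all
    \<open>n\<close>. It thus turns the value under \<open>H\<close> into the value under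
    \<open>H(j := y)\<close>. Its degree \<open>2 * M\<close> does not depend on \<open>n\<close>,
    so modulo \<open>Pj - Qj\<close> it can be replaced by \<open>(Pj * Qj) ^ M\<close>.\<close>
  define up where "up n = nat (int M - \<kappa> j n)" for n
  define dn where "dn n = nat (int M + \<kappa> j n)" for n
  have ud: "up n + dn n = 2 * M" "int (up n) = int M - \<kappa> j n" if "n \<in> ?K" for n
    using M[OF that] by (auto simp: up_def dn_def)
  have "\<exists>c. (Pj * Qj) ^ M - Pj ^ up n * Qj ^ dn n = (Pj - Qj) * c" if "n \<in> ?K" for n
    using minus_dvd_power_product[OF ud(1)[OF that], of Pj Qj] by (elim dvdE) blast
  then obtain c where c: "\<And>n. n \<in> ?K \<Longrightarrow> (Pj * Qj) ^ M - Pj ^ up n * Qj ^ dn n = (Pj - Qj) * c n"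
    by metis
  define co where "co n = cst (Poly_Mapping.lookup f n * \<phi> n) * xm n" for n
  have fco: "f = (\<Sum>n\<in>?K. co n)" unfolding co_def by (rule expansion_xm)
  have "(Pj * Qj) ^ M * f - (\<Sum>n\<in>?K. co n * c n) * (Pj - Qj)
    = (\<Sum>n\<in>?K. (Pj * Qj) ^ M * co n) - (\<Sum>n\<in>?K. co n * c n * (Pj - Qj))"
    by (subst fco) (simp add: sum_distrib_left sum_distrib_right)
  also have "\<dots> = (\<Sum>n\<in>?K. co n * (Pj ^ up n * Qj ^ dn n))"
    unfolding sum_subtractf[symmetric]
  proof (rule sum.cong[OF refl])
    fix n assume "n \<in> ?K"
    have "Pj ^ up n * Qj ^ dn n = (Pj * Qj) ^ M - (Pj - Qj) * c n" by (simp add: c[OF \<open>n \<in> ?K\<close>, symmetric])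
    then show "(Pj * Qj) ^ M * co n - co n * c n * (Pj - Qj) = co n * (Pj ^ up n * Qj ^ dn n)"
      by (simp only:) (simp add: algebra_simps)
  qed
  finally have eq: "(Pj * Qj) ^ M * f - (\<Sum>n\<in>?K. co n * c n) * (Pj - Qj)
    = (\<Sum>n\<in>?K. co n * (Pj ^ up n * Qj ^ dn n))" .
  let ?T = "Theta r \<kappa> \<phi> H"
  note T = hom_type_simps[OF hom_type_Theta[of H, OF H]]
  let ?\<rho> = "H j / y"
  have TP: "?T Pj = ?\<rho> * ?T Qj" using PQ y by (simp add: field_simps)
  have "?T (\<Sum>n\<in>?K. co n * (Pj ^ up n * Qj ^ dn n))
    = (\<Sum>n\<in>?K. rfc (Poly_Mapping.lookup f n * \<phi> n) * chi r \<kappa> (H(j := y)) n * (?\<rho> ^ M * ?T Qj ^ (2 * M)))"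
    unfolding T(8)
  proof (rule sum.cong[OF refl])
    fix n assume n: "n \<in> ?K"
    have \<rho>: "?\<rho> \<noteq> 0" using H[of j] y by simp
    have "(?\<rho>) ^ up n = ?\<rho> powi (int M - \<kappa> j n)"
      using ud(2)[OF n] by (metis power_int_of_nat)
    also have "\<dots> = (y / H j) powi \<kappa> j n * ?\<rho> ^ M"
      using \<rho> by (simp add: power_int_diff power_int_divide_distrib field_simps)
    finally have 1: "(?\<rho>) ^ up n = (y / H j) powi \<kappa> j n * ?\<rho> ^ M" .
    have "?T (co n * (Pj ^ up n * Qj ^ dn n))
      = rfc (Poly_Mapping.lookup f n * \<phi> n) * chi r \<kappa> H n * (?T Pj ^ up n * ?T Qj ^ dn n)"
      unfolding co_def T(3) T(7) Theta_xm Theta_cst[of H, OF H] ..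
    also have "?T Pj ^ up n * ?T Qj ^ dn n = ?\<rho> ^ up n * ?T Qj ^ (up n + dn n)"
      unfolding TP power_mult_distrib power_add by simp
    also have "\<dots> = (y / H j) powi \<kappa> j n * (?\<rho> ^ M * ?T Qj ^ (2 * M))"
      unfolding 1 ud(1)[OF n] by simp
    finally show "?T (co n * (Pj ^ up n * Qj ^ dn n))
      = rfc (Poly_Mapping.lookup f n * \<phi> n) * chi r \<kappa> (H(j := y)) n * (?\<rho> ^ M * ?T Qj ^ (2 * M))"
      unfolding chi_update[of H, OF H y j] by (simp only: mult.assoc)
  qed
  also have "\<dots> = Theta r \<kappa> \<phi> (H(j := y)) f * (?\<rho> ^ M * ?T Qj ^ (2 * M))"
    unfolding Theta_expansion[of _ f] sum_distrib_right ..
  also have "\<dots> = 0" using f by simp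
  finally show ?thesis unfolding eq[symmetric] by blast
qed

text \<open>The difference of the l-th powers vanishes and is the product of
  \<open>xm m - xm n\<close> with a sum \<open>w\<close> of l terms. Modulo \<open>P\<close> these
  terms coincide, so \<open>w\<close> is congruent to \<open>l\<close> times a power of
  \<open>xm n\<close>, and it lies outside \<open>P\<close> because \<open>l\<close> is invertible.
  Locally at \<open>P\<close> the two monomials are therefore equal.\<close>

lemma xm_torsion_congruence:
  assumes P: "prime_set P" and xm: "\<And>n. xm n \<notin> P"
    and mn: "\<And>i. i < r \<Longrightarrow> \<kappa> i m = \<kappa> i n" and diff: "xm m - xm n \<in> P"
  shows "\<exists>w. w \<notin> P \<and> w * (xm m - xm n) = 0"
proof -
  note I = prime_set_ideal[OF P] note Ic = ideal_set_closed[OF I]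
  obtain l where l: "of_nat l \<noteq> (0::'k)" "nmul l m = nmul l n" using tame_torsion mn by blast
  obtain k where k: "l = Suc k" using l(1) by (cases l) auto
  define w where "w = (\<Sum>i<Suc k. xm n ^ (Suc k - Suc i) * xm m ^ i)"
  have "(xm m - xm n) * w = xm m ^ Suc k - xm n ^ Suc k" unfolding w_def by (rule power_diff_sumr2[symmetric])
  also have "\<dots> = 0" using l(2) unfolding k xm_nmul[symmetric] by simp
  finally have 1: "w * (xm m - xm n) = 0" by (simp add: mult.commute)
  have d: "xm n ^ (Suc k - Suc i) * xm m ^ i - xm n ^ k \<in> P" if "i < Suc k" for i
  proof -
    have "xm n ^ k = xm n ^ i * xm n ^ (k - i)" using that by (simp flip: power_add)
    then have "xm n ^ (Suc k - Suc i) * xm m ^ i - xm n ^ k = (xm m ^ i - xm n ^ i) * xm n ^ (k - i)"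
      by (simp add: algebra_simps)
    moreover have "(xm m - xm n) dvd xm m ^ i - xm n ^ i" by (metis dvd_triv_left power_diff_sumr2)
    then have "xm m ^ i - xm n ^ i \<in> P" using Ic(4)[OF diff] by (auto elim!: dvdE)
    ultimately show ?thesis using Ic(4) by simp
  qed
  have "w - of_nat l * xm n ^ k = (\<Sum>i<Suc k. xm n ^ (Suc k - Suc i) * xm m ^ i - xm n ^ k)"
    unfolding w_def k by (simp add: sum_subtractf del: diff_Suc_Suc)
  also have "\<dots> \<in> P" by (intro Ic(7) d) simp
  finally have w: "w - of_nat l * xm n ^ k \<in> P" .
  have "w \<notin> P"
  proof
    assume "w \<in> P"
    then have "of_nat l * xm n ^ k \<in> P" using ideal_set_cong[OF I w] by blast
    then have "of_nat l \<in> P" using prime_set_mult[OF P] prime_set_power[OF P] xm by blast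
    then have "cst (of_nat l) \<in> P" using hom_type_simps(10)[OF hom_type_cst] by metis
    then have "cst (inverse (of_nat l)) * cst (of_nat l) \<in> P" by (rule Ic(3))
    then have "cst (inverse (of_nat l) * of_nat l) \<in> P" using hom_type_simps(3)[OF hom_type_cst] by metis
    then show False using l(1) prime_set_one[OF P] by simp
  qed
  then show ?thesis using 1 by blast
qed

text \<open>Evaluation at independent variables sees only coordinate vectors, so the coefficients of
  \<open>f\<close> with respect to the elements \<open>xm n\<close> sum to zero over each class of
  equal coordinates. The monomials of one class are equal locally at \<open>P\<close>, hence
  \<open>f\<close> vanishes there.\<close>

lemma Theta_generic_kernel:
  assumes P: "prime_set P" and xm: "\<And>n. xm n \<notin> P"
    and diff: "\<And>m n. (\<And>i. i < r \<Longrightarrow> \<kappa> i m = \<kappa> i n) \<Longrightarrow> xm m - xm n \<in> P"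
    and f: "Theta r \<kappa> \<phi> rfv f = 0"
  shows "\<exists>w. w \<notin> P \<and> w * f = 0"
proof -
  let ?K = "Poly_Mapping.keys f"
  define Z where "Z = {g. \<exists>w. w \<notin> P \<and> w * g = 0}"
  have Z: "ideal_set Z"
    unfolding ideal_set_def
  proof (intro conjI ballI allI)
    show "0 \<in> Z" unfolding Z_def using prime_set_one[OF P] by auto
    fix g assume "g \<in> Z"
    then obtain w where w: "w \<notin> P" "w * g = 0" by (auto simp: Z_def)
    have "w * (c * g) = c * (w * g)" for c by (simp add: mult_ac)
    then show "c * g \<in> Z" for c unfolding Z_def using w by auto
    fix h assume "h \<in> Z"
    then obtain v where v: "v \<notin> P" "v * h = 0" by (auto simp: Z_def)
    have "w * v * (g + h) = v * (w * g) + w * (v * h)" by (simp add: algebra_simps)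
    then have "w * v * (g + h) = 0" using w v by simp
    moreover have "w * v \<notin> P" using prime_set_mult[OF P] w v by blast
    ultimately show "g + h \<in> Z" unfolding Z_def by blast
  qed
  define kv where "kv n = (\<Sum>i<r. Poly_Mapping.single i (\<kappa> i n))" for n
  have lk: "Poly_Mapping.lookup (kv n) i = (if i < r then \<kappa> i n else 0)" for n i
    unfolding kv_def lookup_sum by (simp add: lookup_single when_def)
  have kv_eq: "\<kappa> i m = \<kappa> i n" if "kv m = kv n" "i < r" for m n i
    using lk[of m i] lk[of n i] that by simp
  have ch: "chi r \<kappa> (rfv :: nat \<Rightarrow> 'k ratfun) n = rf (mon (kv n))" for n
  proof -
    have "mon (\<Sum>i\<in>A. Poly_Mapping.single i (\<kappa> i n)) = (\<Prod>i\<in>A. mon (Poly_Mapping.single i (\<kappa> i n)) :: _ \<Rightarrow>\<^sub>0 'k)"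
      if "finite A" for A
      using that by (induction A rule: finite_induct) (simp_all add: mon_mult[symmetric])
    from this[OF finite_lessThan[of r]] show ?thesis
      unfolding chi_def kv_def rfv_power by (simp only: hom_type_simps(9)[OF hom_type_rf])
  qed
  define rep where "rep v = (SOME n. kv n = v)" for v
  have rep: "kv (rep (kv n)) = kv n" for n unfolding rep_def by (rule someI) (rule refl)
  let ?c = "\<lambda>n. Poly_Mapping.lookup f n * \<phi> n"
  have "rf (\<Sum>n\<in>?K. Poly_Mapping.single (kv n) (?c n)) = Theta r \<kappa> \<phi> rfv f"
    unfolding Theta_expansion ch hom_type_simps(8)[OF hom_type_rf]
    by (rule sum.cong) (simp_all add: rfc_def mult_single flip: hom_type_simps(3)[OF hom_type_rf])
  then have z: "(\<Sum>n\<in>?K. Poly_Mapping.single (kv n) (?c n)) = 0" using f by (simp add: rf_zero_iff)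
  have zv: "(\<Sum>n\<in>{n \<in> ?K. kv n = v}. ?c n) = 0" for v
  proof -
    have "0 = Poly_Mapping.lookup (\<Sum>n\<in>?K. Poly_Mapping.single (kv n) (?c n)) v" using z by simp
    also have "\<dots> = (\<Sum>n\<in>?K. if kv n = v then ?c n else 0)"
      unfolding lookup_sum by (simp add: lookup_single when_def)
    also have "\<dots> = (\<Sum>n\<in>{n \<in> ?K. kv n = v}. ?c n)" by (simp add: sum.inter_filter)
    finally show ?thesis ..
  qed
  have "(\<Sum>n\<in>?K. cst (?c n) * xm (rep (kv n)))
    = (\<Sum>v\<in>kv ` ?K. \<Sum>n\<in>{n \<in> ?K. kv n = v}. cst (?c n) * xm (rep (kv n)))"
    by (rule sum.group[symmetric]) auto
  also have "\<dots> = (\<Sum>v\<in>kv ` ?K. cst (\<Sum>n\<in>{n \<in> ?K. kv n = v}. ?c n) * xm (rep v))"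
    by (rule sum.cong) (auto simp: hom_type_simps(8)[OF hom_type_cst] sum_distrib_right)
  also have "\<dots> = 0" unfolding zv by simp
  finally have 0: "(\<Sum>n\<in>?K. cst (?c n) * xm (rep (kv n))) = 0" .
  have "f = (\<Sum>n\<in>?K. cst (?c n) * xm n) - (\<Sum>n\<in>?K. cst (?c n) * xm (rep (kv n)))"
    unfolding 0 by (simp add: expansion_xm[symmetric])
  also have "\<dots> = (\<Sum>n\<in>?K. cst (?c n) * (xm n - xm (rep (kv n))))"
    by (simp add: sum_subtractf right_diff_distrib)
  also have "\<dots> \<in> Z"
  proof (intro ideal_set_closed(7)[OF Z] ideal_set_closed(3)[OF Z])
    fix n
    have k: "\<kappa> i n = \<kappa> i (rep (kv n))" if "i < r" for i using kv_eq[OF rep[of n] that] ..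
    show "xm n - xm (rep (kv n)) \<in> Z"
      unfolding Z_def using xm_torsion_congruence[OF P xm k diff[OF k]] by blast
  qed
  finally show ?thesis by (simp add: Z_def)
qed

end

section \<open>The ring k[t, 1/t] and its point t = 1\<close>

abbreviation eval1 :: "(int \<Rightarrow>\<^sub>0 'k::comm_ring_1) \<Rightarrow> 'k"
  where "eval1 \<equiv> mlift (\<lambda>a. a) (\<lambda>_. 1)"

lemma hom_type_eval1: "hom_type eval1"
  by (rule hom_type_mlift[OF hom_type_id]) auto

lemma eval1_loc_par: "eval1 (loc_par :: int \<Rightarrow>\<^sub>0 'k::field) = 0"
  by (simp add: hom_type_simps[OF hom_type_eval1] mlift_single)

lemma loc_par_dvd_mon: "(loc_par :: int \<Rightarrow>\<^sub>0 'k::field) dvd mon z - 1"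
proof -
  have nat: "(loc_par :: int \<Rightarrow>\<^sub>0 'k) dvd mon (int k) - 1" for k
  proof -
    have "mon (int k) = (mon 1 ^ k :: int \<Rightarrow>\<^sub>0 'k)"
      by (simp add: mon_power nmul_def)
    moreover have "(mon 1 - 1 :: int \<Rightarrow>\<^sub>0 'k) dvd mon 1 ^ k - 1 ^ k" by (metis dvd_triv_left power_diff_sumr2)
    ultimately show ?thesis by simp
  qed
  show ?thesis
  proof (cases "z \<ge> 0")
    case True
    then show ?thesis using nat[of "nat z"] by simp
  next
    case False
    have "mon z - 1 = - (mon z * (mon (- z) - 1) :: int \<Rightarrow>\<^sub>0 'k)"
      by (simp add: right_diff_distrib mult_single)
    moreover have "(loc_par :: int \<Rightarrow>\<^sub>0 'k) dvd mon (- z) - 1" using nat[of "nat (- z)"] False by simp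
    ultimately show ?thesis by simp
  qed
qed

lemma eval1_zero_iff: "eval1 f = 0 \<longleftrightarrow> (loc_par :: int \<Rightarrow>\<^sub>0 'k::field) dvd f"
proof
  have "loc_par dvd f - cst (eval1 f)" for f :: "int \<Rightarrow>\<^sub>0 'k"
  proof (induction f rule: pm_induct)
    case (add f g)
    have "f + g - cst (eval1 (f + g)) = (f - cst (eval1 f)) + (g - cst (eval1 g))"
      unfolding hom_type_simps(2)[OF hom_type_eval1] single_add by simp
    then show ?case using add by (simp only: dvd_add)
  next
    case (single n c)
    have "Poly_Mapping.single n c - cst (eval1 (Poly_Mapping.single n c)) = cst c * (mon n - 1)"
      by (simp add: mlift_single right_diff_distrib mult_single)
    then show ?case by (simp only: dvd_mult loc_par_dvd_mon)
  qed
  from this[of f] show "eval1 f = 0 \<Longrightarrow> loc_par dvd f" by simp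
  show "loc_par dvd f \<Longrightarrow> eval1 f = 0"
    using eval1_loc_par by (auto simp: hom_type_simps(3)[OF hom_type_eval1] elim!: dvdE)
qed

lemma lookup_loc_par_mult:
  "Poly_Mapping.lookup ((loc_par :: int \<Rightarrow>\<^sub>0 'k::field) * u) k = Poly_Mapping.lookup u (k - 1) - Poly_Mapping.lookup u k"
proof (induction u rule: pm_induct)
  case (add f g)
  then show ?case by (simp add: distrib_left lookup_add)
next
  case (single n c)
  have "Poly_Mapping.lookup (Poly_Mapping.single (1 + n) c) k = Poly_Mapping.lookup (Poly_Mapping.single n c) (k - 1)"
    by (auto simp: lookup_single when_def)
  then show ?case by (simp add: left_diff_distrib mult_single lookup_minus)
qed

text \<open>Division by \<open>t - 1\<close> lowers the difference between the highest and the
  lowest exponent, so it can be repeated only finitely often.\<close>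

lemma loc_par_factorization:
  fixes f :: "int \<Rightarrow>\<^sub>0 'k::field"
  assumes "f \<noteq> 0"
  shows "\<exists>n u. f = loc_par ^ n * u \<and> eval1 u \<noteq> 0"
  using assms
proof (induction "nat (Max (Poly_Mapping.keys f) - Min (Poly_Mapping.keys f))" arbitrary: f rule: less_induct)
  case less
  show ?case
  proof (cases "eval1 f = 0")
    case False
    then show ?thesis by (intro exI[of _ 0] exI[of _ f]) simp
  next
    case True
    then obtain u where u: "f = loc_par * u" using eval1_zero_iff by (blast elim: dvdE)
    then have "u \<noteq> 0" using less.prems by auto
    let ?K = "Poly_Mapping.keys u" and ?L = "Poly_Mapping.keys f"
    have K: "finite ?K" "?K \<noteq> {}" using \<open>u \<noteq> 0\<close> by auto
    have out: "Poly_Mapping.lookup u (Max ?K + 1) = 0" "Poly_Mapping.lookup u (Min ?K - 1) = 0"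
      using Max_ge[OF K(1), of "Max ?K + 1"] Min_le[OF K(1), of "Min ?K - 1"] by (auto simp: in_keys_iff)
    have "Max ?K + 1 \<in> ?L" "Min ?K \<in> ?L"
      using Max_in[OF K] Min_in[OF K] out unfolding u by (auto simp: in_keys_iff lookup_loc_par_mult)
    then have "Max ?K + 1 \<le> Max ?L" "Min ?L \<le> Min ?K" by auto
    moreover have "Min ?K \<le> Max ?K" using Max_in[OF K] K by simp
    ultimately have "nat (Max ?K - Min ?K) < nat (Max ?L - Min ?L)" by linarith
    from less.hyps[OF this \<open>u \<noteq> 0\<close>] obtain n v where "u = loc_par ^ n * v" "eval1 v \<noteq> 0" by blast
    then show ?thesis using u by (intro exI[of _ "Suc n"] exI[of _ v]) (simp add: mult.assoc)
  qed
qed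

text \<open>A certificate that \<open>J\<close> is a complete intersection locally at
  \<open>P\<close>. There, \<open>Q 0\<close> is zero, \<open>Q (Suc i)\<close> is generated by
  \<open>Q i\<close> and \<open>g i\<close>, and \<open>Q d\<close> agrees with \<open>J\<close>.
  Since each \<open>Q i\<close> is prime and \<open>g i\<close> lies outside it, the elements
  \<open>g i\<close> form a regular sequence.\<close>

definition lci_data :: "'a::comm_ring_1 set \<Rightarrow> 'a set \<Rightarrow> bool"
  where "lci_data P J \<longleftrightarrow> (\<exists>d Q g. (\<forall>i\<le>d. prime_set (Q i)) \<and>
    (\<forall>f\<in>Q 0. \<exists>w. w \<notin> P \<and> w * f = 0) \<and>
    (\<forall>i<d. \<forall>f\<in>Q (Suc i). \<exists>w c. w \<notin> P \<and> w * f - c * g i \<in> Q i) \<and>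
    (\<forall>l\<le>d. \<forall>i<l. g i \<in> Q l) \<and> (\<forall>i<d. g i \<notin> Q i) \<and> J \<subseteq> Q d \<and> (\<forall>i<d. g i \<in> J))"

context twisted_coordinates
begin

lemma curve_fun_add:
  assumes "\<And>n. (\<Sum>i<r. e i * \<kappa> i n) \<ge> 0"
  shows "curve_fun r \<kappa> w e (m + n) = (curve_fun r \<kappa> w e m * curve_fun r \<kappa> w e n :: int \<Rightarrow>\<^sub>0 'k)"
proof -
  have s: "(\<Sum>i<r. v i * \<kappa> i (m + n)) = (\<Sum>i<r. v i * \<kappa> i m) + (\<Sum>i<r. v i * \<kappa> i n)" for v :: "nat \<Rightarrow> int"
    by (simp add: kappa_add distrib_left sum.distrib)
  have "mon (x + y) = (mon x * mon y :: int \<Rightarrow>\<^sub>0 'k)" for x y by (simp add: mult_single)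
  then show ?thesis
    unfolding curve_fun_def s nat_add_distrib[OF assms assms] power_add by (simp only: mult_ac)
qed

lemma curve_fun_zero: "curve_fun r \<kappa> w e 0 = (1 :: int \<Rightarrow>\<^sub>0 'k)"
  by (simp add: curve_fun_def kappa_zero)

lemma hom_type_curve_hom:
  assumes "\<And>n. (\<Sum>i<r. e i * \<kappa> i n) \<ge> 0"
  shows "hom_type (curve_hom r \<kappa> \<phi> w e)"
  unfolding curve_hom_def
  by (rule hom_type_mlift[OF hom_type_cst])
    (simp_all add: phi curve_fun_zero curve_fun_add[OF assms] mult_ac hom_type_simps(3)[OF hom_type_cst])

lemma curve_hom_xm: "curve_hom r \<kappa> \<phi> w e (xm n) = curve_fun r \<kappa> w e n"
proof -
  have "cst (inverse (\<phi> n)) * cst (\<phi> n) = (1 :: int \<Rightarrow>\<^sub>0 'k)" using phi(3)[of n] by (simp add: mult_single)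
  then show ?thesis
    by (simp add: curve_hom_def twisted_mon_def mlift_single mult.assoc[symmetric])
qed

lemma curve_hom_cst: "curve_hom r \<kappa> \<phi> w e (cst c) = cst c"
  by (simp add: curve_hom_def mlift_single phi curve_fun_zero)

lemma curve_fun_basis:
  assumes e: "\<And>n. (\<Sum>i<r. e i * \<kappa> i n) \<ge> 0" "e j \<ge> 0" and j: "j < r"
  shows "curve_fun r \<kappa> w e (a j) = (mon (w j) * loc_par ^ nat (e j) * curve_fun r \<kappa> w e (b j) :: int \<Rightarrow>\<^sub>0 'k)"
proof -
  have s: "(\<Sum>i<r. v i * \<kappa> i (a j)) = v j + (\<Sum>i<r. v i * \<kappa> i (b j))" for v :: "nat \<Rightarrow> int"
  proof -
    have "(\<Sum>i<r. v i * \<kappa> i (a j)) = (\<Sum>i<r. (if i = j then v i else 0) + v i * \<kappa> i (b j))"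
      by (rule sum.cong) (use kappa_basis j in \<open>auto simp: distrib_left\<close>)
    then show ?thesis using j by (simp add: sum.distrib)
  qed
  have "mon (w j + (\<Sum>i<r. w i * \<kappa> i (b j))) = (mon (w j) * mon (\<Sum>i<r. w i * \<kappa> i (b j)) :: int \<Rightarrow>\<^sub>0 'k)"
    by (simp add: mult_single)
  then show ?thesis
    unfolding curve_fun_def s nat_add_distrib[OF e(2) e(1)[of "b j"]] power_add by (simp only: mult_ac)
qed

end

text \<open>The curve parameter t is expressed as the rational function \<open>T\<close>; by
  \<open>h_zero\<close> coordinate 0 is the free variable \<open>rfv 0\<close>, and on the curve
  coordinate \<open>j\<close> has the value \<open>T powi w j * (T - 1) powi e j\<close>. The
  equation \<open>U j = V j\<close> expresses this value without denominators. By
  \<open>UV_avoid\<close> both of its sides are invertible away from \<open>x\<close>, which matters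
  because \<open>elimination\<close> multiplies by powers of \<open>U j * V j\<close>.\<close>

locale monomial_curve = twisted_coordinates r \<kappa> a b \<phi>
  for r :: nat and \<kappa> :: "nat \<Rightarrow> 'n::cancel_comm_monoid_add \<Rightarrow> int" and a b :: "nat \<Rightarrow> 'n"
    and \<phi> :: "'n \<Rightarrow> 'k::field" +
  fixes w e :: "nat \<Rightarrow> int" and T :: "'k ratfun" and U V :: "nat \<Rightarrow> 'n \<Rightarrow>\<^sub>0 'k"
  assumes r_pos: "0 < r"
    and e_sum: "(\<Sum>i<r. e i * \<kappa> i n) \<ge> 0"
    and T: "T \<noteq> 0" "T \<noteq> 1"
    and h_zero: "T powi w 0 * (T - 1) powi e 0 = rfv 0"
    and UV_nonzero: "1 \<le> j \<Longrightarrow> j < r \<Longrightarrow> H 0 = rfv 0 \<Longrightarrow> (\<And>i. H i \<noteq> 0) \<Longrightarrow> Theta r \<kappa> \<phi> H (V j) \<noteq> 0"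
    and UV_eq: "1 \<le> j \<Longrightarrow> j < r \<Longrightarrow> H 0 = rfv 0 \<Longrightarrow> (\<And>i. H i \<noteq> 0) \<Longrightarrow>
      Theta r \<kappa> \<phi> H (U j) * (T powi w j * (T - 1) powi e j) = H j * Theta r \<kappa> \<phi> H (V j)"
    and h_var: "1 \<le> j \<Longrightarrow> j < r \<Longrightarrow> T powi w j * (T - 1) powi e j \<noteq> rfv j"
    and UV_curve: "1 \<le> j \<Longrightarrow> j < r \<Longrightarrow> curve_hom r \<kappa> \<phi> w e (U j) = curve_hom r \<kappa> \<phi> w e (V j)"
    and t_range: "mon 1 \<in> range (curve_hom r \<kappa> \<phi> w e)" "mon (- 1) \<in> range (curve_hom r \<kappa> \<phi> w e)"
    and UV_avoid: "1 \<le> j \<Longrightarrow> j < r \<Longrightarrow> prime_set P \<Longrightarrow> {f. curve_hom r \<kappa> \<phi> w e f = 0} \<subseteq> P \<Longrightarrow>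
      (\<And>g. curve_hom r \<kappa> \<phi> w e g = loc_par \<Longrightarrow> g \<notin> P) \<Longrightarrow> (\<And>n. twisted_mon \<phi> n \<notin> P) \<Longrightarrow>
      U j \<notin> P \<and> V j \<notin> P"
begin

abbreviation \<psi> :: "('n \<Rightarrow>\<^sub>0 'k) \<Rightarrow> int \<Rightarrow>\<^sub>0 'k" where "\<psi> \<equiv> curve_hom r \<kappa> \<phi> w e"

lemmas hom_psi = hom_type_curve_hom[of e w, OF e_sum]
lemmas psi_simps = hom_type_simps[OF hom_psi]

lemma surj_psi: "\<exists>g. \<psi> g = f"
proof -
  have R: "x + y \<in> range \<psi>" "x * y \<in> range \<psi>" if xy: "x \<in> range \<psi>" "y \<in> range \<psi>" for x y
  proof -
    obtain g h where "x = \<psi> g" "y = \<psi> h" using xy by blast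
    then show "x + y \<in> range \<psi>" "x * y \<in> range \<psi>"
      using psi_simps(2)[of g h] psi_simps(3)[of g h] by (metis rangeI)+
  qed
  have c: "cst k \<in> range \<psi>" for k using curve_hom_cst[of w e k] by (metis rangeI)
  have p: "mon (z * int k) \<in> range \<psi>" if "mon z \<in> range \<psi>" for z k
  proof (induction k)
    case 0
    then show ?case using c[of 1] by simp
  next
    case (Suc k)
    have "mon (z * int (Suc k)) = (mon z * mon (z * int k) :: int \<Rightarrow>\<^sub>0 'k)"
      by (simp add: mult_single algebra_simps)
    then show ?case using R(2)[OF that Suc] by simp
  qed
  have m: "mon z \<in> range \<psi>" for z
  proof (cases "z \<ge> 0")
    case True
    then show ?thesis using p[OF t_range(1), of "nat z"] by simp
  next
    case False
    then show ?thesis using p[OF t_range(2), of "nat (- z)"] by simp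
  qed
  have "f \<in> range \<psi>"
  proof (induction f rule: pm_induct)
    case (single n k)
    have "Poly_Mapping.single n k = (cst k * mon n :: int \<Rightarrow>\<^sub>0 'k)" by (simp add: mult_single)
    then show ?case using R(2)[OF c m] by metis
  qed (rule R(1))
  then show ?thesis by auto
qed

definition h :: "nat \<Rightarrow> 'k ratfun" where "h i = T powi w i * (T - 1) powi e i"

lemma h_nonzero: "h i \<noteq> 0" using T by (simp add: h_def)

text \<open>Restriction to the curve followed by the substitution of \<open>T\<close> for t agrees
  with evaluation at \<open>h\<close> on scalars and on monomials. Consequently the kernel of \<psi>
  is contained in the last prime of the chain.\<close>

lemma Theta_h_factors: "Theta r \<kappa> \<phi> h f = mlift rfc (\<lambda>z. T powi z) (\<psi> f)"
proof (rule hom_type_ext_mon[where f = "Theta r \<kappa> \<phi> h" and g = "\<lambda>f. mlift rfc (\<lambda>z. T powi z) (\<psi> f)"])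
  let ?\<iota> = "mlift rfc (\<lambda>z. T powi z) :: (int \<Rightarrow>\<^sub>0 'k) \<Rightarrow> 'k ratfun"
  have hi: "hom_type ?\<iota>"
    by (rule hom_type_mlift[OF hom_type_rfc]) (use T in \<open>auto simp: power_int_add\<close>)
  show "hom_type (Theta r \<kappa> \<phi> h)" by (rule hom_type_Theta) (rule h_nonzero)
  show "hom_type (\<lambda>f. ?\<iota> (\<psi> f))" by (rule hom_type_comp[OF hi hom_psi])
  note ios = hom_type_simps[OF hi]
  have ic: "?\<iota> (cst k) = rfc k" for k
    by (simp add: mlift_single hom_type_simps(4)[OF hom_type_rfc])
  have im: "?\<iota> (mon z) = T powi z" for z
    by (simp add: mlift_single hom_type_simps(1,4)[OF hom_type_rfc])
  show "Theta r \<kappa> \<phi> h (cst k) = ?\<iota> (\<psi> (cst k))" for k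
    unfolding curve_hom_cst ic by (rule Theta_cst) (rule h_nonzero)
  show "Theta r \<kappa> \<phi> h (mon n) = ?\<iota> (\<psi> (mon n))" for n
  proof -
    have "?\<iota> loc_par = T - 1" unfolding ios(6) ios(1) im by simp
    then have "?\<iota> (curve_fun r \<kappa> w e n) = T powi (\<Sum>i<r. w i * \<kappa> i n) * (T - 1) ^ nat (\<Sum>i<r. e i * \<kappa> i n)"
      unfolding curve_fun_def ios(3) ios(7) im by simp
    also have "(T - 1) ^ nat (\<Sum>i<r. e i * \<kappa> i n) = (T - 1) powi (\<Sum>i<r. e i * \<kappa> i n)"
      using e_sum[of n] by (simp add: power_int_def)
    also have "T powi (\<Sum>i<r. w i * \<kappa> i n) * (T - 1) powi (\<Sum>i<r. e i * \<kappa> i n)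
      = (\<Prod>i<r. T powi (w i * \<kappa> i n)) * (\<Prod>i<r. (T - 1) powi (e i * \<kappa> i n))"
    proof -
      have "z powi (\<Sum>i\<in>A. v i) = (\<Prod>i\<in>A. z powi v i)" if "z \<noteq> 0" "finite A"
        for z :: "'k ratfun" and v :: "nat \<Rightarrow> int" and A
        using that(2,1) by (induction A rule: finite_induct) (simp_all add: power_int_add)
      then show ?thesis using T by simp
    qed
    also have "\<dots> = chi r \<kappa> h n"
      unfolding chi_def h_def prod.distrib[symmetric]
      by (rule prod.cong) (simp_all add: power_int_mult_distrib power_int_mult)
    finally have 1: "Theta r \<kappa> \<phi> h (xm n) = ?\<iota> (\<psi> (xm n))" unfolding curve_hom_xm Theta_xm ..
    have "mon n = cst (\<phi> n) * xm n" using single_eq_xm[of n 1] by simp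
    then show ?thesis
      using 1 hom_type_simps(3)[OF hom_type_Theta[of h, OF h_nonzero]] Theta_cst[of h, OF h_nonzero]
      by (simp only: psi_simps(3) ios(3) curve_hom_cst ic)
  qed
qed

lemma lci_on_curve:
  assumes P: "prime_set P" and ker: "{f. \<psi> f = 0} \<subseteq> P" and par: "\<And>g. \<psi> g = loc_par \<Longrightarrow> g \<notin> P"
  shows "lci_data P {f. \<psi> f = 0}"
proof -
  note I = prime_set_ideal[OF P]
  have cong: "f \<in> P \<longleftrightarrow> g \<in> P" if "\<psi> f = \<psi> g" for f g
    using ideal_set_cong[OF I, of f g] ker that psi_simps(6)[of f g] by auto
  obtain g0 where g0: "\<psi> g0 = loc_par" using surj_psi by blast
  \<comment> \<open>A monomial restricts to a power of t times a power of \<open>t - 1\<close>. The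
    first is a unit, and the second stays outside \<open>P\<close> because \<open>P\<close> avoids
    the local parameter.\<close>
  have xmP: "xm n \<notin> P" for n
  proof
    assume n: "xm n \<in> P"
    let ?W = "\<Sum>i<r. w i * \<kappa> i n" and ?E = "nat (\<Sum>i<r. e i * \<kappa> i n)"
    obtain s where s: "\<psi> s = mon (- ?W)" using surj_psi by blast
    have "\<psi> (s * xm n) = mon (- ?W) * mon ?W * loc_par ^ ?E"
      unfolding psi_simps(3) s curve_hom_xm curve_fun_def by (simp only: mult.assoc)
    also have "\<dots> = \<psi> (g0 ^ ?E)" by (simp add: psi_simps(7) g0 mult_single)
    finally have "g0 ^ ?E \<in> P" using cong ideal_set_closed(3)[OF I n] by blast
    then show False using prime_set_power[OF P] par g0 by blast
  qed
  \<comment> \<open>In \<open>Hs i\<close> the coordinates up to \<open>i\<close> take their values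
    on the curve and the others are free variables. Coordinate 0 has the value \<open>rfv 0\<close>
    in either case, so \<open>Hs 0\<close> consists of variables only.\<close>
  define Hs where "Hs i l = (if l \<le> i then h l else rfv l)" for i l
  have Hs0: "Hs i 0 = rfv 0" for i using h_zero by (simp add: Hs_def h_def)
  have Hs: "Hs i l \<noteq> 0" for i l by (simp add: Hs_def h_nonzero rfv_nonzero)
  have HsSuc: "Hs (Suc i) = (Hs i)(Suc i := h (Suc i))" for i
    by (rule ext) (auto simp: Hs_def le_Suc_eq)
  let ?T = "\<lambda>i. Theta r \<kappa> \<phi> (Hs i)"
  have Th: "hom_type (?T i)" for i by (rule hom_type_Theta) (rule Hs)
  define Q where "Q i = {f. ?T i f = 0}" for i
  define g where "g i = U (Suc i) - V (Suc i)" for i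
  have T_g: "?T i (g l) = ?T i (U (Suc l)) - ?T i (V (Suc l))" for i l
    unfolding g_def by (rule hom_type_simps(6)[OF Th])
  have rel: "?T i (U (Suc l)) * h (Suc l) = Hs i (Suc l) * ?T i (V (Suc l))" "?T i (V (Suc l)) \<noteq> 0"
    if "l < r - 1" for i l
    using UV_eq[of "Suc l" "Hs i"] UV_nonzero[of "Suc l" "Hs i"] Hs Hs0 that unfolding h_def by auto
  show ?thesis
    unfolding lci_data_def
  \<comment> \<open>Only r - 1 equations occur because coordinate 0 is the free variable along the
    curve.\<close>
  proof (rule exI[of _ "r - 1"], rule exI[of _ Q], rule exI[of _ g], intro conjI allI ballI impI)
    show "prime_set (Q i)" for i unfolding Q_def by (rule prime_set_kernel[OF Th])
    show "\<exists>w. w \<notin> P \<and> w * f = 0" if "f \<in> Q 0" for f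
    proof (rule Theta_generic_kernel[OF P xmP])
      have "Hs 0 = rfv" using Hs0[of 0] by (auto simp: Hs_def)
      then show "Theta r \<kappa> \<phi> rfv f = 0" using that by (simp add: Q_def)
      show "xm m - xm n \<in> P" if mn: "\<And>i. i < r \<Longrightarrow> \<kappa> i m = \<kappa> i n" for m n
      proof -
        have "curve_fun r \<kappa> w e m = (curve_fun r \<kappa> w e n :: int \<Rightarrow>\<^sub>0 'k)"
          using mn by (simp add: curve_fun_def)
        then have "\<psi> (xm m - xm n) = 0" by (simp add: psi_simps(6) curve_hom_xm)
        then show ?thesis using ker by blast
      qed
    qed
    show "\<exists>w c. w \<notin> P \<and> w * f - c * g i \<in> Q i" if i: "i < r - 1" and f: "f \<in> Q (Suc i)" for i f
    proof -
      have f0: "Theta r \<kappa> \<phi> ((Hs i)(Suc i := h (Suc i))) f = 0" using f by (simp add: Q_def HsSuc)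
      have "Suc i < r" using i by simp
      from elimination[of "Hs i", OF Hs h_nonzero this rel(1)[OF i] f0]
      obtain M c where "?T i ((U (Suc i) * V (Suc i)) ^ M * f - c * (U (Suc i) - V (Suc i))) = 0" by blast
      moreover have "(U (Suc i) * V (Suc i)) ^ M \<notin> P"
        using UV_avoid[of "Suc i", OF _ _ P ker par xmP] i prime_set_power[OF P] prime_set_mult[OF P]
        by (metis One_nat_def Suc_le_mono \<open>Suc i < r\<close> le0)
      ultimately show ?thesis unfolding Q_def g_def by blast
    qed
    show "g i \<in> Q l" if "l \<le> r - 1" "i < l" for i l
    proof -
      have "Hs l (Suc i) = h (Suc i)" using that by (simp add: Hs_def)
      then show ?thesis using rel(1)[of i l] that h_nonzero[of "Suc i"] by (simp add: Q_def T_g)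
    qed
    show "g i \<notin> Q i" if i: "i < r - 1" for i
    proof
      assume "g i \<in> Q i"
      then have "?T i (U (Suc i)) = ?T i (V (Suc i))" by (simp add: Q_def T_g)
      then have "h (Suc i) = Hs i (Suc i)" using rel[OF i, of i] by (simp add: mult.commute)
      then show False using h_var[of "Suc i"] i unfolding h_def Hs_def by simp
    qed
    show "{f. \<psi> f = 0} \<subseteq> Q (r - 1)"
    proof
      fix f assume "f \<in> {f. \<psi> f = 0}"
      then have "Theta r \<kappa> \<phi> h f = 0" by (simp add: Theta_h_factors mlift_zero)
      moreover have "Theta r \<kappa> \<phi> (Hs (r - 1)) f = Theta r \<kappa> \<phi> h f"
        unfolding Theta_expansion chi_def by (intro sum.cong prod.cong arg_cong2[where f = "(*)"]) (auto simp: Hs_def)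
      ultimately show "f \<in> Q (r - 1)" by (simp add: Q_def)
    qed
    show "g i \<in> {f. \<psi> f = 0}" if "i < r - 1" for i
      using UV_curve[of "Suc i"] that by (simp add: g_def psi_simps(6))
  qed
qed

lemma eval1_psi:
  assumes x: "\<And>n. x n = (if (\<Sum>i<r. e i * \<kappa> i n) = 0 then \<phi> n else 0)"
  shows "eval1 (\<psi> f) = mlift (\<lambda>a. a) x f"
proof -
  have "eval1 (\<psi> f) = (\<Sum>n\<in>Poly_Mapping.keys f. Poly_Mapping.lookup f n * (\<phi> n * eval1 (curve_fun r \<kappa> w e n)))"
    unfolding curve_hom_def mlift_def[of cst] hom_type_simps(8)[OF hom_type_eval1] hom_type_simps(3)[OF hom_type_eval1]
    by (simp add: mlift_single)
  also have "eval1 (curve_fun r \<kappa> w e n :: int \<Rightarrow>\<^sub>0 'k) = (if (\<Sum>i<r. e i * \<kappa> i n) = 0 then 1 else 0)" for n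
    using e_sum[of n] unfolding curve_fun_def hom_type_simps(3)[OF hom_type_eval1] hom_type_simps(7)[OF hom_type_eval1] eval1_loc_par
    by (simp add: mlift_single)
  then have "(\<Sum>n\<in>Poly_Mapping.keys f. Poly_Mapping.lookup f n * (\<phi> n * eval1 (curve_fun r \<kappa> w e n))) = mlift (\<lambda>a. a) x f"
    unfolding mlift_def[of "\<lambda>a. a" x] by (intro sum.cong) (auto simp: x)
  finally show ?thesis .
qed

end

definition curve_through :: "('n::cancel_comm_monoid_add \<Rightarrow> 'k::field) \<Rightarrow> bool"
  where "curve_through x \<longleftrightarrow> (\<exists>\<psi> :: ('n \<Rightarrow>\<^sub>0 'k) \<Rightarrow> int \<Rightarrow>\<^sub>0 'k. hom_type \<psi> \<and> (\<forall>f. \<exists>g. \<psi> g = f) \<and>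
    (\<forall>f. eval1 (\<psi> f) = mlift (\<lambda>a. a) x f) \<and>
    (\<forall>P. prime_set P \<longrightarrow> {f. \<psi> f = 0} \<subseteq> P \<longrightarrow> (\<forall>g. \<psi> g = loc_par \<longrightarrow> g \<notin> P) \<longrightarrow> lci_data P {f. \<psi> f = 0}))"

lemma (in monomial_curve) curve_through_eval:
  assumes "\<And>n. x n = (if (\<Sum>i<r. e i * \<kappa> i n) = 0 then \<phi> n else 0)"
  shows "curve_through x"
  unfolding curve_through_def
  using hom_psi surj_psi eval1_psi[OF assms] lci_on_curve by (intro exI[of _ \<psi>]) blast

section \<open>Construction of the curves, according to the face of \<open>x\<close>\<close>

lemma twisted_coordinatesI:
  fixes \<phi> :: "'n::cancel_comm_monoid_add \<Rightarrow> 'k::field"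
  assumes "monoid_coords UNIV r \<kappa> a b" "\<phi> 0 = 1" "\<And>m n. \<phi> (m + n) = \<phi> m * \<phi> n" "\<And>n. \<phi> n \<noteq> 0"
    and "\<And>m n :: 'n. torsion_eq m n \<Longrightarrow> \<exists>l. of_nat l \<noteq> (0::'k) \<and> nmul l m = nmul l n"
  shows "twisted_coordinates r \<kappa> a b \<phi>"
  using assms by unfold_locales (auto simp: monoid_coords_def)

lemma rfv_neq_one: "rfv i \<noteq> (1 :: 'k::field ratfun)"
proof
  assume "rfv i = (1 :: 'k ratfun)"
  then have "mon (Poly_Mapping.single i 1) = (1 :: (nat \<Rightarrow>\<^sub>0 int) \<Rightarrow>\<^sub>0 'k)"
    using rf_eq_iff[of "mon (Poly_Mapping.single i 1)" "1 :: (nat \<Rightarrow>\<^sub>0 int) \<Rightarrow>\<^sub>0 'k"]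
    by (simp add: rfv_def hom_type_simps(1)[OF hom_type_rf])
  then have "Poly_Mapping.keys (mon (Poly_Mapping.single i 1) :: (nat \<Rightarrow>\<^sub>0 int) \<Rightarrow>\<^sub>0 'k) = {0}" by simp
  then have "Poly_Mapping.single i (1::int) = 0" by simp
  then show False by (metis lookup_single_eq lookup_zero zero_neq_one)
qed

lemma single_neq_zero: "Poly_Mapping.single i (1::int) \<noteq> 0"
  by (metis lookup_single_eq lookup_zero zero_neq_one)

text \<open>Cleared of denominators, these fractions are the values of an outer coordinate on the
  curves of \<open>curve_leaving_torus\<close> and \<open>curve_through_vertex\<close>. They involve
  \<open>y_0\<close> only and so differ from the variable \<open>y_j\<close>, as the coefficient of
  a single monomial shows.\<close>

lemma rfv_neq_fraction:
  assumes "j \<noteq> 0"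
  shows "rfv j * rfv 0 \<noteq> rfv 0 - (1 :: 'k::field ratfun)"
    and "rfv j * (1 - rfv 0) \<noteq> (rfv 0 :: 'k::field ratfun)"
proof -
  let ?y = "\<lambda>i. mon (Poly_Mapping.single i 1) :: (nat \<Rightarrow>\<^sub>0 int) \<Rightarrow>\<^sub>0 'k"
  note rs = hom_type_simps[OF hom_type_rf]
  have d: "Poly_Mapping.single j (1::int) + Poly_Mapping.single 0 1 \<noteq> 0"
    "Poly_Mapping.single 0 (1::int) \<noteq> Poly_Mapping.single j 1"
    "Poly_Mapping.single 0 (1::int) \<noteq> Poly_Mapping.single j 1 + Poly_Mapping.single 0 1"
    using assms by (metis lookup_add lookup_single_eq lookup_single_not_eq lookup_zero add.right_neutral zero_neq_one,
      metis lookup_single_eq lookup_single_not_eq zero_neq_one,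
      metis single_neq_zero add_cancel_right_left)
  show "rfv j * rfv 0 \<noteq> rfv 0 - (1 :: 'k ratfun)"
  proof
    assume "rfv j * rfv 0 = rfv 0 - (1 :: 'k ratfun)"
    then have "rf (?y j * ?y 0) = rf (?y 0 - 1)" by (simp only: rfv_def rs(1) rs(3) rs(6))
    then have "?y j * ?y 0 = ?y 0 - 1" using rf_eq_iff by blast
    then have "Poly_Mapping.lookup (?y j * ?y 0) 0 = Poly_Mapping.lookup (?y 0 - 1) 0" by simp
    then show False using d(1) single_neq_zero[of 0]
      by (simp add: mult_single lookup_single when_def lookup_minus lookup_one)
  qed
  show "rfv j * (1 - rfv 0) \<noteq> (rfv 0 :: 'k ratfun)"
  proof
    assume "rfv j * (1 - rfv 0) = (rfv 0 :: 'k ratfun)"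
    then have "rf (?y j * (1 - ?y 0)) = rf (?y 0)" by (simp only: rfv_def rs(1) rs(3) rs(6))
    then have "?y j * (1 - ?y 0) = ?y 0" using rf_eq_iff by blast
    then have "Poly_Mapping.lookup (?y j - ?y j * ?y 0) (Poly_Mapping.single 0 1) = Poly_Mapping.lookup (?y 0) (Poly_Mapping.single 0 1)"
      by (simp add: right_diff_distrib)
    then show False using d(2,3)
      by (auto simp: mult_single lookup_single when_def lookup_minus split: if_splits)
  qed
qed

text \<open>Two independent coordinates are combined: \<open>e\<close> vanishes at \<open>n1\<close>
  but not at \<open>n2\<close>, so subtracting a large multiple of it from \<kappa> 0, with suitable
  signs, makes the value at \<open>n2\<close> negative without affecting the one at
  \<open>n1\<close>. In rank one no such function need exist, as the natural numbers show.\<close>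

lemma additive_both_signs:
  assumes co: "monoid_coords (UNIV :: 'n::cancel_comm_monoid_add set) r \<kappa> a b" and r: "2 \<le> r"
  shows "\<exists>p :: 'n \<Rightarrow> int. additive_on UNIV p \<and> (\<exists>m. p m > 0) \<and> (\<exists>n. p n < 0)"
proof -
  have add: "additive_on UNIV (\<kappa> 0)" "additive_on UNIV (\<kappa> 1)"
    and dual: "\<kappa> 0 (a 0) = \<kappa> 0 (b 0) + 1" "\<kappa> 0 (a 1) = \<kappa> 0 (b 1)" "\<kappa> 1 (a 1) = \<kappa> 1 (b 1) + 1"
    using co r by (auto simp: monoid_coords_def)
  obtain n1 where n1: "\<kappa> 0 n1 \<noteq> 0" using dual(1) by (metis add_cancel_left_right zero_neq_one)
  define e where "e n = \<kappa> 0 n1 * \<kappa> 1 n - \<kappa> 1 n1 * \<kappa> 0 n" for n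
  have "e (a 1) = e (b 1) + \<kappa> 0 n1" using dual by (simp add: e_def algebra_simps)
  then obtain n2 where n2: "e n2 \<noteq> 0" using n1 by (metis add_cancel_left_left)
  define M where "M = \<bar>\<kappa> 0 n2\<bar> + 1"
  define p where "p n = sgn (\<kappa> 0 n1) * \<kappa> 0 n - M * sgn (e n2) * e n" for n
  have "e n1 = 0" by (simp add: e_def)
  then have "p n1 = \<bar>\<kappa> 0 n1\<bar>" by (simp add: p_def abs_sgn mult.commute)
  then have "p n1 > 0" using n1 by simp
  moreover have "p n2 < 0"
  proof -
    have "p n2 = sgn (\<kappa> 0 n1) * \<kappa> 0 n2 - M * \<bar>e n2\<bar>"
      by (simp add: p_def abs_sgn mult_ac)
    moreover have "sgn (\<kappa> 0 n1) * \<kappa> 0 n2 \<le> M - 1" by (auto simp: sgn_if abs_if M_def)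
    moreover have "M * 1 \<le> M * \<bar>e n2\<bar>" using n2 by (intro mult_left_mono) (auto simp: M_def)
    ultimately show ?thesis by linarith
  qed
  moreover have "additive_on UNIV p"
    using add by (auto simp: additive_on_def p_def e_def algebra_simps)
  ultimately show ?thesis by blast
qed

text \<open>A set of integers that is closed under addition and contains both signs is a subgroup,
  so the values of \<open>p\<close> are the multiples of their least positive member
  \<open>d\<close>. Division by \<open>d\<close> gives the values 1 and -1, which put both t and 1/t
  in the image for the curve in the torus.\<close>

lemma additive_attains_units:
  fixes p :: "'n::cancel_comm_monoid_add \<Rightarrow> int"
  assumes p: "additive_on UNIV p" and pos: "p m > 0" and neg: "p n < 0"
  shows "\<exists>q :: 'n \<Rightarrow> int. additive_on UNIV q \<and> (\<exists>m. q m = 1) \<and> (\<exists>n. q n = - 1)"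
proof -
  have U: "submon (UNIV :: 'n set)" by (simp add: submon_def)
  have add: "p (x + y) = p x + p y" for x y using p by (simp add: additive_on_def)
  have nm: "p (nmul k x) = int k * p x" for k x by (rule additive_on_nmul[OF U p]) simp
  define D where "D d \<longleftrightarrow> d > 0 \<and> (\<exists>x. p x = int d)" for d
  have "D (nat (p m))" using pos by (auto simp: D_def)
  define d where "d = (LEAST d. D d)"
  have "D d" unfolding d_def by (rule LeastI) (rule \<open>D (nat (p m))\<close>)
  then obtain x where x: "d > 0" "p x = int d" by (auto simp: D_def)
  have min: "d \<le> k" if "D k" for k unfolding d_def by (rule Least_le) (rule that)
  have pmod: "p y mod int d = 0" if y: "p z = p y mod int d" for y z
  proof (rule ccontr)
    assume "p y mod int d \<noteq> 0"
    then have "p z > 0" using y x(1) pos_mod_sign[of "int d" "p y"] by linarith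
    then have "D (nat (p z))" by (auto simp: D_def)
    then have "int d \<le> p z" using min \<open>p z > 0\<close> by force
    then show False using y x(1) pos_mod_bound[of "int d" "p y"] by linarith
  qed
  have negd: "p y mod int d = 0" if "p y < 0" for y
  proof (rule pmod)
    have "p y div int d \<le> 0" using that x(1) by (simp add: div_nonpos_pos_le0)
    then show "p (y + nmul (nat (- (p y div int d))) x) = p y mod int d"
      by (simp add: add nm x(2) minus_mult_div_eq_mod[symmetric] mult.commute)
  qed
  then obtain k where "p n = int d * k" by (meson dvd_def mod_eq_0_iff_dvd neg)
  then have k: "p n = int d * k" "k < 0" using neg x(1) by (auto simp: zero_less_mult_iff mult_less_0_iff)
  define y where "y = n + nmul (nat (- k - 1)) x"
  have y: "p y = - int d" using k by (simp add: y_def add nm x(2) algebra_simps)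
  have dvd: "int d dvd p z" for z
  proof (cases "p z < 0")
    case True
    then show ?thesis using negd by auto
  next
    case False
    have "p z mod int d = 0"
    proof (rule pmod)
      have "p z div int d \<ge> 0" using False x(1) by (simp add: pos_imp_zdiv_nonneg_iff)
      then show "p (z + nmul (nat (p z div int d)) y) = p z mod int d"
        by (simp add: add nm y minus_mult_div_eq_mod[symmetric] mult.commute)
    qed
    then show ?thesis by auto
  qed
  define q where "q z = p z div int d" for z
  have "additive_on UNIV q"
    using dvd by (auto simp: additive_on_def q_def add div_plus_div_distrib_dvd_left)
  moreover have "q x = 1" using x by (simp add: q_def)
  moreover have "q y = (int d * (- 1)) div int d" by (simp add: q_def y)
  then have "q y = - 1" using x(1) by (simp only: nonzero_mult_div_cancel_left of_nat_eq_0_iff)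
  ultimately show ?thesis by blast
qed

context
  fixes x :: "'n::cancel_comm_monoid_add \<Rightarrow> 'k::field" and \<phi> :: "'n \<Rightarrow> 'k"
    and r s :: nat and \<kappa> :: "nat \<Rightarrow> 'n \<Rightarrow> int" and a b :: "nat \<Rightarrow> 'n"
  assumes tame: "\<And>m n :: 'n. torsion_eq m n \<Longrightarrow> \<exists>l. of_nat l \<noteq> (0::'k) \<and> nmul l m = nmul l n"
    and phi: "\<phi> 0 = 1" "\<And>m n. \<phi> (m + n) = \<phi> m * \<phi> n" "\<And>n. \<phi> n \<noteq> 0"
    and co: "monoid_coords UNIV r \<kappa> a b"
begin

lemma tc: "twisted_coordinates r \<kappa> a b \<phi>"
  by (rule twisted_coordinatesI[OF co phi tame])

interpretation twisted_coordinates r \<kappa> a b \<phi> by (rule tc)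

text \<open>For \<open>x\<close> in the torus the curve is the translate by \<phi> of a
  one-parameter subgroup: coordinate 0 is t, all others are 1, and the equations are
  \<open>xm (a j) = xm (b j)\<close>.\<close>

lemma curve_in_torus:
  assumes x: "\<And>n. x n = \<phi> n" and r: "0 < r" and pm: "\<kappa> 0 m = 1" "\<kappa> 0 n = - 1"
  shows "curve_through x"
proof -
  define w :: "nat \<Rightarrow> int" where "w i = (if i = 0 then 1 else 0)" for i
  define e :: "nat \<Rightarrow> int" where "e i = 0" for i
  have cf: "curve_fun r \<kappa> w e n = (mon (\<kappa> 0 n) :: int \<Rightarrow>\<^sub>0 'k)" for n
  proof -
    have "(\<Sum>i<r. w i * \<kappa> i n) = (\<Sum>i<r. if i = 0 then \<kappa> i n else 0)"
      by (rule sum.cong) (auto simp: w_def)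
    then show ?thesis using r by (simp add: curve_fun_def e_def)
  qed
  interpret monomial_curve r \<kappa> a b \<phi> w e "rfv 0" "\<lambda>j. twisted_mon \<phi> (a j)" "\<lambda>j. twisted_mon \<phi> (b j)"
  proof
    show "rfv 0 powi w 0 * (rfv 0 - 1) powi e 0 = (rfv 0 :: 'k ratfun)" by (simp add: w_def e_def)
    show "curve_hom r \<kappa> \<phi> w e (twisted_mon \<phi> (a j)) = curve_hom r \<kappa> \<phi> w e (twisted_mon \<phi> (b j))"
      if "1 \<le> j" "j < r" for j
      unfolding curve_hom_xm cf using kappa_basis[of 0 j] that r by simp
    show "mon 1 \<in> range (curve_hom r \<kappa> \<phi> w e)" "mon (- 1) \<in> range (curve_hom r \<kappa> \<phi> w e)"
      using curve_hom_xm[of w e m] curve_hom_xm[of w e n] unfolding cf pm by (metis rangeI)+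
    show "rfv 0 powi w j * (rfv 0 - 1) powi e j \<noteq> (rfv j :: 'k ratfun)" if "1 \<le> j" "j < r" for j
      using that rfv_neq_one[of j] by (auto simp: w_def e_def)
    show "Theta r \<kappa> \<phi> H (twisted_mon \<phi> (a j)) * (rfv 0 powi w j * (rfv 0 - 1) powi e j)
      = H j * Theta r \<kappa> \<phi> H (twisted_mon \<phi> (b j))"
      if "1 \<le> j" "j < r" "H 0 = rfv 0" "\<And>i. H i \<noteq> 0" for j H
      using chi_basis[OF co that(4,2)] that(1) by (simp add: Theta_xm w_def e_def)
  qed (use r rfv_nonzero rfv_neq_one in \<open>auto simp: e_def Theta_xm chi_nonzero\<close>)
  show ?thesis by (rule curve_through_eval) (simp add: e_def x)
qed

text \<open>Coordinate 0 is t, the other coordinates of the face are 1, and those outside it are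
  \<open>(t - 1) / t\<close>, which vanish at t = 1. Then \<open>1 - (t - 1) / t\<close> is 1/t, and
  the monomial \<open>m\<close> supplies a positive power of t, from which t is obtained by
  multiplication with powers of 1/t. The equation \<open>y_j = (y_0 - 1) / y_0\<close> is cleared of
  denominators as \<open>y_0 * y_j = y_0 - 1\<close>; as \<open>y_0\<close> itself is only the
  quotient of the monomials of \<open>a 0\<close> and \<open>b 0\<close>, it is multiplied by
  \<open>xm (b 0)\<close>.\<close>

lemma curve_leaving_torus:
  assumes x: "\<And>n. x n = (if \<forall>i\<in>{s..<r}. \<kappa> i n = 0 then \<phi> n else 0)"
    and s: "0 < s" "s < r"
    and nonneg: "\<And>i n. i \<in> {s..<r} \<Longrightarrow> \<kappa> i n \<ge> 0" and b0: "\<And>i. i \<in> {s..<r} \<Longrightarrow> b i = 0"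
    and m: "\<kappa> 0 m > 0" "\<And>i. i \<in> {s..<r} \<Longrightarrow> \<kappa> i m = 0"
  shows "curve_through x"
proof -
  define w :: "nat \<Rightarrow> int" where "w i = (if i = 0 then 1 else if i < s then 0 else - 1)" for i
  define e :: "nat \<Rightarrow> int" where "e i = (if i < s then 0 else 1)" for i
  define U where "U j = (if j < s then xm (a j) else xm (a 0) * xm (a j))" for j
  define V where "V j = (if j < s then xm (b j) else xm (a 0) - xm (b 0))" for j
  have es: "(\<Sum>i<r. e i * \<kappa> i n) \<ge> 0" for n
    by (rule sum_nonneg) (use nonneg in \<open>auto simp: e_def\<close>)
  note hp = hom_type_curve_hom[of e w, OF es] note ps = hom_type_simps[OF hp]
  note cb = curve_fun_basis[of e, OF es, where w = w]
  have a0: "curve_fun r \<kappa> w e (a 0) = (mon 1 * curve_fun r \<kappa> w e (b 0) :: int \<Rightarrow>\<^sub>0 'k)"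
    using cb[of 0] s by (simp add: w_def e_def)
  have aj: "curve_fun r \<kappa> w e (a j) = (mon (- 1) * loc_par :: int \<Rightarrow>\<^sub>0 'k)" if "j \<in> {s..<r}" for j
    using cb[of j] that s b0[OF that] by (auto simp: w_def e_def curve_fun_zero)
  have pV: "curve_hom r \<kappa> \<phi> w e (xm (a 0) - xm (b 0)) = loc_par * curve_fun r \<kappa> w e (b 0)"
    by (simp add: ps(6) curve_hom_xm a0 left_diff_distrib)
  have nz: "rfv i \<noteq> (0 :: 'k ratfun)" "rfv i \<noteq> (1 :: 'k ratfun)" for i by (rule rfv_nonzero, rule rfv_neq_one)
  have hw: "rfv 0 powi w j * (rfv 0 - 1) powi e j = (if j < s then 1 else (rfv 0 - 1) / rfv 0 :: 'k ratfun)"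
    if "1 \<le> j" for j
    using that by (simp add: w_def e_def power_int_minus field_simps)
  have ratio: "Theta r \<kappa> \<phi> H (xm (a 0) - xm (b 0)) = (rfv 0 - 1) / rfv 0 * chi r \<kappa> H (a 0)"
    if "H 0 = rfv 0" "\<And>i. H i \<noteq> 0" for H
  proof -
    have "chi r \<kappa> H (a 0) = rfv 0 * chi r \<kappa> H (b 0)" using chi_basis[OF co that(2), of 0] s that(1) by simp
    then show ?thesis
      using nz(1)[of 0]
      by (simp add: hom_type_simps(6)[OF hom_type_Theta[of H, OF that(2)]] Theta_xm field_simps)
  qed
  have inv: "mon (- 1) \<in> range (curve_hom r \<kappa> \<phi> w e)"
  proof -
    have "curve_hom r \<kappa> \<phi> w e (1 - xm (a s)) = 1 - mon (- 1) * loc_par"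
      using aj[of s] s by (simp add: ps(1,6) curve_hom_xm)
    also have "\<dots> = mon (- 1)" by (simp add: right_diff_distrib mult_single)
    finally show ?thesis by (metis rangeI)
  qed
  interpret monomial_curve r \<kappa> a b \<phi> w e "rfv 0" U V
  proof
    show "rfv 0 powi w 0 * (rfv 0 - 1) powi e 0 = (rfv 0 :: 'k ratfun)" using s by (simp add: w_def e_def)
    show "curve_hom r \<kappa> \<phi> w e (U j) = curve_hom r \<kappa> \<phi> w e (V j)" if "1 \<le> j" "j < r" for j
    proof (cases "j < s")
      case True
      then show ?thesis using cb[of j] that by (simp add: U_def V_def curve_hom_xm w_def e_def)
    next
      case False
      have "curve_hom r \<kappa> \<phi> w e (U j) = mon 1 * curve_fun r \<kappa> w e (b 0) * (mon (- 1) * loc_par)"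
        using False that aj[of j] by (simp add: U_def ps(3) curve_hom_xm a0)
      also have "\<dots> = (mon 1 * mon (- 1)) * (loc_par * curve_fun r \<kappa> w e (b 0))" by (simp only: mult_ac)
      also have "\<dots> = curve_hom r \<kappa> \<phi> w e (V j)" using False pV by (simp add: V_def mult_single)
      finally show ?thesis .
    qed
    show "mon (- 1) \<in> range (curve_hom r \<kappa> \<phi> w e)" by (rule inv)
    show "mon 1 \<in> range (curve_hom r \<kappa> \<phi> w e)"
    proof -
      obtain g where g: "curve_hom r \<kappa> \<phi> w e g = mon (- 1)" using inv by auto
      have cm: "curve_fun r \<kappa> w e m = (mon (\<kappa> 0 m) :: int \<Rightarrow>\<^sub>0 'k)"
      proof -
        have "(\<Sum>i<r. w i * \<kappa> i m) = (\<Sum>i<r. if i = 0 then \<kappa> i m else 0)"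
          by (rule sum.cong) (use m(2) in \<open>auto simp: w_def\<close>)
        moreover have "(\<Sum>i<r. e i * \<kappa> i m) = 0"
          by (rule sum.neutral) (use m(2) in \<open>auto simp: e_def\<close>)
        ultimately show ?thesis using s by (simp add: curve_fun_def)
      qed
      have "curve_hom r \<kappa> \<phi> w e (xm m * g ^ nat (\<kappa> 0 m - 1)) = mon (\<kappa> 0 m) * mon (- 1) ^ nat (\<kappa> 0 m - 1)"
        by (simp add: ps(3) ps(7) curve_hom_xm cm g)
      also have "\<dots> = mon 1" using m(1) by (simp add: mon_power nmul_def mult_single)
      finally show ?thesis by (metis rangeI)
    qed
    show "rfv 0 powi w j * (rfv 0 - 1) powi e j \<noteq> (rfv j :: 'k ratfun)" if "1 \<le> j" "j < r" for j
    proof -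
      have "rfv j * rfv 0 \<noteq> rfv 0 - (1 :: 'k ratfun)" by (rule rfv_neq_fraction(1)) (use that(1) in simp)
      then show ?thesis using nz[of j] nz[of 0] unfolding hw[OF that(1)] by (auto simp: field_simps)
    qed
    show "Theta r \<kappa> \<phi> H (V j) \<noteq> 0" if "1 \<le> j" "j < r" "H 0 = rfv 0" "\<And>i. H i \<noteq> 0" for j H
      using ratio[of H, OF that(3,4)] nz[of 0]
      by (simp add: V_def Theta_xm chi_nonzero[of H, OF that(4)])
    show "Theta r \<kappa> \<phi> H (U j) * (rfv 0 powi w j * (rfv 0 - 1) powi e j) = H j * Theta r \<kappa> \<phi> H (V j)"
      if "1 \<le> j" "j < r" "H 0 = rfv 0" "\<And>i. H i \<noteq> 0" for j H
    proof (cases "j < s")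
      case True
      then show ?thesis unfolding hw[OF that(1)]
        using chi_basis[OF co that(4,2)] by (simp add: U_def V_def Theta_xm)
    next
      case False
      have "Theta r \<kappa> \<phi> H (U j) = chi r \<kappa> H (a 0) * H j"
        using False that chi_basis[OF co that(4,2)] b0[of j]
        by (simp add: U_def hom_type_simps(3)[OF hom_type_Theta[of H, OF that(4)]] Theta_xm chi_zero[OF co])
      then show ?thesis unfolding hw[OF that(1)] using ratio[of H, OF that(3,4)] False by (simp add: V_def)
    qed
    show "U j \<notin> P \<and> V j \<notin> P"
      if "1 \<le> j" "j < r" and P: "prime_set P" "{f. curve_hom r \<kappa> \<phi> w e f = 0} \<subseteq> P"
        "\<And>g. curve_hom r \<kappa> \<phi> w e g = loc_par \<Longrightarrow> g \<notin> P" "\<And>n. xm n \<notin> P" for j P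
    proof -
      have "U j \<notin> P" using P(4) prime_set_mult[OF P(1)] by (auto simp: U_def)
      \<comment> \<open>On the curve this element is \<open>t - 1\<close> times the monomial of
        \<open>b 0\<close>, and neither factor comes from \<open>P\<close>.\<close>
      moreover have "xm (a 0) - xm (b 0) \<notin> P"
      proof
        assume v: "xm (a 0) - xm (b 0) \<in> P"
        obtain g1 where g1: "curve_hom r \<kappa> \<phi> w e g1 = loc_par"
        proof -
          have "mon 1 \<in> range (curve_hom r \<kappa> \<phi> w e)" by fact
          then obtain t where "curve_hom r \<kappa> \<phi> w e t = mon 1" by auto
          then have "curve_hom r \<kappa> \<phi> w e (t - 1) = loc_par" by (simp add: ps(1,6))
          then show ?thesis by (rule that)
        qed
        have "curve_hom r \<kappa> \<phi> w e ((xm (a 0) - xm (b 0)) - g1 * xm (b 0)) = 0"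
          using pV g1 by (simp add: ps(3,6) curve_hom_xm)
        then have "(xm (a 0) - xm (b 0)) - g1 * xm (b 0) \<in> P" using P(2) by blast
        then have "g1 * xm (b 0) \<in> P" using ideal_set_cong[OF prime_set_ideal[OF P(1)]] v by blast
        then show False using prime_set_mult[OF P(1)] P(4) P(3)[OF g1] by blast
      qed
      ultimately show ?thesis using P(4) by (auto simp: V_def)
    qed
  qed (use s es rfv_nonzero rfv_neq_one in auto)
  show ?thesis
  proof (rule curve_through_eval)
    fix n
    have "(\<Sum>i<r. e i * \<kappa> i n) = (\<Sum>i\<in>{s..<r}. \<kappa> i n)"
      by (rule sum.mono_neutral_cong_right) (auto simp: e_def)
    then have "(\<Sum>i<r. e i * \<kappa> i n) = 0 \<longleftrightarrow> (\<forall>i\<in>{s..<r}. \<kappa> i n = 0)"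
      using sum_nonneg_eq_0_iff[of "{s..<r}" "\<lambda>i. \<kappa> i n"] nonneg by auto
    then show "x n = (if (\<Sum>i<r. e i * \<kappa> i n) = 0 then \<phi> n else 0)" unfolding x by simp
  qed
qed

text \<open>Here every coordinate of the curve vanishes at t = 1. Coordinate 0 is
  \<open>(t - 1) / t\<close> and all others are \<open>t - 1\<close>, so that \<open>1 - y_0\<close>
  is 1/t and \<open>1 + y_1\<close> is t; this uses a second coordinate. Solving
  \<open>y_0 = (T - 1) / T\<close> gives \<open>T = 1 / (1 - y_0)\<close>, and
  \<open>y_j = y_0 / (1 - y_0)\<close> becomes the equation
  \<open>(1 - y_0) * y_j = y_0\<close>.\<close>

lemma curve_through_vertex:
  assumes x: "\<And>n. x n = (if \<forall>i\<in>{0..<r}. \<kappa> i n = 0 then \<phi> n else 0)" and r: "2 \<le> r"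
    and nonneg: "\<And>i n. i < r \<Longrightarrow> \<kappa> i n \<ge> 0" and b0: "\<And>i. i < r \<Longrightarrow> b i = 0"
  shows "curve_through x"
proof -
  define w :: "nat \<Rightarrow> int" where "w i = (if i = 0 then - 1 else 0)" for i
  define e :: "nat \<Rightarrow> int" where "e i = 1" for i
  define T :: "'k ratfun" where "T = 1 / (1 - rfv 0)"
  define U where "U j = (1 - xm (a 0)) * xm (a j)" for j
  define V where "V j = xm (a 0)" for j :: nat
  have es: "(\<Sum>i<r. e i * \<kappa> i n) \<ge> 0" for n
    by (rule sum_nonneg) (use nonneg in \<open>auto simp: e_def\<close>)
  note hp = hom_type_curve_hom[of e w, OF es] note ps = hom_type_simps[OF hp]
  note cb = curve_fun_basis[of e, OF es, where w = w]
  have a0: "curve_fun r \<kappa> w e (a 0) = (mon (- 1) * loc_par :: int \<Rightarrow>\<^sub>0 'k)"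
    using cb[of 0] r b0[of 0] by (simp add: w_def e_def curve_fun_zero)
  have aj: "curve_fun r \<kappa> w e (a j) = (loc_par :: int \<Rightarrow>\<^sub>0 'k)" if "1 \<le> j" "j < r" for j
    using cb[of j] that b0[of j] by (simp add: w_def e_def curve_fun_zero)
  have p1: "curve_hom r \<kappa> \<phi> w e (1 - xm (a 0)) = mon (- 1)"
    by (simp add: ps(1,6) curve_hom_xm a0 right_diff_distrib mult_single)
  have y: "rfv 0 \<noteq> (0 :: 'k ratfun)" "1 - rfv 0 \<noteq> (0 :: 'k ratfun)"
    using rfv_nonzero rfv_neq_one[of 0] by auto
  have T1: "T - 1 = rfv 0 / (1 - rfv 0)" using y by (simp add: T_def field_simps)
  have hw: "T powi w j * (T - 1) powi e j = rfv 0 / (1 - rfv 0)" if "1 \<le> j" for j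
    using that by (simp add: w_def e_def T1)
  have c0: "chi r \<kappa> H (a 0) = rfv 0" if "H 0 = rfv 0" "\<And>i. H i \<noteq> 0" for H
    using chi_basis[OF co that(2), of 0] r that(1) b0[of 0] by (simp add: chi_zero[OF co])
  have range1: "mon 1 \<in> range (curve_hom r \<kappa> \<phi> w e)"
  proof -
    have "curve_hom r \<kappa> \<phi> w e (1 + xm (a 1)) = mon 1"
      using aj[of 1] r by (simp add: ps(1,2) curve_hom_xm)
    then show ?thesis by (metis rangeI)
  qed
  interpret monomial_curve r \<kappa> a b \<phi> w e T U V
  proof
    show "T powi w 0 * (T - 1) powi e 0 = (rfv 0 :: 'k ratfun)"
      unfolding T1 using y by (simp add: w_def e_def T_def power_int_minus)
    show "curve_hom r \<kappa> \<phi> w e (U j) = curve_hom r \<kappa> \<phi> w e (V j)" if "1 \<le> j" "j < r" for j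
      using aj[OF that] p1 by (simp add: U_def V_def ps(3) curve_hom_xm a0)
    show "mon (- 1) \<in> range (curve_hom r \<kappa> \<phi> w e)" using p1 by (metis rangeI)
    show "mon 1 \<in> range (curve_hom r \<kappa> \<phi> w e)" by (rule range1)
    show "T powi w j * (T - 1) powi e j \<noteq> (rfv j :: 'k ratfun)" if "1 \<le> j" "j < r" for j
    proof -
      have "rfv j * (1 - rfv 0) \<noteq> (rfv 0 :: 'k ratfun)" by (rule rfv_neq_fraction(2)) (use that(1) in simp)
      then show ?thesis unfolding hw[OF that(1)] using y by (auto simp: field_simps)
    qed
    show "Theta r \<kappa> \<phi> H (V j) \<noteq> 0" if "1 \<le> j" "j < r" "H 0 = rfv 0" "\<And>i. H i \<noteq> 0" for j H
      by (simp add: V_def Theta_xm chi_nonzero[of H, OF that(4)])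
    show "Theta r \<kappa> \<phi> H (U j) * (T powi w j * (T - 1) powi e j) = H j * Theta r \<kappa> \<phi> H (V j)"
      if "1 \<le> j" "j < r" "H 0 = rfv 0" "\<And>i. H i \<noteq> 0" for j H
    proof -
      note Th = hom_type_simps[OF hom_type_Theta[of H, OF that(4)]]
      have "Theta r \<kappa> \<phi> H (U j) = (1 - rfv 0) * H j"
        using chi_basis[OF co that(4,2)] b0[OF that(2)] c0[of H, OF that(3,4)]
        by (simp add: U_def Th(1,3,6) Theta_xm chi_zero[OF co])
      then show ?thesis unfolding hw[OF that(1)] using c0[of H, OF that(3,4)] y by (simp add: V_def Theta_xm)
    qed
    show "U j \<notin> P \<and> V j \<notin> P"
      if "1 \<le> j" "j < r" and P: "prime_set P" "{f. curve_hom r \<kappa> \<phi> w e f = 0} \<subseteq> P"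
        "\<And>g. curve_hom r \<kappa> \<phi> w e g = loc_par \<Longrightarrow> g \<notin> P" "\<And>n. xm n \<notin> P" for j P
    proof -
      note I = prime_set_ideal[OF P(1)]
      obtain t where t: "curve_hom r \<kappa> \<phi> w e t = mon 1" using range1 by auto
      have "1 - xm (a 0) \<notin> P"
      proof
        assume "1 - xm (a 0) \<in> P"
        then have 1: "t * (1 - xm (a 0)) \<in> P" by (rule ideal_set_closed(3)[OF I])
        have "curve_hom r \<kappa> \<phi> w e (t * (1 - xm (a 0)) - 1) = mon 1 * mon (- 1) - 1"
          unfolding ps(6) ps(3) ps(1) t p1[unfolded ps(6) ps(1)] ..
        then have "curve_hom r \<kappa> \<phi> w e (t * (1 - xm (a 0)) - 1) = 0" by (simp add: mult_single)
        then have "t * (1 - xm (a 0)) - 1 \<in> P" using P(2) by blast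
        then show False using ideal_set_cong[OF I] 1 prime_set_one[OF P(1)] by blast
      qed
      then show ?thesis using P(4) prime_set_mult[OF P(1)] by (auto simp: U_def V_def)
    qed
  qed (use r es y in \<open>auto simp: T_def field_simps\<close>)
  show ?thesis
  proof (rule curve_through_eval)
    fix n
    have "(\<Sum>i<r. e i * \<kappa> i n) = 0 \<longleftrightarrow> (\<forall>i\<in>{0..<r}. \<kappa> i n = 0)"
      using sum_nonneg_eq_0_iff[of "{..<r}" "\<lambda>i. \<kappa> i n"] nonneg by (auto simp: e_def)
    then show "x n = (if (\<Sum>i<r. e i * \<kappa> i n) = 0 then \<phi> n else 0)" unfolding x by simp
  qed
qed

end

theorem regular_character_curve:
  fixes x :: "'n::cancel_comm_monoid_add \<Rightarrow> 'k::field" and \<Gamma> :: "'n set"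
  assumes fin: "finite \<Gamma>" "mspan \<Gamma> = UNIV"
    and tame: "\<And>m n :: 'n. torsion_eq m n \<Longrightarrow> \<exists>l. of_nat l \<noteq> (0::'k) \<and> nmul l m = nmul l n"
    and phi: "\<phi> 0 = 1" "\<And>m n. \<phi> (m + n) = \<phi> m * \<phi> n" "\<And>n. \<phi> n \<noteq> 0"
    and co: "monoid_coords UNIV r \<kappa> a b" and s: "s \<le> r" and r: "2 \<le> r"
    and outer: "\<forall>i\<in>{s..<r}. b i = 0 \<and> (\<forall>n. \<kappa> i n \<ge> 0)"
    and inner: "\<forall>i<s. \<forall>j\<in>{s..<r}. \<kappa> j (a i) = 0 \<and> \<kappa> j (b i) = 0"
    and x: "\<And>n. x n = (if \<forall>i\<in>{s..<r}. \<kappa> i n = 0 then \<phi> n else 0)"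
  shows "curve_through x"
proof -
  consider "s = r" | "s = 0" | "0 < s" "s < r" using s by linarith
  then show ?thesis
  proof cases
    case 1
    obtain p :: "'n \<Rightarrow> int" and m n where p: "additive_on UNIV p" "p m = 1" "p n = - 1"
      using additive_both_signs[OF co r] additive_attains_units by blast
    have p0: "p 0 = 0" using additive_on_submon(1)[of UNIV p] p(1) by (simp add: submon_def)
    \<comment> \<open>The given coordinates are exchanged for others whose first member attains both
      1 and -1.\<close>
    obtain t \<kappa>' a' b' where co': "monoid_coords UNIV (Suc t) \<kappa>' a' b'" "\<kappa>' 0 = p"
      using monoid_coords_exist_extending[OF fin(1), of p m 0] p p0 unfolding fin(2) by auto
    show ?thesis
      by (rule curve_in_torus[OF tame phi co'(1)]) (use 1 x p co'(2) in auto)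
  next
    case 2
    show ?thesis
      by (rule curve_through_vertex[OF tame phi co]) (use 2 x r outer in auto)
  next
    case 3
    show ?thesis
    proof (cases "\<kappa> 0 (a 0) > 0 \<or> \<kappa> 0 (b 0) > 0")
      case True
      then obtain m where "\<kappa> 0 m > 0" "\<And>i. i \<in> {s..<r} \<Longrightarrow> \<kappa> i m = 0" using inner 3 by blast
      then show ?thesis
        using curve_leaving_torus[OF tame phi co, of x s m] x 3 outer by blast
    next
      case False
      \<comment> \<open>Since \<open>\<kappa> 0 (a 0) = \<kappa> 0 (b 0) + 1\<close>, in this case
        \<open>\<kappa> 0 (b 0)\<close> is negative. Changing the sign of coordinate 0 and
        exchanging \<open>a 0\<close> with \<open>b 0\<close> makes it positive.\<close>
      define \<kappa>' where "\<kappa>' i n = (if i = 0 then - \<kappa> 0 n else \<kappa> i n)" for i n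
      define a' where "a' i = (if i = 0 then b 0 else a i)" for i
      define b' where "b' i = (if i = 0 then a 0 else b i)" for i
      have co': "monoid_coords UNIV r \<kappa>' a' b'"
        unfolding monoid_coords_def
      proof (intro conjI allI impI ballI)
        show "additive_on UNIV (\<kappa>' i)" if "i < r" for i
          using co that by (cases "i = 0") (auto simp: monoid_coords_def additive_on_def \<kappa>'_def)
        show "\<kappa>' i (a' j) = \<kappa>' i (b' j) + (if i = j then 1 else 0)" if "i < r" "j < r" for i j
          using co that 3 by (auto simp: monoid_coords_def \<kappa>'_def a'_def b'_def)
        show "torsion_eq m n" if "\<forall>i<r. \<kappa>' i m = \<kappa>' i n" for m n
        proof -
          have "\<kappa> i m = \<kappa> i n" if "i < r" for i
            using \<open>\<forall>i<r. \<kappa>' i m = \<kappa>' i n\<close> that by (cases "i = 0") (auto simp: \<kappa>'_def dest!: spec[of _ i])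
          then show ?thesis using co by (auto simp: monoid_coords_def)
        qed
      qed auto
      have "\<kappa> 0 (a 0) = \<kappa> 0 (b 0) + 1" using co 3 by (auto simp: monoid_coords_def)
      then have m: "\<kappa>' 0 (b 0) > 0" using False by (simp add: \<kappa>'_def)
      have eq: "\<kappa>' i = \<kappa> i" "b' i = b i" if "i \<in> {s..<r}" for i using that 3 by (auto simp: \<kappa>'_def b'_def)
      have x': "x n = (if \<forall>i\<in>{s..<r}. \<kappa>' i n = 0 then \<phi> n else 0)" for n
        unfolding x using eq(1) by simp
      show ?thesis
        by (rule curve_leaving_torus[OF tame phi co' x' _ _ _ _ m]) (use 3 outer inner eq in auto)
    qed
  qed
qed

section \<open>Rings represented by types, and their localizations\<close>

lemma idealI_cring:
  assumes "cring R" and sub: "I \<subseteq> carrier R" and zeroI: "\<zero>\<^bsub>R\<^esub> \<in> I"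
    and addI: "\<And>x y. x \<in> I \<Longrightarrow> y \<in> I \<Longrightarrow> x \<oplus>\<^bsub>R\<^esub> y \<in> I"
    and multI: "\<And>x r. x \<in> I \<Longrightarrow> r \<in> carrier R \<Longrightarrow> r \<otimes>\<^bsub>R\<^esub> x \<in> I"
  shows "ideal I R"
proof -
  interpret cring R by fact
  show ?thesis
  proof (rule idealI)
    show "ring R" by (rule ring_axioms)
    show "subgroup I (add_monoid R)"
    proof
      show "inv\<^bsub>add_monoid R\<^esub> x \<in> I" if x: "x \<in> I" for x
      proof -
        have "(\<ominus>\<^bsub>R\<^esub> \<one>\<^bsub>R\<^esub>) \<otimes>\<^bsub>R\<^esub> x \<in> I" using multI[OF x] by simp
        moreover have "(\<ominus>\<^bsub>R\<^esub> \<one>\<^bsub>R\<^esub>) \<otimes>\<^bsub>R\<^esub> x = \<ominus>\<^bsub>R\<^esub> x" using x sub by (auto simp: l_minus)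
        ultimately show ?thesis by (simp add: a_inv_def)
      qed
    qed (use sub zeroI addI in auto)
    show "r \<otimes>\<^bsub>R\<^esub> x \<in> I" "x \<otimes>\<^bsub>R\<^esub> r \<in> I" if "x \<in> I" "r \<in> carrier R" for x r
      using multI[OF that] that sub m_comm[of x r] by auto
  qed
qed

text \<open>A record ring presented by a type of class \<open>comm_ring_1\<close>, so that ring
  arithmetic takes place in the type. It is used with singletons for the monoid algebra and with
  cosets for the coordinate ring of the curve.\<close>

locale typed_ring =
  fixes A :: "('b, 'x) ring_scheme" and \<iota> :: "'a::comm_ring_1 \<Rightarrow> 'b"
  assumes inj: "inj \<iota>" and car: "carrier A = range \<iota>"
    and i_add: "\<iota> x \<oplus>\<^bsub>A\<^esub> \<iota> y = \<iota> (x + y)" and i_mult: "\<iota> x \<otimes>\<^bsub>A\<^esub> \<iota> y = \<iota> (x * y)"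
    and i_one: "\<one>\<^bsub>A\<^esub> = \<iota> 1" and i_zero: "\<zero>\<^bsub>A\<^esub> = \<iota> 0"
begin

lemma iota_eq [simp]: "\<iota> x = \<iota> y \<longleftrightarrow> x = y" using inj by (auto dest: injD)

lemma iota_image [simp]: "\<iota> x \<in> \<iota> ` B \<longleftrightarrow> x \<in> B" by auto

lemma iota_carrier [simp]: "\<iota> x \<in> carrier A" by (simp add: car)

lemma cring_A: "cring A"
proof (rule cringI)
  show "abelian_group A"
  proof (rule abelian_groupI)
    show "\<exists>y\<in>carrier A. y \<oplus>\<^bsub>A\<^esub> x = \<zero>\<^bsub>A\<^esub>" if x: "x \<in> carrier A" for x
    proof -
      obtain z where "x = \<iota> z" using x by (auto simp: car)
      then show ?thesis by (intro bexI[of _ "\<iota> (- z)"]) (simp_all add: i_add i_zero)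
    qed
  qed (auto simp: car i_add i_zero ac_simps)
  show "comm_monoid A" by unfold_locales (auto simp: car i_mult i_one ac_simps)
qed (auto simp: car i_add i_mult algebra_simps)

sublocale cring A by (rule cring_A)

lemma minus: "\<iota> x \<ominus>\<^bsub>A\<^esub> \<iota> y = \<iota> (x - y)"
proof -
  have "\<ominus>\<^bsub>A\<^esub> \<iota> y = \<iota> (- y)" by (rule minus_equality) (simp_all add: i_add i_zero)
  then show ?thesis by (simp add: a_minus_def i_add)
qed

lemma ideal_iota: "ideal_set I \<Longrightarrow> ideal (\<iota> ` I) A"
  by (rule idealI_cring[OF cring_A]) (auto simp: car i_add i_zero i_mult ideal_set_def)

lemma ideal_vimage:
  assumes "ideal I A"
  shows "ideal_set {x. \<iota> x \<in> I}" "I = \<iota> ` {x. \<iota> x \<in> I}"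
proof -
  interpret I: ideal I A by fact
  show "ideal_set {x. \<iota> x \<in> I}"
    unfolding ideal_set_def using I.zero_closed I.a_closed I.I_l_closed
    by (auto simp: i_zero simp flip: i_add i_mult)
  show "I = \<iota> ` {x. \<iota> x \<in> I}" using I.a_subset by (auto simp: car)
qed

lemma primeideal_iota:
  assumes "prime_set P" shows "primeideal (\<iota> ` P) A"
proof (rule primeidealI)
  show "ideal (\<iota> ` P) A" by (rule ideal_iota[OF prime_set_ideal[OF assms]])
  show "carrier A \<noteq> \<iota> ` P" using prime_set_one[OF assms] by (metis iota_carrier iota_image)
  show "x \<in> \<iota> ` P \<or> y \<in> \<iota> ` P" if xy: "x \<in> carrier A" "y \<in> carrier A" "x \<otimes>\<^bsub>A\<^esub> y \<in> \<iota> ` P" for x y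
  proof -
    obtain u v where "x = \<iota> u" "y = \<iota> v" using xy by (auto simp: car)
    then show ?thesis using prime_set_mult[OF assms, of u v] xy(3) by (simp add: i_mult)
  qed
qed (rule cring_A)

lemma primeideal_vimage:
  assumes "primeideal Q A"
  shows "prime_set {x. \<iota> x \<in> Q}" "Q = \<iota> ` {x. \<iota> x \<in> Q}"
proof -
  interpret Q: primeideal Q A by fact
  note iv = ideal_vimage[OF Q.ideal_axioms]
  have "\<iota> 1 \<notin> Q" using Q.I_notcarr Q.one_imp_carrier i_one by auto
  then show "prime_set {x. \<iota> x \<in> Q}"
    unfolding prime_set_def using iv(1) Q.I_prime by (auto simp flip: i_mult)
  show "Q = \<iota> ` {x. \<iota> x \<in> Q}" by (rule iv(2))
qed

lemma maximal_vimage: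
  assumes Q: "maximalideal Q A"
  shows "prime_set {x. \<iota> x \<in> Q}" "Q = \<iota> ` {x. \<iota> x \<in> Q}"
    "\<And>J. ideal_set J \<Longrightarrow> {x. \<iota> x \<in> Q} \<subseteq> J \<Longrightarrow> 1 \<notin> J \<Longrightarrow> J = {x. \<iota> x \<in> Q}"
proof -
  have P: "primeideal Q A" by (rule maximalideal_prime[OF Q])
  show "prime_set {x. \<iota> x \<in> Q}" and eq: "Q = \<iota> ` {x. \<iota> x \<in> Q}" using primeideal_vimage[OF P] by auto
  fix J assume J: "ideal_set J" "{x. \<iota> x \<in> Q} \<subseteq> J" "1 \<notin> J"
  have "Q \<subseteq> \<iota> ` J" by (subst eq) (rule image_mono[OF J(2)])
  then have "\<iota> ` J = Q \<or> \<iota> ` J = carrier A"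
    by (rule maximalideal.I_maximal[OF Q ideal_iota[OF J(1)]]) (auto simp: car)
  moreover have "\<iota> ` J \<noteq> carrier A" using J(3) by (metis iota_carrier iota_image)
  ultimately show "J = {x. \<iota> x \<in> Q}" by auto
qed

end

section \<open>Localization at a prime\<close>

locale typed_local = typed_ring A \<iota>
  for A :: "('b, 'x) ring_scheme" and \<iota> :: "'a::comm_ring_1 \<Rightarrow> 'b" +
  fixes P :: "'a set"
  assumes P: "prime_set P"
begin

abbreviation loc where "loc \<equiv> localization_at A (\<iota> ` P)"

definition fr :: "'a \<Rightarrow> 'a \<Rightarrow> ('b \<times> 'b) set"
  where "fr x s = fraction A (carrier A - \<iota> ` P) (\<iota> x) (\<iota> s)"

lemmas P_ideal = ideal_set_closed[OF prime_set_ideal[OF P]]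

lemma one_nP [simp]: "1 \<notin> P" by (rule prime_set_one[OF P])

lemma mult_nP [simp]: "x * y \<in> P \<longleftrightarrow> x \<in> P \<or> y \<in> P"
  using prime_set_mult[OF P] P_ideal(3,4) by blast

lemma fr_altdef: "fr x s = {(\<iota> y, \<iota> t) | y t. t \<notin> P \<and> (\<exists>u. u \<notin> P \<and> u * (t * x - s * y) = 0)}"
proof -
  have ex: "(\<exists>t\<in>carrier A - \<iota> ` P. t \<otimes>\<^bsub>A\<^esub> \<iota> w = \<zero>\<^bsub>A\<^esub>) \<longleftrightarrow> (\<exists>u. u \<notin> P \<and> u * w = 0)" for w
  proof
    show "\<exists>u. u \<notin> P \<and> u * w = 0" if "\<exists>t\<in>carrier A - \<iota> ` P. t \<otimes>\<^bsub>A\<^esub> \<iota> w = \<zero>\<^bsub>A\<^esub>"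
      using that by (auto simp: car i_mult i_zero)
    show "\<exists>t\<in>carrier A - \<iota> ` P. t \<otimes>\<^bsub>A\<^esub> \<iota> w = \<zero>\<^bsub>A\<^esub>" if u: "\<exists>u. u \<notin> P \<and> u * w = 0"
    proof -
      obtain u where "u \<notin> P" "u * w = 0" using u by blast
      then show ?thesis by (intro bexI[of _ "\<iota> u"]) (simp_all add: i_mult i_zero)
    qed
  qed
  have "z \<in> fr x s \<longleftrightarrow> z \<in> {(\<iota> y, \<iota> t) | y t. t \<notin> P \<and> (\<exists>u. u \<notin> P \<and> u * (t * x - s * y) = 0)}" for z
  proof -
    have "z \<in> fr x s \<longleftrightarrow> (\<exists>y t. z = (\<iota> y, \<iota> t) \<and> t \<notin> P \<and>
      (\<exists>u\<in>carrier A - \<iota> ` P. u \<otimes>\<^bsub>A\<^esub> (\<iota> t \<otimes>\<^bsub>A\<^esub> \<iota> x \<ominus>\<^bsub>A\<^esub> \<iota> s \<otimes>\<^bsub>A\<^esub> \<iota> y) = \<zero>\<^bsub>A\<^esub>))"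
      unfolding fr_def fraction_def by (cases z) (auto simp: car)
    then show ?thesis unfolding i_mult minus ex by blast
  qed
  then show ?thesis by blast
qed

lemma fr_self: "s \<notin> P \<Longrightarrow> (\<iota> x, \<iota> s) \<in> fr x s"
  unfolding fr_altdef by (intro CollectI exI[of _ x] exI[of _ s] conjI refl exI[of _ 1]) auto

lemma fr_rel_trans:
  assumes "u * (t * x - s * y) = (0::'a)" "v * (t' * y - t * z) = 0"
  shows "(u * v * t) * (t' * x - s * z) = 0"
proof -
  have "(u * v * t) * (t' * x - s * z) = v * t' * (u * (t * x - s * y)) + u * s * (v * (t' * y - t * z))"
    by (simp add: algebra_simps)
  then show ?thesis using assms by simp
qed

lemma fr_eq:
  assumes s: "s \<notin> P" "t \<notin> P"
  shows "fr x s = fr y t \<longleftrightarrow> (\<exists>u. u \<notin> P \<and> u * (t * x - s * y) = 0)"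
proof
  assume eq: "fr x s = fr y t"
  have "(\<iota> y, \<iota> t) \<in> fr x s" unfolding eq using s(2) by (rule fr_self)
  then show "\<exists>u. u \<notin> P \<and> u * (t * x - s * y) = 0" unfolding fr_altdef by auto
next
  assume "\<exists>u. u \<notin> P \<and> u * (t * x - s * y) = 0"
  then obtain u where u: "u \<notin> P" "u * (t * x - s * y) = 0" by blast
  have u': "u * (s * y - t * x) = 0"
    using u(2) by (simp add: algebra_simps)
  have 1: "\<exists>w. w \<notin> P \<and> w * (t' * y - t * z) = 0" if v: "v \<notin> P" "v * (t' * x - s * z) = 0" for v t' z
    using fr_rel_trans[OF u' v(2)] u(1) v(1) s by (intro exI[of _ "u * v * s"]) simp
  have 2: "\<exists>w. w \<notin> P \<and> w * (t' * x - s * z) = 0" if v: "v \<notin> P" "v * (t' * y - t * z) = 0" for v t' z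
    using fr_rel_trans[OF u(2) v(2)] u(1) v(1) s by (intro exI[of _ "u * v * t"]) simp
  show "fr x s = fr y t" unfolding fr_altdef using 1 2 by blast
qed

lemma fr_rep:
  assumes "z \<in> fr x s" "s \<notin> P"
  obtains y t where "z = (\<iota> y, \<iota> t)" "t \<notin> P" "fr y t = fr x s"
proof -
  obtain y t u where y: "z = (\<iota> y, \<iota> t)" "t \<notin> P" "u \<notin> P" "u * (t * x - s * y) = 0"
    using assms(1) unfolding fr_altdef by blast
  then have "fr x s = fr y t" using fr_eq assms(2) by blast
  then show thesis using that y by metis
qed

lemma loc_carrier: "carrier loc = {fr x s | x s. s \<notin> P}"
proof -
  have "carrier loc = {fraction A (carrier A - \<iota> ` P) r s | r s. r \<in> carrier A \<and> s \<in> carrier A - \<iota> ` P}"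
    by (simp add: localization_def)
  also have "\<dots> = {fr x s | x s. s \<notin> P}" (is "?L = ?R")
  proof
    show "?L \<subseteq> ?R" unfolding fr_def by (auto simp: car)
    show "?R \<subseteq> ?L"
    proof
      fix z assume "z \<in> ?R"
      then obtain x s where "z = fr x s" "s \<notin> P" by blast
      then show "z \<in> ?L" unfolding fr_def by (intro CollectI exI[of _ "\<iota> x"] exI[of _ "\<iota> s"]) auto
    qed
  qed
  finally show ?thesis .
qed

lemma fr_carrier [simp]: "s \<notin> P \<Longrightarrow> fr x s \<in> carrier loc"
  unfolding loc_carrier by blast

lemma loc_cases:
  assumes "z \<in> carrier loc" obtains x s where "z = fr x s" "s \<notin> P"
  using assms unfolding loc_carrier by blast

lemma UN_const: "U \<noteq> {} \<Longrightarrow> (\<And>x. x \<in> U \<Longrightarrow> f x = c) \<Longrightarrow> (\<Union>x\<in>U. f x) = c" by auto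

lemma loc_mult: "s \<notin> P \<Longrightarrow> t \<notin> P \<Longrightarrow> fr x s \<otimes>\<^bsub>loc\<^esub> fr y t = fr (x * y) (s * t)"
proof -
  assume st: "s \<notin> P" "t \<notin> P"
  let ?F = "fraction A (carrier A - \<iota> ` P)"
  have inner: "?F (\<iota> x' \<otimes>\<^bsub>A\<^esub> \<iota> y') (\<iota> s' \<otimes>\<^bsub>A\<^esub> \<iota> t') = fr (x * y) (s * t)"
    if p: "s' \<notin> P" "t' \<notin> P" "fr x' s' = fr x s" "fr y' t' = fr y t" for x' s' y' t'
  proof -
    obtain u where u: "u \<notin> P" "u * (s * x' - s' * x) = 0"
      using p(3) fr_eq[OF p(1) st(1)] by blast
    obtain v where v: "v \<notin> P" "v * (t * y' - t' * y) = 0"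
      using p(4) fr_eq[OF p(2) st(2)] by blast
    have "(u * v) * (s * t * (x' * y') - s' * t' * (x * y))
      = v * t * y' * (u * (s * x' - s' * x)) + u * s' * x * (v * (t * y' - t' * y))"
      by (simp add: algebra_simps)
    then have "(u * v) * (s * t * (x' * y') - s' * t' * (x * y)) = 0" using u v by simp
    then have "fr (x' * y') (s' * t') = fr (x * y) (s * t)"
      using fr_eq[of "s' * t'" "s * t"] p st u v by (metis mult_nP)
    then show ?thesis by (simp add: fr_def i_mult)
  qed
  have "fr x s \<otimes>\<^bsub>loc\<^esub> fr y t = (\<Union>(r, s)\<in>fr x s. \<Union>(r', s')\<in>fr y t. ?F (r \<otimes>\<^bsub>A\<^esub> r') (s \<otimes>\<^bsub>A\<^esub> s'))"
    by (simp add: localization_def)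
  also have "\<dots> = fr (x * y) (s * t)"
  proof (rule UN_const)
    show "fr x s \<noteq> {}" using fr_self[OF st(1)] by blast
    fix z assume "z \<in> fr x s"
    then obtain x' s' where z: "z = (\<iota> x', \<iota> s')" "s' \<notin> P" "fr x' s' = fr x s" using fr_rep st(1) by blast
    show "(case z of (r, s) \<Rightarrow> \<Union>(r', s')\<in>fr y t. ?F (r \<otimes>\<^bsub>A\<^esub> r') (s \<otimes>\<^bsub>A\<^esub> s')) = fr (x * y) (s * t)"
      unfolding z(1) prod.case
    proof (rule UN_const)
      show "fr y t \<noteq> {}" using fr_self[OF st(2)] by blast
      fix z' assume "z' \<in> fr y t"
      then obtain y' t' where z': "z' = (\<iota> y', \<iota> t')" "t' \<notin> P" "fr y' t' = fr y t" using fr_rep st(2) by blast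
      show "(case z' of (r', s'a) \<Rightarrow> ?F (\<iota> x' \<otimes>\<^bsub>A\<^esub> r') (\<iota> s' \<otimes>\<^bsub>A\<^esub> s'a)) = fr (x * y) (s * t)"
        unfolding z'(1) prod.case by (rule inner[OF z(2) z'(2) z(3) z'(3)])
    qed
  qed
  finally show ?thesis .
qed

lemma loc_add: "s \<notin> P \<Longrightarrow> t \<notin> P \<Longrightarrow> fr x s \<oplus>\<^bsub>loc\<^esub> fr y t = fr (x * t + y * s) (s * t)"
proof -
  assume st: "s \<notin> P" "t \<notin> P"
  let ?F = "fraction A (carrier A - \<iota> ` P)"
  have inner: "?F (\<iota> x' \<otimes>\<^bsub>A\<^esub> \<iota> t' \<oplus>\<^bsub>A\<^esub> \<iota> y' \<otimes>\<^bsub>A\<^esub> \<iota> s') (\<iota> s' \<otimes>\<^bsub>A\<^esub> \<iota> t') = fr (x * t + y * s) (s * t)"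
    if p: "s' \<notin> P" "t' \<notin> P" "fr x' s' = fr x s" "fr y' t' = fr y t" for x' s' y' t'
  proof -
    obtain u where u: "u \<notin> P" "u * (s * x' - s' * x) = 0"
      using p(3) fr_eq[OF p(1) st(1)] by blast
    obtain v where v: "v \<notin> P" "v * (t * y' - t' * y) = 0"
      using p(4) fr_eq[OF p(2) st(2)] by blast
    have "(u * v) * (s * t * (x' * t' + y' * s') - s' * t' * (x * t + y * s))
      = v * t * t' * (u * (s * x' - s' * x)) + u * s * s' * (v * (t * y' - t' * y))"
      by (simp add: algebra_simps)
    then have "(u * v) * (s * t * (x' * t' + y' * s') - s' * t' * (x * t + y * s)) = 0" using u v by simp
    then have "fr (x' * t' + y' * s') (s' * t') = fr (x * t + y * s) (s * t)"
      using fr_eq[of "s' * t'" "s * t"] p st u v by (metis mult_nP)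
    then show ?thesis by (simp add: fr_def i_mult i_add)
  qed
  have "fr x s \<oplus>\<^bsub>loc\<^esub> fr y t = (\<Union>(r, s)\<in>fr x s. \<Union>(r', s')\<in>fr y t.
      ?F (r \<otimes>\<^bsub>A\<^esub> s' \<oplus>\<^bsub>A\<^esub> r' \<otimes>\<^bsub>A\<^esub> s) (s \<otimes>\<^bsub>A\<^esub> s'))"
    by (simp add: localization_def)
  also have "\<dots> = fr (x * t + y * s) (s * t)"
  proof (rule UN_const)
    show "fr x s \<noteq> {}" using fr_self[OF st(1)] by blast
    fix z assume "z \<in> fr x s"
    then obtain x' s' where z: "z = (\<iota> x', \<iota> s')" "s' \<notin> P" "fr x' s' = fr x s" using fr_rep st(1) by blast
    show "(case z of (r, s) \<Rightarrow> \<Union>(r', s')\<in>fr y t. ?F (r \<otimes>\<^bsub>A\<^esub> s' \<oplus>\<^bsub>A\<^esub> r' \<otimes>\<^bsub>A\<^esub> s) (s \<otimes>\<^bsub>A\<^esub> s')) = fr (x * t + y * s) (s * t)"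
      unfolding z(1) prod.case
    proof (rule UN_const)
      show "fr y t \<noteq> {}" using fr_self[OF st(2)] by blast
      fix z' assume "z' \<in> fr y t"
      then obtain y' t' where z': "z' = (\<iota> y', \<iota> t')" "t' \<notin> P" "fr y' t' = fr y t" using fr_rep st(2) by blast
      show "(case z' of (r', s'a) \<Rightarrow> ?F (\<iota> x' \<otimes>\<^bsub>A\<^esub> s'a \<oplus>\<^bsub>A\<^esub> r' \<otimes>\<^bsub>A\<^esub> \<iota> s') (\<iota> s' \<otimes>\<^bsub>A\<^esub> s'a)) = fr (x * t + y * s) (s * t)"
        unfolding z'(1) prod.case by (rule inner[OF z(2) z'(2) z(3) z'(3)])
    qed
  qed
  finally show ?thesis .
qed

lemma loc_one: "\<one>\<^bsub>loc\<^esub> = fr 1 1" and loc_zero: "\<zero>\<^bsub>loc\<^esub> = fr 0 1"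
  by (simp_all add: localization_def fr_def i_one i_zero)

lemma to_local_fr: "to_local A (\<iota> ` P) (\<iota> x) = fr x 1"
  by (simp add: fr_def i_one)

lemma fr_eqI: "s \<notin> P \<Longrightarrow> t \<notin> P \<Longrightarrow> t * x = s * y \<Longrightarrow> fr x s = fr y t"
  using fr_eq[of s t x y] by (auto intro!: exI[of _ 1])

lemma cring_loc: "cring loc"
proof (rule cringI)
  show "abelian_group loc"
  proof (rule abelian_groupI)
    show "\<exists>y\<in>carrier loc. y \<oplus>\<^bsub>loc\<^esub> z = \<zero>\<^bsub>loc\<^esub>" if zc: "z \<in> carrier loc" for z
    proof -
      obtain x s where z: "z = fr x s" "s \<notin> P" using zc by (rule loc_cases)
      have "fr (- x) s \<oplus>\<^bsub>loc\<^esub> z = \<zero>\<^bsub>loc\<^esub>"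
        unfolding z(1) loc_zero using z(2) by (subst loc_add) (auto intro!: fr_eqI del: equalityI)
      then show ?thesis using z(2) by (intro bexI[of _ "fr (- x) s"]) auto
    qed
  qed (auto elim!: loc_cases simp: loc_add loc_zero algebra_simps intro!: fr_eqI del: equalityI)
  show "comm_monoid loc"
    by unfold_locales (auto elim!: loc_cases simp: loc_mult loc_one algebra_simps intro!: fr_eqI del: equalityI)
qed (auto elim!: loc_cases simp: loc_mult loc_add algebra_simps intro!: fr_eqI del: equalityI)

sublocale loc: cring loc by (rule cring_loc)

text \<open>Extension of ideals to the localization; \<open>con\<close> is the contraction. Together
  they identify the ideals of the localization with those ideals of the ring that are closed under
  division by elements outside \<open>P\<close>.\<close>

definition ext :: "'a set \<Rightarrow> ('b \<times> 'b) set set"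
  where "ext I = {fr x s | x s. x \<in> I \<and> s \<notin> P}"

lemma fr_in_ext:
  assumes I: "ideal_set I" and s: "s \<notin> P"
  shows "fr x s \<in> ext I \<longleftrightarrow> (\<exists>w. w \<notin> P \<and> w * x \<in> I)"
proof
  assume "fr x s \<in> ext I"
  then obtain y t where y: "y \<in> I" "t \<notin> P" "fr x s = fr y t" unfolding ext_def by blast
  then obtain u where u: "u \<notin> P" "u * (t * x - s * y) = 0" using fr_eq s by blast
  then have "(u * t) * x = (u * s) * y" by (simp add: algebra_simps)
  then have "(u * t) * x \<in> I" using ideal_set_closed(3)[OF I y(1)] by simp
  then show "\<exists>w. w \<notin> P \<and> w * x \<in> I" using u y by (intro exI[of _ "u * t"]) simp
next
  assume "\<exists>w. w \<notin> P \<and> w * x \<in> I"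
  then obtain w where w: "w \<notin> P" "w * x \<in> I" by blast
  have eq: "fr x s = fr (w * x) (w * s)" by (rule fr_eqI) (use w s in \<open>simp_all add: mult_ac\<close>)
  show "fr x s \<in> ext I" unfolding eq ext_def
    by (intro CollectI exI[of _ "w * x"] exI[of _ "w * s"] conjI refl) (use w s in simp_all)
qed

lemma ext_carrier: "ext I \<subseteq> carrier loc" unfolding ext_def by auto

lemma ideal_ext:
  assumes I: "ideal_set I" shows "ideal (ext I) loc"
proof (rule idealI_cring[OF cring_loc ext_carrier])
  note Ic = ideal_set_closed[OF I]
  show "\<zero>\<^bsub>loc\<^esub> \<in> ext I" unfolding loc_zero ext_def using Ic(1) by (intro CollectI exI[of _ 0] exI[of _ 1]) simp
  fix z assume "z \<in> ext I"
  then obtain x s where z: "z = fr x s" "x \<in> I" "s \<notin> P" unfolding ext_def by blast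
  show "z \<oplus>\<^bsub>loc\<^esub> z' \<in> ext I" if "z' \<in> ext I" for z'
  proof -
    obtain y t where z': "z' = fr y t" "y \<in> I" "t \<notin> P" using \<open>z' \<in> ext I\<close> unfolding ext_def by blast
    have "x * t + y * s \<in> I" by (intro Ic(2,4) z z')
    then show ?thesis using z z' unfolding z(1) z'(1) loc_add[OF z(3) z'(3)] ext_def
      by (intro CollectI exI[of _ "x * t + y * s"] exI[of _ "s * t"]) simp
  qed
  show "c \<otimes>\<^bsub>loc\<^esub> z \<in> ext I" if "c \<in> carrier loc" for c
  proof -
    obtain y t where c: "c = fr y t" "t \<notin> P" using \<open>c \<in> carrier loc\<close> by (rule loc_cases)
    have "y * x \<in> I" by (intro Ic(3) z)
    then show ?thesis using z c unfolding z(1) c(1) loc_mult[OF c(2) z(3)] ext_def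
      by (intro CollectI exI[of _ "y * x"] exI[of _ "t * s"]) simp
  qed
qed

definition con :: "('b \<times> 'b) set set \<Rightarrow> 'a set"
  where "con K = {x. fr x 1 \<in> K}"

lemma fr_in_ideal:
  assumes K: "ideal K loc" and s: "s \<notin> P"
  shows "fr x s \<in> K \<longleftrightarrow> x \<in> con K"
proof -
  interpret K: ideal K loc by fact
  have "fr (s * x) s = fr x 1" by (rule fr_eqI) (use s in \<open>simp_all add: mult_ac\<close>)
  then have 1: "fr s 1 \<otimes>\<^bsub>loc\<^esub> fr x s = fr x 1" and 2: "fr 1 s \<otimes>\<^bsub>loc\<^esub> fr x 1 = fr x s"
    using s by (simp_all add: loc_mult)
  show ?thesis
    unfolding con_def using K.I_l_closed[of "fr x s" "fr s 1"] K.I_l_closed[of "fr x 1" "fr 1 s"] 1 2 s by auto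
qed

lemma ideal_set_con:
  assumes K: "ideal K loc" shows "ideal_set (con K)"
proof -
  interpret K: ideal K loc by fact
  have a: "fr x 1 \<oplus>\<^bsub>loc\<^esub> fr y 1 = fr (x + y) 1" and m: "fr r 1 \<otimes>\<^bsub>loc\<^esub> fr x 1 = fr (r * x) 1" for x y r
    by (simp_all add: loc_add loc_mult)
  show ?thesis
    unfolding ideal_set_def con_def
  proof (intro conjI ballI allI)
    show "0 \<in> {x. fr x 1 \<in> K}" using K.zero_closed by (simp add: loc_zero)
    show "x + y \<in> {x. fr x 1 \<in> K}" if "x \<in> {x. fr x 1 \<in> K}" "y \<in> {x. fr x 1 \<in> K}" for x y
      using K.a_closed[of "fr x 1" "fr y 1"] that by (simp add: a)
    show "r * x \<in> {x. fr x 1 \<in> K}" if "x \<in> {x. fr x 1 \<in> K}" for x r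
      using K.I_l_closed[of "fr x 1" "fr r 1"] that by (simp add: m)
  qed
qed

lemma con_saturated:
  assumes K: "ideal K loc" and w: "w \<notin> P" "w * x \<in> con K"
  shows "x \<in> con K"
proof -
  have eq: "fr x 1 = fr (w * x) w" by (rule fr_eqI) (use w in simp_all)
  have "fr (w * x) w \<in> K" using fr_in_ideal[OF K w(1)] w(2) by simp
  then show ?thesis unfolding con_def by (simp add: eq)
qed

lemma ext_con: "ideal K loc \<Longrightarrow> ext (con K) = K"
proof -
  assume K: "ideal K loc"
  interpret K: ideal K loc by fact
  show ?thesis
  proof
    show "ext (con K) \<subseteq> K" unfolding ext_def using fr_in_ideal[OF K] by auto
    show "K \<subseteq> ext (con K)"
    proof
      fix z assume z: "z \<in> K"
      then obtain x s where "z = fr x s" "s \<notin> P" using K.a_subset by (blast elim: loc_cases)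
      then show "z \<in> ext (con K)" unfolding ext_def using fr_in_ideal[OF K] z by auto
    qed
  qed
qed

lemma con_proper: "ideal K loc \<Longrightarrow> K \<noteq> carrier loc \<Longrightarrow> con K \<subseteq> P"
proof
  fix x assume K: "ideal K loc" "K \<noteq> carrier loc" and x: "x \<in> con K"
  interpret K: ideal K loc by fact
  show "x \<in> P"
  proof (rule ccontr)
    assume "x \<notin> P"
    then have "1 \<in> con K" using con_saturated[OF K(1), of x 1] x by simp
    then have "\<one>\<^bsub>loc\<^esub> \<in> K" by (simp add: con_def loc_one)
    then show False using K(2) K.one_imp_carrier by blast
  qed
qed

lemma ext_proper: "ideal_set I \<Longrightarrow> I \<subseteq> P \<Longrightarrow> ext I \<noteq> carrier loc"
proof
  assume I: "ideal_set I" "I \<subseteq> P" "ext I = carrier loc"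
  then have "fr 1 1 \<in> ext I" by simp
  then show False using fr_in_ext[OF I(1), of 1 1] I(2) by auto
qed

lemma prime_set_con:
  assumes Q: "primeideal Q loc"
  shows "prime_set (con Q)" "con Q \<subseteq> P"
proof -
  interpret Q: primeideal Q loc by fact
  show sub: "con Q \<subseteq> P" by (rule con_proper[OF Q.ideal_axioms]) (use Q.I_notcarr in auto)
  have "x \<in> con Q \<or> y \<in> con Q" if "x * y \<in> con Q" for x y
    using Q.I_prime[of "fr x 1" "fr y 1"] that by (simp add: con_def loc_mult)
  then show "prime_set (con Q)"
    unfolding prime_set_def using ideal_set_con[OF Q.ideal_axioms] sub one_nP by blast
qed

lemma fr_unit: "x \<notin> P \<Longrightarrow> s \<notin> P \<Longrightarrow> fr x s \<in> Units loc"
proof -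
  assume x: "x \<notin> P" "s \<notin> P"
  have "fr (s * x) (x * s) = fr 1 1" by (rule fr_eqI) (use x in \<open>simp_all add: mult_ac\<close>)
  then have "fr s x \<otimes>\<^bsub>loc\<^esub> fr x s = \<one>\<^bsub>loc\<^esub>" "fr x s \<otimes>\<^bsub>loc\<^esub> fr s x = \<one>\<^bsub>loc\<^esub>"
    using x by (simp_all add: loc_mult loc_one mult.commute)
  then show ?thesis unfolding Units_def using x by auto
qed

text \<open>Numerators of the generators of the maximal ideal generate \<open>P\<close> locally, and
  contraction turns a chain of primes of the localization into one below \<open>P\<close>. The
  dimension, being finite, is attained by such a chain, which allows the number of generators to be
  compared with chains in the ring itself.\<close>

lemma regular_local_generators:
  assumes reg: "regular_local_ring loc"
  shows "\<exists>G n (Q :: nat \<Rightarrow> 'a set). finite G \<and> card G \<le> n \<and> G \<subseteq> P \<and>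
    (\<forall>K h. ideal_set K \<longrightarrow> G \<subseteq> K \<longrightarrow> h \<in> P \<longrightarrow> (\<exists>w. w \<notin> P \<and> w * h \<in> K)) \<and>
    (\<forall>i\<le>n. prime_set (Q i)) \<and> (\<forall>i<n. Q i \<subset> Q (Suc i))"
proof -
  obtain M G where M: "{I. maximalideal I loc} = {M}" and G: "G \<subseteq> carrier loc" "finite G"
    "enat (card G) = krull_dim loc" "M = genideal loc G"
    using reg unfolding regular_local_ring_def by blast
  have Mm: "maximalideal M loc" using M by blast
  note Mi = maximalideal.axioms(1)[OF Mm]
  have PI: "ideal_set P" by (rule prime_set_ideal[OF P])
  have "con M \<subseteq> P" by (rule con_proper[OF Mi]) (use maximalideal.I_notcarr[OF Mm] in auto)
  then have "M \<subseteq> ext P" using ext_con[OF Mi] unfolding ext_def by blast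
  then have ME: "M = ext P"
    using maximalideal.I_maximal[OF Mm ideal_ext[OF PI] _ ext_carrier] ext_proper[OF PI] by auto
  have GM: "G \<subseteq> M" unfolding G(4) by (rule loc.genideal_self[OF G(1)])
  have "\<exists>x. x \<in> P \<and> (\<exists>s. s \<notin> P \<and> g = fr x s)" if "g \<in> G" for g
    using that GM unfolding ME ext_def by blast
  then obtain num where num: "\<And>g. g \<in> G \<Longrightarrow> num g \<in> P \<and> (\<exists>s. s \<notin> P \<and> g = fr (num g) s)" by metis
  have gen: "\<exists>w. w \<notin> P \<and> w * h \<in> K" if K: "ideal_set K" "num ` G \<subseteq> K" and h: "h \<in> P" for K h
  proof -
    have "G \<subseteq> ext K" unfolding ext_def using num K(2) by blast
    then have "M \<subseteq> ext K" unfolding G(4) by (rule loc.genideal_minimal[OF ideal_ext[OF K(1)]])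
    moreover have "fr h 1 \<in> M" unfolding ME ext_def using h one_nP by blast
    ultimately show ?thesis using fr_in_ext[OF K(1), of 1 h] one_nP by blast
  qed
  define XS where "XS = {enat n | n. \<exists>Q. (\<forall>i\<le>n. primeideal (Q i) loc) \<and> (\<forall>i<n. Q i \<subset> Q (Suc i))}"
  have XS: "enat (card G) = Sup XS" unfolding G(3) krull_dim_def XS_def ..
  have Mp: "primeideal M loc" by (rule loc.maximalideal_prime[OF Mm])
  have "enat (card G) \<in> XS"
  \<comment> \<open>The supremum of the empty set is also 0, so in this case a chain of length 0 has
    to be exhibited; the maximal ideal provides it.\<close>
  proof (cases "card G = 0")
    case True
    show ?thesis unfolding XS_def True using Mp by (intro CollectI exI[of _ 0] conjI refl exI[of _ "\<lambda>_. M"]) auto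
  next
    case False
    show ?thesis
    proof (rule ccontr)
      assume no: "enat (card G) \<notin> XS"
      have "z \<le> enat (card G - 1)" if z: "z \<in> XS" for z
      proof -
        have "z \<le> enat (card G)" unfolding XS by (rule Sup_upper[OF z])
        moreover obtain n where "z = enat n" using z unfolding XS_def by blast
        ultimately show ?thesis using no z by (cases "n = card G") auto
      qed
      then have "enat (card G) \<le> enat (card G - 1)" unfolding XS by (rule Sup_least)
      then show False using False by simp
    qed
  qed
  then obtain Q where Q: "\<forall>i\<le>card G. primeideal (Q i) loc" "\<forall>i<card G. Q i \<subset> Q (Suc i)"
    unfolding XS_def by auto
  have strict: "con (Q i) \<subset> con (Q (Suc i))" if i: "i < card G" for i
  proof -
    have id: "ideal (Q i) loc" "ideal (Q (Suc i)) loc" using Q(1) i by (auto intro: primeideal.axioms(1))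
    have "con (Q i) \<subseteq> con (Q (Suc i))" using Q(2) i unfolding con_def by blast
    moreover have "con (Q i) \<noteq> con (Q (Suc i))"
    proof
      assume "con (Q i) = con (Q (Suc i))"
      then have "ext (con (Q i)) = ext (con (Q (Suc i)))" by (rule arg_cong)
      then have "Q i = Q (Suc i)" unfolding ext_con[OF id(1)] ext_con[OF id(2)] .
      moreover have "Q i \<subset> Q (Suc i)" using Q(2) i by simp
      ultimately show False by (simp only: less_irrefl)
    qed
    ultimately show ?thesis by blast
  qed
  show ?thesis
  proof (rule exI[of _ "num ` G"], rule exI[of _ "card G"], rule exI[of _ "\<lambda>i. con (Q i)"], intro conjI allI impI)
    show "finite (num ` G)" "card (num ` G) \<le> card G" "num ` G \<subseteq> P"
      using G(2) num by (auto simp: card_image_le)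
    show "\<exists>w. w \<notin> P \<and> w * h \<in> K" if "ideal_set K" "num ` G \<subseteq> K" "h \<in> P" for K h
      using that by (rule gen)
    show "prime_set (con (Q i))" if "i \<le> card G" for i using prime_set_con(1) Q(1) that by simp
    show "con (Q i) \<subset> con (Q (Suc i))" if "i < card G" for i using that by (rule strict)
  qed
qed

text \<open>The contraction of the generated ideal contains the numerators of \<open>XS\<close> and
  is closed under division by elements outside \<open>P\<close>. Hence it is enough to test such
  ideals \<open>K\<close> of the original ring, as \<open>gen\<close> does.\<close>

lemma genideal_image:
  assumes XS: "XS \<subseteq> carrier loc" and E: "ideal_set E" "XS \<subseteq> ext E"
    and gen: "\<And>K f. ideal_set K \<Longrightarrow> (\<And>x s. s \<notin> P \<Longrightarrow> fr x s \<in> XS \<Longrightarrow> x \<in> K) \<Longrightarrow>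
      (\<And>w x. w \<notin> P \<Longrightarrow> w * x \<in> K \<Longrightarrow> x \<in> K) \<Longrightarrow> f \<in> E \<Longrightarrow> f \<in> K"
  shows "genideal loc XS = ext E"
proof
  show "genideal loc XS \<subseteq> ext E" by (rule loc.genideal_minimal[OF ideal_ext[OF E(1)] E(2)])
  let ?G = "genideal loc XS"
  have G: "ideal ?G loc" by (rule loc.genideal_ideal[OF XS])
  have "f \<in> con ?G" if f: "f \<in> E" for f
  proof (rule gen[OF ideal_set_con[OF G] _ _ f])
    show "x \<in> con ?G" if "s \<notin> P" "fr x s \<in> XS" for x s
      using fr_in_ideal[OF G that(1)] loc.genideal_self[OF XS] that(2) by blast
    show "x \<in> con ?G" if "w \<notin> P" "w * x \<in> con ?G" for w x
      using con_saturated[OF G that] .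
  qed
  then have "ext E \<subseteq> ext (con ?G)" unfolding ext_def by blast
  then show "ext E \<subseteq> ?G" unfolding ext_con[OF G] .
qed

text \<open>Locally at \<open>P\<close> the first l equations generate exactly \<open>Q l\<close>.
  Since \<open>Q l\<close> is prime and does not contain \<open>g l\<close>, the image of
  \<open>g l\<close> is a nonzerodivisor modulo the earlier equations.\<close>

lemma lci_regular_sequence:
  assumes lci: "lci_data P J" and J: "ideal_set J" "J \<subseteq> P"
  shows "\<exists>xs. regular_sequence loc xs \<and>
    genideal loc (to_local A (\<iota> ` P) ` \<iota> ` J) = genideal loc (set xs)"
proof -
  obtain d Q g where L: "\<forall>i\<le>d. prime_set (Q i)" "\<forall>f\<in>Q 0. \<exists>w. w \<notin> P \<and> w * f = 0"
    "\<forall>i<d. \<forall>f\<in>Q (Suc i). \<exists>w c. w \<notin> P \<and> w * f - c * g i \<in> Q i"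
    "\<forall>l\<le>d. \<forall>i<l. g i \<in> Q l" "\<forall>i<d. g i \<notin> Q i" "J \<subseteq> Q d" "\<forall>i<d. g i \<in> J"
    using lci unfolding lci_data_def by (elim exE conjE)
  have Q: "\<And>i. i \<le> d \<Longrightarrow> prime_set (Q i)"
    and Q0: "\<And>f. f \<in> Q 0 \<Longrightarrow> \<exists>w. w \<notin> P \<and> w * f = 0"
    and QS: "\<And>i f. i < d \<Longrightarrow> f \<in> Q (Suc i) \<Longrightarrow> \<exists>w c. w \<notin> P \<and> w * f - c * g i \<in> Q i"
    and g_in: "\<And>l i. l \<le> d \<Longrightarrow> i < l \<Longrightarrow> g i \<in> Q l" and g_nin: "\<And>i. i < d \<Longrightarrow> g i \<notin> Q i"
    and JQ: "J \<subseteq> Q d" and gJ: "\<And>i. i < d \<Longrightarrow> g i \<in> J"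
    using L by simp_all
  define xs where "xs = map (\<lambda>i. fr (g i) 1) [0..<d]"
  have len: "length xs = d" by (simp add: xs_def)
  have nth: "xs ! i = fr (g i) 1" if "i < d" for i using that by (simp add: xs_def)
  have take: "set (take l xs) = (\<lambda>i. fr (g i) 1) ` {..<l}" if "l \<le> d" for l
    using that by (auto simp: xs_def take_map)
  \<comment> \<open>The primes of the chain stay inside \<open>P\<close>, because locally at
    \<open>P\<close> they are generated by elements of \<open>J\<close>. This makes their extensions
    proper.\<close>
  have QP: "f \<in> P" if "l \<le> d" "f \<in> Q l" for f l
    using that
  proof (induction l arbitrary: f)
    case 0
    then obtain w where "w \<notin> P" "w * f = 0" using Q0 by blast
    then show ?case using P_ideal(1) mult_nP[of w f] by auto
  next
    case (Suc l)
    then obtain w c where w: "w \<notin> P" "w * f - c * g l \<in> Q l" using QS[of l f] by auto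
    then have "w * f - c * g l \<in> P" using Suc by simp
    moreover have "c * g l \<in> P" using gJ[of l] J(2) Suc.prems(1) P_ideal(3) by auto
    ultimately have "(w * f - c * g l) + c * g l \<in> P" by (rule P_ideal(2))
    then show ?case using w(1) mult_nP[of w f] by auto
  qed
  have gen: "f \<in> K" if K: "ideal_set K" "\<And>i. i < l \<Longrightarrow> g i \<in> K"
      "\<And>w x. w \<notin> P \<Longrightarrow> w * x \<in> K \<Longrightarrow> x \<in> K" and l: "l \<le> d" and f: "f \<in> Q l" for K l f
    using K(2) l f
  proof (induction l arbitrary: f)
    case 0
    then obtain w where "w \<notin> P" "w * f = 0" using Q0 by blast
    then show ?case using K(3)[of w f] ideal_set_closed(1)[OF K(1)] by simp
  next
    case (Suc l)
    then obtain w c where w: "w \<notin> P" "w * f - c * g l \<in> Q l" using QS[of l f] by auto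
    then have "w * f - c * g l \<in> K" using Suc by simp
    moreover have "c * g l \<in> K" using Suc.prems(1) ideal_set_closed(3)[OF K(1)] by simp
    ultimately have "(w * f - c * g l) + c * g l \<in> K" by (rule ideal_set_closed(2)[OF K(1)])
    then show ?case using w(1) K(3)[of w f] by simp
  qed
  have gl: "genideal loc (set (take l xs)) = ext (Q l)" if l: "l \<le> d" for l
  proof (rule genideal_image)
    show "set (take l xs) \<subseteq> carrier loc" unfolding take[OF l] by auto
    show "ideal_set (Q l)" by (rule prime_set_ideal[OF Q[OF l]])
    show "set (take l xs) \<subseteq> ext (Q l)" unfolding take[OF l] ext_def using g_in[OF l] one_nP by blast
    show "f \<in> K" if "ideal_set K" "\<And>x s. s \<notin> P \<Longrightarrow> fr x s \<in> set (take l xs) \<Longrightarrow> x \<in> K"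
      "\<And>w x. w \<notin> P \<Longrightarrow> w * x \<in> K \<Longrightarrow> x \<in> K" "f \<in> Q l" for K f
      by (rule gen[OF that(1) _ that(3) l that(4)]) (use that(2)[of 1] take[OF l] in auto)
  qed
  have all: "genideal loc (set xs) = ext (Q d)" using gl[of d] len by simp
  have "regular_sequence loc xs"
    unfolding regular_sequence_def
  proof (intro conjI allI impI ballI)
    show "set xs \<subseteq> carrier loc" by (auto simp: xs_def)
    show "genideal loc (set xs) \<noteq> carrier loc"
      unfolding all by (rule ext_proper[OF prime_set_ideal[OF Q]]) (use QP in auto)
    fix i z assume i: "i < length xs" and z: "z \<in> carrier loc"
      and m: "xs ! i \<otimes>\<^bsub>loc\<^esub> z \<in> genideal loc (set (take i xs))"
    have id: "i < d" "i \<le> d" using i len by auto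
    obtain x s where x: "z = fr x s" "s \<notin> P" using z by (rule loc_cases)
    note I = prime_set_ideal[OF Q[OF id(2)]]
    have "fr (g i * x) s \<in> ext (Q i)" using m x(2) unfolding gl[OF id(2)] nth[OF id(1)] x(1) by (simp add: loc_mult)
    then obtain w where "w \<notin> P" "w * (g i * x) \<in> Q i" using fr_in_ext[OF I x(2)] by blast
    then have "x \<in> Q i" using prime_set_mult[OF Q[OF id(2)]] QP[OF id(2)] g_nin[OF id(1)] by blast
    then show "z \<in> genideal loc (set (take i xs))" unfolding gl[OF id(2)] x(1) ext_def using x(2) by blast
  qed
  moreover have "genideal loc (to_local A (\<iota> ` P) ` \<iota> ` J) = ext (Q d)"
  proof -
    have im: "to_local A (\<iota> ` P) ` \<iota> ` J = (\<lambda>x. fr x 1) ` J" unfolding image_image to_local_fr ..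
    show ?thesis
      unfolding im
    proof (rule genideal_image)
      show "(\<lambda>x. fr x 1) ` J \<subseteq> carrier loc" by auto
      show "ideal_set (Q d)" by (rule prime_set_ideal[OF Q]) simp
      show "(\<lambda>x. fr x 1) ` J \<subseteq> ext (Q d)" unfolding ext_def using JQ one_nP by blast
      show "f \<in> K" if K: "ideal_set K" "\<And>x s. s \<notin> P \<Longrightarrow> fr x s \<in> (\<lambda>x. fr x 1) ` J \<Longrightarrow> x \<in> K"
        "\<And>w x. w \<notin> P \<Longrightarrow> w * x \<in> K \<Longrightarrow> x \<in> K" "f \<in> Q d" for K f
        by (rule gen[OF K(1) _ K(3) _ K(4)]) (use K(2)[of 1] gJ in auto)
    qed
  qed
  ultimately show ?thesis using all by auto
qed

end

section \<open>Lengths over a discrete valuation ring\<close>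

locale typed_dvr = typed_local A \<iota> P
  for A :: "('b, 'x) ring_scheme" and \<iota> :: "'a::idom \<Rightarrow> 'b" and P :: "'a set" +
  fixes \<tau> :: 'a
  assumes tau_nonzero: "\<tau> \<noteq> 0" and P_tau: "P = {\<tau> * y | y. True}"
    and factorization: "z \<noteq> 0 \<Longrightarrow> \<exists>n u. z = \<tau> ^ n * u \<and> u \<notin> P"
begin

definition pw :: "nat \<Rightarrow> 'a set" where "pw i = {\<tau> ^ i * y | y. True}"

lemma ideal_pw: "ideal_set (pw i)"
  unfolding ideal_set_def
proof (intro conjI ballI allI)
  show "0 \<in> pw i" unfolding pw_def by (intro CollectI exI[of _ 0]) simp
  fix x assume "x \<in> pw i"
  then obtain y where y: "x = \<tau> ^ i * y" unfolding pw_def by blast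
  show "c * x \<in> pw i" for c unfolding pw_def y by (intro CollectI exI[of _ "c * y"]) (simp add: mult_ac)
  fix x' assume "x' \<in> pw i"
  then obtain y' where y': "x' = \<tau> ^ i * y'" unfolding pw_def by blast
  show "x + x' \<in> pw i" unfolding pw_def y y' by (intro CollectI exI[of _ "y + y'"]) (simp add: distrib_left)
qed

lemma genideal_power:
  assumes u: "u \<notin> P"
  shows "genideal loc {fr (\<tau> ^ n * u) 1} = ext (pw n)"
proof (rule genideal_image[OF _ ideal_pw])
  show "{fr (\<tau> ^ n * u) 1} \<subseteq> carrier loc" by simp
  show "{fr (\<tau> ^ n * u) 1} \<subseteq> ext (pw n)" unfolding ext_def pw_def using one_nP by blast
  fix K f assume K: "ideal_set K" "\<And>x s. s \<notin> P \<Longrightarrow> fr x s \<in> {fr (\<tau> ^ n * u) 1} \<Longrightarrow> x \<in> K"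
    "\<And>w x. w \<notin> P \<Longrightarrow> w * x \<in> K \<Longrightarrow> x \<in> K" and f: "f \<in> pw n"
  have "\<tau> ^ n * u \<in> K" by (rule K(2)[of 1]) simp_all
  then have "\<tau> ^ n \<in> K" using K(3)[OF u, of "\<tau> ^ n"] by (simp add: mult.commute)
  then show "f \<in> K" using f ideal_set_closed(4)[OF K(1)] unfolding pw_def by auto
qed

definition ix :: "('b \<times> 'b) set set \<Rightarrow> nat" where "ix K = (LEAST i. \<tau> ^ i \<in> con K)"

text \<open>Every nonzero element of the contraction is a power of \<tau> times an element outside
  \<open>P\<close>, so the least power of \<tau> that occurs generates the ideal.\<close>

lemma ideal_above_power:
  assumes K: "ideal K loc" and n: "ext (pw n) \<subseteq> K"
  shows "ix K \<le> n" "\<tau> ^ ix K \<in> con K" "K = ext (pw (ix K))"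
proof -
  have "fr (\<tau> ^ n) 1 \<in> ext (pw n)"
    unfolding ext_def pw_def by (intro CollectI exI[of _ "\<tau> ^ n"] exI[of _ 1] conjI refl exI[of _ 1]) auto
  then have tn: "\<tau> ^ n \<in> con K" using n by (auto simp: con_def)
  show "ix K \<le> n" unfolding ix_def using tn by (rule Least_le)
  show mem: "\<tau> ^ ix K \<in> con K" unfolding ix_def using tn by (rule LeastI)
  note Ic = ideal_set_closed[OF ideal_set_con[OF K]]
  have "con K = pw (ix K)"
  proof
    show "pw (ix K) \<subseteq> con K" unfolding pw_def using Ic(4)[OF mem] by blast
    show "con K \<subseteq> pw (ix K)"
    proof
      fix z assume z: "z \<in> con K"
      show "z \<in> pw (ix K)"
      proof (cases "z = 0")
        case True
        then show ?thesis using ideal_set_closed(1)[OF ideal_pw] by simp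
      next
        case False
        then obtain j v where v: "z = \<tau> ^ j * v" "v \<notin> P" using factorization by blast
        then have "v * \<tau> ^ j \<in> con K" using z by (simp add: mult.commute)
        then have "\<tau> ^ j \<in> con K" by (rule con_saturated[OF K v(2)])
        then have "ix K \<le> j" unfolding ix_def by (rule Least_le)
        then have "z = \<tau> ^ ix K * (\<tau> ^ (j - ix K) * v)"
          unfolding v(1) by (simp add: mult.assoc[symmetric] power_add[symmetric])
        then show ?thesis unfolding pw_def by blast
      qed
    qed
  qed
  then show "K = ext (pw (ix K))" using ext_con[OF K] by simp
qed

lemma ix_strict:
  assumes "ideal K loc" "ideal K' loc" "ext (pw n) \<subseteq> K" "K \<subset> K'"
  shows "ix K' < ix K"
proof -
  have n': "ext (pw n) \<subseteq> K'" using assms(3,4) by blast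
  note a = ideal_above_power[OF assms(1,3)] and a' = ideal_above_power[OF assms(2) n']
  have "\<tau> ^ ix K \<in> con K'" using a(2) assms(4) unfolding con_def by blast
  then have "ix K' \<le> ix K" unfolding ix_def[of K'] by (rule Least_le)
  moreover have "ix K' \<noteq> ix K"
  proof
    assume "ix K' = ix K"
    then have "K' = K" using a(3) a'(3) by simp
    then show False using assms(4) by simp
  qed
  ultimately show ?thesis by simp
qed

lemma ext_pw_strict: "ext (pw (Suc i)) \<subset> ext (pw i)"
proof -
  have "pw (Suc i) \<subseteq> pw i"
  proof
    fix z assume "z \<in> pw (Suc i)"
    then obtain y where "z = \<tau> ^ i * (\<tau> * y)" unfolding pw_def by (auto simp: mult_ac)
    then show "z \<in> pw i" unfolding pw_def by blast
  qed
  then have "ext (pw (Suc i)) \<subseteq> ext (pw i)" unfolding ext_def by blast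
  moreover have "fr (\<tau> ^ i) 1 \<in> ext (pw i)"
    unfolding ext_def pw_def by (intro CollectI exI[of _ "\<tau> ^ i"] exI[of _ 1] conjI refl exI[of _ 1]) auto
  moreover have "fr (\<tau> ^ i) 1 \<notin> ext (pw (Suc i))"
  proof
    assume "fr (\<tau> ^ i) 1 \<in> ext (pw (Suc i))"
    then obtain w where w: "w \<notin> P" "w * \<tau> ^ i \<in> pw (Suc i)" using fr_in_ext[OF ideal_pw one_nP] by blast
    then obtain y where "w * \<tau> ^ i = \<tau> ^ Suc i * y" unfolding pw_def by blast
    then have "\<tau> ^ i * w = \<tau> ^ i * (\<tau> * y)" by (simp add: mult_ac)
    then have "w = \<tau> * y" using tau_nonzero by simp
    then show False using w(1) P_tau by blast
  qed
  ultimately show ?thesis by blast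
qed

text \<open>The powers of \<tau> give a chain with n steps. Conversely, along any strict chain the
  exponent \<open>ix\<close> of the preimages drops at each step and is at most n at the
  start.\<close>

lemma length_quotient_power: "ring_length (loc Quot ext (pw n)) = enat n"
proof -
  let ?I = "ext (pw n)" let ?Q = "loc Quot ?I"
  have I: "ideal ?I loc" by (rule ideal_ext[OF ideal_pw])
  interpret I: ideal ?I loc by (rule I)
  have le: "m \<le> n" if J: "\<forall>i\<le>m. ideal (J i) ?Q" "\<forall>i<m. J i \<subset> J (Suc i)" for m J
  proof -
    have sub: "J i \<subseteq> carrier ?Q" if i: "i \<le> m" for i
    proof -
      have "ideal (J i) ?Q" using J(1) i by blast
      then interpret Ji: ideal "J i" ?Q .
      show ?thesis by (rule Ji.a_subset)
    qed
    have K: "ideal (\<Union> (J i)) loc" if "i \<le> m" for i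
      using loc.quot_ideal_imp_ring_ideal[OF I] J(1) that by blast
    have mem: "a \<in> \<Union> (J i) \<longleftrightarrow> ?I +>\<^bsub>loc\<^esub> a \<in> J i" if "i \<le> m" "a \<in> carrier loc" for i a
      by (rule loc.canonical_proj_vimage_mem_iff[OF I sub[OF that(1)] that(2)])
    have IK: "?I \<subseteq> \<Union> (J i)" if i: "i \<le> m" for i
    proof -
      have "ideal (J i) ?Q" using J(1) i by blast
      then interpret Ji: ideal "J i" ?Q .
      have "\<zero>\<^bsub>?Q\<^esub> \<in> J i" by (rule additive_subgroup.zero_closed[OF Ji.additive_subgroup_axioms])
      then have "?I \<in> J i" by (simp add: FactRing_def)
      then show ?thesis by blast
    qed
    have strict: "\<Union> (J i) \<subset> \<Union> (J (Suc i))" if i: "i < m" for i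
    proof -
      have im: "i \<le> m" "Suc i \<le> m" using i by auto
      obtain z where z: "z \<in> J (Suc i)" "z \<notin> J i" using J(2) i by blast
      then have "z \<in> carrier ?Q" using sub[OF im(2)] by blast
      then obtain a where a: "a \<in> carrier loc" "z = ?I +>\<^bsub>loc\<^esub> a"
        by (auto simp: FactRing_def A_RCOSETS_def' a_r_coset_def')
      have "a \<in> \<Union> (J (Suc i))" "a \<notin> \<Union> (J i)" using mem[OF im(1) a(1)] mem[OF im(2) a(1)] z a(2) by auto
      moreover have "\<Union> (J i) \<subseteq> \<Union> (J (Suc i))" using J(2) i by blast
      ultimately show ?thesis by blast
    qed
    have "ix (\<Union> (J i)) + i \<le> n" if "i \<le> m" for i
      using that
    proof (induction i)
      case 0
      then show ?case using ideal_above_power(1)[OF K IK] by simp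
    next
      case (Suc i)
      have "ix (\<Union> (J (Suc i))) < ix (\<Union> (J i))"
        by (rule ix_strict[OF K K IK strict]) (use Suc.prems in auto)
      then show ?case using Suc by simp
    qed
    from this[of m] show ?thesis by simp
  qed
  let ?J = "\<lambda>i. (+>\<^bsub>loc\<^esub>) ?I ` ext (pw (n - i))"
  have anti: "ext (pw (i + k)) \<subseteq> ext (pw i)" for i k
  proof (induction k)
    case (Suc k)
    then show ?case using ext_pw_strict[of "i + k"] by auto
  qed simp
  have IJ: "?I \<subseteq> ext (pw (n - i))" for i
  proof (cases "i \<le> n")
    case True
    then show ?thesis using anti[of "n - i" i] by simp
  next
    case False
    then show ?thesis using anti[of 0 n] by simp
  qed
  have un: "ext (pw (n - i)) = \<Union> (?J i)" for i
    using loc.ideal_incl_iff[OF I ideal_ext[OF ideal_pw[of "n - i"]]] IJ[of i] by simp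
  have "?J i \<subset> ?J (Suc i)" if i: "i < n" for i
  proof -
    have eq: "n - i = Suc (n - Suc i)" using i by simp
    have s: "ext (pw (n - i)) \<subset> ext (pw (n - Suc i))" unfolding eq by (rule ext_pw_strict)
    then have "?J i \<subseteq> ?J (Suc i)" by (intro image_mono) auto
    moreover have "?J i \<noteq> ?J (Suc i)"
    proof
      assume "?J i = ?J (Suc i)"
      then have "\<Union> (?J i) = \<Union> (?J (Suc i))" by simp
      then show False using s unfolding un[symmetric] by simp
    qed
    ultimately show ?thesis by blast
  qed
  moreover have "ideal (?J i) ?Q" for i
    by (rule loc.ring_ideal_imp_quot_ideal[OF I ideal_ext[OF ideal_pw]])
  ultimately have "enat n \<in> {enat n | n. \<exists>J. (\<forall>i\<le>n. ideal (J i) ?Q) \<and> (\<forall>i<n. J i \<subset> J (Suc i))}"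
    by (intro CollectI exI[of _ n] conjI refl exI[of _ ?J]) blast+
  then show ?thesis
    unfolding ring_length_def
    by (intro antisym Sup_upper Sup_least) (use le in auto)
qed

lemma local_colength_power:
  assumes "u \<notin> P"
  shows "local_colength A (\<iota> ` P) (\<iota> (\<tau> ^ n * u)) = int n"
  unfolding local_colength_def to_local_fr genideal_power[OF assms] length_quotient_power by simp

end

lemma (in typed_local) genideal_unit_multiple:
  assumes "c \<notin> P"
  shows "genideal loc {fr (c * x) 1} = genideal loc {fr x 1}"
proof -
  let ?E = "{x * y | y. True}"
  have E: "ideal_set ?E"
    unfolding ideal_set_def
  proof (intro conjI ballI allI)
    show "0 \<in> ?E" by (intro CollectI exI[of _ 0]) simp
    fix z assume "z \<in> ?E"
    then obtain y where y: "z = x * y" by blast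
    show "d * z \<in> ?E" for d unfolding y by (intro CollectI exI[of _ "d * y"]) (simp add: mult_ac)
    fix z' assume "z' \<in> ?E"
    then obtain y' where y': "z' = x * y'" by blast
    show "z + z' \<in> ?E" unfolding y y' by (intro CollectI exI[of _ "y + y'"]) (simp add: distrib_left)
  qed
  have gen: "genideal loc {fr (d * x) 1} = ext ?E" if d: "d \<notin> P" for d
  proof (rule genideal_image[OF _ E])
    show "{fr (d * x) 1} \<subseteq> carrier loc" by simp
    have "d * x \<in> ?E" by (intro CollectI exI[of _ d]) (simp add: mult.commute)
    then show "{fr (d * x) 1} \<subseteq> ext ?E" unfolding ext_def using one_nP by blast
    fix K f assume K: "ideal_set K" "\<And>z s. s \<notin> P \<Longrightarrow> fr z s \<in> {fr (d * x) 1} \<Longrightarrow> z \<in> K"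
      "\<And>w z. w \<notin> P \<Longrightarrow> w * z \<in> K \<Longrightarrow> z \<in> K" and f: "f \<in> ?E"
    have "d * x \<in> K" by (rule K(2)[of 1]) simp_all
    then have "x \<in> K" by (rule K(3)[OF d])
    then show "f \<in> K" using f ideal_set_closed(4)[OF K(1)] by auto
  qed
  show ?thesis using gen[OF assms] gen[OF one_nP] by simp
qed

section \<open>A curve with coordinate ring k[t, 1/t] on an affine scheme\<close>

lemma prime_set_image:
  assumes h: "hom_type \<psi>" and surj: "\<And>f. \<exists>g. \<psi> g = f" and P: "prime_set P" and ker: "{f. \<psi> f = 0} \<subseteq> P"
  shows "prime_set (\<psi> ` P)" "\<psi> g \<in> \<psi> ` P \<longleftrightarrow> g \<in> P"
proof -
  note I = prime_set_ideal[OF P] note Ic = ideal_set_closed[OF I] note hs = hom_type_simps[OF h]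
  show mem: "\<psi> g \<in> \<psi> ` P \<longleftrightarrow> g \<in> P" for g
  proof
    assume "\<psi> g \<in> \<psi> ` P"
    then obtain f where f: "f \<in> P" "\<psi> g = \<psi> f" by blast
    then have "\<psi> (g - f) = 0" by (simp add: hs)
    then show "g \<in> P" using ideal_set_cong[OF I, of g f] ker f(1) by blast
  qed blast
  show "prime_set (\<psi> ` P)"
    unfolding prime_set_def ideal_set_def
  proof (intro conjI ballI allI impI)
    show "0 \<in> \<psi> ` P" using mem[of 0] Ic(1) by (simp add: hs)
    show "1 \<notin> \<psi> ` P" using mem[of 1] prime_set_one[OF P] by (simp add: hs)
    show "x + y \<in> \<psi> ` P" if xy: "x \<in> \<psi> ` P" "y \<in> \<psi> ` P" for x y
    proof -
      obtain f g where "x = \<psi> f" "y = \<psi> g" "f \<in> P" "g \<in> P" using xy by blast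
      then show ?thesis using mem[of "f + g"] Ic(2) by (simp add: hs)
    qed
    show "c * x \<in> \<psi> ` P" if x: "x \<in> \<psi> ` P" for x c
    proof -
      obtain f g where "x = \<psi> f" "f \<in> P" "\<psi> g = c" using x surj by blast
      then show ?thesis using mem[of "g * f"] Ic(3)[of f g] by (simp add: hs)
    qed
    show "x \<in> \<psi> ` P \<or> y \<in> \<psi> ` P" if xy: "x * y \<in> \<psi> ` P" for x y
    proof -
      obtain f g where fg: "x = \<psi> f" "y = \<psi> g" using surj by metis
      then have "f * g \<in> P" using xy mem[of "f * g"] by (simp add: hs)
      then show ?thesis using prime_set_mult[OF P] fg by blast
    qed
  qed
qed

lemma loc_par_nonzero: "(loc_par :: int \<Rightarrow>\<^sub>0 'k::field) \<noteq> 0"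
proof
  assume "(loc_par :: int \<Rightarrow>\<^sub>0 'k) = 0"
  moreover have "Poly_Mapping.lookup (loc_par :: int \<Rightarrow>\<^sub>0 'k) 1 = 1"
    by (simp add: lookup_minus lookup_single lookup_one when_def)
  ultimately show False by simp
qed

lemma (in typed_ring) iota_psubset: "\<iota> ` U \<subset> \<iota> ` V \<longleftrightarrow> U \<subset> V"
  by (simp add: psubset_eq inj_image_subset_iff[OF inj] inj_image_eq_iff[OF inj])

locale affine_curve = typed_ring A \<iota>
  for A :: "('b, 'x) ring_scheme" and \<iota> :: "'a::comm_ring_1 \<Rightarrow> 'b" +
  fixes \<psi> :: "'a \<Rightarrow> int \<Rightarrow>\<^sub>0 'k::alg_closed_field"
  assumes psi: "hom_type \<psi>" and psi_surj: "\<exists>g. \<psi> g = l"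
    and psi_lci: "prime_set Q \<Longrightarrow> {f. \<psi> f = 0} \<subseteq> Q \<Longrightarrow> (\<And>g. \<psi> g = loc_par \<Longrightarrow> g \<notin> Q) \<Longrightarrow> lci_data Q {f. \<psi> f = 0}"
begin

abbreviation (input) J0 where "J0 \<equiv> {f. \<psi> f = 0}"

definition J where "J = \<iota> ` J0"

definition pt where "pt = {f. eval1 (\<psi> f) = 0}"

abbreviation B where "B \<equiv> A Quot J"

text \<open>The preimage of \<open>l\<close> is chosen arbitrarily; \<open>iota_psi\<close> shows
  that the coset does not depend on it.\<close>

definition \<iota>B where "\<iota>B l = J +>\<^bsub>A\<^esub> \<iota> (SOME g. \<psi> g = l)"

lemmas psi_simps = hom_type_simps[OF psi]

lemma prime_J0: "prime_set J0" by (rule prime_set_kernel[OF psi])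

lemma primeideal_J: "primeideal J A" unfolding J_def by (rule primeideal_iota[OF prime_J0])

sublocale J: primeideal J A by (rule primeideal_J)

lemma coset_eq: "J +>\<^bsub>A\<^esub> \<iota> f = J +>\<^bsub>A\<^esub> \<iota> g \<longleftrightarrow> \<psi> f = \<psi> g"
  using quotient_eq_iff_same_a_r_cos[OF J.ideal_axioms, of "\<iota> f" "\<iota> g"]
  by (simp add: minus J_def psi_simps)

lemma iota_psi: "\<iota>B (\<psi> g) = J +>\<^bsub>A\<^esub> \<iota> g"
  unfolding \<iota>B_def coset_eq by (rule someI[of _ g]) simp

lemma typed_ring_B: "typed_ring B \<iota>B"
proof
  have hom: "ring_hom_ring A B ((+>\<^bsub>A\<^esub>) J)" by (rule J.rcos_ring_hom_ring)
  interpret h: ring_hom_ring A B "(+>\<^bsub>A\<^esub>) J" by (rule hom)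
  show "inj \<iota>B"
  proof
    fix l m assume lm: "\<iota>B l = \<iota>B m"
    obtain f g where "\<psi> f = l" "\<psi> g = m" using psi_surj by meson
    then show "l = m" using lm coset_eq iota_psi by metis
  qed
  have "carrier B = (\<lambda>a. J +>\<^bsub>A\<^esub> a) ` carrier A"
    unfolding FactRing_def A_RCOSETS_def' by auto
  also have "\<dots> = (\<lambda>g. J +>\<^bsub>A\<^esub> \<iota> g) ` UNIV" unfolding car image_image ..
  also have "\<dots> = (\<lambda>g. \<iota>B (\<psi> g)) ` UNIV" unfolding iota_psi ..
  also have "\<dots> = \<iota>B ` range \<psi>" by auto
  also have "range \<psi> = UNIV" using psi_surj unfolding surj_def by metis
  finally show "carrier B = range \<iota>B" .
  fix l m
  obtain f g where fg: "\<psi> f = l" "\<psi> g = m" using psi_surj by meson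
  show "\<iota>B l \<oplus>\<^bsub>B\<^esub> \<iota>B m = \<iota>B (l + m)"
    unfolding fg[symmetric] psi_simps(2)[symmetric] iota_psi
    using h.hom_add[of "\<iota> f" "\<iota> g"] by (simp add: i_add)
  show "\<iota>B l \<otimes>\<^bsub>B\<^esub> \<iota>B m = \<iota>B (l * m)"
    unfolding fg[symmetric] psi_simps(3)[symmetric] iota_psi
    using h.hom_mult[of "\<iota> f" "\<iota> g"] by (simp add: i_mult)
  show "\<one>\<^bsub>B\<^esub> = \<iota>B 1" using h.hom_one iota_psi[of 1] by (simp add: i_one psi_simps)
  show "\<zero>\<^bsub>B\<^esub> = \<iota>B 0" using h.hom_zero iota_psi[of 0] by (simp add: i_zero psi_simps)
qed

sublocale B: typed_ring B \<iota>B by (rule typed_ring_B)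

lemma quot_point_iota: "quot_point A J (\<iota> ` P0) = \<iota>B ` \<psi> ` P0"
  unfolding quot_point_def image_image iota_psi ..

lemma prime_zero: "prime_set {0 :: int \<Rightarrow>\<^sub>0 'k}"
  unfolding prime_set_def ideal_set_def by auto

lemma prime_point: "prime_set {l :: int \<Rightarrow>\<^sub>0 'k. eval1 l = 0}"
  by (rule prime_set_kernel[OF hom_type_eval1])

text \<open>The zero ideal and the ideal of t = 1 give a chain with one step. The upper bound is
  \<open>prime_chain_length_le\<close> for the monoid \<open>int\<close>, whose single coordinate is
  the identity.\<close>

lemma krull_dim_B: "krull_dim B = 1"
proof -
  let ?Q = "\<lambda>i :: nat. \<iota>B ` (if i = 0 then {0} else {l. eval1 l = 0})"
  have pr: "primeideal (?Q i) B" for i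
    using B.primeideal_iota[OF prime_zero] B.primeideal_iota[OF prime_point] by simp
  have tau: "(loc_par :: int \<Rightarrow>\<^sub>0 'k) \<noteq> 0" by (rule loc_par_nonzero)
  have "?Q 0 \<subset> ?Q 1"
  proof -
    have "{0 :: int \<Rightarrow>\<^sub>0 'k} \<subset> {l. eval1 l = 0}"
    proof -
      have "(0 :: int \<Rightarrow>\<^sub>0 'k) \<in> {l. eval1 l = 0}" by (simp add: hom_type_simps[OF hom_type_eval1])
      moreover have "(loc_par :: int \<Rightarrow>\<^sub>0 'k) \<in> {l. eval1 l = 0}" using eval1_loc_par by blast
      ultimately show ?thesis using tau by blast
    qed
    then have "\<iota>B ` {0} \<subset> \<iota>B ` {l. eval1 l = 0}" unfolding B.iota_psubset .
    then show ?thesis by simp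
  qed
  then have "enat 1 \<in> {enat n | n. \<exists>P. (\<forall>i\<le>n. primeideal (P i) B) \<and> (\<forall>i<n. P i \<subset> P (Suc i))}"
    using pr by (intro CollectI exI[of _ 1] conjI refl exI[of _ ?Q]) auto
  moreover have "n \<le> 1" if P: "\<forall>i\<le>n. primeideal (P i) B" "\<forall>i<n. P i \<subset> P (Suc i)" for n P
  proof (rule prime_chain_length_le[where \<kappa> = "\<lambda>_ z. z" and Q = "\<lambda>i. {l. \<iota>B l \<in> P i}"])
    show "additive_on UNIV (\<lambda>z :: int. z)" by (simp add: additive_on_def)
    show "torsion_eq x y" if "\<And>i. i < (1 :: nat) \<Longrightarrow> x = y" for x y :: int
      using that[of 0] unfolding torsion_eq_def by (intro exI[of _ 1]) auto
    show "prime_set {l. \<iota>B l \<in> P i}" if "i \<le> n" for i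
      using P(1) that by (intro B.primeideal_vimage) blast
    show "{l. \<iota>B l \<in> P i} \<subset> {l. \<iota>B l \<in> P (Suc i)}" if i: "i < n" for i
    proof -
      have "P i = \<iota>B ` {l. \<iota>B l \<in> P i}" "P (Suc i) = \<iota>B ` {l. \<iota>B l \<in> P (Suc i)}"
        by (rule B.primeideal_vimage; use P(1) i in auto)+
      moreover have "P i \<subset> P (Suc i)" using P(2) i by simp
      ultimately have "\<iota>B ` {l. \<iota>B l \<in> P i} \<subset> \<iota>B ` {l. \<iota>B l \<in> P (Suc i)}" by (simp only:)
      then show ?thesis unfolding B.iota_psubset .
    qed
  qed
  ultimately show ?thesis
    unfolding krull_dim_def one_enat_def by (intro antisym Sup_upper Sup_least) auto
qed

text \<open>Modulo the kernel the parameter generates the ideal of t = 1, and this ideal is maximal,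
  since a function with nonzero value there is invertible modulo it. In particular, if
  \<open>pt\<close> is regular, the singular points on the curve avoid the parameter.\<close>

lemma point_eq:
  assumes P0: "prime_set P0" "J0 \<subseteq> P0" and g: "\<psi> g = loc_par" "g \<in> P0"
  shows "P0 = pt"
proof
  note Ic = ideal_set_closed[OF prime_set_ideal[OF P0(1)]]
  have sub: "pt \<subseteq> P0"
  proof
    fix f assume "f \<in> pt"
    then obtain l where l: "\<psi> f = loc_par * l" unfolding pt_def eval1_zero_iff by (auto elim: dvdE)
    obtain h where "\<psi> h = l" using psi_surj by blast
    then have "\<psi> (f - g * h) = 0" using l g(1) by (simp add: psi_simps)
    then show "f \<in> P0"
      using ideal_set_cong[OF prime_set_ideal[OF P0(1)], of f "g * h"] P0(2) Ic(4)[OF g(2)] by blast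
  qed
  then show "pt \<subseteq> P0" .
  show "P0 \<subseteq> pt"
  proof
    fix f assume f: "f \<in> P0"
    show "f \<in> pt"
    proof (rule ccontr)
      let ?c = "eval1 (\<psi> f)"
      assume "f \<notin> pt"
      then have c: "?c \<noteq> 0" by (simp add: pt_def)
      obtain h where h: "\<psi> h = cst (inverse ?c)" using psi_surj by blast
      have "1 - h * f \<in> pt"
        using c by (simp add: pt_def psi_simps h hom_type_simps[OF hom_type_eval1] mlift_single)
      then have "(1 - h * f) + h * f \<in> P0" using sub f by (intro Ic(2) Ic(3)) auto
      then show False using prime_set_one[OF P0(1)] by simp
    qed
  qed
qed

text \<open>The ideal \<open>J\<close> is prime, hence its own minimal prime, and the regular point
  \<open>pt\<close> keeps the curve from lying in the singular locus. A singular point on the curve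
  differs from \<open>pt\<close> and so avoids the parameter; there \<open>psi_lci\<close>
  applies.\<close>

lemma cartier_curve_J:
  assumes reg: "\<iota> ` pt \<in> reg_locus A"
  shows "cartier_curve A J"
proof -
  have min: "P = J" if "minimal_prime_over A J P" for P
    using that primeideal_J unfolding minimal_prime_over_def by auto
  have "J \<subseteq> \<iota> ` pt" unfolding J_def pt_def by (auto simp: hom_type_simps[OF hom_type_eval1])
  then have V: "\<iota> ` pt \<in> vanishing_set A J" using reg by (auto simp: vanishing_set_def reg_locus_def)
  have "\<exists>xs. regular_sequence (localization_at A P) xs \<and>
      genideal (localization_at A P) (to_local A P ` J) = genideal (localization_at A P) (set xs)"
    if P: "P \<in> vanishing_set A J" "P \<in> sing_locus A" for P
  proof -
    define P0 where "P0 = {x. \<iota> x \<in> P}"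
    have "primeideal P A" using P(1) by (simp add: vanishing_set_def Spec_def)
    then have P0: "prime_set P0" "P = \<iota> ` P0" unfolding P0_def by (rule primeideal_vimage)+
    have JP: "J0 \<subseteq> P0" using P(1) by (auto simp: vanishing_set_def J_def P0_def)
    have "P0 \<noteq> pt" using P(2) reg P0(2) by (auto simp: sing_locus_def)
    then have "lci_data P0 J0" using point_eq[OF P0(1) JP] by (intro psi_lci[OF P0(1) JP]) blast
    interpret typed_local A \<iota> P0 by unfold_locales (rule P0(1))
    show ?thesis
      unfolding P0(2) J_def
      by (rule lci_regular_sequence[OF \<open>lci_data P0 J0\<close> prime_set_ideal[OF prime_J0] JP])
  qed
  then show ?thesis
    unfolding cartier_curve_def using J.ideal_axioms min krull_dim_B V reg by (auto simp: sing_locus_def)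
qed

lemma nonzerodivisors_B: "nonzerodivisors B = carrier B - \<iota>B ` {0}"
proof -
  have "\<iota>B l \<in> nonzerodivisors B \<longleftrightarrow> l \<noteq> 0" for l
  proof
    show "l \<noteq> 0" if "\<iota>B l \<in> nonzerodivisors B"
    proof
      assume "l = 0"
      then have "\<iota>B l \<otimes>\<^bsub>B\<^esub> \<iota>B 1 = \<zero>\<^bsub>B\<^esub>" by (simp add: B.i_mult B.i_zero)
      then have "\<iota>B 1 = \<zero>\<^bsub>B\<^esub>" using that B.iota_carrier unfolding nonzerodivisors_def by blast
      then show False by (simp add: B.i_zero)
    qed
    show "\<iota>B l \<in> nonzerodivisors B" if "l \<noteq> 0"
      using that unfolding nonzerodivisors_def B.car by (auto simp: B.i_mult B.i_zero)
  qed
  moreover have "nonzerodivisors B \<subseteq> carrier B" unfolding nonzerodivisors_def by blast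
  ultimately show ?thesis unfolding B.car by blast
qed

definition par where "par = fraction B (nonzerodivisors B) (\<iota>B loc_par) (\<iota>B 1)"

text \<open>The ring \<open>B\<close> is a domain, so its total quotient ring is the localization at
  the zero ideal, and the calculus of fractions applies to it.\<close>

sublocale Z: typed_local B \<iota>B "{0}" by unfold_locales (rule prime_zero)

lemma par_fr: "fraction B (nonzerodivisors B) (\<iota>B x) (\<iota>B y) = Z.fr x y"
  unfolding nonzerodivisors_B Z.fr_def ..

lemma curve_units_par:
  assumes reg: "\<iota> ` pt \<in> reg_locus A"
  shows "par \<in> curve_units A J"
  unfolding curve_units_def
proof (intro CollectI conjI ballI)
  show "par \<in> Units (total_quotient_ring B)"
    unfolding par_def par_fr unfolding nonzerodivisors_B
    by (rule Z.fr_unit) (use loc_par_nonzero in blast, simp)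
  fix P assume P: "P \<in> vanishing_set A J \<inter> sing_locus A"
  define P0 where "P0 = {x. \<iota> x \<in> P}"
  have "primeideal P A" using P by (simp add: vanishing_set_def Spec_def)
  then have P0: "prime_set P0" "P = \<iota> ` P0" unfolding P0_def by (rule primeideal_vimage)+
  have JP: "J0 \<subseteq> P0" using P by (auto simp: vanishing_set_def J_def P0_def)
  have ne: "P0 \<noteq> pt" using P reg P0(2) by (auto simp: sing_locus_def)
  note im = prime_set_image[OF psi psi_surj P0(1) JP]
  obtain g where g: "\<psi> g = loc_par" using psi_surj by blast
  have nin: "loc_par \<notin> \<psi> ` P0" using im(2)[of g] point_eq[OF P0(1) JP g] ne unfolding g by blast
  interpret L: typed_local B \<iota>B "\<psi> ` P0" by unfold_locales (rule im(1))
  have l: "\<iota>B loc_par \<in> carrier B" "\<iota>B 1 \<in> nonzerodivisors B"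
    unfolding nonzerodivisors_B by simp_all
  have u: "L.fr loc_par 1 \<in> Units L.loc" by (rule L.fr_unit[OF nin]) simp
  show "unit_at B (quot_point A J P) par"
    unfolding unit_at_def P0(2) quot_point_iota L.to_local_fr
    apply (rule bexI[OF _ l(1)], rule bexI[OF _ l(2)])
    apply (intro conjI bexI[OF _ u])
     apply (simp add: par_def)
    apply (simp add: L.to_local_fr L.loc_mult)
    done
qed

text \<open>Where \<open>t - 1\<close> lies outside \<open>p\<close> it is a local unit and does not
  change colengths. Where it lies in \<open>p\<close>, this prime is generated by
  \<open>t - 1\<close>, and multiplication by the uniformizer raises the colength by one.\<close>

lemma vanishing_order_par:
  assumes P: "prime_set p"
  shows "vanishing_order B (\<iota>B ` p) par = (if loc_par \<in> p then 1 else 0)"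
proof -
  let ?l = "\<lambda>x. local_colength B (\<iota>B ` p) (\<iota>B x)"
  interpret L: typed_local B \<iota>B p by unfold_locales (rule P)
  \<comment> \<open>The order is defined through all representations of the function as a fraction.
    Each has the form \<open>((t - 1) * y) / y\<close>, so the difference of colengths is computed
    for arbitrary nonzero \<open>y\<close>.\<close>
  have diff: "?l (loc_par * y) - ?l y = (if loc_par \<in> p then 1 else 0)" if y: "y \<noteq> 0" for y
  proof (cases "loc_par \<in> p")
    case False
    then show ?thesis using L.genideal_unit_multiple[OF False, of y]
      unfolding local_colength_def L.to_local_fr by simp
  next
    case True
    have p_eq: "l \<in> p \<longleftrightarrow> eval1 l = 0" for l
    proof
      show "l \<in> p" if "eval1 l = 0"
      proof -
        obtain z where "l = loc_par * z" using \<open>eval1 l = 0\<close> unfolding eval1_zero_iff by (auto elim: dvdE)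
        then show ?thesis using L.P_ideal(4)[OF True] by simp
      qed
    next
      assume l: "l \<in> p"
      show "eval1 l = 0"
      proof (rule ccontr)
        assume c: "eval1 l \<noteq> 0"
        let ?m = "1 - cst (inverse (eval1 l)) * l"
        have "eval1 ?m = 0" using c by (simp add: hom_type_simps[OF hom_type_eval1] mlift_single)
        then obtain z where "?m = loc_par * z" unfolding eval1_zero_iff by (auto elim: dvdE)
        then have "?m \<in> p" using L.P_ideal(4)[OF True] by simp
        then have "?m + cst (inverse (eval1 l)) * l \<in> p" using l by (intro L.P_ideal(2) L.P_ideal(3))
        then show False by simp
      qed
    qed
    interpret D: typed_dvr B \<iota>B p loc_par
    proof unfold_locales
      show "loc_par \<noteq> (0 :: int \<Rightarrow>\<^sub>0 'k)" by (rule loc_par_nonzero)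
      show "p = {loc_par * y | y. True}"
        using p_eq unfolding eval1_zero_iff dvd_def by blast
      show "\<exists>n u. z = loc_par ^ n * u \<and> u \<notin> p" if "z \<noteq> 0" for z
        using loc_par_factorization[OF that] p_eq by blast
    qed
    obtain n u where u: "y = loc_par ^ n * u" "u \<notin> p" using D.factorization[OF y] by blast
    have "loc_par * y = loc_par ^ Suc n * u" by (simp add: u mult.assoc)
    then show ?thesis using D.local_colength_power[OF u(2), of n] D.local_colength_power[OF u(2), of "Suc n"] True u(1)
      by (simp add: mult.assoc)
  qed
  have nz: "a \<in> nonzerodivisors B \<longleftrightarrow> (\<exists>x. x \<noteq> 0 \<and> a = \<iota>B x)" for a
    unfolding nonzerodivisors_B B.car by auto
  show ?thesis
    unfolding vanishing_order_def
  proof (rule the_equality)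
    show "\<exists>a\<in>nonzerodivisors B. \<exists>b\<in>nonzerodivisors B. par = fraction B (nonzerodivisors B) a b \<and>
        (if loc_par \<in> p then 1 else 0) = local_colength B (\<iota>B ` p) a - local_colength B (\<iota>B ` p) b"
      apply (rule bexI[of _ "\<iota>B loc_par"], rule bexI[of _ "\<iota>B 1"])
      using diff[of 1] apply (simp add: par_def)
      using loc_par_nonzero nz apply auto
      done
    fix m assume "\<exists>a\<in>nonzerodivisors B. \<exists>b\<in>nonzerodivisors B. par = fraction B (nonzerodivisors B) a b \<and>
        m = local_colength B (\<iota>B ` p) a - local_colength B (\<iota>B ` p) b"
    then obtain a b where ab: "a \<in> nonzerodivisors B" "b \<in> nonzerodivisors B"
      "par = fraction B (nonzerodivisors B) a b" "m = local_colength B (\<iota>B ` p) a - local_colength B (\<iota>B ` p) b"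
      by (elim bexE conjE)
    obtain x y where "y \<noteq> 0" "a = \<iota>B x" "b = \<iota>B y" using ab(1,2) unfolding nz by (elim exE conjE)
    then have xy: "y \<noteq> 0" "par = fraction B (nonzerodivisors B) (\<iota>B x) (\<iota>B y)" "m = ?l x - ?l y"
      using ab(3,4) by simp_all
    then have "Z.fr loc_par 1 = Z.fr x y" unfolding par_def par_fr by simp
    then have "x = loc_par * y" using Z.fr_eq[of 1 y loc_par x] xy(1) by (auto simp: mult.commute)
    then show "m = (if loc_par \<in> p then 1 else 0)" using xy(3) diff[OF xy(1)] by simp
  qed
qed

lemma curve_divisor_par:
  assumes cl: "\<iota> ` pt \<in> closed_points A"
  shows "curve_divisor A J par = frag_of (\<iota> ` pt)"
proof -
  have ord: "vanishing_order B (quot_point A J P) par = (if P = \<iota> ` pt then 1 else 0)"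
    if P: "P \<in> closed_points A" "J \<subseteq> P" for P
  proof -
    define P0 where "P0 = {x. \<iota> x \<in> P}"
    have "primeideal P A" using P(1) maximalideal_prime by (auto simp: closed_points_def)
    then have P0: "prime_set P0" "P = \<iota> ` P0" unfolding P0_def by (rule primeideal_vimage)+
    have JP: "J0 \<subseteq> P0" using P(2) by (auto simp: J_def P0_def)
    note im = prime_set_image[OF psi psi_surj P0(1) JP]
    obtain g where g: "\<psi> g = loc_par" using psi_surj by blast
    have "g \<in> pt" by (simp add: pt_def g eval1_loc_par)
    then have "loc_par \<in> \<psi> ` P0 \<longleftrightarrow> P0 = pt" using im(2)[of g] point_eq[OF P0(1) JP g] unfolding g by blast
    moreover have "\<iota> ` P0 = \<iota> ` pt \<longleftrightarrow> P0 = pt" by (rule inj_image_eq_iff[OF inj])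
    ultimately show ?thesis unfolding P0(2) quot_point_iota vanishing_order_par[OF im(1)] by simp
  qed
  have Jpt: "J \<subseteq> \<iota> ` pt" unfolding J_def pt_def by (auto simp: hom_type_simps[OF hom_type_eval1])
  have only: "P = \<iota> ` pt" if "P \<in> closed_points A" "J \<subseteq> P" "vanishing_order B (quot_point A J P) par \<noteq> 0" for P
    using ord[OF that(1,2)] that(3) by metis
  have "{P \<in> closed_points A. J \<subseteq> P \<and> vanishing_order B (quot_point A J P) par \<noteq> 0} = {\<iota> ` pt}"
  proof (intro subset_antisym subsetI)
    fix P assume "P \<in> {P \<in> closed_points A. J \<subseteq> P \<and> vanishing_order B (quot_point A J P) par \<noteq> 0}"
    then show "P \<in> {\<iota> ` pt}" using only[of P] by blast
  next
    fix P assume "P \<in> {\<iota> ` pt}"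
    then show "P \<in> {P \<in> closed_points A. J \<subseteq> P \<and> vanishing_order B (quot_point A J P) par \<noteq> 0}"
      using cl Jpt ord[OF cl Jpt] by simp
  qed
  then show ?thesis unfolding curve_divisor_def using ord[OF cl Jpt] by simp
qed

end

section \<open>Triviality of the Chow group from curves through all regular closed points\<close>

lemma group_singleton:
  assumes "carrier Q = {H}" "\<one>\<^bsub>Q\<^esub> = H" "H \<otimes>\<^bsub>Q\<^esub> H = H"
  shows "group Q"
  by (rule groupI) (use assms in auto)

text \<open>Each free generator of the zero-cycles is itself a relation, so the relations exhaust
  the group of cycles and every coset is the subgroup of relations.\<close>

lemma trivial_CH0_LW:
  assumes "\<And>x. x \<in> closed_points A \<Longrightarrow> x \<in> reg_locus A \<Longrightarrow>
    \<exists>J f. cartier_curve A J \<and> f \<in> curve_units A J \<and> curve_divisor A J f = frag_of x"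
  shows "trivial_group (CH0_LW A)"
proof -
  let ?S = "closed_points A \<inter> reg_locus A"
  let ?D = "{curve_divisor A J f | J f. cartier_curve A J \<and> f \<in> curve_units A J}"
  let ?F = "free_Abelian_group ?S"
  let ?H = "generate ?F ?D"
  interpret F: group ?F by simp
  have gens: "frag_of x \<in> ?H" if x: "x \<in> ?S" for x
  proof (rule generate.incl)
    obtain J f where "cartier_curve A J" "f \<in> curve_units A J" "curve_divisor A J f = frag_of x"
      using assms[of x] x by auto
    then show "frag_of x \<in> ?D" by (intro CollectI exI[of _ J] exI[of _ f]) simp
  qed
  have full: "x \<in> generate ?F (frag_of ` ?S)" if x: "Poly_Mapping.keys x \<subseteq> ?S" for x
    using x
  proof (rule free_Abelian_group_induct)
    let ?G = "generate ?F (frag_of ` ?S)"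
    have sub: "subgroup ?G ?F" by (rule F.generate_is_subgroup) auto
    show "0 \<in> ?G" using subgroup.one_closed[OF sub] by simp
    show "x - y \<in> ?G" if "Poly_Mapping.keys y \<subseteq> ?S" "x \<in> ?G" "y \<in> ?G" for x y
      using subgroup.m_closed[OF sub that(2) subgroup.m_inv_closed[OF sub that(3)]] that(1) by simp
    show "frag_of a \<in> ?G" if "a \<in> ?S" for a using that by (intro generate.incl) simp
  qed
  have "generate ?F (frag_of ` ?S) \<subseteq> ?H"
  proof
    fix x assume "x \<in> generate ?F (frag_of ` ?S)"
    then show "x \<in> ?H"
    proof induction
      case one
      show ?case by (rule generate.one)
    next
      case (incl h)
      then show ?case using gens by blast
    next
      case (inv h)
      then obtain y where y: "y \<in> ?S" "h = frag_of y" by blast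
      obtain J f where "cartier_curve A J" "f \<in> curve_units A J" "curve_divisor A J f = frag_of y"
        using assms[of y] y by auto
      then have "h \<in> ?D" unfolding y(2) by (intro CollectI exI[of _ J] exI[of _ f]) simp
      then show ?case by (rule generate.inv)
    next
      case (eng g h)
      then show ?case by (intro generate.eng)
    qed
  qed
  then have cH: "carrier ?F \<subseteq> ?H" using full by auto
  have closed: "x + y \<in> ?H" if "x \<in> ?H" "y \<in> ?H" for x y using generate.eng[OF that] by simp
  \<comment> \<open>\<open>?D\<close> is not known to lie in the carrier, so \<open>?H\<close> may be larger than the whole group.\<close>
  have coset: "?H #>\<^bsub>?F\<^esub> a = ?H" if a: "a \<in> carrier ?F" for a
  proof
    show "?H #>\<^bsub>?F\<^esub> a \<subseteq> ?H" using closed subsetD[OF cH a] unfolding r_coset_def by simp blast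
    show "?H \<subseteq> ?H #>\<^bsub>?F\<^esub> a"
    proof
      fix h assume h: "h \<in> ?H"
      have "- a \<in> ?H" using a cH by auto
      from closed[OF h this] show "h \<in> ?H #>\<^bsub>?F\<^esub> a"
        unfolding r_coset_def by (intro UN_I[of "h + - a"]) simp_all
    qed
  qed
  let ?Q = "?F Mod ?H"
  have car: "carrier ?Q = {?H}"
  proof
    show "carrier ?Q \<subseteq> {?H}" using coset unfolding FactGroup_def RCOSETS_def by auto
    show "{?H} \<subseteq> carrier ?Q"
      using coset[OF F.one_closed] F.one_closed unfolding FactGroup_def RCOSETS_def by auto
  qed
  have one: "\<one>\<^bsub>?Q\<^esub> = ?H" by (simp add: FactGroup_def)
  have "?H <#>\<^bsub>?F\<^esub> ?H = ?H"
  proof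
    show "?H <#>\<^bsub>?F\<^esub> ?H \<subseteq> ?H" using closed unfolding set_mult_def by auto
    show "?H \<subseteq> ?H <#>\<^bsub>?F\<^esub> ?H"
      using generate.one[of ?F ?D] unfolding set_mult_def by force
  qed
  then have mult: "?H \<otimes>\<^bsub>?Q\<^esub> ?H = ?H" by (simp add: FactGroup_def)
  have "group ?Q" by (rule group_singleton[OF car one mult])
  then show ?thesis unfolding CH0_LW_def zero_cycles_def trivial_group_def car one by simp
qed

section \<open>Rank\<close>

lemma rees_quotient_empty:
  "carrier (rees_quotient {}) = range (\<lambda>x::'n::comm_monoid_add. {x})"
  "{x} \<otimes>\<^bsub>rees_quotient {}\<^esub> {y} = {x + y :: 'n}" "\<one>\<^bsub>rees_quotient {}\<^esub> = {0 :: 'n}"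
  by (auto simp: rees_quotient_def rees_class_def)

lemma finitely_generated_mspan:
  assumes "finitely_generated_monoid (rees_quotient {} :: 'n::comm_monoid_add set monoid)"
  obtains \<Gamma> :: "'n::comm_monoid_add set" where "finite \<Gamma>" "mspan \<Gamma> = UNIV"
proof -
  let ?M = "rees_quotient {} :: 'n set monoid"
  obtain S where S: "S \<subseteq> carrier ?M" "finite S" "\<And>H. submonoid H ?M \<Longrightarrow> S \<subseteq> H \<Longrightarrow> H = carrier ?M"
    using assms unfolding finitely_generated_monoid_def by blast
  define \<Gamma> where "\<Gamma> = {x. {x} \<in> S}"
  have fin: "finite \<Gamma>" unfolding \<Gamma>_def by (rule finite_vimageI[OF S(2), unfolded vimage_def]) simp
  let ?H = "(\<lambda>x. {x}) ` mspan \<Gamma>"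
  have "submonoid ?H ?M"
  proof
    show "?H \<subseteq> carrier ?M" by (auto simp: rees_quotient_empty)
    show "\<one>\<^bsub>?M\<^esub> \<in> ?H" using mspan_closed(1)[of \<Gamma>] by (simp add: rees_quotient_empty)
    show "U \<otimes>\<^bsub>?M\<^esub> V \<in> ?H" if "U \<in> ?H" "V \<in> ?H" for U V
      using that mspan_closed(2)[of _ \<Gamma>] by (auto simp: rees_quotient_empty)
  qed
  moreover have "S \<subseteq> ?H"
  proof
    fix U assume U: "U \<in> S"
    then obtain x where "U = {x}" using S(1) by (auto simp: rees_quotient_empty)
    then show "U \<in> ?H" using U mspan_superset[OF fin] unfolding \<Gamma>_def by blast
  qed
  ultimately have "?H = carrier ?M" by (rule S(3))
  then have "mspan \<Gamma> = UNIV" by (auto simp: rees_quotient_empty)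
  then show thesis using fin that by blast
qed

text \<open>The description operator is resolved by uniqueness: isomorphic free abelian groups have
  equipotent bases.\<close>

lemma free_rank_eqI:
  fixes r :: nat
  assumes "torsion_subgroup G \<lhd> G" "(G Mod torsion_subgroup G) \<cong> free_Abelian_group {..<r}"
  shows "free_rank G = r"
  unfolding free_rank_def
proof (rule the_equality)
  show "(G Mod torsion_subgroup G) \<cong> free_Abelian_group {..<r}" by fact
  fix s :: nat assume s: "(G Mod torsion_subgroup G) \<cong> free_Abelian_group {..<s}"
  have grp: "group (G Mod torsion_subgroup G)" by (rule normal.factorgroup_is_group[OF assms(1)])
  have "free_Abelian_group {..<s} \<cong> (G Mod torsion_subgroup G)" by (rule group.iso_sym[OF grp s])
  then have "free_Abelian_group {..<s} \<cong> free_Abelian_group {..<r}" using assms(2) by (rule iso_trans)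
  then have "{..<s} \<approx> {..<r}" by (simp add: isomorphic_free_Abelian_groups)
  then show "s = r" by (simp add: eqpoll_iff_card)
qed

section \<open>The group completion of a cancellative monoid and its rank\<close>

abbreviation gp_empty :: "('n::cancel_comm_monoid_add set \<times> 'n set) set monoid"
  where "gp_empty \<equiv> group_completion (rees_quotient {})"

definition fdiff :: "'n::cancel_comm_monoid_add \<Rightarrow> 'n \<Rightarrow> ('n set \<times> 'n set) set"
  where "fdiff x y = gp_class (rees_quotient {}) {x} {y}"

lemma fdiff_altdef:
  fixes x y :: "'n::cancel_comm_monoid_add"
  shows "fdiff x y = {({c}, {d}) | c d. x + d = c + y}"
proof -
  have m: "{a :: 'n} \<otimes>\<^bsub>rees_quotient {}\<^esub> {b} = {a + b}" for a b by (rule rees_quotient_empty)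
  show ?thesis
    unfolding fdiff_def gp_class_def rees_quotient_empty(1)
    by (auto simp: m)
qed

lemma fdiff_eq: "fdiff x y = fdiff x' y' \<longleftrightarrow> x + y' = x' + y"
proof
  assume "fdiff x y = fdiff x' y'"
  moreover have "({x}, {y}) \<in> fdiff x y" unfolding fdiff_altdef by blast
  ultimately show "x + y' = x' + y" unfolding fdiff_altdef by (auto simp: add.commute)
next
  assume eq: "x + y' = x' + y"
  have "x + d = c + y \<longleftrightarrow> x' + d = c + y'" for c d
  proof -
    have "x + d = c + y \<longleftrightarrow> x + d + y' = c + y + y'" by simp
    also have "\<dots> \<longleftrightarrow> (x + y') + d = (c + y') + y" by (simp add: ac_simps)
    also have "\<dots> \<longleftrightarrow> x' + d = c + y'" unfolding eq by (metis add.commute add.left_commute add_right_cancel)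
    finally show ?thesis .
  qed
  then show "fdiff x y = fdiff x' y'" unfolding fdiff_altdef by simp
qed

lemma gp_carrier: "carrier (gp_empty) = {fdiff x y | x y. True}"
  unfolding group_completion_def fdiff_def by (auto simp: rees_quotient_empty)

lemma gp_one: "\<one>\<^bsub>gp_empty\<^esub> = fdiff 0 0"
  unfolding group_completion_def fdiff_def by (simp add: rees_quotient_empty)

lemma gp_mult:
  fixes x y :: "'n::cancel_comm_monoid_add"
  shows "fdiff x y \<otimes>\<^bsub>gp_empty\<^esub> fdiff x' y' = fdiff (x + x') (y + y')"
proof -
  let ?F = "gp_class (rees_quotient {} :: 'n set monoid)"
  have in1: "?F ({c} \<otimes>\<^bsub>rees_quotient {}\<^esub> {c'}) ({d} \<otimes>\<^bsub>rees_quotient {}\<^esub> {d'}) = fdiff (x + x') (y + y')"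
    if "x + d = c + y" "x' + d' = c' + y'" for c d c' d'
  proof -
    have "?F ({c} \<otimes>\<^bsub>rees_quotient {}\<^esub> {c'}) ({d} \<otimes>\<^bsub>rees_quotient {}\<^esub> {d'}) = fdiff (c + c') (d + d')"
      unfolding rees_quotient_empty(2) fdiff_def ..
    moreover have "(c + c') + (y + y') = (x + x') + (d + d')"
      using arg_cong2[OF that, of "(+)"] by (simp add: ac_simps)
    moreover from this have "fdiff (c + c') (d + d') = fdiff (x + x') (y + y')" unfolding fdiff_eq by simp
    ultimately show ?thesis by simp
  qed
  have "fdiff x y \<otimes>\<^bsub>gp_empty\<^esub> fdiff x' y' = (\<Union>(a, b)\<in>fdiff x y. \<Union>(c, d)\<in>fdiff x' y'.
      ?F (a \<otimes>\<^bsub>rees_quotient {}\<^esub> c) (b \<otimes>\<^bsub>rees_quotient {}\<^esub> d))"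
    unfolding group_completion_def by simp
  also have "\<dots> = fdiff (x + x') (y + y')"
  proof (rule SUP_eq_const)
    show "fdiff x y \<noteq> {}" unfolding fdiff_altdef by blast
    fix p assume "p \<in> fdiff x y"
    then obtain c d where p: "p = ({c}, {d})" "x + d = c + y" unfolding fdiff_altdef by blast
    show "(case p of (a, b) \<Rightarrow> \<Union>(c, d)\<in>fdiff x' y'. ?F (a \<otimes>\<^bsub>rees_quotient {}\<^esub> c) (b \<otimes>\<^bsub>rees_quotient {}\<^esub> d))
      = fdiff (x + x') (y + y')"
      unfolding p(1) prod.case
    proof (rule SUP_eq_const)
      show "fdiff x' y' \<noteq> {}" unfolding fdiff_altdef by blast
      fix q assume "q \<in> fdiff x' y'"
      then obtain c' d' where q: "q = ({c'}, {d'})" "x' + d' = c' + y'" unfolding fdiff_altdef by blast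
      show "(case q of (c', d') \<Rightarrow> ?F ({c} \<otimes>\<^bsub>rees_quotient {}\<^esub> c') ({d} \<otimes>\<^bsub>rees_quotient {}\<^esub> d'))
        = fdiff (x + x') (y + y')"
        unfolding q(1) prod.case by (rule in1[OF p(2) q(2)])
    qed
  qed
  finally show ?thesis .
qed

lemma gp_cases: "U \<in> carrier gp_empty \<Longrightarrow> (\<And>x y. U = fdiff x y \<Longrightarrow> thesis) \<Longrightarrow> thesis"
  unfolding gp_carrier by blast

lemma gp_closed: "fdiff x y \<in> carrier gp_empty"
  unfolding gp_carrier by blast

lemma group_gp: "group gp_empty"
proof (rule groupI)
  show "U \<otimes>\<^bsub>gp_empty\<^esub> V \<in> carrier gp_empty" if "U \<in> carrier gp_empty" "V \<in> carrier gp_empty" for U V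
    by (rule gp_cases[OF that(1)], rule gp_cases[OF that(2)]) (simp add: gp_mult gp_closed)
  show "\<one>\<^bsub>gp_empty\<^esub> \<in> carrier gp_empty" by (simp add: gp_one gp_closed)
  show "U \<otimes>\<^bsub>gp_empty\<^esub> V \<otimes>\<^bsub>gp_empty\<^esub> W = U \<otimes>\<^bsub>gp_empty\<^esub> (V \<otimes>\<^bsub>gp_empty\<^esub> W)"
    if "U \<in> carrier gp_empty" "V \<in> carrier gp_empty" "W \<in> carrier gp_empty" for U V W
    by (rule gp_cases[OF that(1)], rule gp_cases[OF that(2)], rule gp_cases[OF that(3)]) (simp add: gp_mult add.assoc)
  show "\<one>\<^bsub>gp_empty\<^esub> \<otimes>\<^bsub>gp_empty\<^esub> U = U" if "U \<in> carrier gp_empty" for U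
    by (rule gp_cases[OF that]) (simp add: gp_mult gp_one)
  show "\<exists>V\<in>carrier gp_empty. V \<otimes>\<^bsub>gp_empty\<^esub> U = \<one>\<^bsub>gp_empty\<^esub>" if "U \<in> carrier gp_empty" for U
  proof (rule gp_cases[OF that])
    fix x y assume "U = fdiff x y"
    then show ?thesis
      by (intro bexI[OF _ gp_closed[of y x]]) (simp add: gp_mult gp_one fdiff_eq add.commute)
  qed
qed

lemma gp_pow: "fdiff x y [^]\<^bsub>gp_empty\<^esub> (m :: nat) = fdiff (nmul m x) (nmul m y)"
proof -
  interpret group gp_empty by (rule group_gp)
  show ?thesis by (induction m) (simp_all add: gp_one gp_mult add.commute)
qed

lemma torsion_gp: "fdiff x y \<in> torsion_subgroup gp_empty \<longleftrightarrow> torsion_eq x y"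
  unfolding torsion_subgroup_def torsion_eq_def
  by (simp add: gp_closed gp_pow gp_one fdiff_eq)

text \<open>The value does not depend on the chosen representative, as
  \<open>coord_hom_fdiff\<close> shows for additive coordinates.\<close>

definition coord_hom :: "nat \<Rightarrow> (nat \<Rightarrow> 'n::cancel_comm_monoid_add \<Rightarrow> int) \<Rightarrow> ('n set \<times> 'n set) set \<Rightarrow> nat \<Rightarrow>\<^sub>0 int"
  where "coord_hom r \<kappa> U = (let p = SOME p. U = fdiff (fst p) (snd p) in
    (\<Sum>i<r. frag_cmul (\<kappa> i (fst p) - \<kappa> i (snd p)) (frag_of i)))"

lemma coord_hom_fdiff:
  assumes "\<And>i. i < r \<Longrightarrow> additive_on UNIV (\<kappa> i)"
  shows "coord_hom r \<kappa> (fdiff x y) = (\<Sum>i<r. frag_cmul (\<kappa> i x - \<kappa> i y) (frag_of i))"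
proof -
  define p where "p = (SOME p. fdiff x y = fdiff (fst p) (snd p))"
  have "fdiff x y = fdiff (fst p) (snd p)" unfolding p_def by (rule someI[of _ "(x, y)"]) simp
  then have eq: "x + snd p = fst p + y" unfolding fdiff_eq .
  have "\<kappa> i (fst p) - \<kappa> i (snd p) = \<kappa> i x - \<kappa> i y" if "i < r" for i
    using additive_onD[OF assms[OF that], of x "snd p"] additive_onD[OF assms[OF that], of "fst p" y] eq by simp
  then show ?thesis unfolding coord_hom_def p_def[symmetric] Let_def by (intro sum.cong) auto
qed

lemma lookup_frag_sum:
  "Poly_Mapping.lookup (\<Sum>i<r. frag_cmul (c i) (frag_of i)) j = (if j < (r :: nat) then c j else 0)"
proof -
  have "Poly_Mapping.lookup (\<Sum>i<r. frag_cmul (c i) (frag_of i)) j = (\<Sum>i<r. if i = j then c i else 0)"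
    by (induction r) (auto simp: lookup_add lookup_frag_of)
  then show ?thesis by simp
qed

text \<open>The coordinates map the group completion onto Z^r, since the dual pairs go to the unit
  vectors, and the kernel is the torsion subgroup because the coordinates separate elements exactly
  up to torsion.\<close>

lemma free_rank_gp:
  fixes \<kappa> :: "nat \<Rightarrow> 'n::cancel_comm_monoid_add \<Rightarrow> int"
  assumes co: "monoid_coords UNIV r \<kappa> a b"
  shows "free_rank (gp_empty :: ('n set \<times> 'n set) set monoid) = r"
proof -
  let ?G = "gp_empty :: ('n set \<times> 'n set) set monoid"
  let ?F = "free_Abelian_group {..<r}"
  have add: "additive_on UNIV (\<kappa> i)" if "i < r" for i using co that by (simp add: monoid_coords_def)
  let ?h = "coord_hom r \<kappa>"
  have cl: "?h (fdiff x y) = (\<Sum>i<r. frag_cmul (\<kappa> i x - \<kappa> i y) (frag_of i))" for x y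
    by (rule coord_hom_fdiff[OF add])
  have keys: "Poly_Mapping.keys (?h (fdiff x y)) \<subseteq> {..<r}" for x y
    unfolding cl by (auto simp: in_keys_iff lookup_frag_sum split: if_splits)
  have "?h \<in> hom ?G ?F"
  proof (rule homI)
    show "?h U \<in> carrier ?F" if "U \<in> carrier ?G" for U
      by (rule gp_cases[OF that]) (use keys in simp)
    show "?h (U \<otimes>\<^bsub>?G\<^esub> V) = ?h U \<otimes>\<^bsub>?F\<^esub> ?h V" if UV: "U \<in> carrier ?G" "V \<in> carrier ?G" for U V
    proof -
      obtain x y x' y' where c: "U = fdiff x y" "V = fdiff x' y'"
        by (rule gp_cases[OF UV(1)], rule gp_cases[OF UV(2)])
      have "?h (fdiff (x + x') (y + y')) = ?h (fdiff x y) + ?h (fdiff x' y')"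
        unfolding cl sum.distrib[symmetric] frag_cmul_distrib[symmetric]
        by (intro sum.cong refl) (use additive_onD[OF add] in \<open>simp add: algebra_simps\<close>)
      then show ?thesis unfolding c gp_mult by simp
    qed
  qed
  then interpret h: group_hom ?G ?F ?h
    by (intro group_hom.intro group_gp group_free_Abelian_group group_hom_axioms.intro)
  have zero: "?h (fdiff x y) = 0 \<longleftrightarrow> (\<forall>i<r. \<kappa> i x = \<kappa> i y)" for x y
    unfolding poly_mapping_eq_iff fun_eq_iff cl lookup_frag_sum by auto
  have tor: "(\<forall>i<r. \<kappa> i x = \<kappa> i y) \<longleftrightarrow> torsion_eq x y" for x y
  proof
    show "torsion_eq x y" if "\<forall>i<r. \<kappa> i x = \<kappa> i y" using co that unfolding monoid_coords_def by blast
    assume "torsion_eq x y"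
    then obtain m where m: "m > 0" "nmul m x = nmul m y" unfolding torsion_eq_def by blast
    show "\<forall>i<r. \<kappa> i x = \<kappa> i y"
    proof (intro allI impI)
      fix i assume i: "i < r"
      have "submon (UNIV :: 'n set)" by (simp add: submon_def)
      from additive_on_nmul[OF this add[OF i], of _ m]
      have "int m * \<kappa> i x = int m * \<kappa> i y" using m(2) by (metis UNIV_I)
      then show "\<kappa> i x = \<kappa> i y" using m(1) by simp
    qed
  qed
  have ker: "kernel ?G ?F ?h = torsion_subgroup ?G"
  proof (intro Set.set_eqI iffI)
    fix U assume U: "U \<in> kernel ?G ?F ?h"
    then have "U \<in> carrier ?G" by (simp add: kernel_def)
    then show "U \<in> torsion_subgroup ?G"
      by (rule gp_cases) (use U in \<open>simp add: kernel_def torsion_gp zero tor\<close>)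
  next
    fix U assume U: "U \<in> torsion_subgroup ?G"
    then have "U \<in> carrier ?G" by (simp add: torsion_subgroup_def)
    then show "U \<in> kernel ?G ?F ?h"
      by (rule gp_cases) (use U in \<open>simp add: kernel_def torsion_gp zero tor gp_closed\<close>)
  qed
  have img: "x \<in> ?h ` carrier ?G" if x: "Poly_Mapping.keys x \<subseteq> {..<r}" for x
    using x
  proof (rule free_Abelian_group_induct)
    note sub = h.img_is_subgroup
    show "0 \<in> ?h ` carrier ?G" using subgroup.one_closed[OF sub] by simp
    show "x - y \<in> ?h ` carrier ?G"
      if "Poly_Mapping.keys y \<subseteq> {..<r}" "x \<in> ?h ` carrier ?G" "y \<in> ?h ` carrier ?G" for x y
      using subgroup.m_closed[OF sub that(2) subgroup.m_inv_closed[OF sub that(3)]] that(1) by simp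
    show "frag_of i \<in> ?h ` carrier ?G" if "i \<in> {..<r}" for i
    proof (rule image_eqI[OF _ gp_closed])
      have "\<kappa> j (a i) - \<kappa> j (b i) = (if j = i then 1 else 0)" if "j < r" for j
        using co \<open>i \<in> {..<r}\<close> that unfolding monoid_coords_def by simp
      then show "frag_of i = ?h (fdiff (a i) (b i))"
        unfolding poly_mapping_eq_iff fun_eq_iff cl lookup_frag_sum
        using that by (auto simp: lookup_frag_of)
    qed
  qed
  have iso: "(?G Mod torsion_subgroup ?G) \<cong> ?F"
    unfolding ker[symmetric] by (rule h.FactGroup_iso) (use img keys gp_cases in \<open>force simp: gp_carrier\<close>)
  have "torsion_subgroup ?G \<lhd> ?G" using h.normal_kernel unfolding ker .
  then show ?thesis using iso by (rule free_rank_eqI)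
qed

lemma monoid_rank_empty:
  fixes \<kappa> :: "nat \<Rightarrow> 'n::cancel_comm_monoid_add \<Rightarrow> int"
  assumes "monoid_coords UNIV r \<kappa> a b"
  shows "monoid_rank (rees_quotient {} :: 'n set monoid) = r"
  unfolding monoid_rank_def by (rule free_rank_gp[OF assms])

text \<open>The absorbing element identifies all formal differences.\<close>

lemma monoid_rank_nonempty:
  assumes I: "monoid_ideal I" "I \<noteq> {}"
  shows "monoid_rank (rees_quotient I) = 0"
proof -
  let ?M = "rees_quotient I"
  have ideal: "x + y \<in> I" if "x \<in> I" for x y using I(1) that unfolding monoid_ideal_def by blast
  have zero: "Z \<otimes>\<^bsub>?M\<^esub> I = I" if Z: "Z \<noteq> {}" for Z
  proof -
    have "rees_class I (x + y) = I" if "y \<in> I" for x y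
      using ideal[OF that, of x] by (simp add: rees_class_def add.commute)
    then show ?thesis using Z I(2) unfolding rees_quotient_def by simp
  qed
  have ne: "Z \<noteq> {}" if "Z \<in> carrier ?M" for Z
    using that I(2) unfolding rees_quotient_def rees_class_def by auto
  have Ic: "I \<in> carrier ?M" using I(2) by (auto simp: rees_quotient_def rees_class_def image_iff)
  have mne: "Z \<otimes>\<^bsub>?M\<^esub> W \<noteq> {}" if ZW: "Z \<in> carrier ?M" "W \<in> carrier ?M" for Z W
  proof -
    obtain x y where "x \<in> Z" "y \<in> W" using ne[OF ZW(1)] ne[OF ZW(2)] by blast
    moreover have "rees_class I (x + y) \<noteq> {}" for x y using I(2) by (auto simp: rees_class_def)
    ultimately show ?thesis unfolding rees_quotient_def by auto
  qed
  let ?C = "carrier ?M \<times> carrier ?M"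
  have cls: "gp_class ?M Z W = ?C" if "Z \<in> carrier ?M" "W \<in> carrier ?M" for Z W
  proof -
    have "Z \<otimes>\<^bsub>?M\<^esub> D \<otimes>\<^bsub>?M\<^esub> I = E \<otimes>\<^bsub>?M\<^esub> W \<otimes>\<^bsub>?M\<^esub> I" if "D \<in> carrier ?M" "E \<in> carrier ?M" for D E
      using zero[OF mne[OF \<open>Z \<in> carrier ?M\<close> that(1)]] zero[OF mne[OF that(2) \<open>W \<in> carrier ?M\<close>]] by simp
    then show ?thesis unfolding gp_class_def using Ic by blast
  qed
  let ?G = "group_completion ?M"
  have car: "carrier ?G = {?C}"
  proof -
    have "carrier ?G = {gp_class ?M Z W | Z W. Z \<in> carrier ?M \<and> W \<in> carrier ?M}"
      by (simp add: group_completion_def)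
    also have "\<dots> = {?C}" using cls Ic by blast
    finally show ?thesis .
  qed
  let ?Q = "?G Mod torsion_subgroup ?G"
  obtain T where T: "carrier ?Q = {T}" unfolding FactGroup_def RCOSETS_def car by auto
  have F0: "carrier (free_Abelian_group {..<0 :: nat}) = {0}" by (auto simp: free_Abelian_group_def)
  show ?thesis
    unfolding monoid_rank_def free_rank_def
  proof (rule the_equality)
    have "T \<otimes>\<^bsub>?Q\<^esub> T = T \<or> True" by simp
    have "(\<lambda>_. 0) \<in> iso ?Q (free_Abelian_group {..<0 :: nat})"
      unfolding iso_def hom_def by (simp add: T F0[simplified] bij_betw_def)
    then show "?Q \<cong> free_Abelian_group {..<0 :: nat}" unfolding is_iso_def by blast
    fix s assume "?Q \<cong> free_Abelian_group {..<s :: nat}"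
    then obtain h where h: "bij_betw h {T} (carrier (free_Abelian_group {..<s}))"
      unfolding is_iso_def iso_def T by blast
    then have eq: "carrier (free_Abelian_group {..<s}) = {h T}" by (simp add: bij_betw_def)
    show "s = 0"
    proof (rule ccontr)
      assume "s \<noteq> 0"
      then have "frag_of 0 \<in> carrier (free_Abelian_group {..<s})" by simp
      moreover have "0 \<in> carrier (free_Abelian_group {..<s})" by simp
      ultimately have "frag_of (0 :: nat) = 0" unfolding eq by simp
      then show False by simp
    qed
  qed
qed

section \<open>The monoid algebra\<close>

text \<open>For the empty ideal the algebra is a quotient by the zero ideal, whose cosets are
  singletons.\<close>

lemma typed_ring_monoid_algebra:
  "typed_ring (quotient_monoid_algebra {} :: ('n::comm_monoid_add \<Rightarrow>\<^sub>0 'k::field) set ring) (\<lambda>f. {f})"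
proof -
  let ?R = "ring_of_type_algebra :: ('n \<Rightarrow>\<^sub>0 'k) ring"
  let ?A = "quotient_monoid_algebra {} :: ('n \<Rightarrow>\<^sub>0 'k) set ring"
  have A: "?A = ?R Quot {0}" by (simp add: quotient_monoid_algebra_def)
  interpret R: ring ?R by (rule ring_from_type_algebra)
  have s: "carrier ?R = UNIV" "x \<otimes>\<^bsub>?R\<^esub> y = x * y" "x \<oplus>\<^bsub>?R\<^esub> y = x + y" "\<one>\<^bsub>?R\<^esub> = 1" "\<zero>\<^bsub>?R\<^esub> = 0" for x y
    by (simp_all add: ring_of_type_algebra_def)
  have "ideal {0} ?R" using R.zeroideal by (simp add: s)
  then interpret I: ideal "{0}" ?R .
  have coset: "{0} +>\<^bsub>?R\<^esub> f = {f}" for f by (simp add: a_r_coset_def' s)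
  show ?thesis
  proof
    show "inj (\<lambda>f :: 'n \<Rightarrow>\<^sub>0 'k. {f})" by (simp add: inj_def)
    show "carrier ?A = range (\<lambda>f. {f})" unfolding A FactRing_def A_RCOSETS_def' by (simp add: s coset) blast
    show "{f} \<oplus>\<^bsub>?A\<^esub> {g} = {f + g}" for f g
      using I.a_rcos_sum[of f g] unfolding A FactRing_def by (simp add: s coset)
    show "{f} \<otimes>\<^bsub>?A\<^esub> {g} = {f * g}" for f g
      using I.rcoset_mult_add[of f g] unfolding A FactRing_def by (simp add: s coset)
    show "\<one>\<^bsub>?A\<^esub> = {1}" unfolding A FactRing_def by (simp add: s coset)
    show "\<zero>\<^bsub>?A\<^esub> = {0}" unfolding A FactRing_def by simp
  qed
qed

lemma (in typed_ring) reduced_ring_nilpotent: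
  fixes x :: 'a and n :: nat
  assumes "reduced_ring A" "x ^ n = 0"
  shows "x = 0"
proof -
  have "\<iota> x [^]\<^bsub>A\<^esub> n = \<iota> (x ^ n)" by (induction n) (simp_all add: i_one i_mult mult.commute)
  then have "\<iota> x = \<zero>\<^bsub>A\<^esub>" using assms unfolding reduced_ring_def by (metis i_zero iota_carrier)
  then show ?thesis by (simp add: i_zero)
qed

text \<open>In characteristic p write \<open>L = p^v * l\<close> with \<open>l\<close> prime to p.
  The difference of the monomials of \<open>l m\<close> and \<open>l n\<close> has a vanishing power
  of exponent \<open>p^v\<close>, since raising to that power is additive; reducedness then makes
  the two monomials equal. In characteristic 0 the given multiplier serves.\<close>

lemma tame_torsion:
  fixes m n :: "'n::cancel_comm_monoid_add"
  assumes red: "\<And>(f :: 'n \<Rightarrow>\<^sub>0 'k::field) e :: nat. f ^ e = 0 \<Longrightarrow> f = 0" and mn: "torsion_eq m n"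
  shows "\<exists>l. of_nat l \<noteq> (0 :: 'k) \<and> nmul l m = nmul l n"
proof -
  obtain L where L: "L > 0" "nmul L m = nmul L n" using mn unfolding torsion_eq_def by blast
  have of_nat: "of_nat c = (0 :: 'n \<Rightarrow>\<^sub>0 'k) \<longleftrightarrow> of_nat c = (0 :: 'k)" for c
  proof -
    have eq: "of_nat c = (cst (of_nat c) :: 'n \<Rightarrow>\<^sub>0 'k)" by (simp add: hom_type_simps(10)[OF hom_type_cst])
    have "cst x = (0 :: 'n \<Rightarrow>\<^sub>0 'k) \<longleftrightarrow> x = 0" for x :: 'k
      by (simp add: poly_mapping_eq_iff fun_eq_iff lookup_single when_def)
    then show ?thesis by (subst eq)
  qed
  have char: "CHAR('n \<Rightarrow>\<^sub>0 'k) = CHAR('k)"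
    by (rule CHAR_eqI) (simp_all add: of_nat of_nat_eq_0_iff_char_dvd)
  show ?thesis
  proof (cases "CHAR('k) = 0")
    case True
    then show ?thesis using L by (intro exI[of _ L]) (simp add: of_nat_eq_0_iff_char_dvd)
  next
    case False
    let ?p = "CHAR('k)"
    have p: "normalization_semidom_class.prime ?p" by (rule prime_CHAR_semidom) (use False in simp)
    obtain l where l: "L = ?p ^ multiplicity ?p L * l" "\<not> ?p dvd l"
      using multiplicity_decompose'[of L ?p] L(1) p by (metis not_prime_unit not_gr_zero)
    define q where "q = ?p ^ multiplicity ?p L"
    define u v :: "'n \<Rightarrow>\<^sub>0 'k" where "u = mon (nmul l m)" and "v = mon (nmul l n)"
    have "nmul (q * l) m = nmul (q * l) n" using L(2) l(1) unfolding q_def by simp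
    then have "u ^ q = v ^ q" unfolding u_def v_def mon_power by (simp add: nmul_mult)
    moreover have "((u - v) + v) ^ q = (u - v) ^ q + v ^ q"
      unfolding q_def by (rule freshmans_dream') (simp_all add: char p)
    ultimately have "(u - v) ^ q = 0" by simp
    then have "u = v" using red[of "u - v" q] by simp
    then have "nmul l m = nmul l n" unfolding u_def v_def by (metis keys_single the_elem_eq zero_neq_one)
    then show ?thesis using l(2) by (intro exI[of _ l]) (simp add: of_nat_eq_0_iff_char_dvd)
  qed
qed

theorem theorem0p5:
  fixes I :: "'n::cancel_comm_monoid_add set"
    and M :: "'n set monoid"
    and kM :: "('n \<Rightarrow>\<^sub>0 'k::alg_closed_field) set ring"
  assumes "monoid_ideal I"
    and "M = rees_quotient I"
    and "finitely_generated_monoid M"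
    and "monoid_rank M \<ge> 2"
    and "kM = quotient_monoid_algebra I"
    and "reduced_ring kM"
  shows "trivial_group (CH0_LW kM)"
proof -
  have empty: "I = {}" using monoid_rank_nonempty[OF assms(1)] assms(2,4) by (cases "I = {}") auto
  have M: "M = rees_quotient {}" using assms(2) empty by simp
  obtain \<Gamma> :: "'n set" where fin: "finite \<Gamma>" "mspan \<Gamma> = UNIV"
    using assms(3) unfolding M by (rule finitely_generated_mspan)
  obtain r and \<Lambda> :: "nat \<Rightarrow> 'n \<Rightarrow> int" and a0 b0 where co: "monoid_coords UNIV r \<Lambda> a0 b0"
    using monoid_coords_exist[OF fin(1)] unfolding fin(2) by blast
  have r: "2 \<le> r" using assms(4) unfolding M monoid_rank_empty[OF co] .
  let ?i = "\<lambda>f :: 'n \<Rightarrow>\<^sub>0 'k. {f}"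
  have "typed_ring kM ?i" unfolding assms(5) empty by (rule typed_ring_monoid_algebra)
  then interpret A: typed_ring kM ?i .
  have red: "f = 0" if "f ^ e = 0" for f :: "'n \<Rightarrow>\<^sub>0 'k" and e :: nat
    by (rule A.reduced_ring_nilpotent[OF assms(6) that])
  have tame: "\<exists>l. of_nat l \<noteq> (0 :: 'k) \<and> nmul l m = nmul l n" if "torsion_eq m n" for m n :: 'n
    using red that by (rule tame_torsion)
  show ?thesis
  proof (rule trivial_CH0_LW)
    fix p assume cl: "p \<in> closed_points kM" and reg: "p \<in> reg_locus kM"
    define P where "P = {f. ?i f \<in> p}"
    have "maximalideal p kM" using cl by (simp add: closed_points_def)
    note mv = A.maximal_vimage[OF this, folded P_def]
    obtain x where x: "x 0 = 1" "\<And>m n. x (m + n) = x m * x n" "P = {f. mlift (\<lambda>a. a) x f = 0}"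
      using maximal_ideal_is_character[OF fin mv(1) mv(3)] by blast
    interpret L: typed_local kM ?i P by unfold_locales (rule mv(1))
    have "regular_local_ring L.loc" using reg mv(2) by (simp add: reg_locus_def)
    from L.regular_local_generators[OF this]
    obtain G n and Q :: "nat \<Rightarrow> ('n \<Rightarrow>\<^sub>0 'k) set" where G: "finite G" "card G \<le> n" "G \<subseteq> P"
      and gen: "\<forall>K h. ideal_set K \<longrightarrow> G \<subseteq> K \<longrightarrow> h \<in> P \<longrightarrow> (\<exists>w. w \<notin> P \<and> w * h \<in> K)"
      and Q: "\<forall>i\<le>n. prime_set (Q i)" "\<forall>i<n. Q i \<subset> Q (Suc i)"
      by (elim exE conjE)
    \<comment> \<open>The chain is as long as the number of local generators supplied by regularity,
      so the rank bounds that number.\<close>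
    have "n \<le> r"
      by (rule prime_chain_length_le[of r \<Lambda> n Q]) (use co Q in \<open>auto simp: monoid_coords_def\<close>)
    then have "card G \<le> r" using G(2) by simp
    moreover have "\<exists>w. mlift (\<lambda>a. a) x w \<noteq> 0 \<and> w * h \<in> K"
      if "ideal_set K" "G \<subseteq> K" "mlift (\<lambda>a. a) x h = 0" for K h
      using gen that unfolding x(3) by simp
    ultimately have "\<exists>s \<kappa> a b \<phi>. monoid_coords UNIV r \<kappa> a b \<and> s \<le> r \<and>
      (\<forall>i\<in>{s..<r}. b i = 0 \<and> (\<forall>n. \<kappa> i n \<ge> 0)) \<and>
      (\<forall>i<s. \<forall>j\<in>{s..<r}. \<kappa> j (a i) = 0 \<and> \<kappa> j (b i) = 0) \<and>
      \<phi> 0 = 1 \<and> (\<forall>m n. \<phi> (m + n) = \<phi> m * \<phi> n) \<and> (\<forall>n. \<phi> n \<noteq> 0) \<and>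
      (\<forall>n. x n = (if \<forall>i\<in>{s..<r}. \<kappa> i n = 0 then \<phi> n else 0))"
      by (intro regular_character_coordinates[OF fin x(1,2) co G(1) _ G(3)[unfolded x(3)]])
    then    obtain s \<kappa> a b \<phi> where c: "monoid_coords UNIV r \<kappa> a b" "s \<le> r"
      "\<forall>i\<in>{s..<r}. b i = 0 \<and> (\<forall>n. \<kappa> i n \<ge> 0)"
      "\<forall>i<s. \<forall>j\<in>{s..<r}. \<kappa> j (a i) = 0 \<and> \<kappa> j (b i) = 0"
      "\<phi> 0 = 1" "\<forall>m n. \<phi> (m + n) = \<phi> m * \<phi> n" "\<forall>n. \<phi> n \<noteq> 0"
      "\<forall>n. x n = (if \<forall>i\<in>{s..<r}. \<kappa> i n = 0 then \<phi> n else 0)"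
      by (elim exE conjE)
    have "curve_through x"
    proof (rule regular_character_curve[where \<Gamma> = \<Gamma> and \<phi> = \<phi> and r = r and \<kappa> = \<kappa> and a = a and b = b and s = s])
      show "\<exists>l. of_nat l \<noteq> (0 :: 'k) \<and> nmul l m = nmul l n" if "torsion_eq m n" for m n :: 'n
        by (rule tame[OF that])
    qed (use fin r c in simp_all)
    then obtain \<psi> :: "('n \<Rightarrow>\<^sub>0 'k) \<Rightarrow> int \<Rightarrow>\<^sub>0 'k" where psi: "hom_type \<psi>" "\<forall>f. \<exists>g. \<psi> g = f"
      "\<forall>f. eval1 (\<psi> f) = mlift (\<lambda>a. a) x f"
      "\<forall>P. prime_set P \<longrightarrow> {f. \<psi> f = 0} \<subseteq> P \<longrightarrow> (\<forall>g. \<psi> g = loc_par \<longrightarrow> g \<notin> P) \<longrightarrow> lci_data P {f. \<psi> f = 0}"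
      unfolding curve_through_def by blast
    interpret C: affine_curve kM ?i \<psi> by unfold_locales (use psi in simp_all)
    have "C.pt = P" unfolding C.pt_def x(3) using psi(3) by simp
    then have pt: "?i ` C.pt = p" using mv(2) by simp
    show "\<exists>J f. cartier_curve kM J \<and> f \<in> curve_units kM J \<and> curve_divisor kM J f = frag_of p"
      using C.cartier_curve_J C.curve_units_par C.curve_divisor_par cl reg unfolding pt by blast
  qed
qed

end
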